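(* Let $(\lambda_N)_{N}$ be a sequence of non-trivial conjugacy classes $\lambda_N\subset\mathfrak{S}(N)$ which converges, and for each $N$ let $(S^N_t)_{t\ge 0}$ be a $\lambda_N$-random walk on $\mathfrak{S}(N)$. The family $(S^N_t)_{t\ge0}$ converges in $\mathcal{P}$-distribution as $N\to\infty$ toward the $\mathcal{P}$-distribution of a multiplicative $\mathcal{P}$-Lévy process. If $(\lambda_N)_N$ is evanescent, the limit is not a multiplicative free Lévy process: the multiplicative increments are not asymptotically free, i.e. for $0\le s_1<t_1\le s_2<t_2$ the increments $S^N_{t_1}(S^N_{s_1})^{-1}$ and $S^N_{t_2}(S^N_{s_2})^{-1}$ are not asymptotically free (in the sense of Voiculescu, with respect to $\mathbb{E}\,\frac1N Tr$) as $N\to\infty$.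
   Context: Random walks. $\mathfrak{S}(N)$ is the symmetric group; permutations $S$ are identified with $N\times N$ permutation matrices ($S e_j=e_{S(j)}$). For a permutation $\sigma$, the period of $j$ in $\sigma$ is the smallest $n\ge1$ with $\sigma^n(j)=j$. For a conjugacy class $\lambda_N$ of $\mathfrak{S}(N)$, $\lambda_N(i)$ is the number of $j\in\{1,\dots,N\}$ whose period in $\sigma$ equals $i$ (any $\sigma\in\lambda_N$), and $\lambda_N(1^c)=N-\lambda_N(1)$. Classes are assumed non-trivial: $\lambda_N\neq\{id_N\}$ ($N\ge2$). The $\lambda_N$-random walk $(S^N_t)_{t\ge0}$ is the Markov process on $\mathfrak{S}(N)$ with $S^N_0=id_N$ and generator $$H_Nf(\sigma_0)=\frac{N}{\lambda_N(1^c)}\frac{1}{\#\lambda_N}\sum_{\sigma\in\lambda_N}[f(\sigma\sigma_0)-f(\sigma_0)].$$ The sequence $(\lambda_N)_N$ converges if there are $\lambda(i)\ge0$ ($i\ge2$) with $\sum_{i\ge2}\lambda(i)\le1$ and $\lambda_N(i)/\lambda_N(1^c)\to\lambda(i)$ for every $i\ge2$, and there is $\alpha\in[0,1]$ with $\lambda_N(1)/N\to1-\alpha$. It is evanescent if $\alpha=0$. Partitions and moments. $\mathcal{P}_k$ is the set of partitions of $\{1,\dots,k,1',\dots,k'\}$, $id=id_k=\{\{i,i'\}:1\le i\le k\}$, $p\vee p'$ is the supremum (finest common coarsening), ${\sf nc}(p)$ is the number of blocks; a cycle of $p$ is a block of $p\vee id$; $p_1\otimes p_2$ is the juxtaposition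 of $p_1$ and $p_2$ ($p_2$ on the right). For $I=(i_1,\dots,i_k,i_{1'},\dots,i_{k'})\in\{1,\dots,N\}^{2k}$, ${\sf Ker}(I)$ is the partition in which $a,b$ are in the same block iff $i_a=i_b$. For $N\times N$ matrices $M_1,\dots,M_k$, $$m_p(M_1,\dots,M_k)=\frac{1}{N^{{\sf nc}(p\vee id)}}\sum_{I:\ p\text{ finer than or equal to }{\sf Ker}(I)}\ \prod_{l=1}^k(M_l)_{i_{l'}i_l}.$$ A family $(M_{i})_{i\in J}$ of sequences $M_i=(M_{i,N})_N$ of random matrices (with law jointly invariant under conjugation by $\mathfrak{S}(N)$) converges in $\mathcal{P}$-distribution if $\mathbb{E}[m_p(M_{i_1,N},\dots,M_{i_k,N})]$ converges for all $k$, $p\in\mathcal{P}_k$, $i_1,\dots,i_k\in J$. $\mathcal{P}$-cumulants. With $\rho_N(p)=\sum_{I:\,p\text{ finer than or equal to }{\sf Ker}(I)}E_{i_{1'}}^{i_1}\otimes\dots\otimes E_{i_{k'}}^{i_k}$ ($E_i^j$ maps $e_j$ to $e_i$ and the other basis vectors to $0$), for $N\ge2k$ the numbers $\mathbb{E}\kappa_p(M_{1,N},\dots,M_{k,N})$ are defined by $\mathbb{E}[M_{1,N}\otimes\dots\otimes M_{k,N}]=\sum_{p\in\mathcal{P}_k}N^{-({\sf nc}(p)-{\sf nc}(p\vee id))}\,\mathbb{E}\kappa_p(M_{1,N},\dots,M_{k,N})\,\rho_N(p)$. Convergence in $\mathcal{P}$-distribution is equivalent to convergence of all these numbers; $\mathbb{E}\kappa_p(M_1,\dots,M_k)$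 denotes the limit. $\mathcal{P}$-freeness. Elements $A_1,\dots,A_n$ (jointly convergent in $\mathcal{P}$-distribution) are $\mathcal{P}$-free if (a) $\mathbb{E}\kappa_p(B_1,\dots,B_k)=0$ for $B_1,\dots,B_k\in\{A_1,\dots,A_n\}$ whenever there are $i,j$ in the same cycle of $p$ with $B_i\ne B_j$, and (b) for $p_j\in\mathcal{P}_{k_j}$, $\mathbb{E}\kappa_{p_1\otimes\dots\otimes p_n}(A_1,\dots,A_1,\dots,A_n,\dots,A_n)=\prod_j\mathbb{E}\kappa_{p_j}(A_j,\dots,A_j)$. Multiplicative $\mathcal{P}$-Lévy process. The limiting $\mathcal{P}$-distribution is that of a multiplicative $\mathcal{P}$-Lévy process if the limiting process starts from the identity, the limiting $\mathcal{P}$-distribution of the increment from $s$ to $t$ (limit of $S^N_t(S^N_s)^{-1}$) depends only on $t-s$, the increments over consecutive disjoint time intervals are $\mathcal{P}$-free, and the limiting $\mathcal{P}$-moments of the time-$t$ marginal converge to those of the identity as $t\to0$. A multiplicative free Lévy process is defined analogously with freeness in the sense of Voiculescu of the increments. *)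

theory Defs
  imports
    "HOL-Probability.Probability"
    "HOL-Combinatorics.Cycles"
    "HOL-Computational_Algebra.Polynomial"
    "Jordan_Normal_Form.Matrix"
begin

text \<open>
  The sets \<open>{1,...,N}\<close> and \<open>{1,...,k}\<close> are rendered as \<open>{..<N}\<close> and \<open>{..<k}\<close>. A sequence
  indexed by \<open>N\<close> is a function on \<^typ>\<open>nat\<close> of which only the values at \<open>N \<ge> 2\<close> are relevant.
  Each \<open>N\<close> has its own probability space \<open>M N\<close>.
\<close>

section \<open>Conjugacy classes of the symmetric group\<close>

definition conjugacy_class :: "nat \<Rightarrow> (nat \<Rightarrow> nat) set \<Rightarrow> bool" where
  "conjugacy_class N C \<longleftrightarrow>
     (\<exists>\<sigma>. \<sigma> permutes {..<N} \<and> C = {\<tau> \<circ> \<sigma> \<circ> inv_into UNIV \<tau> | \<tau>. \<tau> permutes {..<N}})"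

text \<open>\<^const>\<open>least_power\<close> \<open>\<sigma> j\<close> is the period of \<open>j\<close> in \<open>\<sigma>\<close>.\<close>

definition period_count :: "nat \<Rightarrow> (nat \<Rightarrow> nat) \<Rightarrow> nat \<Rightarrow> nat" where
  "period_count N \<sigma> i = card {j \<in> {..<N}. least_power \<sigma> j = i}"

text \<open>The value does not depend on the chosen element of the class.\<close>

definition class_count :: "nat \<Rightarrow> (nat \<Rightarrow> nat) set \<Rightarrow> nat \<Rightarrow> nat" where
  "class_count N C i = period_count N (SOME \<sigma>. \<sigma> \<in> C) i"

definition class_support :: "nat \<Rightarrow> (nat \<Rightarrow> nat) set \<Rightarrow> nat" where
  "class_support N C = N - class_count N C 1"

definition classes_converge :: "(nat \<Rightarrow> (nat \<Rightarrow> nat) set) \<Rightarrow> real \<Rightarrow> bool" where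
  "classes_converge L \<alpha> \<longleftrightarrow>
     (\<exists>l :: nat \<Rightarrow> real.
        (\<forall>i\<ge>2. l i \<ge> 0) \<and> l summable_on {2..} \<and> infsum l {2..} \<le> 1 \<and>
        (\<forall>i\<ge>2. (\<lambda>N. real (class_count N (L N) i) / real (class_support N (L N))) \<longlonglongrightarrow> l i)) \<and>
     0 \<le> \<alpha> \<and> \<alpha> \<le> 1 \<and>
     (\<lambda>N. real (class_count N (L N) 1) / real N) \<longlonglongrightarrow> 1 - \<alpha>"

section \<open>Random walks\<close>

definition walk_generator ::
  "nat \<Rightarrow> (nat \<Rightarrow> nat) set \<Rightarrow> ((nat \<Rightarrow> nat) \<Rightarrow> real) \<Rightarrow> (nat \<Rightarrow> nat) \<Rightarrow> real" where
  "walk_generator N C f \<sigma>\<^sub>0 =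
     real N / real (class_support N C) * (1 / real (card C)) * (\<Sum>\<sigma>\<in>C. f (\<sigma> \<circ> \<sigma>\<^sub>0) - f \<sigma>\<^sub>0)"

text \<open>The semigroup \<open>exp (t H)\<close> of an operator on functions, as a pointwise exponential series.\<close>

definition semigroup_of :: "(('a \<Rightarrow> real) \<Rightarrow> 'a \<Rightarrow> real) \<Rightarrow> real \<Rightarrow> ('a \<Rightarrow> real) \<Rightarrow> 'a \<Rightarrow> real" where
  "semigroup_of H t f x = (\<Sum>n. t ^ n / fact n * (H ^^ n) f x)"

text \<open>
  Markov property on a finite state space \<open>E\<close>: given the positions \<open>y\<close> at finitely many times \<open>T\<close>
  up to \<open>s\<close> and the position \<open>x\<close> at time \<open>s\<close>, the position at time \<open>t\<close> is governed by
  \<open>exp ((t - s) H)\<close>. No path regularity is required.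
\<close>

definition markov_process ::
  "'w measure \<Rightarrow> 'a set \<Rightarrow> (('a \<Rightarrow> real) \<Rightarrow> 'a \<Rightarrow> real) \<Rightarrow> (real \<Rightarrow> 'w \<Rightarrow> 'a) \<Rightarrow> bool" where
  "markov_process M E H X \<longleftrightarrow>
     prob_space M \<and>
     (\<forall>t\<ge>0. X t \<in> measurable M (count_space E)) \<and>
     (\<forall>T y s t x z. finite T \<and> T \<subseteq> {0..s} \<and> 0 \<le> s \<and> s \<le> t \<and> x \<in> E \<and> z \<in> E \<longrightarrow>
        measure M {\<omega> \<in> space M. (\<forall>u\<in>T. X u \<omega> = y u) \<and> X s \<omega> = x \<and> X t \<omega> = z} =
        measure M {\<omega> \<in> space M. (\<forall>u\<in>T. X u \<omega> = y u) \<and> X s \<omega> = x} *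
          semigroup_of H (t - s) (indicator {z}) x)"

definition random_walk ::
  "nat \<Rightarrow> (nat \<Rightarrow> nat) set \<Rightarrow> 'w measure \<Rightarrow> (real \<Rightarrow> 'w \<Rightarrow> nat \<Rightarrow> nat) \<Rightarrow> bool" where
  "random_walk N C M S \<longleftrightarrow>
     markov_process M {\<sigma>. \<sigma> permutes {..<N}} (walk_generator N C) S \<and>
     (AE \<omega> in M. S 0 \<omega> = id)"

definition perm_mat :: "nat \<Rightarrow> (nat \<Rightarrow> nat) \<Rightarrow> complex mat" where
  "perm_mat N \<sigma> = mat N N (\<lambda>(a, b). if a = \<sigma> b then 1 else 0)"

section \<open>Partitions\<close>

text \<open>The point \<open>i\<close> is \<^term>\<open>Inl i\<close>, the point \<open>i'\<close> is \<^term>\<open>Inr i\<close>.\<close>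

type_synonym point = "nat + nat"

definition points :: "nat \<Rightarrow> point set" where
  "points k = Inl ` {..<k} \<union> Inr ` {..<k}"

definition Parts :: "nat \<Rightarrow> point set set set" where
  "Parts k = {p. partition_on (points k) p}"

definition part_id :: "nat \<Rightarrow> point set set" where
  "part_id k = (\<lambda>i. {Inl i, Inr i}) ` {..<k}"

definition block_rel :: "'a set set \<Rightarrow> ('a \<times> 'a) set" where
  "block_rel p = {(x, y). \<exists>b\<in>p. x \<in> b \<and> y \<in> b}"

definition part_sup :: "'a set \<Rightarrow> 'a set set \<Rightarrow> 'a set set \<Rightarrow> 'a set set" where
  "part_sup A p q = A // (block_rel p \<union> block_rel q)\<^sup>+"

text \<open>The supremum is the finest common coarsening of \<open>p\<close> and \<open>q\<close>.\<close>

lemma refines_part_supI: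
  assumes "partition_on A p" "partition_on A q"
  shows "partition_on A (part_sup A p q)"
    and "refines A p (part_sup A p q)" "refines A q (part_sup A p q)"
    and "refines A p r \<Longrightarrow> refines A q r \<Longrightarrow> refines A (part_sup A p q) r"
proof -
  define R where "R = block_rel p \<union> block_rel q"
  have eq: "equiv A (R\<^sup>+)"
  proof (rule equivI)
    have "R \<subseteq> A \<times> A"
      using assms by (auto simp: R_def block_rel_def partition_on_def)
    then show "R\<^sup>+ \<subseteq> A \<times> A" by (rule trancl_subset_Sigma)
    have "(x, x) \<in> R" if "x \<in> A" for x
      using assms(1) that by (auto simp: R_def block_rel_def partition_on_def)
    then show "refl_on A (R\<^sup>+)"
      by (auto simp: refl_on_def)
    show "sym (R\<^sup>+)"
      by (rule sym_trancl) (auto simp: sym_def R_def block_rel_def)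
  qed auto
  show P: "partition_on A (part_sup A p q)"
    unfolding part_sup_def R_def[symmetric] by (rule partition_on_quotient[OF eq])
  have sub: "\<exists>c\<in>part_sup A p q. b \<subseteq> c" if b: "b \<in> p \<union> q" for b
  proof -
    have "b \<noteq> {}" "b \<subseteq> A"
      using b assms by (auto simp: partition_on_def)
    then obtain x where x: "x \<in> b" "x \<in> A" by blast
    have "b \<subseteq> R\<^sup>+ `` {x}"
    proof
      fix y assume "y \<in> b"
      then have "(x, y) \<in> R" using b x by (auto simp: R_def block_rel_def)
      then show "y \<in> R\<^sup>+ `` {x}" by blast
    qed
    then show ?thesis
      unfolding part_sup_def R_def[symmetric] using x(2) by (metis quotientI)
  qed
  show "refines A p (part_sup A p q)" "refines A q (part_sup A p q)"
    using assms P sub by (auto simp: refines_def)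
  assume r: "refines A p r" "refines A q r"
  have pr: "partition_on A r" using r by (simp add: refines_def)
  have in_block: "\<exists>c\<in>r. x \<in> c \<and> y \<in> c" if xy: "(x, y) \<in> R" for x y
  proof -
    obtain b where b: "b \<in> p \<union> q" "x \<in> b" "y \<in> b"
      using xy unfolding R_def block_rel_def by blast
    then obtain c where "c \<in> r" "b \<subseteq> c"
      using r unfolding refines_def by blast
    then show ?thesis using b by blast
  qed
  have same: "c = d" if "c \<in> r" "d \<in> r" "y \<in> c" "y \<in> d" for c d y
    using partition_onD2[OF pr] that unfolding disjoint_def by blast
  have "\<exists>c\<in>r. x \<in> c \<and> y \<in> c" if "(x, y) \<in> R\<^sup>+" for x y
    using that
  proof induction
    case (step y z)
    from step.IH obtain c where "c \<in> r" "x \<in> c" "y \<in> c" by blast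
    moreover from in_block[OF step.hyps(2)] obtain d where "d \<in> r" "y \<in> d" "z \<in> d" by blast
    ultimately show ?case using same by blast
  qed (rule in_block)
  note conn = this
  have "\<exists>c\<in>r. R\<^sup>+ `` {x} \<subseteq> c" if x: "x \<in> A" for x
  proof -
    obtain c where c: "c \<in> r" "x \<in> c" using x pr by (auto simp: partition_on_def)
    have "y \<in> c" if "(x, y) \<in> R\<^sup>+" for y
      using conn[OF that] c same by blast
    with c(1) show ?thesis by blast
  qed
  then show "refines A (part_sup A p q) r"
    using P pr by (auto simp: refines_def part_sup_def R_def elim!: quotientE)
qed

definition cycles_of :: "nat \<Rightarrow> point set set \<Rightarrow> point set set" where
  "cycles_of k p = part_sup (points k) p (part_id k)"

definition part_tensor :: "nat \<Rightarrow> point set set \<Rightarrow> point set set \<Rightarrow> point set set" where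
  "part_tensor k p q = p \<union> (\<lambda>b. map_sum ((+) k) ((+) k) ` b) ` q"

fun part_tensors :: "(nat \<times> point set set) list \<Rightarrow> point set set" where
  "part_tensors [] = {}"
| "part_tensors ((k, p) # kps) = part_tensor k p (part_tensors kps)"

definition Ker :: "nat \<Rightarrow> (point \<Rightarrow> nat) \<Rightarrow> point set set" where
  "Ker k I = points k // {(a, b). a \<in> points k \<and> b \<in> points k \<and> I a = I b}"

section \<open>Moments and cumulants\<close>

definition indices :: "nat \<Rightarrow> nat \<Rightarrow> (point \<Rightarrow> nat) set" where
  "indices N k = points k \<rightarrow>\<^sub>E {..<N}"

text \<open>
  The entry of \<open>M\<^sub>1 \<otimes> \<dots> \<otimes> M\<^sub>k\<close> in the row given by the primed and the column given by the
  unprimed indices.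
\<close>

definition tensor_entry :: "complex mat list \<Rightarrow> (point \<Rightarrow> nat) \<Rightarrow> complex" where
  "tensor_entry Ms I = (\<Prod>l<length Ms. (Ms ! l) $$ (I (Inr l), I (Inl l)))"

definition P_moment :: "nat \<Rightarrow> point set set \<Rightarrow> complex mat list \<Rightarrow> complex" where
  "P_moment N p Ms =
     1 / of_nat N ^ card (cycles_of (length Ms) p) *
     (\<Sum>I | I \<in> indices N (length Ms) \<and> refines (points (length Ms)) p (Ker (length Ms) I).
        tensor_entry Ms I)"

text \<open>\<open>mat_unit N i j\<close> maps \<open>e\<^sub>j\<close> to \<open>e\<^sub>i\<close>.\<close>

definition mat_unit :: "nat \<Rightarrow> nat \<Rightarrow> nat \<Rightarrow> complex mat" where
  "mat_unit N i j = mat N N (\<lambda>(a, b). if a = i \<and> b = j then 1 else 0)"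

definition rho_entry :: "nat \<Rightarrow> nat \<Rightarrow> point set set \<Rightarrow> (point \<Rightarrow> nat) \<Rightarrow> complex" where
  "rho_entry N k p J =
     (\<Sum>I | I \<in> indices N k \<and> refines (points k) p (Ker k I).
        tensor_entry (map (\<lambda>l. mat_unit N (I (Inr l)) (I (Inl l))) [0..<k]) J)"

text \<open>
  The truncated subtraction is exact, since the join with \<open>id\<close> never has more blocks than \<open>p\<close>.
  Existence needs a law invariant under conjugation by permutations; uniqueness needs \<open>N \<ge> 2 k\<close>.
\<close>

definition P_cumulant ::
  "'w measure \<Rightarrow> nat \<Rightarrow> point set set \<Rightarrow> ('w \<Rightarrow> complex mat) list \<Rightarrow> complex" where
  "P_cumulant M N p Xs =
     (let k = length Xs in
      (THE \<kappa>. \<kappa> \<in> extensional (Parts k) \<and>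
        (\<forall>J\<in>indices N k.
           integral\<^sup>L M (\<lambda>\<omega>. tensor_entry (map (\<lambda>X. X \<omega>) Xs) J) =
           (\<Sum>q\<in>Parts k.
              1 / of_nat N ^ (card q - card (cycles_of k q)) * \<kappa> q * rho_entry N k q J))) p)"

type_synonym 'w random_mats = "nat \<Rightarrow> 'w \<Rightarrow> complex mat"

definition E_P_moment ::
  "(nat \<Rightarrow> 'w measure) \<Rightarrow> point set set \<Rightarrow> 'w random_mats list \<Rightarrow> nat \<Rightarrow> complex" where
  "E_P_moment M p Xs N = integral\<^sup>L (M N) (\<lambda>\<omega>. P_moment N p (map (\<lambda>X. X N \<omega>) Xs))"

definition random_matrix :: "'w measure \<Rightarrow> nat \<Rightarrow> ('w \<Rightarrow> complex mat) \<Rightarrow> bool" where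
  "random_matrix M N X \<longleftrightarrow>
     (\<forall>\<omega>\<in>space M. X \<omega> \<in> carrier_mat N N) \<and>
     (\<forall>a<N. \<forall>b<N. (\<lambda>\<omega>. X \<omega> $$ (a, b)) \<in> borel_measurable M)"

definition joint_law ::
  "'w measure \<Rightarrow> nat \<Rightarrow> 'j set \<Rightarrow> ('j \<Rightarrow> 'w \<Rightarrow> complex mat) \<Rightarrow> ('j \<times> nat \<times> nat \<Rightarrow> complex) measure" where
  "joint_law M N J X =
     distr M (Pi\<^sub>M (J \<times> {..<N} \<times> {..<N}) (\<lambda>_. borel))
       (\<lambda>\<omega>. \<lambda>(j, a, b)\<in>J \<times> {..<N} \<times> {..<N}. X j \<omega> $$ (a, b))"

definition conj_invariant ::
  "'w measure \<Rightarrow> nat \<Rightarrow> 'j set \<Rightarrow> ('j \<Rightarrow> 'w \<Rightarrow> complex mat) \<Rightarrow> bool" where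
  "conj_invariant M N J X \<longleftrightarrow>
     (\<forall>\<tau>. \<tau> permutes {..<N} \<longrightarrow>
        joint_law M N J (\<lambda>j \<omega>. perm_mat N \<tau> * X j \<omega> * perm_mat N (inv_into UNIV \<tau>)) = joint_law M N J X)"

definition P_converges ::
  "(nat \<Rightarrow> 'w measure) \<Rightarrow> 'j set \<Rightarrow> ('j \<Rightarrow> 'w random_mats) \<Rightarrow> bool" where
  "P_converges M J X \<longleftrightarrow>
     (\<forall>N\<ge>2. (\<forall>j\<in>J. random_matrix (M N) N (X j N)) \<and> conj_invariant (M N) N J (\<lambda>j. X j N)) \<and>
     (\<forall>js p. set js \<subseteq> J \<and> p \<in> Parts (length js) \<longrightarrow>
        (\<forall>N\<ge>2. integrable (M N) (\<lambda>\<omega>. P_moment N p (map (\<lambda>j. X j N \<omega>) js))) \<and>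
        convergent (E_P_moment M p (map X js)))"

definition lim_P_cumulant ::
  "(nat \<Rightarrow> 'w measure) \<Rightarrow> point set set \<Rightarrow> 'w random_mats list \<Rightarrow> complex" where
  "lim_P_cumulant M p Xs = lim (\<lambda>N. P_cumulant (M N) N p (map (\<lambda>X. X N) Xs))"

section \<open>Freeness\<close>

definition P_free :: "(nat \<Rightarrow> 'w measure) \<Rightarrow> 'w random_mats list \<Rightarrow> bool" where
  "P_free M As \<longleftrightarrow>
     P_converges M {..<length As} (\<lambda>i. As ! i) \<and>
     (\<forall>js p. set js \<subseteq> {..<length As} \<and> p \<in> Parts (length js) \<and>
        (\<exists>a<length js. \<exists>b<length js. js ! a \<noteq> js ! b \<and>
           (\<exists>c\<in>cycles_of (length js) p. Inl a \<in> c \<and> Inl b \<in> c)) \<longrightarrow>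
        lim_P_cumulant M p (map (\<lambda>j. As ! j) js) = 0) \<and>
     (\<forall>kps. length kps = length As \<and> (\<forall>(k, p)\<in>set kps. p \<in> Parts k) \<longrightarrow>
        lim_P_cumulant M (part_tensors kps)
          (concat (map2 (\<lambda>(k, p) A. replicate k A) kps As)) =
        (\<Prod>j<length As. lim_P_cumulant M (snd (kps ! j)) (replicate (fst (kps ! j)) (As ! j))))"

definition ntr :: "nat \<Rightarrow> complex mat \<Rightarrow> complex" where
  "ntr N A = (\<Sum>i<N. A $$ (i, i)) / of_nat N"

definition mat_prod :: "nat \<Rightarrow> complex mat list \<Rightarrow> complex mat" where
  "mat_prod N Ms = foldr (*) Ms (1\<^sub>m N)"

definition mat_poly :: "nat \<Rightarrow> complex poly \<Rightarrow> complex mat \<Rightarrow> complex mat" where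
  "mat_poly N P A = mat N N (\<lambda>ab. \<Sum>i\<le>degree P. coeff P i * (A ^\<^sub>m i) $$ ab)"

definition E_tr_word :: "(nat \<Rightarrow> 'w measure) \<Rightarrow> 'w random_mats list \<Rightarrow> nat \<Rightarrow> complex" where
  "E_tr_word M Xs N = integral\<^sup>L (M N) (\<lambda>\<omega>. ntr N (mat_prod N (map (\<lambda>X. X N \<omega>) Xs)))"

text \<open>
  Freeness, with respect to the limit of \<open>E (1/N) Tr\<close>, of the unital algebras generated by the
  single elements: alternating products of centred polynomials are centred.
\<close>

definition asymptotically_free :: "(nat \<Rightarrow> 'w measure) \<Rightarrow> 'w random_mats list \<Rightarrow> bool" where
  "asymptotically_free M As \<longleftrightarrow>
     (\<forall>js. set js \<subseteq> {..<length As} \<longrightarrow> convergent (E_tr_word M (map (\<lambda>j. As ! j) js))) \<and>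
     (\<forall>w :: (nat \<times> complex poly) list.
        w \<noteq> [] \<and> distinct_adj (map fst w) \<and>
        (\<forall>(i, P)\<in>set w. i < length As \<and>
           E_tr_word M [\<lambda>N \<omega>. mat_poly N P ((As ! i) N \<omega>)] \<longlonglongrightarrow> 0) \<longrightarrow>
        E_tr_word M (map (\<lambda>(i, P) N \<omega>. mat_poly N P ((As ! i) N \<omega>)) w) \<longlonglongrightarrow> 0)"

section \<open>Multiplicative Levy processes\<close>

type_synonym 'w perm_process = "nat \<Rightarrow> real \<Rightarrow> 'w \<Rightarrow> nat \<Rightarrow> nat"

definition marginal :: "'w perm_process \<Rightarrow> real \<Rightarrow> 'w random_mats" where
  "marginal S t N \<omega> = perm_mat N (S N t \<omega>)"

definition increment :: "'w perm_process \<Rightarrow> real \<Rightarrow> real \<Rightarrow> 'w random_mats" where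
  "increment S s t N \<omega> = perm_mat N (S N t \<omega> \<circ> inv_into UNIV (S N s \<omega>))"

definition reset_at_0 :: "'w perm_process \<Rightarrow> 'w perm_process" where
  "reset_at_0 S N t \<omega> = (if t = 0 then id else S N t \<omega>)"

text \<open>The time intervals \<open>[s i, t i]\<close>, \<open>i < n\<close>, are disjoint up to endpoints and in increasing order.\<close>

definition successive_intervals :: "nat \<Rightarrow> (nat \<Rightarrow> real) \<Rightarrow> (nat \<Rightarrow> real) \<Rightarrow> bool" where
  "successive_intervals n s t \<longleftrightarrow>
     (\<forall>i<n. 0 \<le> s i \<and> s i < t i) \<and> (\<forall>i. Suc i < n \<longrightarrow> t i \<le> s (Suc i))"

definition increments ::
  "'w perm_process \<Rightarrow> nat \<Rightarrow> (nat \<Rightarrow> real) \<Rightarrow> (nat \<Rightarrow> real) \<Rightarrow> 'w random_mats list" where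
  "increments S n s t = map (\<lambda>i. increment S (s i) (t i)) [0..<n]"

text \<open>
  The process starts from the identity in the limit: replacing its value at time \<open>0\<close> by the
  identity leaves all limiting joint moments unchanged. Stationarity: the limiting moments of the
  increment from \<open>s\<close> to \<open>t\<close> exist and are functions \<open>\<mu>\<close> of \<open>t - s\<close>.
\<close>

definition multiplicative_P_levy :: "(nat \<Rightarrow> 'w measure) \<Rightarrow> 'w perm_process \<Rightarrow> bool" where
  "multiplicative_P_levy M S \<longleftrightarrow>
     (\<forall>ts p. set ts \<subseteq> {0..} \<and> p \<in> Parts (length ts) \<longrightarrow>
        (\<lambda>N. E_P_moment M p (map (marginal S) ts) N -
             E_P_moment M p (map (marginal (reset_at_0 S)) ts) N) \<longlonglongrightarrow> 0) \<and>
     (\<forall>k. \<forall>p\<in>Parts k. \<exists>\<mu>. \<forall>s t. 0 \<le> s \<and> s \<le> t \<longrightarrow>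
        E_P_moment M p (replicate k (increment S s t)) \<longlonglongrightarrow> \<mu> (t - s)) \<and>
     (\<forall>n s t. successive_intervals n s t \<longrightarrow> P_free M (increments S n s t)) \<and>
     (\<forall>k. \<forall>p\<in>Parts k.
        ((\<lambda>t. lim (E_P_moment M p (replicate k (marginal S t)))) \<longlongrightarrow>
          lim (\<lambda>N. P_moment N p (replicate k (1\<^sub>m N)))) (at_right 0))"

definition multiplicative_free_levy :: "(nat \<Rightarrow> 'w measure) \<Rightarrow> 'w perm_process \<Rightarrow> bool" where
  "multiplicative_free_levy M S \<longleftrightarrow>
     (\<forall>ts. set ts \<subseteq> {0..} \<longrightarrow>
        (\<lambda>N. E_tr_word M (map (marginal S) ts) N -
             E_tr_word M (map (marginal (reset_at_0 S)) ts) N) \<longlonglongrightarrow> 0) \<and>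
     (\<forall>k. \<exists>\<mu>. \<forall>s t. 0 \<le> s \<and> s \<le> t \<longrightarrow>
        E_tr_word M (replicate k (increment S s t)) \<longlonglongrightarrow> \<mu> (t - s)) \<and>
     (\<forall>n s t. successive_intervals n s t \<longrightarrow> asymptotically_free M (increments S n s t)) \<and>
     (\<forall>k. ((\<lambda>t. lim (E_tr_word M (replicate k (marginal S t)))) \<longlongrightarrow>
        lim (\<lambda>N. ntr N (mat_prod N (replicate k (1\<^sub>m N))))) (at_right 0))"

end

theory Submission
  imports Defs "HOL-Real_Asymp.Real_Asymp"
begin

text \<open>
  Moments, values on index tuples with prescribed kernel, and cumulants of a conjugation-invariant
  random tensor determine one another through triangular systems whose coefficients stay bounded
  after normalization, because coarsening one partition removes at least as many blocks as coarsening
  its join with another. Hence convergence of the moments implies convergence of the cumulants.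

  Multiplying a word by an independent permutation acts on the moments through the cumulants of that
  permutation, with coefficients that converge. Applied to a uniform element of \<open>\<lambda>\<^sub>N\<close> this says that
  the generator acts on the finitely many moments of order \<open>k\<close> by a matrix that converges, so the
  exponential series of the semigroup converges as well. The moments of a single permutation
  factorize over the cycles of the partition and are read off the cycle counts. Applied to the
  independent increments of the walk it gives convergence of all joint moments, while independence
  itself yields the two conditions of P-freeness already for finite \<open>N\<close>.

  For centred increments \<open>A - a\<close>, \<open>B - b\<close> with \<open>a = exp (-s)\<close>, \<open>b = exp (-t)\<close> the limiting expected
  trace of \<open>(A - a)(B - b)(A - a)(B - b)\<close> is at least \<open>ab(1 - a)(1 - b) > 0\<close>, whereas freeness would
  make it vanish.
\<close>

section \<open>Functions constant on the blocks of a partition\<close>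

definition const_on :: "'a set set \<Rightarrow> ('a \<Rightarrow> 'b) \<Rightarrow> bool" where
  "const_on p I \<longleftrightarrow> (\<forall>b\<in>p. \<forall>x\<in>b. \<forall>y\<in>b. I x = I y)"

lemma const_onD: "const_on p I \<Longrightarrow> b \<in> p \<Longrightarrow> x \<in> b \<Longrightarrow> y \<in> b \<Longrightarrow> I x = I y"
  unfolding const_on_def by blast

lemma const_onI: "(\<And>b x y. b \<in> p \<Longrightarrow> x \<in> b \<Longrightarrow> y \<in> b \<Longrightarrow> I x = I y) \<Longrightarrow> const_on p I"
  unfolding const_on_def by blast

lemma const_on_Un: "const_on (p \<union> q) I \<longleftrightarrow> const_on p I \<and> const_on q I"
  unfolding const_on_def by blast

lemma const_on_cong:
  assumes "\<Union>p \<subseteq> A" "\<And>x. x \<in> A \<Longrightarrow> I x = J x"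
  shows "const_on p I \<longleftrightarrow> const_on p J"
  using assms unfolding const_on_def by (metis Union_upper subsetD)

lemma const_on_refines: "refines A p q \<Longrightarrow> const_on q I \<Longrightarrow> const_on p I"
  unfolding const_on_def refines_def by (meson subsetD)

lemma same_block:
  assumes "partition_on A p" "b \<in> p" "c \<in> p" "x \<in> b" "x \<in> c"
  shows "b = c"
  using partition_onD2[OF assms(1)] assms(2-5) unfolding disjoint_def by blast

lemma card_const_on_extending:
  assumes T: "finite T" and P: "partition_on T P" and B: "B \<subseteq> T" and I: "I \<in> B \<rightarrow> {..<N}"
  shows "card {K \<in> T \<rightarrow>\<^sub>E {..<N}. const_on P K \<and> (\<forall>x\<in>B. K x = I x)} =
    (if const_on ((\<lambda>c. c \<inter> B) ` P) I then N ^ card {c \<in> P. c \<inter> B = {}} else 0)"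
proof (cases "const_on ((\<lambda>c. c \<inter> B) ` P) I")
  case False
  then obtain c x y where c: "c \<in> P" "x \<in> c \<inter> B" "y \<in> c \<inter> B" "I x \<noteq> I y"
    unfolding const_on_def by blast
  have "{K \<in> T \<rightarrow>\<^sub>E {..<N}. const_on P K \<and> (\<forall>x\<in>B. K x = I x)} = {}"
  proof -
    have "I x = I y" if "const_on P K" "\<forall>x\<in>B. K x = I x" for K
      using const_onD[OF that(1) c(1), of x y] that(2) c by auto
    then show ?thesis using c(4) by blast
  qed
  then show ?thesis unfolding if_not_P[OF False] by (simp only: card.empty)
next
  case True
  define D where "D = {c \<in> P. c \<inter> B = {}}"
  define blk where "blk x = (THE c. c \<in> P \<and> x \<in> c)" for x
  have blk_eq: "blk x = c" if "c \<in> P" "x \<in> c" for c x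
    unfolding blk_def using that same_block[OF P] by (intro the_equality) auto
  have blk: "blk x \<in> P" "x \<in> blk x" if "x \<in> T" for x
  proof -
    obtain c where "c \<in> P" "x \<in> c" using \<open>x \<in> T\<close> P by (auto simp: partition_on_def)
    then show "blk x \<in> P" "x \<in> blk x" using blk_eq by auto
  qed
  have sub: "c \<subseteq> T" if "c \<in> P" for c using that P by (auto simp: partition_on_def)
  have ne: "c \<noteq> {}" if "c \<in> P" for c using that P by (auto simp: partition_on_def)
  define rep where "rep c = (SOME x. x \<in> c)" for c :: "'a set"
  have rep: "rep c \<in> c" if "c \<in> P" for c
    unfolding rep_def using ne[OF that] by (simp add: some_in_eq)
  define rep' where "rep' c = (SOME x. x \<in> c \<inter> B)" for c :: "'a set"
  have rep': "rep' c \<in> c \<inter> B" if "c \<in> P" "c \<notin> D" for c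
    unfolding rep'_def some_in_eq using that by (simp add: D_def)
  have fin: "finite P" using finite_elements[OF T P] .
  define \<Phi> where "\<Phi> K = restrict (\<lambda>c. K (rep c)) D" for K :: "'a \<Rightarrow> nat"
  define \<Psi> where "\<Psi> F = restrict (\<lambda>x. if blk x \<in> D then F (blk x) else I (rep' (blk x))) T"
    for F :: "'a set \<Rightarrow> nat"
  define S where "S = {K \<in> T \<rightarrow>\<^sub>E {..<N}. const_on P K \<and> (\<forall>x\<in>B. K x = I x)}"
  have Ib: "I (rep' c) = I x" if "c \<in> P" "x \<in> c" "x \<in> B" for c x
  proof -
    have "c \<notin> D" using that by (auto simp: D_def)
    from rep'[OF that(1) this] show ?thesis
      using that by (intro const_onD[OF True, of "c \<inter> B"]) auto
  qed
  have "bij_betw \<Phi> S (D \<rightarrow>\<^sub>E {..<N})"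
  proof (rule bij_betw_byWitness[where f' = \<Psi>])
    show "\<forall>K\<in>S. \<Psi> (\<Phi> K) = K"
    proof
      fix K assume K: "K \<in> S"
      show "\<Psi> (\<Phi> K) = K"
      proof
        fix x
        show "\<Psi> (\<Phi> K) x = K x"
        proof (cases "x \<in> T")
          case True
          note bx = blk[OF True]
          show ?thesis
          proof (cases "blk x \<in> D")
            case D: True
            then have "\<Psi> (\<Phi> K) x = K (rep (blk x))" using True by (simp add: \<Psi>_def \<Phi>_def)
            also have "\<dots> = K x" using K const_onD[of P K, OF _ bx(1) rep[OF bx(1)] bx(2)] by (simp add: S_def)
            finally show ?thesis .
          next
            case nD: False
            note r = rep'[OF bx(1) nD]
            have "\<Psi> (\<Phi> K) x = I (rep' (blk x))" using True nD by (simp add: \<Psi>_def)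
            also have "\<dots> = K (rep' (blk x))" using K r by (auto simp: S_def)
            also have "\<dots> = K x"
              using r by (intro const_onD[of P K, OF _ bx(1) _ bx(2)]) (use K in \<open>auto simp: S_def\<close>)
            finally show ?thesis .
          qed
        next
          case False
          then show ?thesis using K by (auto simp: \<Psi>_def S_def PiE_def extensional_def)
        qed
      qed
    qed
    show "\<forall>F\<in>D \<rightarrow>\<^sub>E {..<N}. \<Phi> (\<Psi> F) = F"
    proof
      fix F assume F: "F \<in> D \<rightarrow>\<^sub>E {..<N}"
      show "\<Phi> (\<Psi> F) = F"
      proof
        fix c
        show "\<Phi> (\<Psi> F) c = F c"
        proof (cases "c \<in> D")
          case True
          then have c: "c \<in> P" by (simp add: D_def)
          have "rep c \<in> T" using rep[OF c] sub[OF c] by blast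
          moreover have "blk (rep c) = c" using blk_eq[OF c rep[OF c]] .
          ultimately show ?thesis using True by (simp add: \<Phi>_def \<Psi>_def)
        next
          case False
          then show ?thesis using F by (auto simp: \<Phi>_def PiE_def extensional_def)
        qed
      qed
    qed
    show "\<Phi> ` S \<subseteq> D \<rightarrow>\<^sub>E {..<N}"
    proof
      fix F assume "F \<in> \<Phi> ` S"
      then obtain K where K: "K \<in> S" "F = \<Phi> K" by blast
      have "K (rep c) < N" if "c \<in> D" for c
      proof -
        have "c \<in> P" using that by (simp add: D_def)
        then have "rep c \<in> T" using rep sub by blast
        then show ?thesis using K by (auto simp: S_def PiE_def Pi_def)
      qed
      then show "F \<in> D \<rightarrow>\<^sub>E {..<N}" by (simp add: K \<Phi>_def)
    qed
    show "\<Psi> ` (D \<rightarrow>\<^sub>E {..<N}) \<subseteq> S"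
    proof
      fix K assume "K \<in> \<Psi> ` (D \<rightarrow>\<^sub>E {..<N})"
      then obtain F where F: "F \<in> D \<rightarrow>\<^sub>E {..<N}" "K = \<Psi> F" by blast
      have val: "K x = (if c \<in> D then F c else I (rep' c))" if "c \<in> P" "x \<in> c" for c x
      proof -
        have "x \<in> T" using sub that by blast
        then show ?thesis using blk_eq[OF that] by (simp add: F \<Psi>_def)
      qed
      have "K x < N" if "x \<in> T" for x
      proof (cases "blk x \<in> D")
        case True
        then show ?thesis using val[OF blk[OF that]] F(1) by (auto simp: PiE_def Pi_def)
      next
        case False
        then show ?thesis using val[OF blk[OF that]] I rep'[OF blk(1)[OF that] False]
          by (auto simp: Pi_def)
      qed
      moreover have "K \<in> extensional T" by (simp add: F \<Psi>_def)
      moreover have "const_on P K" unfolding const_on_def using val by simp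
      moreover have "K x = I x" if "x \<in> B" for x
      proof -
        have xT: "x \<in> T" using that B by blast
        note bx = blk[OF xT]
        have "blk x \<notin> D" using bx that by (auto simp: D_def)
        then show ?thesis using val[OF bx] Ib[OF bx that] by simp
      qed
      ultimately show "K \<in> S" by (auto simp: S_def PiE_def)
    qed
  qed
  then have "card S = card (D \<rightarrow>\<^sub>E {..<N})" by (rule bij_betw_same_card)
  also have "\<dots> = N ^ card D" using fin by (subst card_PiE) (auto simp: D_def)
  finally show ?thesis using True by (simp add: S_def D_def)
qed

lemma card_const_on:
  assumes "finite A" "partition_on A p"
  shows "card {I \<in> A \<rightarrow>\<^sub>E {..<N}. const_on p I} = N ^ card p"
  using card_const_on_extending[OF assms, of "{}" undefined N]
  by (simp add: const_on_def)

lemma const_on_part_sup: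
  assumes "partition_on A p" "partition_on A q"
  shows "const_on (part_sup A p q) I \<longleftrightarrow> const_on p I \<and> const_on q I"
proof
  assume "const_on (part_sup A p q) I"
  then show "const_on p I \<and> const_on q I"
    using refines_part_supI(2,3)[OF assms] const_on_refines by blast
next
  assume c: "const_on p I \<and> const_on q I"
  have "I x = I y" if "(x, y) \<in> (block_rel p \<union> block_rel q)\<^sup>+" for x y
    using that
  proof induction
    case (base y)
    then show ?case using c by (auto simp: block_rel_def dest: const_onD)
  next
    case (step y z)
    then have "I y = I z" using c by (auto simp: block_rel_def dest: const_onD)
    then show ?case using step.IH by simp
  qed
  then show "const_on (part_sup A p q) I"
    unfolding part_sup_def quotient_def by (intro const_onI) (clarsimp, metis)
qed

lemma card_refines_le:
  assumes "finite A" "refines A p q"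
  shows "card q \<le> card p"
proof -
  have pq: "partition_on A p" "partition_on A q" using assms(2) by (auto simp: refines_def)
  have "{I \<in> A \<rightarrow>\<^sub>E {..<2::nat}. const_on q I} \<subseteq> {I \<in> A \<rightarrow>\<^sub>E {..<2}. const_on p I}"
    using const_on_refines[OF assms(2)] by blast
  moreover have "finite {I \<in> A \<rightarrow>\<^sub>E {..<2::nat}. const_on p I}"
    using assms(1) by (auto intro: finite_subset[OF _ finite_PiE[of A "\<lambda>_. {..<2::nat}"]])
  ultimately have "(2::nat) ^ card q \<le> 2 ^ card p"
    unfolding card_const_on[OF assms(1) pq(1), of 2, symmetric]
      card_const_on[OF assms(1) pq(2), of 2, symmetric]
    by (intro card_mono)
  then show ?thesis by simp
qed

text \<open>
  On the functions into the field with two elements this is the second isomorphism theorem.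
\<close>

lemma card_part_sup_Lipschitz:
  assumes A: "finite A" and qq: "refines A q q'" and r: "partition_on A r"
  shows "card (part_sup A q r) + card q' \<le> card q + card (part_sup A q' r)"
proof -
  have q: "partition_on A q" and q': "partition_on A q'" using qq by (auto simp: refines_def)
  define V where "V X = {I \<in> A \<rightarrow>\<^sub>E {..<2::nat}. const_on X I}" for X
  define add where "add I J = restrict (\<lambda>x. (I x + J x) mod 2) A" for I J :: "'a \<Rightarrow> nat"
  have fV: "finite (V X)" for X
    unfolding V_def using A by (auto intro: finite_subset[OF _ finite_PiE[of A "\<lambda>_. {..<2::nat}"]])
  have sub: "\<Union>X \<subseteq> A" if "partition_on A X" for X using that by (auto simp: partition_on_def)
  have add_V: "add I J \<in> V X" if "const_on X I" "const_on X J" "\<Union>X \<subseteq> A" for I J X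
  proof -
    have "add I J x = add I J y" if b: "b \<in> X" "x \<in> b" "y \<in> b" for b x y
    proof -
      have "x \<in> A" "y \<in> A" using b \<open>\<Union>X \<subseteq> A\<close> by auto
      moreover have "I x = I y" "J x = J y"
        using const_onD[OF \<open>const_on X I\<close> b] const_onD[OF \<open>const_on X J\<close> b] by blast+
      ultimately show ?thesis by (simp add: add_def)
    qed
    then have "const_on X (add I J)" by (rule const_onI)
    then show ?thesis unfolding V_def by (simp add: add_def)
  qed
  have card_V: "card (V X) = 2 ^ card X" if "partition_on A X" for X
    unfolding V_def by (rule card_const_on[OF A that])
  have card_V2: "card (V (X \<union> r)) = 2 ^ card (part_sup A X r)" if "partition_on A X" for X
  proof -
    have "V (X \<union> r) = V (part_sup A X r)"
      unfolding V_def const_on_Un const_on_part_sup[OF that r] by simp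
    then show ?thesis using card_V[OF refines_part_supI(1)[OF that r]] by simp
  qed
  define Dm where "Dm = V (q \<union> r) \<times> V q'"
  define f where "f = (\<lambda>(I, J). add I J)"
  have fDm: "finite Dm" by (simp add: Dm_def fV)
  have img: "f ` Dm \<subseteq> V q"
  proof
    fix K assume "K \<in> f ` Dm"
    then obtain I J where "I \<in> V (q \<union> r)" "J \<in> V q'" "K = add I J"
      by (auto simp: f_def Dm_def)
    then show "K \<in> V q"
      using add_V[of q I J] sub[OF q] const_on_refines[OF qq, of J]
      by (simp add: V_def const_on_Un)
  qed
  have fibre: "card {z \<in> Dm. f z = K} \<le> card (V (q' \<union> r))" for K
  proof (cases "{z \<in> Dm. f z = K} = {}")
    case False
    then obtain I0 J0 where z0: "I0 \<in> V (q \<union> r)" "J0 \<in> V q'" "add I0 J0 = K"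
      by (auto simp: f_def Dm_def)
    have inj: "inj_on (\<lambda>(I, J). add I I0) {z \<in> Dm. f z = K}"
    proof (rule inj_onI, clarsimp simp: f_def Dm_def)
      fix I J I' J'
      assume h: "I \<in> V (q \<union> r)" "J \<in> V q'" "K = add I J" "I' \<in> V (q \<union> r)" "J' \<in> V q'"
        "add I' J' = add I J" "add I I0 = add I' I0"
      have lt: "I x < 2" "J x < 2" "I' x < 2" "J' x < 2" if "x \<in> A" for x
        using h that by (auto simp: V_def PiE_def Pi_def)
      have 1: "I x = I' x" if "x \<in> A" for x
      proof -
        have "(I x + I0 x) mod 2 = (I' x + I0 x) mod 2"
          using fun_cong[OF h(7), of x] that by (simp add: add_def)
        then show ?thesis using lt[OF that] by presburger
      qed
      have 2: "J x = J' x" if "x \<in> A" for x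
      proof -
        have "(I' x + J' x) mod 2 = (I x + J x) mod 2"
          using fun_cong[OF h(6), of x] that by (simp add: add_def)
        then show ?thesis using lt[OF that] 1[OF that] by presburger
      qed
      show "I = I' \<and> J = J'"
        using 1 2 h by (auto simp: V_def PiE_def intro: extensionalityI)
    qed
    have "(\<lambda>(I, J). add I I0) ` {z \<in> Dm. f z = K} \<subseteq> V (q' \<union> r)"
    proof (clarsimp simp: f_def Dm_def)
      fix I J assume h: "I \<in> V (q \<union> r)" "J \<in> V q'" "K = add I J"
      have 1: "const_on q' (add I I0)"
      proof (rule const_onI)
        fix b x y assume b: "b \<in> q'" "x \<in> b" "y \<in> b"
        have xA: "x \<in> A" "y \<in> A" using sub[OF q'] b by auto
        have "(I x + J x) mod 2 = (I0 x + J0 x) mod 2" "(I y + J y) mod 2 = (I0 y + J0 y) mod 2"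
          using fun_cong[OF trans[OF z0(3) h(3)], of x] fun_cong[OF trans[OF z0(3) h(3)], of y] xA
          by (simp_all add: add_def)
        then have "even (I x + J x) = even (I0 x + J0 x)" "even (I y + J y) = even (I0 y + J0 y)"
          by (metis even_mod_2_iff)+
        moreover have "J x = J y" "J0 x = J0 y"
          using const_onD[of q' J, OF _ b] const_onD[of q' J0, OF _ b] h(2) z0(2) by (simp_all add: V_def)
        ultimately have "even (I x + I0 x) = even (I y + I0 y)" by (simp only: even_add) blast
        then show "add I I0 x = add I I0 y"
          using xA by (simp add: add_def mod2_eq_if)
      qed
      have 2: "const_on r (add I I0)"
        using add_V[of r I I0] h(1) z0(1) sub[OF r] by (auto simp: V_def const_on_Un)
      show "add I I0 \<in> V (q' \<union> r)" using 1 2 by (auto simp: V_def const_on_Un add_def)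
    qed
    then show ?thesis by (rule card_inj_on_le[OF inj _ fV])
  next
    case True
    then show ?thesis by (simp only: card.empty)
  qed
  have "card Dm = (\<Sum>K\<in>V q. card {z \<in> Dm. f z = K})"
  proof -
    have "(\<Sum>z\<in>Dm. 1) = (\<Sum>K\<in>V q. \<Sum>z\<in>{z \<in> Dm. f z = K}. 1::nat)"
      by (rule sum.group[OF fDm fV img, symmetric])
    then show ?thesis by simp
  qed
  also have "\<dots> \<le> (\<Sum>K\<in>V q. card (V (q' \<union> r)))" by (rule sum_mono) (rule fibre)
  finally have "card (V (q \<union> r)) * card (V q') \<le> card (V q) * card (V (q' \<union> r))"
    by (simp add: Dm_def card_cartesian_product)
  then have "(2::nat) ^ (card (part_sup A q r) + card q') \<le> 2 ^ (card q + card (part_sup A q' r))"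
    unfolding card_V[OF q] card_V[OF q'] card_V2[OF q] card_V2[OF q'] by (simp add: power_add)
  then show ?thesis by simp
qed

lemma part_sup_commute: "part_sup A p q = part_sup A q p"
  unfolding part_sup_def by (simp add: Un_commute)

section \<open>Partitions and index tuples\<close>

lemma finite_points [simp]: "finite (points k)"
  by (simp add: points_def)

lemma card_points: "card (points k) = 2 * k"
  unfolding points_def by (subst card_Un_disjoint) (auto simp: card_image)

lemma Inl_in_points [simp]: "Inl l \<in> points k \<longleftrightarrow> l < k"
  and Inr_in_points [simp]: "Inr l \<in> points k \<longleftrightarrow> l < k"
  by (auto simp: points_def)

lemma Parts_partition: "p \<in> Parts k \<Longrightarrow> partition_on (points k) p"
  by (simp add: Parts_def)

lemma Parts_sub: "p \<in> Parts k \<Longrightarrow> \<Union>p \<subseteq> points k"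
  by (auto simp: Parts_def partition_on_def)

lemma finite_Parts [simp]: "finite (Parts k)"
proof (rule finite_subset)
  show "Parts k \<subseteq> Pow (Pow (points k))" by (auto simp: Parts_def partition_on_def)
qed simp

lemma finite_Parts_elem: "p \<in> Parts k \<Longrightarrow> finite p"
  using finite_elements[OF finite_points Parts_partition] .

lemma part_id_Parts [simp]: "part_id k \<in> Parts k"
  unfolding Parts_def part_id_def partition_on_def points_def disjoint_def by auto

lemma const_on_part_id: "const_on (part_id k) I \<longleftrightarrow> (\<forall>l<k. I (Inl l) = I (Inr l))"
  unfolding const_on_def part_id_def by auto

lemma cycles_of_Parts: "p \<in> Parts k \<Longrightarrow> cycles_of k p \<in> Parts k"
  unfolding cycles_of_def using refines_part_supI(1)[OF Parts_partition Parts_partition[OF part_id_Parts]]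
  by (auto simp: Parts_def)

lemma const_on_cycles_of:
  "p \<in> Parts k \<Longrightarrow> const_on (cycles_of k p) I \<longleftrightarrow> const_on p I \<and> (\<forall>l<k. I (Inl l) = I (Inr l))"
  unfolding cycles_of_def
  by (simp add: const_on_part_sup[OF Parts_partition Parts_partition[OF part_id_Parts]] const_on_part_id)

lemma refines_cycles_of: "p \<in> Parts k \<Longrightarrow> refines (points k) p (cycles_of k p)"
  unfolding cycles_of_def
  by (rule refines_part_supI(2)[OF Parts_partition Parts_partition[OF part_id_Parts]])

lemma card_cycles_le: "p \<in> Parts k \<Longrightarrow> card (cycles_of k p) \<le> card p"
  using card_refines_le[OF finite_points refines_cycles_of] .

definition defect :: "nat \<Rightarrow> point set set \<Rightarrow> nat" where
  "defect k p = card p - card (cycles_of k p)"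

lemma defect_mono:
  assumes "refines (points k) q p"
  shows "defect k p \<le> defect k q" "card (cycles_of k p) \<le> card (cycles_of k q)"
proof -
  have pq: "p \<in> Parts k" "q \<in> Parts k" using assms by (auto simp: refines_def Parts_def)
  have "card (cycles_of k q) + card p \<le> card q + card (cycles_of k p)"
    unfolding cycles_of_def
    by (rule card_part_sup_Lipschitz[OF finite_points assms Parts_partition[OF part_id_Parts]])
  then show "defect k p \<le> defect k q"
    using card_cycles_le[OF pq(1)] card_cycles_le[OF pq(2)] by (simp add: defect_def)
  have "refines (points k) (cycles_of k q) (cycles_of k p)"
    unfolding cycles_of_def
    using refines_part_supI[OF Parts_partition[OF pq(2)] Parts_partition[OF part_id_Parts]]
      refines_part_supI[OF Parts_partition[OF pq(1)] Parts_partition[OF part_id_Parts]]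
      refines_trans[OF assms] by blast
  then show "card (cycles_of k p) \<le> card (cycles_of k q)"
    by (rule card_refines_le[OF finite_points])
qed

lemma card_part_sup_le:
  assumes p: "p \<in> Parts k" and q: "q \<in> Parts k"
  shows "card (part_sup (points k) p q) \<le> card (cycles_of k p) + defect k q"
proof -
  let ?A = "points k"
  note pp = Parts_partition[OF p] and qp = Parts_partition[OF q]
  note cq = cycles_of_Parts[OF q] note cqp = Parts_partition[OF cq]
  have "card (part_sup ?A q p) + card (cycles_of k q) \<le> card q + card (part_sup ?A (cycles_of k q) p)"
    by (rule card_part_sup_Lipschitz[OF finite_points refines_cycles_of[OF q] pp])
  moreover have "card (part_sup ?A (cycles_of k q) p) \<le> card (cycles_of k p)"
  proof (rule card_refines_le[OF finite_points])
    have "refines ?A (part_id k) (cycles_of k q)"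
      unfolding cycles_of_def
      by (rule refines_part_supI(3)[OF qp Parts_partition[OF part_id_Parts]])
    then have 1: "refines ?A (part_id k) (part_sup ?A (cycles_of k q) p)"
      using refines_part_supI(2)[OF cqp pp] refines_trans by blast
    show "refines ?A (cycles_of k p) (part_sup ?A (cycles_of k q) p)"
      unfolding cycles_of_def[of k p]
      by (rule refines_part_supI(4)[OF pp Parts_partition[OF part_id_Parts] _ 1])
        (rule refines_part_supI(3)[OF cqp pp])
  qed
  ultimately show ?thesis
    using card_cycles_le[OF q] by (simp add: defect_def part_sup_commute[of ?A p q])
qed

lemma finite_indices [simp]: "finite (indices N k)"
  unfolding indices_def by (intro finite_PiE) auto

lemma indices_less: "I \<in> indices N k \<Longrightarrow> x \<in> points k \<Longrightarrow> I x < N"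
  by (auto simp: indices_def PiE_def Pi_def)

lemma Ker_equiv: "equiv (points k) {(a, b). a \<in> points k \<and> b \<in> points k \<and> I a = I b}"
  by (rule equivI) (auto simp: refl_on_def sym_def trans_def)

lemma Ker_Parts [simp]: "Ker k I \<in> Parts k"
  unfolding Ker_def Parts_def using partition_on_quotient[OF Ker_equiv] by auto

lemma refines_Ker_iff:
  assumes "p \<in> Parts k"
  shows "refines (points k) p (Ker k I) \<longleftrightarrow> const_on p I"
proof
  assume "refines (points k) p (Ker k I)"
  moreover have "const_on (Ker k I) I"
    unfolding const_on_def Ker_def quotient_def by auto
  ultimately show "const_on p I" by (rule const_on_refines)
next
  assume c: "const_on p I"
  have "\<exists>Y\<in>Ker k I. X \<subseteq> Y" if X: "X \<in> p" for X
  proof -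
    have "X \<noteq> {}" using X Parts_partition[OF assms] by (auto simp: partition_on_def)
    then obtain x where x: "x \<in> X" by blast
    have "X \<subseteq> points k" using X Parts_sub[OF assms] by blast
    have "X \<subseteq> {(a, b). a \<in> points k \<and> b \<in> points k \<and> I a = I b} `` {x}"
    proof
      fix y assume y: "y \<in> X"
      then show "y \<in> {(a, b). a \<in> points k \<and> b \<in> points k \<and> I a = I b} `` {x}"
        using const_onD[OF c X x y] x \<open>X \<subseteq> points k\<close> by blast
    qed
    then show ?thesis unfolding Ker_def using x \<open>X \<subseteq> points k\<close> by (meson quotientI subsetD)
  qed
  then show "refines (points k) p (Ker k I)"
    using Parts_partition[OF assms] Parts_partition[OF Ker_Parts] by (auto simp: refines_def)
qed

lemma Ker_eq_iff:
  "Ker k I = Ker k J \<longleftrightarrow> (\<forall>x\<in>points k. \<forall>y\<in>points k. I x = I y \<longleftrightarrow> J x = J y)"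
proof
  assume "Ker k I = Ker k J"
  then have "refines (points k) (Ker k I) (Ker k J)" "refines (points k) (Ker k J) (Ker k I)"
    using refines_refl[OF Parts_partition[OF Ker_Parts]] by metis+
  then have c: "const_on (Ker k I) J" "const_on (Ker k J) I"
    by (simp_all add: refines_Ker_iff)
  have *: "\<exists>b\<in>Ker k H. x \<in> b \<and> y \<in> b" if "x \<in> points k" "y \<in> points k" "H x = H y" for x y and H :: "point \<Rightarrow> nat"
    unfolding Ker_def quotient_def using that by auto
  show "\<forall>x\<in>points k. \<forall>y\<in>points k. I x = I y \<longleftrightarrow> J x = J y"
  proof (intro ballI)
    fix x y assume xy: "x \<in> points k" "y \<in> points k"
    show "I x = I y \<longleftrightarrow> J x = J y"
      using *[OF xy, of I] *[OF xy, of J] const_onD[OF c(1), of _ x y] const_onD[OF c(2), of _ x y]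
      by blast
  qed
next
  assume "\<forall>x\<in>points k. \<forall>y\<in>points k. I x = I y \<longleftrightarrow> J x = J y"
  then have "{(a, b). a \<in> points k \<and> b \<in> points k \<and> I a = I b} =
    {(a, b). a \<in> points k \<and> b \<in> points k \<and> J a = J b}" by auto
  then show "Ker k I = Ker k J" by (simp add: Ker_def)
qed

lemma Ker_surj:
  assumes p: "p \<in> Parts k" and N: "2 * k \<le> N"
  shows "\<exists>J\<in>indices N k. Ker k J = p"
proof -
  note pp = Parts_partition[OF p]
  have "card p \<le> card (points k)"
  proof -
    have "inj_on (\<lambda>b. SOME x. x \<in> b) p"
    proof (rule inj_onI)
      fix b c assume bc: "b \<in> p" "c \<in> p" "(SOME x. x \<in> b) = (SOME x. x \<in> c)"
      have "b \<noteq> {}" "c \<noteq> {}" using bc pp by (auto simp: partition_on_def)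
      then have "(SOME x. x \<in> b) \<in> b" "(SOME x. x \<in> b) \<in> c"
        using some_in_eq[of b] some_in_eq[of c] bc(3) by metis+
      then show "b = c" using same_block[OF pp bc(1,2)] by blast
    qed
    moreover have "(\<lambda>b. SOME x. x \<in> b) ` p \<subseteq> points k"
    proof clarify
      fix b assume b: "b \<in> p"
      then have "b \<noteq> {}" using pp by (auto simp: partition_on_def)
      then have "(SOME x. x \<in> b) \<in> b" by (simp add: some_in_eq)
      then show "(SOME x. x \<in> b) \<in> points k" using b Parts_sub[OF p] by blast
    qed
    ultimately show ?thesis by (rule card_inj_on_le) simp
  qed
  then have "card p \<le> card {..<N}" using N by (simp add: card_points)
  then obtain e where e: "e ` p \<subseteq> {..<N}" "inj_on e p"
    using card_le_inj[OF finite_Parts_elem[OF p]] by (metis finite_lessThan)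
  define blk where "blk x = (THE c. c \<in> p \<and> x \<in> c)" for x
  have blk_eq: "blk x = c" if "c \<in> p" "x \<in> c" for c x
    unfolding blk_def using that same_block[OF pp] by (intro the_equality) auto
  have blk: "blk x \<in> p" "x \<in> blk x" if "x \<in> points k" for x
  proof -
    obtain c where "c \<in> p" "x \<in> c" using \<open>x \<in> points k\<close> pp by (auto simp: partition_on_def)
    then show "blk x \<in> p" "x \<in> blk x" using blk_eq by auto
  qed
  define J where "J = restrict (\<lambda>x. e (blk x)) (points k)"
  have J: "J \<in> indices N k" using e blk by (auto simp: J_def indices_def)
  have r1: "refines (points k) p (Ker k J)"
    unfolding refines_Ker_iff[OF p] const_on_def J_def
    using blk_eq Parts_sub[OF p] by auto
  have "\<exists>Y\<in>p. X \<subseteq> Y" if "X \<in> Ker k J" for X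
  proof -
    obtain x where x: "x \<in> points k" "X = {y \<in> points k. J x = J y}"
      using \<open>X \<in> Ker k J\<close> by (auto simp: Ker_def quotient_def)
    have "y \<in> blk x" if "y \<in> X" for y
    proof -
      have y: "y \<in> points k" "e (blk x) = e (blk y)" using that x by (auto simp: J_def)
      then have "blk x = blk y" using e(2) blk x(1) by (metis inj_onD)
      then show ?thesis using blk(2)[OF y(1)] by simp
    qed
    then show ?thesis using blk(1)[OF x(1)] by blast
  qed
  then have "refines (points k) (Ker k J) p"
    using pp Parts_partition[OF Ker_Parts] by (auto simp: refines_def)
  then have "Ker k J = p" using r1 refines_asym by blast
  then show ?thesis using J by blast
qed

section \<open>Triangular systems\<close>

lemma triangular_exists:
  fixes F :: "'a \<Rightarrow> 'b :: ab_group_add"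
  assumes P: "finite P" and refl: "\<And>\<pi>. \<pi> \<in> P \<Longrightarrow> rl \<pi> \<pi>"
    and r: "\<And>q \<pi>. q \<in> P \<Longrightarrow> \<pi> \<in> P \<Longrightarrow> rl q \<pi> \<Longrightarrow> q \<noteq> \<pi> \<Longrightarrow> (r q :: nat) < r \<pi>"
  shows "\<exists>c. \<forall>\<pi>\<in>P. F \<pi> = (\<Sum>q\<in>{q \<in> P. rl q \<pi>}. c q)"
proof -
  have "\<exists>c. \<forall>\<pi>\<in>P. r \<pi> < n \<longrightarrow> F \<pi> = (\<Sum>q\<in>{q \<in> P. rl q \<pi>}. c q)" for n
  proof (induction n)
    case (Suc n)
    then obtain c where c: "\<forall>\<pi>\<in>P. r \<pi> < n \<longrightarrow> F \<pi> = (\<Sum>q\<in>{q \<in> P. rl q \<pi>}. c q)" by blast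
    define c' where "c' \<pi> = (if r \<pi> = n then F \<pi> - (\<Sum>q\<in>{q \<in> P. rl q \<pi>} - {\<pi>}. c q) else c \<pi>)" for \<pi>
    have less: "r q < r \<pi>" if "q \<in> {q \<in> P. rl q \<pi>} - {\<pi>}" "\<pi> \<in> P" for q \<pi>
      using r[of q \<pi>] that by blast
    have "F \<pi> = (\<Sum>q\<in>{q \<in> P. rl q \<pi>}. c' q)" if \<pi>: "\<pi> \<in> P" "r \<pi> < Suc n" for \<pi>
    proof -
      have "(\<Sum>q\<in>{q \<in> P. rl q \<pi>}. c' q) = c' \<pi> + (\<Sum>q\<in>{q \<in> P. rl q \<pi>} - {\<pi>}. c' q)"
        using P \<pi> refl by (intro sum.remove) auto
      also have "(\<Sum>q\<in>{q \<in> P. rl q \<pi>} - {\<pi>}. c' q) = (\<Sum>q\<in>{q \<in> P. rl q \<pi>} - {\<pi>}. c q)"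
        using less[OF _ \<pi>(1)] \<pi>(2) by (intro sum.cong) (force simp: c'_def)+
      also have "c' \<pi> + \<dots> = F \<pi>"
      proof (cases "r \<pi> = n")
        case False
        have "F \<pi> = (\<Sum>q\<in>{q \<in> P. rl q \<pi>}. c q)" using c \<pi> False by simp
        also have "\<dots> = c \<pi> + (\<Sum>q\<in>{q \<in> P. rl q \<pi>} - {\<pi>}. c q)"
          using P \<pi> refl by (intro sum.remove) auto
        finally show ?thesis using False by (simp add: c'_def)
      qed (simp add: c'_def)
      finally show ?thesis by simp
    qed
    then show ?case by blast
  qed simp
  note ex = this
  define n where "n = Suc (Max (r ` P))"
  have "r \<pi> < n" if "\<pi> \<in> P" for \<pi> unfolding n_def using that P by (simp add: le_imp_less_Suc)
  then show ?thesis using ex[of n] by blast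
qed

lemma triangular_unique:
  fixes c c' :: "'a \<Rightarrow> 'b :: ab_group_add"
  assumes P: "finite P" and refl: "\<And>\<pi>. \<pi> \<in> P \<Longrightarrow> rl \<pi> \<pi>"
    and r: "\<And>q \<pi>. q \<in> P \<Longrightarrow> \<pi> \<in> P \<Longrightarrow> rl q \<pi> \<Longrightarrow> q \<noteq> \<pi> \<Longrightarrow> (r q :: nat) < r \<pi>"
    and eq: "\<And>\<pi>. \<pi> \<in> P \<Longrightarrow> (\<Sum>q\<in>{q \<in> P. rl q \<pi>}. c q) = (\<Sum>q\<in>{q \<in> P. rl q \<pi>}. c' q)"
  shows "\<pi> \<in> P \<Longrightarrow> c \<pi> = c' \<pi>"
proof (induction "r \<pi>" arbitrary: \<pi> rule: less_induct)
  case less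
  have "(\<Sum>q\<in>{q \<in> P. rl q \<pi>} - {\<pi>}. c q) = (\<Sum>q\<in>{q \<in> P. rl q \<pi>} - {\<pi>}. c' q)"
    using less r[OF _ less(2)] by (intro sum.cong) auto
  moreover have "(\<Sum>q\<in>{q \<in> P. rl q \<pi>}. d q) = d \<pi> + (\<Sum>q\<in>{q \<in> P. rl q \<pi>} - {\<pi>}. d q)" for d :: "'a \<Rightarrow> 'b"
    using P less(2) refl by (intro sum.remove) auto
  ultimately show ?case using eq[OF less(2)] by simp
qed

lemma triangular_convergent:
  fixes F c W :: "nat \<Rightarrow> 'a \<Rightarrow> real"
  assumes P: "finite P" and refl: "\<And>\<pi>. \<pi> \<in> P \<Longrightarrow> rl \<pi> \<pi>"
    and r: "\<And>q \<pi>. q \<in> P \<Longrightarrow> \<pi> \<in> P \<Longrightarrow> rl q \<pi> \<Longrightarrow> q \<noteq> \<pi> \<Longrightarrow> (r q :: nat) < r \<pi>"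
    and eq: "\<forall>\<^sub>F N in sequentially. \<forall>\<pi>\<in>P. W N \<pi> \<noteq> 0 \<and> F N \<pi> = (\<Sum>q\<in>{q \<in> P. rl q \<pi>}. c N q)"
    and F: "\<And>\<pi>. \<pi> \<in> P \<Longrightarrow> convergent (\<lambda>N. W N \<pi> * F N \<pi>)"
    and W: "\<And>q \<pi>. q \<in> P \<Longrightarrow> \<pi> \<in> P \<Longrightarrow> rl q \<pi> \<Longrightarrow> convergent (\<lambda>N. W N \<pi> / W N q)"
  shows "\<pi> \<in> P \<Longrightarrow> convergent (\<lambda>N. W N \<pi> * c N \<pi>)"
proof (induction "r \<pi>" arbitrary: \<pi> rule: less_induct)
  case less
  let ?Q = "{q \<in> P. rl q \<pi>} - {\<pi>}"
  have ev: "\<forall>\<^sub>F N in sequentially. W N \<pi> * c N \<pi> = W N \<pi> * F N \<pi> - (\<Sum>q\<in>?Q. (W N \<pi> / W N q) * (W N q * c N q))"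
    using eq
  proof eventually_elim
    case (elim N)
    have "F N \<pi> = (\<Sum>q\<in>{q \<in> P. rl q \<pi>}. c N q)" using elim less(2) by blast
    also have "\<dots> = c N \<pi> + (\<Sum>q\<in>?Q. c N q)"
      using P less(2) refl by (intro sum.remove) auto
    finally have "W N \<pi> * c N \<pi> = W N \<pi> * F N \<pi> - (\<Sum>q\<in>?Q. W N \<pi> * c N q)"
      by (simp add: algebra_simps sum_distrib_left)
    also have "(\<Sum>q\<in>?Q. W N \<pi> * c N q) = (\<Sum>q\<in>?Q. (W N \<pi> / W N q) * (W N q * c N q))"
      using elim by (intro sum.cong) auto
    finally show ?case .
  qed
  have "convergent (\<lambda>N. W N \<pi> * F N \<pi> - (\<Sum>q\<in>?Q. (W N \<pi> / W N q) * (W N q * c N q)))"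
  proof (intro convergent_diff F convergent_sum)
    fix q assume q: "q \<in> ?Q"
    show "convergent (\<lambda>N. (W N \<pi> / W N q) * (W N q * c N q))"
      using q less(2) r[OF _ less(2), of q] by (intro convergent_mult W less(1)) auto
  qed (fact less(2))
  then obtain l where "(\<lambda>N. W N \<pi> * F N \<pi> - (\<Sum>q\<in>?Q. (W N \<pi> / W N q) * (W N q * c N q))) \<longlonglongrightarrow> l"
    by (auto simp: convergent_def)
  then have "(\<lambda>N. W N \<pi> * c N \<pi>) \<longlonglongrightarrow> l" using ev by (simp add: tendsto_cong)
  then show ?case by (auto simp: convergent_def)
qed

lemma convergent_eventually_eq:
  fixes f g :: "nat \<Rightarrow> 'a :: topological_space"
  assumes "\<forall>\<^sub>F n in sequentially. f n = g n" "convergent g"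
  shows "convergent f"
  using assms tendsto_cong[OF assms(1)] unfolding convergent_def by simp

lemma tendsto_power_ratio_0:
  assumes "a < b"
  shows "(\<lambda>N. real N ^ a / real N ^ b) \<longlonglongrightarrow> 0"
proof -
  have "(\<lambda>N. (1 / real N) ^ (b - a)) \<longlonglongrightarrow> 0 ^ (b - a)"
    by (intro tendsto_power lim_1_over_n)
  moreover have "\<forall>\<^sub>F N in sequentially. (1 / real N) ^ (b - a) = real N ^ a / real N ^ b"
    using eventually_gt_at_top[of 0]
    by eventually_elim (use assms in \<open>simp add: power_diff power_one_over field_simps\<close>)
  ultimately show ?thesis using assms by (simp add: tendsto_cong zero_power)
qed

lemma convergent_power_ratio:
  assumes "a \<le> b"
  shows "convergent (\<lambda>N. real N ^ a / real N ^ b)"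
proof (cases "a = b")
  case True
  have "\<forall>\<^sub>F N in sequentially. real N ^ a / real N ^ b = 1"
    using eventually_gt_at_top[of 0] by eventually_elim (use True in simp)
  then show ?thesis by (rule convergent_eventually_eq) (rule convergent_const)
next
  case False
  then show ?thesis using tendsto_power_ratio_0[of a b] assms by (auto simp: convergent_def)
qed

lemma card_refines_less:
  assumes A: "finite A" and pq: "refines A p q" and ne: "p \<noteq> q"
  shows "card q < card p"
proof (rule ccontr)
  assume "\<not> card q < card p"
  then have eq: "card p = card q" using card_refines_le[OF A pq] by simp
  have part: "partition_on A p" "partition_on A q" using pq by (auto simp: refines_def)
  define V where "V X = {I \<in> A \<rightarrow>\<^sub>E {..<2::nat}. const_on X I}" for X
  have fin: "finite (V p)"
    unfolding V_def using A by (auto intro: finite_subset[OF _ finite_PiE[of A "\<lambda>_. {..<2::nat}"]])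
  have sub: "V q \<subseteq> V p" unfolding V_def using const_on_refines[OF pq] by blast
  have "card (V p) = card (V q)"
    unfolding V_def card_const_on[OF A part(1)] card_const_on[OF A part(2)] eq ..
  then have VV: "V q = V p" using card_subset_eq[OF fin sub] by simp
  have "b \<in> q" if b: "b \<in> p" for b
  proof -
    obtain Y where Y: "Y \<in> q" "b \<subseteq> Y" using pq b by (auto simp: refines_def)
    have bA: "b \<subseteq> A" "b \<noteq> {}" using part(1) b by (auto simp: partition_on_def)
    define I where "I = restrict (\<lambda>x. if x \<in> b then 1 else 0::nat) A"
    have "const_on p I"
    proof (rule const_onI)
      fix c x y assume c: "c \<in> p" "x \<in> c" "y \<in> c"
      have "x \<in> b \<longleftrightarrow> y \<in> b" using same_block[OF part(1) b c(1)] c by blast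
      moreover have "x \<in> A" "y \<in> A" using part(1) c by (auto simp: partition_on_def)
      ultimately show "I x = I y" by (simp add: I_def)
    qed
    then have "I \<in> V p" by (simp add: V_def I_def)
    then have "I \<in> V q" using VV by simp
    then have cq: "const_on q I" by (simp add: V_def)
    obtain x where x: "x \<in> b" using bA by blast
    have "Y \<subseteq> b"
    proof
      fix y assume y: "y \<in> Y"
      have "I y = I x" using const_onD[OF cq Y(1) y] x Y(2) by blast
      moreover have "y \<in> A" "x \<in> A" using part(2) Y(1) y x bA by (auto simp: partition_on_def)
      ultimately show "y \<in> b" using x by (simp add: I_def split: if_splits)
    qed
    then show ?thesis using Y by (metis subset_antisym)
  qed
  then have "p \<subseteq> q" by blast
  then have "p = q" using card_subset_eq[OF finite_elements[OF A part(2)] _ eq] by blast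
  then show False using ne by simp
qed

definition corank :: "nat \<Rightarrow> point set set \<Rightarrow> nat" where
  "corank k p = (\<Sum>q\<in>Parts k. card q) - card p"

lemma corank_less:
  assumes "refines (points k) q p" "q \<noteq> p"
  shows "corank k q < corank k p"
proof -
  have "q \<in> Parts k" using assms(1) by (auto simp: refines_def Parts_def)
  then have "card q \<le> (\<Sum>q\<in>Parts k. card q)" by (intro member_le_sum) auto
  then show ?thesis using card_refines_less[OF finite_points assms] by (simp add: corank_def)
qed

section \<open>Moments and cumulants of tensors\<close>

definition mom :: "nat \<Rightarrow> nat \<Rightarrow> point set set \<Rightarrow> ((point \<Rightarrow> nat) \<Rightarrow> real) \<Rightarrow> real" where
  "mom N k p f = (\<Sum>I | I \<in> indices N k \<and> const_on p I. f I) / real N ^ card (cycles_of k p)"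

definition ker_invariant :: "nat \<Rightarrow> nat \<Rightarrow> ((point \<Rightarrow> nat) \<Rightarrow> 'a) \<Rightarrow> bool" where
  "ker_invariant N k f \<longleftrightarrow> (\<forall>I\<in>indices N k. \<forall>J\<in>indices N k. Ker k I = Ker k J \<longrightarrow> f I = f J)"

definition is_cumulant ::
  "nat \<Rightarrow> nat \<Rightarrow> ((point \<Rightarrow> nat) \<Rightarrow> 'a) \<Rightarrow> (point set set \<Rightarrow> 'a :: ab_group_add) \<Rightarrow> bool" where
  "is_cumulant N k f c \<longleftrightarrow> (\<forall>J\<in>indices N k. f J = (\<Sum>q\<in>{q \<in> Parts k. const_on q J}. c q))"

definition cum :: "nat \<Rightarrow> nat \<Rightarrow> ((point \<Rightarrow> nat) \<Rightarrow> real) \<Rightarrow> point set set \<Rightarrow> real" where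
  "cum N k f = (SOME c. is_cumulant N k f c)"

definition kap :: "nat \<Rightarrow> nat \<Rightarrow> ((point \<Rightarrow> nat) \<Rightarrow> real) \<Rightarrow> point set set \<Rightarrow> real" where
  "kap N k f q = real N ^ defect k q * cum N k f q"

lemma Ker_rep_ex: "\<exists>R. \<forall>\<pi>\<in>Parts k. 2 * k \<le> N \<longrightarrow> R \<pi> \<in> indices N k \<and> Ker k (R \<pi>) = \<pi>"
  by (rule bchoice) (use Ker_surj in blast)

lemma refines_Ker_set: "{q \<in> Parts k. refines (points k) q (Ker k J)} = {q \<in> Parts k. const_on q J}"
  using refines_Ker_iff by blast

lemma cumulant_exists:
  assumes N: "2 * k \<le> N" and f: "ker_invariant N k (f :: _ \<Rightarrow> 'a :: ab_group_add)"
  shows "\<exists>c. is_cumulant N k f c"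
proof -
  obtain R where R: "\<And>\<pi>. \<pi> \<in> Parts k \<Longrightarrow> R \<pi> \<in> indices N k \<and> Ker k (R \<pi>) = \<pi>"
    using Ker_rep_ex[of k N] N by blast
  have "\<exists>c. \<forall>\<pi>\<in>Parts k. f (R \<pi>) = (\<Sum>q\<in>{q \<in> Parts k. refines (points k) q \<pi>}. c q)"
    using refines_refl[OF Parts_partition] corank_less
    by (intro triangular_exists[where r = "corank k"]) auto
  then obtain c where c: "\<And>\<pi>. \<pi> \<in> Parts k \<Longrightarrow> f (R \<pi>) = (\<Sum>q\<in>{q \<in> Parts k. refines (points k) q \<pi>}. c q)"
    by blast
  have "f J = (\<Sum>q\<in>{q \<in> Parts k. const_on q J}. c q)" if J: "J \<in> indices N k" for J
  proof -
    have "f J = f (R (Ker k J))"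
      using f J R[OF Ker_Parts[of k J]] unfolding ker_invariant_def by metis
    then show ?thesis using c[OF Ker_Parts[of k J]] by (simp add: refines_Ker_set)
  qed
  then show ?thesis unfolding is_cumulant_def by blast
qed

lemma cumulant_unique:
  fixes c c' :: "point set set \<Rightarrow> 'a :: ab_group_add"
  assumes N: "2 * k \<le> N" and c: "is_cumulant N k f c" "is_cumulant N k f c'" and p: "p \<in> Parts k"
  shows "c p = c' p"
proof -
  obtain R where R: "\<And>\<pi>. \<pi> \<in> Parts k \<Longrightarrow> R \<pi> \<in> indices N k \<and> Ker k (R \<pi>) = \<pi>"
    using Ker_rep_ex[of k N] N by blast
  show ?thesis
  proof (rule triangular_unique[OF finite_Parts _ _ _ p, where rl = "refines (points k)" and r = "corank k"])
    fix \<pi> assume \<pi>: "\<pi> \<in> Parts k"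
    show "refines (points k) \<pi> \<pi>" by (rule refines_refl[OF Parts_partition[OF \<pi>]])
    have "f (R \<pi>) = (\<Sum>q\<in>{q \<in> Parts k. refines (points k) q \<pi>}. c q)"
      "f (R \<pi>) = (\<Sum>q\<in>{q \<in> Parts k. refines (points k) q \<pi>}. c' q)"
      using R[OF \<pi>] c refines_Ker_set[of k "R \<pi>"] unfolding is_cumulant_def by simp_all
    then show "(\<Sum>q\<in>{q \<in> Parts k. refines (points k) q \<pi>}. c q) =
      (\<Sum>q\<in>{q \<in> Parts k. refines (points k) q \<pi>}. c' q)" by simp
  qed (rule corank_less)
qed

lemma cum_is_cumulant:
  "2 * k \<le> N \<Longrightarrow> ker_invariant N k f \<Longrightarrow> is_cumulant N k f (cum N k f)"
  unfolding cum_def using cumulant_exists by (rule someI_ex)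

definition kernel_count :: "nat \<Rightarrow> nat \<Rightarrow> point set set \<Rightarrow> nat" where
  "kernel_count N k \<pi> = card {J \<in> indices N k. Ker k J = \<pi>}"

lemma sum_by_kernel:
  fixes g :: "(point \<Rightarrow> nat) \<Rightarrow> real"
  assumes p: "p \<in> Parts k"
  shows "(\<Sum>I | I \<in> indices N k \<and> const_on p I. g I) =
    (\<Sum>\<pi>\<in>{\<pi> \<in> Parts k. refines (points k) p \<pi>}. \<Sum>I\<in>{I \<in> indices N k. Ker k I = \<pi>}. g I)"
proof -
  have "(\<Sum>I | I \<in> indices N k \<and> const_on p I. g I) =
    (\<Sum>\<pi>\<in>{\<pi> \<in> Parts k. refines (points k) p \<pi>}. \<Sum>I\<in>{I \<in> {I \<in> indices N k. const_on p I}. Ker k I = \<pi>}. g I)"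
    by (rule sum.group[symmetric]) (auto simp: refines_Ker_iff[OF p])
  also have "\<dots> = (\<Sum>\<pi>\<in>{\<pi> \<in> Parts k. refines (points k) p \<pi>}. \<Sum>I\<in>{I \<in> indices N k. Ker k I = \<pi>}. g I)"
    using refines_Ker_iff[OF p] by (intro sum.cong) auto
  finally show ?thesis .
qed

lemma kernel_count_asymp:
  assumes p: "p \<in> Parts k"
  shows "(\<lambda>N. real (kernel_count N k p) / real N ^ card p) \<longlonglongrightarrow> 1"
proof -
  let ?Q = "{\<pi> \<in> Parts k. refines (points k) p \<pi>} - {p}"
  have card_I: "real (card {I \<in> indices N k. const_on \<pi> I}) = real N ^ card \<pi>" if "\<pi> \<in> Parts k" for N \<pi>
    unfolding indices_def card_const_on[OF finite_points Parts_partition[OF that]] by simp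
  have le: "real (kernel_count N k \<pi>) \<le> real N ^ card \<pi>" if "\<pi> \<in> Parts k" for N \<pi>
  proof -
    have "kernel_count N k \<pi> \<le> card {I \<in> indices N k. const_on \<pi> I}"
      unfolding kernel_count_def using refines_Ker_iff[OF that] refines_refl[OF Parts_partition[OF that]]
      by (intro card_mono) auto
    then show ?thesis unfolding card_I[OF that, symmetric] by (rule of_nat_mono)
  qed
  have eq: "real N ^ card p = real (kernel_count N k p) + (\<Sum>\<pi>\<in>?Q. real (kernel_count N k \<pi>))" for N
  proof -
    have "real N ^ card p = (\<Sum>I | I \<in> indices N k \<and> const_on p I. 1)"
      using card_I[OF p] by simp
    also have "\<dots> = (\<Sum>\<pi>\<in>{\<pi> \<in> Parts k. refines (points k) p \<pi>}. real (kernel_count N k \<pi>))"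
      unfolding sum_by_kernel[OF p] by (simp add: kernel_count_def)
    also have "\<dots> = real (kernel_count N k p) + (\<Sum>\<pi>\<in>?Q. real (kernel_count N k \<pi>))"
      using p refines_refl[OF Parts_partition[OF p]] by (intro sum.remove) auto
    finally show ?thesis .
  qed
  have "(\<lambda>N. \<Sum>\<pi>\<in>?Q. real (kernel_count N k \<pi>) / real N ^ card p) \<longlonglongrightarrow> (\<Sum>\<pi>\<in>?Q. 0)"
  proof (rule tendsto_sum)
    fix \<pi> assume \<pi>: "\<pi> \<in> ?Q"
    then have "card \<pi> < card p" using card_refines_less[OF finite_points, of k p \<pi>] by auto
    then have "(\<lambda>N. real N ^ card \<pi> / real N ^ card p) \<longlonglongrightarrow> 0" by (rule tendsto_power_ratio_0)
    then show "(\<lambda>N. real (kernel_count N k \<pi>) / real N ^ card p) \<longlonglongrightarrow> 0"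
    proof (rule Lim_null_comparison[rotated], intro always_eventually allI)
      fix N show "norm (real (kernel_count N k \<pi>) / real N ^ card p) \<le> real N ^ card \<pi> / real N ^ card p"
        using le[of \<pi> N] \<pi> by (simp add: divide_right_mono)
    qed
  qed
  then have "(\<lambda>N. 1 - (\<Sum>\<pi>\<in>?Q. real (kernel_count N k \<pi>) / real N ^ card p)) \<longlonglongrightarrow> 1 - (\<Sum>\<pi>\<in>?Q. 0)"
    by (intro tendsto_diff tendsto_const)
  moreover have "\<forall>\<^sub>F N in sequentially. 1 - (\<Sum>\<pi>\<in>?Q. real (kernel_count N k \<pi>) / real N ^ card p) =
    real (kernel_count N k p) / real N ^ card p"
    using eventually_gt_at_top[of 0]
  proof eventually_elim
    case (elim N)
    then have "1 = real N ^ card p / real N ^ card p" by simp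
    also have "\<dots> = real (kernel_count N k p) / real N ^ card p + (\<Sum>\<pi>\<in>?Q. real (kernel_count N k \<pi>) / real N ^ card p)"
      by (subst eq) (simp add: add_divide_distrib sum_divide_distrib)
    finally show ?case by linarith
  qed
  ultimately show ?thesis by (simp add: tendsto_cong)
qed

lemma convergent_kap:
  assumes inv: "\<forall>\<^sub>F N in sequentially. ker_invariant N k (f N)"
    and conv: "\<And>p. p \<in> Parts k \<Longrightarrow> convergent (\<lambda>N. mom N k p (f N))"
    and q: "q \<in> Parts k"
  shows "convergent (\<lambda>N. kap N k (f N) q)"
proof -
  have "\<exists>R. \<forall>\<pi>\<in>Parts k. 2 * k \<le> N \<longrightarrow> R \<pi> \<in> indices N k \<and> Ker k (R \<pi>) = \<pi>" for N
    by (rule Ker_rep_ex)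
  then have "\<exists>R. \<forall>N. \<forall>\<pi>\<in>Parts k. 2 * k \<le> N \<longrightarrow> R N \<pi> \<in> indices N k \<and> Ker k (R N \<pi>) = \<pi>"
    by (intro choice) blast
  then obtain R where R: "\<And>N \<pi>. \<pi> \<in> Parts k \<Longrightarrow> 2 * k \<le> N \<Longrightarrow> R N \<pi> \<in> indices N k \<and> Ker k (R N \<pi>) = \<pi>"
    by blast
  define e where "e N \<pi> = f N (R N \<pi>)" for N \<pi>
  have ev: "\<forall>\<^sub>F N in sequentially. ker_invariant N k (f N) \<and> 2 * k \<le> N \<and> 0 < N"
    using inv eventually_ge_at_top[of "2 * k"] eventually_gt_at_top[of 0] by eventually_elim simp
  have fe: "f N J = e N (Ker k J)" if "ker_invariant N k (f N)" "2 * k \<le> N" "J \<in> indices N k" for N J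
    using that R[OF Ker_Parts[of k J] that(2)] unfolding ker_invariant_def e_def by metis
  have 1: "convergent (\<lambda>N. 1 / real N ^ card (cycles_of k \<pi>) * (real (kernel_count N k \<pi>) * e N \<pi>))"
    if \<pi>: "\<pi> \<in> Parts k" for \<pi>
  proof (rule triangular_convergent[OF finite_Parts _ _ _ _ _ \<pi>, where rl = "\<lambda>q \<pi>. refines (points k) \<pi> q"
        and r = card and F = "\<lambda>N p. \<Sum>I | I \<in> indices N k \<and> const_on p I. f N I"])
    show "refines (points k) \<pi> \<pi>" if "\<pi> \<in> Parts k" for \<pi> by (rule refines_refl[OF Parts_partition[OF that]])
    show "card q < card \<pi>" if "refines (points k) \<pi> q" "q \<noteq> \<pi>" for q \<pi>
      using card_refines_less[OF finite_points that(1)] that(2) by auto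
    show "\<forall>\<^sub>F N in sequentially. \<forall>p\<in>Parts k. 1 / real N ^ card (cycles_of k p) \<noteq> 0 \<and>
      (\<Sum>I | I \<in> indices N k \<and> const_on p I. f N I) =
      (\<Sum>\<pi>\<in>{\<pi> \<in> Parts k. refines (points k) p \<pi>}. real (kernel_count N k \<pi>) * e N \<pi>)"
      using ev
    proof eventually_elim
      case (elim N)
      have "(\<Sum>I\<in>{I \<in> indices N k. Ker k I = \<pi>}. f N I) = real (kernel_count N k \<pi>) * e N \<pi>" for \<pi>
        using fe elim by (simp add: kernel_count_def)
      then show ?case using elim by (simp add: sum_by_kernel)
    qed
    show "convergent (\<lambda>N. 1 / real N ^ card (cycles_of k p) * (\<Sum>I | I \<in> indices N k \<and> const_on p I. f N I))"
      if "p \<in> Parts k" for p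
      using conv[OF that] by (simp add: mom_def)
    show "convergent (\<lambda>N. 1 / real N ^ card (cycles_of k \<pi>) / (1 / real N ^ card (cycles_of k q)))"
      if "refines (points k) \<pi> q" for q \<pi>
      using convergent_power_ratio[OF defect_mono(2)[OF that]] by simp
  qed
  have 2: "convergent (\<lambda>N. real N ^ defect k \<pi> * e N \<pi>)" if \<pi>: "\<pi> \<in> Parts k" for \<pi>
  proof (rule convergent_eventually_eq)
    have "(\<lambda>N. inverse (real (kernel_count N k \<pi>) / real N ^ card \<pi>)) \<longlonglongrightarrow> inverse 1"
      by (intro tendsto_inverse kernel_count_asymp[OF \<pi>]) simp
    then have "convergent (\<lambda>N. inverse (real (kernel_count N k \<pi>) / real N ^ card \<pi>))"
      by (auto simp: convergent_def)
    then show "convergent (\<lambda>N. inverse (real (kernel_count N k \<pi>) / real N ^ card \<pi>) *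
      (1 / real N ^ card (cycles_of k \<pi>) * (real (kernel_count N k \<pi>) * e N \<pi>)))"
      by (intro convergent_mult 1[OF \<pi>])
    have nz: "\<forall>\<^sub>F N in sequentially. real (kernel_count N k \<pi>) / real N ^ card \<pi> > 0"
      using order_tendstoD(1)[OF kernel_count_asymp[OF \<pi>], of 0] by simp
    show "\<forall>\<^sub>F N in sequentially. real N ^ defect k \<pi> * e N \<pi> =
      inverse (real (kernel_count N k \<pi>) / real N ^ card \<pi>) *
      (1 / real N ^ card (cycles_of k \<pi>) * (real (kernel_count N k \<pi>) * e N \<pi>))"
      using nz ev
    proof eventually_elim
      case (elim N)
      then have k: "real (kernel_count N k \<pi>) \<noteq> 0" "N > 0" by (auto simp: zero_less_divide_iff)
      have "real N ^ defect k \<pi> = real N ^ card \<pi> / real N ^ card (cycles_of k \<pi>)"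
        unfolding defect_def using card_cycles_le[OF \<pi>] k by (simp add: power_diff)
      then show ?case using k by (simp add: field_simps)
    qed
  qed
  have "convergent (\<lambda>N. real N ^ defect k q * cum N k (f N) q)"
  proof (rule triangular_convergent[OF finite_Parts _ _ _ _ _ q, where rl = "refines (points k)"
        and r = "corank k" and F = e])
    show "refines (points k) \<pi> \<pi>" if "\<pi> \<in> Parts k" for \<pi> by (rule refines_refl[OF Parts_partition[OF that]])
    show "corank k q < corank k \<pi>" if "refines (points k) q \<pi>" "q \<noteq> \<pi>" for q \<pi>
      by (rule corank_less[OF that])
    show "\<forall>\<^sub>F N in sequentially. \<forall>\<pi>\<in>Parts k. real N ^ defect k \<pi> \<noteq> 0 \<and>
      e N \<pi> = (\<Sum>q\<in>{q \<in> Parts k. refines (points k) q \<pi>}. cum N k (f N) q)"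
      using ev
    proof eventually_elim
      case (elim N)
      have "e N \<pi> = (\<Sum>q\<in>{q \<in> Parts k. refines (points k) q \<pi>}. cum N k (f N) q)" if "\<pi> \<in> Parts k" for \<pi>
      proof -
        have "is_cumulant N k (f N) (cum N k (f N))" using cum_is_cumulant elim by blast
        then have "e N \<pi> = (\<Sum>q\<in>{q \<in> Parts k. const_on q (R N \<pi>)}. cum N k (f N) q)"
          using R[OF that] elim by (simp add: is_cumulant_def e_def)
        then show ?thesis using refines_Ker_set[of k "R N \<pi>"] R[OF that] elim by simp
      qed
      then show ?case using elim by simp
    qed
    show "convergent (\<lambda>N. real N ^ defect k \<pi> / real N ^ defect k q)" if "refines (points k) q \<pi>" for q \<pi>
      by (rule convergent_power_ratio[OF defect_mono(1)[OF that]])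
  qed (rule 2)
  then show ?thesis by (simp add: kap_def)
qed

section \<open>Convolution of tensors\<close>

lemma generated_partition:
  assumes "\<Union>F \<subseteq> T"
  shows "\<exists>P. partition_on T P \<and> (\<forall>K :: 'a \<Rightarrow> 'b. const_on P K \<longleftrightarrow> const_on F K)"
proof -
  define R where "R = block_rel F \<union> Id_on T"
  have eq: "equiv T (R\<^sup>+)"
  proof (rule equivI)
    have "R \<subseteq> T \<times> T" using assms by (auto simp: R_def block_rel_def)
    then show "R\<^sup>+ \<subseteq> T \<times> T" by (rule trancl_subset_Sigma)
    show "refl_on T (R\<^sup>+)" by (auto simp: refl_on_def R_def)
    show "sym (R\<^sup>+)" by (rule sym_trancl) (auto simp: sym_def R_def block_rel_def)
  qed auto
  have "const_on (T // R\<^sup>+) K \<longleftrightarrow> const_on F K" for K :: "'a \<Rightarrow> 'b"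
  proof
    assume c: "const_on (T // R\<^sup>+) K"
    show "const_on F K"
    proof (rule const_onI)
      fix b x y assume b: "b \<in> F" "x \<in> b" "y \<in> b"
      have "x \<in> T" using b assms by blast
      then have "R\<^sup>+ `` {x} \<in> T // R\<^sup>+" by (rule quotientI)
      moreover have "(x, y) \<in> R" "(x, x) \<in> R" using b by (auto simp: R_def block_rel_def)
      ultimately show "K x = K y" using const_onD[OF c, of "R\<^sup>+ `` {x}" x y] by blast
    qed
  next
    assume c: "const_on F K"
    have "K x = K y" if "(x, y) \<in> R\<^sup>+" for x y
      using that
    proof induction
      case (base y)
      then show ?case using const_onD[OF c] by (auto simp: R_def block_rel_def)
    next
      case (step y z)
      then have "K y = K z" using const_onD[OF c] by (auto simp: R_def block_rel_def)
      then show ?case using step.IH by simp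
    qed
    then show "const_on (T // R\<^sup>+) K"
      unfolding quotient_def by (intro const_onI) (clarsimp, metis)
  qed
  then show ?thesis using partition_on_quotient[OF eq] by blast
qed

lemma const_on_image: "const_on ((`) \<phi> ` p) K \<longleftrightarrow> const_on p (K \<circ> \<phi>)"
  unfolding const_on_def by simp

definition mid :: "nat \<Rightarrow> (point \<Rightarrow> nat) \<Rightarrow> (point \<Rightarrow> nat) \<Rightarrow> point \<Rightarrow> nat" where
  "mid k I' I = restrict (case_sum (\<lambda>l. I' (Inr l)) (\<lambda>l. I (Inr l))) (points k)"

lemma mid_indices: "I' \<in> indices N k \<Longrightarrow> I \<in> indices N k \<Longrightarrow> mid k I' I \<in> indices N k"
  by (auto simp: mid_def indices_def points_def PiE_def Pi_def)

lemma mid_simps [simp]: "l < k \<Longrightarrow> mid k I' I (Inl l) = I' (Inr l)" "l < k \<Longrightarrow> mid k I' I (Inr l) = I (Inr l)"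
  by (simp_all add: mid_def)

definition comp_tensor ::
  "nat \<Rightarrow> nat \<Rightarrow> ((point \<Rightarrow> nat) \<Rightarrow> real) \<Rightarrow> ((point \<Rightarrow> nat) \<Rightarrow> real) \<Rightarrow> (point \<Rightarrow> nat) \<Rightarrow> real" where
  "comp_tensor N k e f I =
    (\<Sum>I' | I' \<in> indices N k \<and> (\<forall>l<k. I' (Inl l) = I (Inl l)). e (mid k I' I) * f I')"

text \<open>
  A composition has three layers of \<open>k\<close> points, input, middle and output. Here \<^term>\<open>Inl x\<close> is the
  point \<open>x\<close> of the lower tensor, whose output is the middle layer, and \<^term>\<open>Inr l\<close> is the output
  point \<open>l\<close> of the upper one.
\<close>

lemma glue_exists:
  assumes p: "p \<in> Parts k" and q: "q \<in> Parts k"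
  shows "\<exists>z. fst z \<in> Parts k \<and> (\<forall>N. \<forall>I'\<in>indices N k.
    card {I \<in> indices N k. (\<forall>l<k. I (Inl l) = I' (Inl l)) \<and> const_on p I \<and> const_on q (mid k I' I)} =
    (if const_on (fst z) I' then N ^ snd z else 0))"
proof -
  define T :: "(point + nat) set" where "T = Inl ` points k \<union> Inr ` {..<k}"
  define B :: "(point + nat) set" where "B = Inl ` points k"
  define \<phi> :: "point \<Rightarrow> point + nat" where "\<phi> = case_sum (\<lambda>l. Inl (Inl l)) Inr"
  define \<psi> :: "point \<Rightarrow> point + nat" where "\<psi> = case_sum (\<lambda>l. Inl (Inr l)) Inr"
  have \<phi>: "\<phi> x \<in> T" and \<psi>: "\<psi> x \<in> T" if "x \<in> points k" for x
    using that by (auto simp: \<phi>_def \<psi>_def T_def points_def)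
  have "\<Union> ((`) \<phi> ` p \<union> (`) \<psi> ` q) \<subseteq> T"
    using Parts_sub[OF p] Parts_sub[OF q] \<phi> \<psi> by blast
  from generated_partition[OF this] obtain P where P: "partition_on T P"
    and cP: "\<And>K :: point + nat \<Rightarrow> nat. const_on P K \<longleftrightarrow> const_on p (K \<circ> \<phi>) \<and> const_on q (K \<circ> \<psi>)"
    unfolding const_on_Un const_on_image by blast
  have fT: "finite T" and BT: "B \<subseteq> T" by (auto simp: T_def B_def)
  define p' where "p' = (\<lambda>c. Inl -` c) ` P - {{}}"
  have "partition_on (points k) p'"
  proof (rule partition_onI)
    have "\<Union>P = T" using P by (simp add: partition_on_def)
    then have "x \<in> \<Union>p' \<longleftrightarrow> Inl x \<in> T" for x unfolding p'_def by blast
    then show "\<Union>p' = points k" by (auto simp: T_def)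
    show "disjnt c d" if cd: "c \<in> p'" "d \<in> p'" "c \<noteq> d" for c d
    proof -
      obtain c' d' where "c' \<in> P" "d' \<in> P" "c = Inl -` c'" "d = Inl -` d'"
        using cd by (auto simp: p'_def)
      then show ?thesis using same_block[OF P, of c' d'] cd(3) by (auto simp: disjnt_def)
    qed
    show "{} \<notin> p'" by (simp add: p'_def)
  qed
  then have p': "p' \<in> Parts k" by (simp add: Parts_def)
  define n where "n = card {c \<in> P. c \<inter> B = {}}"
  have "card {I \<in> indices N k. (\<forall>l<k. I (Inl l) = I' (Inl l)) \<and> const_on p I \<and> const_on q (mid k I' I)} =
    (if const_on p' I' then N ^ n else 0)" if I': "I' \<in> indices N k" for N I'
  proof -
    define I0 :: "point + nat \<Rightarrow> nat" where "I0 = case_sum I' (\<lambda>_. 0)"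
    have I0: "I0 \<in> B \<rightarrow> {..<N}" using indices_less[OF I'] by (auto simp: I0_def B_def)
    have "const_on ((\<lambda>c. c \<inter> B) ` P) I0 \<longleftrightarrow> const_on p' I'"
    proof
      assume c: "const_on ((\<lambda>c. c \<inter> B) ` P) I0"
      show "const_on p' I'"
      proof (rule const_onI)
        fix b x y assume b: "b \<in> p'" "x \<in> b" "y \<in> b"
        then obtain c' where c': "c' \<in> P" "Inl x \<in> c'" "Inl y \<in> c'" by (auto simp: p'_def)
        have "x \<in> points k" "y \<in> points k" using b Parts_sub[OF p'] by auto
        then have "I0 (Inl x) = I0 (Inl y)"
          using c' by (intro const_onD[OF c, of "c' \<inter> B"]) (auto simp: B_def)
        then show "I' x = I' y" by (simp add: I0_def)
      qed
    next
      assume c: "const_on p' I'"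
      show "const_on ((\<lambda>c. c \<inter> B) ` P) I0"
      proof (rule const_onI)
        fix b x y assume b: "b \<in> (\<lambda>c. c \<inter> B) ` P" "x \<in> b" "y \<in> b"
        then obtain c' x' y' where c': "c' \<in> P" "x = Inl x'" "y = Inl y'" "Inl x' \<in> c'" "Inl y' \<in> c'"
          by (auto simp: B_def)
        then have "I' x' = I' y'"
          by (intro const_onD[OF c, of "Inl -` c'"]) (auto simp: p'_def)
        then show "I0 x = I0 y" by (simp add: I0_def c')
      qed
    qed
    moreover have "card {I \<in> indices N k. (\<forall>l<k. I (Inl l) = I' (Inl l)) \<and> const_on p I \<and> const_on q (mid k I' I)} =
      card {K \<in> T \<rightarrow>\<^sub>E {..<N}. const_on P K \<and> (\<forall>x\<in>B. K x = I0 x)}"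
    proof (rule bij_betw_same_card)
      let ?up = "\<lambda>I. restrict (case_sum I' (\<lambda>l. I (Inr l))) T"
      let ?dn = "\<lambda>K. restrict (case_sum (\<lambda>l. I' (Inl l)) (\<lambda>l. K (Inr l))) (points k)"
      have cong: "const_on P (?up I) \<longleftrightarrow> const_on p I \<and> const_on q (mid k I' I)"
        if "\<forall>l<k. I (Inl l) = I' (Inl l)" for I
      proof -
        have "const_on p (?up I \<circ> \<phi>) \<longleftrightarrow> const_on p I"
          by (rule const_on_cong[OF Parts_sub[OF p]]) (use that in \<open>auto simp: points_def \<phi>_def T_def\<close>)
        moreover have "const_on q (?up I \<circ> \<psi>) \<longleftrightarrow> const_on q (mid k I' I)"
          by (rule const_on_cong[OF Parts_sub[OF q]]) (auto simp: points_def \<psi>_def T_def mid_def)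
        ultimately show ?thesis unfolding cP by blast
      qed
      have up: "?up I \<in> {K \<in> T \<rightarrow>\<^sub>E {..<N}. const_on P K \<and> (\<forall>x\<in>B. K x = I0 x)}"
        if I: "I \<in> {I \<in> indices N k. (\<forall>l<k. I (Inl l) = I' (Inl l)) \<and> const_on p I \<and> const_on q (mid k I' I)}" for I
      proof -
        have "?up I \<in> T \<rightarrow>\<^sub>E {..<N}"
          using I indices_less[OF I'] indices_less[of I N k] by (auto simp: T_def)
        moreover have "const_on P (?up I)" using cong[of I] I by blast
        moreover have "\<forall>x\<in>B. ?up I x = I0 x" by (auto simp: B_def T_def I0_def)
        ultimately show ?thesis by blast
      qed
      have dn: "?dn K \<in> {I \<in> indices N k. (\<forall>l<k. I (Inl l) = I' (Inl l)) \<and> const_on p I \<and> const_on q (mid k I' I)}"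
        and up_dn: "?up (?dn K) = K"
        if K: "K \<in> {K \<in> T \<rightarrow>\<^sub>E {..<N}. const_on P K \<and> (\<forall>x\<in>B. K x = I0 x)}" for K
      proof -
        have Kl: "K (Inl x) = I' x" if "x \<in> points k" for x
          using K that by (auto simp: B_def I0_def)
        have KT: "K \<in> T \<rightarrow>\<^sub>E {..<N}" using K by blast
        show ud: "?up (?dn K) = K"
        proof
          fix x show "?up (?dn K) x = K x"
          proof (cases "x \<in> T")
            case True
            then show ?thesis using Kl by (auto simp: T_def points_def)
          next
            case False
            then show ?thesis using PiE_arb[OF KT False] by simp
          qed
        qed
        have "?dn K \<in> indices N k"
          unfolding indices_def
        proof (rule PiE_I)
          fix x assume x: "x \<in> points k"
          have "K (Inr l) < N" if "l < k" for l
            using PiE_mem[OF KT, of "Inr l"] that by (auto simp: T_def)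
          then show "?dn K x \<in> {..<N}"
            using x indices_less[OF I'] by (auto simp: points_def)
        qed simp
        moreover have a: "\<forall>l<k. ?dn K (Inl l) = I' (Inl l)" by simp
        moreover have "const_on P (?up (?dn K))" unfolding ud using K by blast
        ultimately show "?dn K \<in> {I \<in> indices N k. (\<forall>l<k. I (Inl l) = I' (Inl l)) \<and> const_on p I \<and> const_on q (mid k I' I)}"
          using cong[OF a] by blast
      qed
      have dn_up: "?dn (?up I) = I" if I: "I \<in> indices N k" "\<forall>l<k. I (Inl l) = I' (Inl l)" for I
      proof
        fix x show "?dn (?up I) x = I x"
        proof (cases "x \<in> points k")
          case True
          then show ?thesis using I by (auto simp: points_def T_def)
        next
          case False
          then show ?thesis using PiE_arb[OF I(1)[unfolded indices_def] False] by simp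
        qed
      qed
      show "bij_betw ?up {I \<in> indices N k. (\<forall>l<k. I (Inl l) = I' (Inl l)) \<and> const_on p I \<and> const_on q (mid k I' I)}
        {K \<in> T \<rightarrow>\<^sub>E {..<N}. const_on P K \<and> (\<forall>x\<in>B. K x = I0 x)}"
      proof (rule bij_betw_byWitness[where f' = ?dn])
        show "\<forall>I\<in>{I \<in> indices N k. (\<forall>l<k. I (Inl l) = I' (Inl l)) \<and> const_on p I \<and> const_on q (mid k I' I)}.
          ?dn (?up I) = I" using dn_up by blast
      qed (use up dn up_dn in blast)+
    qed
    ultimately show ?thesis
      using card_const_on_extending[OF fT P BT I0] by (simp add: n_def)
  qed
  then show ?thesis using p' by (intro exI[of _ "(p', n)"]) simp
qed

definition glue :: "nat \<Rightarrow> point set set \<Rightarrow> point set set \<Rightarrow> point set set \<times> nat" where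
  "glue k p q = (SOME z. fst z \<in> Parts k \<and> (\<forall>N. \<forall>I'\<in>indices N k.
    card {I \<in> indices N k. (\<forall>l<k. I (Inl l) = I' (Inl l)) \<and> const_on p I \<and> const_on q (mid k I' I)} =
    (if const_on (fst z) I' then N ^ snd z else 0)))"

abbreviation glued :: "nat \<Rightarrow> point set set \<Rightarrow> point set set \<Rightarrow> point set set" where
  "glued k p q \<equiv> fst (glue k p q)"

lemma glued_Parts: "p \<in> Parts k \<Longrightarrow> q \<in> Parts k \<Longrightarrow> glued k p q \<in> Parts k"
  and glue_card: "p \<in> Parts k \<Longrightarrow> q \<in> Parts k \<Longrightarrow> I' \<in> indices N k \<Longrightarrow>
    card {I \<in> indices N k. (\<forall>l<k. I (Inl l) = I' (Inl l)) \<and> const_on p I \<and> const_on q (mid k I' I)} =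
    (if const_on (glued k p q) I' then N ^ snd (glue k p q) else 0)"
  using someI_ex[OF glue_exists[of p k q]] unfolding glue_def[symmetric] by blast+

lemma card_const_on_indices: "p \<in> Parts k \<Longrightarrow> card {I \<in> indices N k. const_on p I} = N ^ card p"
  unfolding indices_def by (rule card_const_on[OF finite_points Parts_partition])

text \<open>The exponent is found by gluing below the identity.\<close>

lemma glue_exponent:
  assumes p: "p \<in> Parts k" and q: "q \<in> Parts k"
  shows "snd (glue k p q) + card (cycles_of k (glued k p q)) = card (part_sup (points k) p q)"
proof -
  let ?N = "2 :: nat"
  define S where "S = {I \<in> indices ?N k. const_on p I \<and> const_on q I}"
  define D where "D = {I' \<in> indices ?N k. \<forall>l<k. I' (Inl l) = I' (Inr l)}"
  define h where "h I = restrict (case_sum (\<lambda>l. I (Inl l)) (\<lambda>l. I (Inl l))) (points k)" for I :: "point \<Rightarrow> nat"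
  have ps: "part_sup (points k) p q \<in> Parts k"
    using refines_part_supI(1)[OF Parts_partition[OF p] Parts_partition[OF q]] by (simp add: Parts_def)
  have card_S: "card S = ?N ^ card (part_sup (points k) p q)"
    unfolding card_const_on_indices[OF ps, symmetric] S_def
      const_on_part_sup[OF Parts_partition[OF p] Parts_partition[OF q]] ..
  have fS: "finite S" "finite D" by (simp_all add: S_def D_def)
  have hS: "h ` S \<subseteq> D"
    by (auto simp: S_def D_def h_def indices_def points_def)
  have fib: "{I \<in> S. h I = I'} =
    {I \<in> indices ?N k. (\<forall>l<k. I (Inl l) = I' (Inl l)) \<and> const_on p I \<and> const_on q (mid k I' I)}"
    if I': "I' \<in> D" for I'
  proof -
    have heq: "h I = I' \<longleftrightarrow> (\<forall>l<k. I (Inl l) = I' (Inl l))" if "I \<in> indices ?N k" for I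
    proof
      assume "h I = I'"
      then show "\<forall>l<k. I (Inl l) = I' (Inl l)" by (auto simp: h_def)
    next
      assume a: "\<forall>l<k. I (Inl l) = I' (Inl l)"
      show "h I = I'"
      proof
        fix x show "h I x = I' x"
        proof (cases "x \<in> points k")
          case True
          then show ?thesis using a I' by (auto simp: h_def D_def points_def)
        next
          case False
          then show ?thesis using I' by (auto simp: h_def D_def indices_def PiE_def extensional_def)
        qed
      qed
    qed
    have "const_on q (mid k I' I) \<longleftrightarrow> const_on q I" if "\<forall>l<k. I (Inl l) = I' (Inl l)" for I
      by (rule const_on_cong[OF Parts_sub[OF q]])
        (use that I' in \<open>auto simp: mid_def points_def D_def\<close>)
    then show ?thesis unfolding S_def using heq by blast
  qed
  have "card S = (\<Sum>I'\<in>D. card {I \<in> S. h I = I'})"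
  proof -
    have "(\<Sum>I'\<in>D. \<Sum>I\<in>{I \<in> S. h I = I'}. 1::nat) = (\<Sum>I\<in>S. 1)"
      by (rule sum.group[OF fS hS])
    then show ?thesis by simp
  qed
  also have "\<dots> = (\<Sum>I'\<in>D. if const_on (glued k p q) I' then ?N ^ snd (glue k p q) else 0)"
  proof (rule sum.cong[OF refl])
    fix I' assume I': "I' \<in> D"
    then have "I' \<in> indices ?N k" by (simp add: D_def)
    then show "card {I \<in> S. h I = I'} = (if const_on (glued k p q) I' then ?N ^ snd (glue k p q) else 0)"
      unfolding fib[OF I'] by (rule glue_card[OF p q])
  qed
  also have "\<dots> = card {I' \<in> D. const_on (glued k p q) I'} * ?N ^ snd (glue k p q)"
    using fS(2) by (simp add: sum.If_cases Int_def)
  also have "{I' \<in> D. const_on (glued k p q) I'} = {I' \<in> indices ?N k. const_on (cycles_of k (glued k p q)) I'}"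
    unfolding D_def const_on_cycles_of[OF glued_Parts[OF p q]] by blast
  also have "card \<dots> = ?N ^ card (cycles_of k (glued k p q))"
    by (rule card_const_on_indices[OF cycles_of_Parts[OF glued_Parts[OF p q]]])
  finally have "?N ^ card (part_sup (points k) p q) =
    ?N ^ (snd (glue k p q) + card (cycles_of k (glued k p q)))"
    using card_S by (simp add: power_add mult.commute)
  then show ?thesis by simp
qed

definition coef :: "nat \<Rightarrow> nat \<Rightarrow> point set set \<Rightarrow> point set set \<Rightarrow> real" where
  "coef N k p q = real N ^ card (part_sup (points k) p q) / real N ^ (card (cycles_of k p) + defect k q)"

lemma convergent_coef: "p \<in> Parts k \<Longrightarrow> q \<in> Parts k \<Longrightarrow> convergent (\<lambda>N. coef N k p q)"
  unfolding coef_def by (intro convergent_power_ratio card_part_sup_le)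

lemma mom_comp_tensor:
  assumes N: "2 * k \<le> N" "0 < N" and e: "ker_invariant N k e" and p: "p \<in> Parts k"
  shows "mom N k p (comp_tensor N k e f) = (\<Sum>q\<in>Parts k. kap N k e q * coef N k p q * mom N k (glued k p q) f)"
proof -
  let ?c = "cum N k e"
  have c: "e J = (\<Sum>q\<in>Parts k. if const_on q J then ?c q else 0)" if "J \<in> indices N k" for J
    using cum_is_cumulant[OF N(1) e] that by (simp add: is_cumulant_def sum.inter_filter)
  define S where "S = {I \<in> indices N k. const_on p I}"
  have fS: "finite S" by (simp add: S_def)
  have "(\<Sum>I\<in>S. comp_tensor N k e f I) =
    (\<Sum>I\<in>S. \<Sum>I'\<in>indices N k. if \<forall>l<k. I' (Inl l) = I (Inl l) then e (mid k I' I) * f I' else 0)"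
    unfolding comp_tensor_def by (simp add: sum.inter_filter)
  also have "\<dots> = (\<Sum>I'\<in>indices N k. \<Sum>I\<in>S. if \<forall>l<k. I' (Inl l) = I (Inl l) then e (mid k I' I) * f I' else 0)"
    by (rule sum.swap)
  also have "\<dots> = (\<Sum>I'\<in>indices N k. \<Sum>I\<in>S. \<Sum>q\<in>Parts k.
      if (\<forall>l<k. I (Inl l) = I' (Inl l)) \<and> const_on q (mid k I' I) then ?c q * f I' else 0)"
  proof (intro sum.cong refl)
    fix I' I assume I: "I' \<in> indices N k" "I \<in> S"
    then have "mid k I' I \<in> indices N k" by (auto simp: S_def intro: mid_indices)
    note c = c[OF this]
    show "(if \<forall>l<k. I' (Inl l) = I (Inl l) then e (mid k I' I) * f I' else 0) =
      (\<Sum>q\<in>Parts k. if (\<forall>l<k. I (Inl l) = I' (Inl l)) \<and> const_on q (mid k I' I) then ?c q * f I' else 0)"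
    proof (cases "\<forall>l<k. I (Inl l) = I' (Inl l)")
      case True
      then show ?thesis unfolding c by (simp add: sum_distrib_right if_distrib[of "\<lambda>x. x * f I'"] cong: if_cong)
    next
      case False
      then have "\<not> (\<forall>l<k. I' (Inl l) = I (Inl l))" by metis
      with False show ?thesis by (simp only: simp_thms if_False sum.neutral_const)
    qed
  qed
  also have "\<dots> = (\<Sum>I'\<in>indices N k. \<Sum>q\<in>Parts k. \<Sum>I\<in>S.
      if (\<forall>l<k. I (Inl l) = I' (Inl l)) \<and> const_on q (mid k I' I) then ?c q * f I' else 0)"
    by (intro sum.cong refl sum.swap)
  also have "\<dots> = (\<Sum>I'\<in>indices N k. \<Sum>q\<in>Parts k.
      if const_on (glued k p q) I' then real N ^ snd (glue k p q) * ?c q * f I' else 0)"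
  proof (intro sum.cong refl)
    fix I' q assume I': "I' \<in> indices N k" and q: "q \<in> Parts k"
    have "(\<Sum>I\<in>S. if (\<forall>l<k. I (Inl l) = I' (Inl l)) \<and> const_on q (mid k I' I) then ?c q * f I' else 0) =
      real (card {I \<in> indices N k. (\<forall>l<k. I (Inl l) = I' (Inl l)) \<and> const_on p I \<and> const_on q (mid k I' I)}) * (?c q * f I')"
    proof -
      have "{I \<in> S. (\<forall>l<k. I (Inl l) = I' (Inl l)) \<and> const_on q (mid k I' I)} =
        {I \<in> indices N k. (\<forall>l<k. I (Inl l) = I' (Inl l)) \<and> const_on p I \<and> const_on q (mid k I' I)}"
        by (auto simp: S_def)
      then show ?thesis by (simp add: sum.inter_filter[OF fS, symmetric])
    qed
    then show "(\<Sum>I\<in>S. if (\<forall>l<k. I (Inl l) = I' (Inl l)) \<and> const_on q (mid k I' I) then ?c q * f I' else 0) =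
      (if const_on (glued k p q) I' then real N ^ snd (glue k p q) * ?c q * f I' else 0)"
      unfolding glue_card[OF p q I'] by simp
  qed
  also have "\<dots> = (\<Sum>q\<in>Parts k. \<Sum>I'\<in>indices N k.
      if const_on (glued k p q) I' then real N ^ snd (glue k p q) * ?c q * f I' else 0)"
    by (rule sum.swap)
  also have "\<dots> = (\<Sum>q\<in>Parts k. real N ^ snd (glue k p q) * ?c q * (\<Sum>I' | I' \<in> indices N k \<and> const_on (glued k p q) I'. f I'))"
    by (simp add: sum.inter_filter[symmetric] sum_distrib_left)
  finally have eq: "(\<Sum>I\<in>S. comp_tensor N k e f I) = \<dots>" .
  have "mom N k p (comp_tensor N k e f) = (\<Sum>I\<in>S. comp_tensor N k e f I) / real N ^ card (cycles_of k p)"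
    by (simp add: mom_def S_def)
  also have "\<dots> = (\<Sum>q\<in>Parts k. kap N k e q * coef N k p q * mom N k (glued k p q) f)"
    unfolding eq sum_divide_distrib
  proof (intro sum.cong refl)
    fix q assume q: "q \<in> Parts k"
    show "real N ^ snd (glue k p q) * ?c q * (\<Sum>I' | I' \<in> indices N k \<and> const_on (glued k p q) I'. f I') /
        real N ^ card (cycles_of k p) = kap N k e q * coef N k p q * mom N k (glued k p q) f"
      using N(2) glue_exponent[OF p q, symmetric]
      by (simp add: kap_def coef_def mom_def power_add field_simps)
  qed
  finally show ?thesis .
qed

section \<open>Tensors of words in permutations\<close>

abbreviation perms :: "nat \<Rightarrow> (nat \<Rightarrow> nat) set" where
  "perms N \<equiv> {\<sigma>. \<sigma> permutes {..<N}}"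

definition ext :: "'l set \<Rightarrow> (nat \<Rightarrow> nat) \<Rightarrow> 'l \<Rightarrow> nat \<Rightarrow> nat" where
  "ext A g l = (if l \<in> A then g else id)"

definition word_tensor :: "nat \<Rightarrow> (nat \<Rightarrow> nat \<Rightarrow> nat) \<Rightarrow> (point \<Rightarrow> nat) \<Rightarrow> real" where
  "word_tensor k u J = of_bool (\<forall>l<k. J (Inr l) = u l (J (Inl l)))"

definition letter_tensor :: "nat \<Rightarrow> nat set \<Rightarrow> ((nat \<Rightarrow> nat) \<Rightarrow> real) \<Rightarrow> (point \<Rightarrow> nat) \<Rightarrow> real" where
  "letter_tensor N A wt J = (\<Sum>g\<in>perms N. wt g * of_bool (\<forall>l\<in>A. J (Inr l) = g (J (Inl l))))"

definition law_tensor :: "nat \<Rightarrow> nat \<Rightarrow> nat set \<Rightarrow> ((nat \<Rightarrow> nat) \<Rightarrow> real) \<Rightarrow> (point \<Rightarrow> nat) \<Rightarrow> real" where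
  "law_tensor N k A wt J = (\<Sum>g\<in>perms N. wt g * word_tensor k (ext A g) J)"

definition class_weight :: "nat \<Rightarrow> ((nat \<Rightarrow> nat) \<Rightarrow> real) \<Rightarrow> bool" where
  "class_weight N wt \<longleftrightarrow> (\<forall>\<tau>\<in>perms N. \<forall>\<sigma>\<in>perms N. wt (\<tau> \<circ> \<sigma> \<circ> inv_into UNIV \<tau>) = wt \<sigma>)"

lemma finite_perms [simp]: "finite (perms N)"
  by (rule finite_permutations) simp

lemma perms_conj: "\<tau> \<in> perms N \<Longrightarrow> \<sigma> \<in> perms N \<Longrightarrow> \<tau> \<circ> \<sigma> \<circ> inv_into UNIV \<tau> \<in> perms N"
  by (simp add: permutes_compose permutes_inv)

lemma perms_compose: "\<sigma> \<in> perms N \<Longrightarrow> \<tau> \<in> perms N \<Longrightarrow> \<sigma> \<circ> \<tau> \<in> perms N"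
  by (simp add: permutes_compose)

lemma perms_less: "\<sigma> \<in> perms N \<Longrightarrow> x < N \<Longrightarrow> \<sigma> x < N"
  using permutes_in_image[of \<sigma> "{..<N}" x] by simp

lemma id_perms [simp]: "id \<in> perms N"
  by (simp add: permutes_id)

lemma conj_inv_cancel: "\<tau> \<in> perms N \<Longrightarrow> inv_into UNIV \<tau> \<circ> (\<tau> \<circ> \<sigma> \<circ> inv_into UNIV \<tau>) \<circ> \<tau> = \<sigma>"
  by (auto simp: fun_eq_iff permutes_inverses)

lemma sum_perms_conj:
  assumes "\<tau> \<in> perms N"
  shows "(\<Sum>g\<in>perms N. F (\<tau> \<circ> g \<circ> inv_into UNIV \<tau>)) = (\<Sum>g\<in>perms N. F g)"
proof (rule sum.reindex_bij_witness[where i = "\<lambda>g. inv_into UNIV \<tau> \<circ> g \<circ> \<tau>" and j = "\<lambda>g. \<tau> \<circ> g \<circ> inv_into UNIV \<tau>"])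
  fix g assume g: "g \<in> perms N"
  show "inv_into UNIV \<tau> \<circ> (\<tau> \<circ> g \<circ> inv_into UNIV \<tau>) \<circ> \<tau> = g" using assms by (rule conj_inv_cancel)
  show "\<tau> \<circ> (inv_into UNIV \<tau> \<circ> g \<circ> \<tau>) \<circ> inv_into UNIV \<tau> = g" using assms by (auto simp: fun_eq_iff permutes_inverses)
  show "\<tau> \<circ> g \<circ> inv_into UNIV \<tau> \<in> perms N" using assms g by (rule perms_conj)
  show "inv_into UNIV \<tau> \<circ> g \<circ> \<tau> \<in> perms N" using assms g by (simp add: permutes_compose permutes_inv)
qed auto

lemma extend_to_perm:
  assumes X: "finite X" and I: "I \<in> X \<rightarrow> {..<N}" and J: "J \<in> X \<rightarrow> {..<N}"
    and eq: "\<forall>x\<in>X. \<forall>y\<in>X. I x = I y \<longleftrightarrow> J x = J y"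
  shows "\<exists>\<tau>\<in>perms N. \<forall>x\<in>X. J x = \<tau> (I x)"
proof -
  define f where "f a = J (SOME x. x \<in> X \<and> I x = a)" for a
  have f: "f (I x) = J x" if "x \<in> X" for x
  proof -
    have "(SOME y. y \<in> X \<and> I y = I x) \<in> X \<and> I (SOME y. y \<in> X \<and> I y = I x) = I x"
      by (rule someI[of _ x]) (use that in simp)
    then show ?thesis unfolding f_def using eq that by blast
  qed
  have b1: "bij_betw f (I ` X) (J ` X)"
    unfolding bij_betw_def
  proof
    show "inj_on f (I ` X)" by (rule inj_onI) (use f eq in auto)
    show "f ` I ` X = J ` X" using f by (simp add: image_image)
  qed
  have "card (I ` X) = card (J ` X)" using b1 by (rule bij_betw_same_card)
  moreover have sub: "I ` X \<subseteq> {..<N}" "J ` X \<subseteq> {..<N}" using I J by auto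
  ultimately have "card ({..<N} - I ` X) = card ({..<N} - J ` X)"
    using X by (simp add: card_Diff_subset)
  then obtain h where h: "bij_betw h ({..<N} - I ` X) ({..<N} - J ` X)"
    using finite_same_card_bij by (metis finite_Diff finite_lessThan)
  define \<tau> where "\<tau> a = (if a \<in> I ` X then f a else if a < N then h a else a)" for a
  have "bij_betw \<tau> (I ` X) (J ` X)" using b1 by (rule bij_betw_cong[THEN iffD1, rotated]) (simp add: \<tau>_def)
  moreover have "bij_betw \<tau> ({..<N} - I ` X) ({..<N} - J ` X)"
    using h by (rule bij_betw_cong[THEN iffD1, rotated]) (simp add: \<tau>_def)
  ultimately have "bij_betw \<tau> (I ` X \<union> ({..<N} - I ` X)) (J ` X \<union> ({..<N} - J ` X))"
    by (rule bij_betw_combine) auto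
  moreover have "I ` X \<union> ({..<N} - I ` X) = {..<N}" "J ` X \<union> ({..<N} - J ` X) = {..<N}" using sub by auto
  ultimately have "bij_betw \<tau> {..<N} {..<N}" by simp
  moreover have "\<tau> a = a" if "a \<notin> {..<N}" for a using that sub(1) by (auto simp: \<tau>_def)
  ultimately have "\<tau> permutes {..<N}" by (rule bij_imp_permutes)
  moreover have "\<forall>x\<in>X. J x = \<tau> (I x)" using f by (simp add: \<tau>_def)
  ultimately show ?thesis by blast
qed

lemma letter_tensor_perm:
  assumes wt: "class_weight N wt" and \<tau>: "\<tau> \<in> perms N"
    and J: "\<And>l. l \<in> A \<Longrightarrow> J (Inl l) = \<tau> (I (Inl l)) \<and> J (Inr l) = \<tau> (I (Inr l))"
  shows "letter_tensor N A wt J = letter_tensor N A wt I"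
proof -
  have "letter_tensor N A wt J = (\<Sum>g\<in>perms N. wt (\<tau> \<circ> g \<circ> inv_into UNIV \<tau>) * of_bool (\<forall>l\<in>A. J (Inr l) = (\<tau> \<circ> g \<circ> inv_into UNIV \<tau>) (J (Inl l))))"
    unfolding letter_tensor_def by (rule sum_perms_conj[OF \<tau>, symmetric])
  also have "\<dots> = letter_tensor N A wt I"
    unfolding letter_tensor_def
  proof (intro sum.cong refl)
    fix g assume g: "g \<in> perms N"
    have "J (Inr l) = (\<tau> \<circ> g \<circ> inv_into UNIV \<tau>) (J (Inl l)) \<longleftrightarrow> I (Inr l) = g (I (Inl l))" if "l \<in> A" for l
      using J[OF that] \<tau> permutes_inj[of \<tau> "{..<N}"] by (auto simp: permutes_inverses inj_eq)
    then show "wt (\<tau> \<circ> g \<circ> inv_into UNIV \<tau>) * of_bool (\<forall>l\<in>A. J (Inr l) = (\<tau> \<circ> g \<circ> inv_into UNIV \<tau>) (J (Inl l))) =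
      wt g * of_bool (\<forall>l\<in>A. I (Inr l) = g (I (Inl l)))"
      using wt \<tau> g unfolding class_weight_def by simp
  qed
  finally show ?thesis .
qed

lemma letter_tensor_kernel:
  assumes wt: "class_weight N wt" and A: "A \<subseteq> {..<k}" and I: "I \<in> indices N k" and J: "J \<in> indices N k"
    and eq: "\<And>x y. x \<in> Inl ` A \<union> Inr ` A \<Longrightarrow> y \<in> Inl ` A \<union> Inr ` A \<Longrightarrow> I x = I y \<longleftrightarrow> J x = J y"
  shows "letter_tensor N A wt J = letter_tensor N A wt I"
proof -
  have sub: "Inl ` A \<union> Inr ` A \<subseteq> points k" using A by auto
  have "I \<in> Inl ` A \<union> Inr ` A \<rightarrow> {..<N}" "J \<in> Inl ` A \<union> Inr ` A \<rightarrow> {..<N}"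
    using indices_less[OF I] indices_less[OF J] sub by auto
  moreover have "finite (Inl ` A \<union> Inr ` A :: point set)" using finite_subset[OF sub] by simp
  ultimately obtain \<tau> where "\<tau> \<in> perms N" "\<forall>x\<in>Inl ` A \<union> Inr ` A. J x = \<tau> (I x)"
    using extend_to_perm[of "Inl ` A \<union> Inr ` A" I N J] eq by blast
  then show ?thesis by (intro letter_tensor_perm[OF wt]) auto
qed

lemma law_tensor_eq:
  "law_tensor N k A wt J = of_bool (\<forall>l<k. l \<notin> A \<longrightarrow> J (Inr l) = J (Inl l)) * letter_tensor N (A \<inter> {..<k}) wt J"
proof -
  have "word_tensor k (ext A g) J = of_bool (\<forall>l<k. l \<notin> A \<longrightarrow> J (Inr l) = J (Inl l)) *
    of_bool (\<forall>l\<in>A \<inter> {..<k}. J (Inr l) = g (J (Inl l)))" for g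
  proof -
    have "(\<forall>l<k. J (Inr l) = ext A g l (J (Inl l))) \<longleftrightarrow>
      (\<forall>l<k. l \<notin> A \<longrightarrow> J (Inr l) = J (Inl l)) \<and> (\<forall>l\<in>A \<inter> {..<k}. J (Inr l) = g (J (Inl l)))"
      by (auto simp: ext_def)
    then show ?thesis unfolding word_tensor_def by (simp only: of_bool_conj)
  qed
  then show ?thesis
    unfolding law_tensor_def letter_tensor_def sum_distrib_left
    by (intro sum.cong refl) (simp only: mult.left_commute)
qed

lemma law_tensor_invariant:
  assumes "class_weight N wt"
  shows "ker_invariant N k (law_tensor N k A wt)"
  unfolding ker_invariant_def
proof (intro ballI impI)
  fix I J assume IJ: "I \<in> indices N k" "J \<in> indices N k" "Ker k I = Ker k J"
  then have eq: "I x = I y \<longleftrightarrow> J x = J y" if "x \<in> points k" "y \<in> points k" for x y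
    using that Ker_eq_iff by blast
  have "letter_tensor N (A \<inter> {..<k}) wt J = letter_tensor N (A \<inter> {..<k}) wt I"
    by (rule letter_tensor_kernel[OF assms _ IJ(1,2)]) (auto intro!: eq)
  moreover have "(\<forall>l<k. l \<notin> A \<longrightarrow> J (Inr l) = J (Inl l)) \<longleftrightarrow> (\<forall>l<k. l \<notin> A \<longrightarrow> I (Inr l) = I (Inl l))"
    using eq by simp
  ultimately show "law_tensor N k A wt I = law_tensor N k A wt J"
    unfolding law_tensor_eq by simp
qed

lemma mom_cong: "(\<And>I. I \<in> indices N k \<Longrightarrow> f I = g I) \<Longrightarrow> mom N k p f = mom N k p g"
  unfolding mom_def by (intro arg_cong2[where f = "(/)"] sum.cong) auto

lemma mom_sum: "mom N k p (\<lambda>I. \<Sum>z\<in>Z. a z * f z I) = (\<Sum>z\<in>Z. a z * mom N k p (f z))"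
  unfolding mom_def by (simp add: sum_divide_distrib[symmetric] sum_distrib_left sum.swap[of _ Z])

lemma mom_law_tensor:
  "mom N k p (law_tensor N k A wt) = (\<Sum>g\<in>perms N. wt g * mom N k p (word_tensor k (ext A g)))"
  unfolding law_tensor_def[abs_def] by (rule mom_sum)

lemma comp_word_tensor:
  assumes w: "\<And>l. l < k \<Longrightarrow> w l \<in> perms N" and I: "I \<in> indices N k"
  shows "comp_tensor N k (word_tensor k u) (word_tensor k w) I = word_tensor k (\<lambda>l. u l \<circ> w l) I"
proof -
  define I0 where "I0 = restrict (case_sum (\<lambda>l. I (Inl l)) (\<lambda>l. w l (I (Inl l)))) (points k)"
  have I0: "I0 \<in> indices N k"
    unfolding indices_def I0_def using indices_less[OF I] perms_less[OF w] by (auto simp: points_def)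
  have "comp_tensor N k (word_tensor k u) (word_tensor k w) I =
    (\<Sum>I'\<in>{I0}. word_tensor k u (mid k I' I) * word_tensor k w I')"
    unfolding comp_tensor_def
  proof (rule sum.mono_neutral_right)
    show "{I0} \<subseteq> {I' \<in> indices N k. \<forall>l<k. I' (Inl l) = I (Inl l)}" using I0 by (auto simp: I0_def)
    show "\<forall>I'\<in>{I' \<in> indices N k. \<forall>l<k. I' (Inl l) = I (Inl l)} - {I0}.
      word_tensor k u (mid k I' I) * word_tensor k w I' = 0"
    proof
      fix I' assume I': "I' \<in> {I' \<in> indices N k. \<forall>l<k. I' (Inl l) = I (Inl l)} - {I0}"
      have "\<not> (\<forall>l<k. I' (Inr l) = w l (I' (Inl l)))"
      proof
        assume a: "\<forall>l<k. I' (Inr l) = w l (I' (Inl l))"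
        have "I' = I0"
        proof
          fix x show "I' x = I0 x"
          proof (cases "x \<in> points k")
            case True
            then show ?thesis using a I' by (auto simp: I0_def points_def)
          next
            case False
            then show ?thesis using I' by (auto simp: I0_def indices_def PiE_def extensional_def)
          qed
        qed
        then show False using I' by simp
      qed
      then show "word_tensor k u (mid k I' I) * word_tensor k w I' = 0"
        unfolding word_tensor_def by simp
    qed
  qed simp
  also have "\<dots> = word_tensor k (\<lambda>l. u l \<circ> w l) I"
    by (simp add: word_tensor_def I0_def)
  finally show ?thesis .
qed

lemma comp_tensor_sum_left:
  "comp_tensor N k (\<lambda>J. \<Sum>z\<in>Z. a z * e z J) f I = (\<Sum>z\<in>Z. a z * comp_tensor N k (e z) f I)"
  unfolding comp_tensor_def sum_distrib_right sum_distrib_left mult.assoc by (rule sum.swap)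

lemma comp_tensor_sum_right:
  "comp_tensor N k e (\<lambda>J. \<Sum>z\<in>Z. a z * f z J) I = (\<Sum>z\<in>Z. a z * comp_tensor N k e (f z) I)"
  unfolding comp_tensor_def sum_distrib_left
  by (subst sum.swap) (simp add: mult_ac)

lemma comp_law_word:
  assumes w: "\<And>l. l < k \<Longrightarrow> w l \<in> perms N" and I: "I \<in> indices N k"
  shows "comp_tensor N k (law_tensor N k A wt) (word_tensor k w) I =
    (\<Sum>g\<in>perms N. wt g * word_tensor k (\<lambda>l. ext A g l \<circ> w l) I)"
  unfolding law_tensor_def[abs_def] comp_tensor_sum_left by (simp add: comp_word_tensor[OF w I])

lemma ext_perms: "g \<in> perms N \<Longrightarrow> ext A g l \<in> perms N"
  by (simp add: ext_def)

lemma mom_word_id: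
  assumes p: "p \<in> Parts k" and N: "0 < N"
  shows "mom N k p (word_tensor k (\<lambda>l. id)) = 1"
proof -
  have "(\<Sum>I | I \<in> indices N k \<and> const_on p I. word_tensor k (\<lambda>l. id) I) =
    (\<Sum>I | I \<in> indices N k \<and> const_on p I. if \<forall>l<k. I (Inl l) = I (Inr l) then 1 else 0)"
    by (intro sum.cong refl) (auto simp: word_tensor_def)
  also have "\<dots> = (\<Sum>I | I \<in> {I \<in> indices N k. const_on p I} \<and> (\<forall>l<k. I (Inl l) = I (Inr l)). 1)"
    by (subst sum.inter_filter[symmetric]) simp_all
  also have "{I \<in> {I \<in> indices N k. const_on p I}. \<forall>l<k. I (Inl l) = I (Inr l)} =
    {I \<in> indices N k. const_on (cycles_of k p) I}"
    unfolding const_on_cycles_of[OF p] by blast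
  also have "sum (\<lambda>_. 1) {I \<in> indices N k. const_on (cycles_of k p) I} =
    real (card {I \<in> indices N k. const_on (cycles_of k p) I})" by simp
  finally have eq: "(\<Sum>I | I \<in> indices N k \<and> const_on p I. word_tensor k (\<lambda>l. id) I) =
    real (card {I \<in> indices N k. const_on (cycles_of k p) I})" .
  show ?thesis
    unfolding mom_def eq card_const_on_indices[OF cycles_of_Parts[OF p]] using N by simp
qed

lemma ext_id: "ext A id = (\<lambda>l. id)"
  by (auto simp: ext_def)

section \<open>Moments of a single permutation\<close>

definition base :: "'a set \<Rightarrow> 'a" where
  "base B = (SOME x. x \<in> B)"

text \<open>
  In a tuple that contributes to the moment of \<open>g\<close>, an entry reachable with displacement \<open>z\<close> is the
  image under the \<open>z\<close>-th power of \<open>g\<close> of the entry at the base point.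
\<close>

inductive reach :: "nat \<Rightarrow> point set set \<Rightarrow> nat set \<Rightarrow> point \<Rightarrow> point \<Rightarrow> int \<Rightarrow> bool"
  for k p A x where
  start: "reach k p A x x 0"
| block: "reach k p A x y z \<Longrightarrow> b \<in> p \<Longrightarrow> y \<in> b \<Longrightarrow> y' \<in> b \<Longrightarrow> reach k p A x y' z"
| fwd: "reach k p A x (Inl l) z \<Longrightarrow> l < k \<Longrightarrow> reach k p A x (Inr l) (z + of_bool (l \<in> A))"
| bwd: "reach k p A x (Inr l) z \<Longrightarrow> l < k \<Longrightarrow> reach k p A x (Inl l) (z - of_bool (l \<in> A))"

definition admissible :: "nat \<Rightarrow> point set set \<Rightarrow> nat set \<Rightarrow> point set \<Rightarrow> nat \<Rightarrow> bool" where
  "admissible k p A B i \<longleftrightarrow>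
    (\<forall>y z z'. reach k p A (base B) y z \<longrightarrow> reach k p A (base B) y z' \<longrightarrow> int i dvd z - z')"

lemma base_in: "B \<in> q \<Longrightarrow> q \<in> Parts k \<Longrightarrow> base B \<in> B"
  unfolding base_def by (auto simp: some_in_eq Parts_def partition_on_def)

lemma reach_cycle:
  assumes p: "p \<in> Parts k" and B: "B \<in> cycles_of k p" and y: "y \<in> B"
  shows "\<exists>z. reach k p A (base B) y z"
proof -
  define I :: "point \<Rightarrow> bool" where "I y = (\<exists>z. reach k p A (base B) y z)" for y
  have "const_on p I"
    unfolding I_def by (rule const_onI) (blast intro: reach.block)
  moreover have "\<forall>l<k. I (Inl l) = I (Inr l)"
    unfolding I_def by (blast intro: reach.fwd reach.bwd)
  ultimately have "const_on (cycles_of k p) I" by (simp add: const_on_cycles_of[OF p])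
  from const_onD[OF this B y base_in[OF B cycles_of_Parts[OF p]]] show ?thesis
    unfolding I_def using reach.start by blast
qed

definition pw :: "(nat \<Rightarrow> nat) \<Rightarrow> nat \<Rightarrow> int \<Rightarrow> nat" where
  "pw g x z = (g ^^ nat (z mod int (least_power g x))) x"

lemma perms_permutation: "g \<in> perms N \<Longrightarrow> permutation g"
  by (auto intro: permutation_permutes[THEN iffD2])

lemma least_power_pos: "g \<in> perms N \<Longrightarrow> 0 < least_power g x"
  using least_power_of_permutation(2)[OF perms_permutation] .

lemma pw_0 [simp]: "pw g x 0 = x"
  by (simp add: pw_def)

lemma pw_Suc:
  assumes g: "g \<in> perms N"
  shows "pw g x (z + 1) = g (pw g x z)"
proof -
  let ?i = "least_power g x"
  let ?m = "nat (z mod int ?i)"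
  have i: "0 < ?i" "(g ^^ ?i) x = x" using least_power_of_permutation[OF perms_permutation[OF g]] by auto
  have "int ?m = z mod int ?i" using i by simp
  then have "int (Suc ?m mod ?i) = (z mod int ?i + 1) mod int ?i"
    by (simp only: zmod_int of_nat_Suc add.commute)
  then have "(z + 1) mod int ?i = int (Suc ?m mod ?i)"
    by (simp only: mod_add_left_eq)
  then have "pw g x (z + 1) = (g ^^ (Suc ?m mod ?i)) x" by (simp add: pw_def)
  also have "\<dots> = (g ^^ Suc ?m) x" using i(2) by (rule funpow_mod_eq)
  finally show ?thesis by (simp add: pw_def)
qed

lemma pw_eq_iff:
  assumes g: "g \<in> perms N"
  shows "pw g x z = pw g x z' \<longleftrightarrow> int (least_power g x) dvd z - z'"
proof -
  let ?i = "least_power g x"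
  have i: "0 < ?i" using least_power_pos[OF g] .
  have inj: "inj g" using g by (auto intro: permutes_inj)
  have *: "a = b" if "(g ^^ a) x = (g ^^ b) x" "a \<le> b" "b < ?i" for a b
  proof -
    have "(g ^^ (b - a)) x = x"
      using funpow_diff[OF inj, of a b x] that by (cases "a = b") auto
    then have "?i dvd b - a" by (rule least_power_minimal)
    then show ?thesis using that by (metis diff_is_0_eq dvd_imp_le le_antisym less_imp_diff_less linorder_not_le not_gr_zero)
  qed
  have lt: "nat (z mod int ?i) < ?i" for z using i by (simp add: nat_less_iff)
  have "pw g x z = pw g x z' \<longleftrightarrow> nat (z mod int ?i) = nat (z' mod int ?i)"
    unfolding pw_def using *[OF _ _ lt] by (metis nat_le_linear)
  also have "\<dots> \<longleftrightarrow> z mod int ?i = z' mod int ?i" using i by (simp add: eq_nat_nat_iff)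
  also have "\<dots> \<longleftrightarrow> int ?i dvd z - z'" by (rule mod_eq_dvd_iff)
  finally show ?thesis .
qed

lemma pw_less: "g \<in> perms N \<Longrightarrow> x < N \<Longrightarrow> pw g x z < N"
proof -
  assume g: "g \<in> perms N" and x: "x < N"
  have "(g ^^ n) x < N" for n by (induction n) (use x perms_less[OF g] in auto)
  then show ?thesis by (simp add: pw_def)
qed

lemma mom_perm:
  assumes p: "p \<in> Parts k" and g: "g \<in> perms N"
  shows "mom N k p (word_tensor k (ext A g)) =
    (\<Prod>B\<in>cycles_of k p. real (card {x \<in> {..<N}. admissible k p A B (least_power g x)}) / real N)"
proof -
  let ?C = "cycles_of k p"
  note C = cycles_of_Parts[OF p] note Cp = Parts_partition[OF C]
  let ?X = "\<lambda>B. {x \<in> {..<N}. admissible k p A B (least_power g x)}"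
  define S where "S = {I \<in> indices N k. const_on p I \<and> (\<forall>l<k. I (Inr l) = ext A g l (I (Inl l)))}"
  have pw1: "pw g x (z - 1) = y \<longleftrightarrow> pw g x z = g y" for x y z
    using pw_Suc[OF g, of x "z - 1"] permutes_inj[of g "{..<N}"] g by (auto simp: inj_eq)
  have along: "y \<in> points k \<and> I y = pw g (I (base B)) z"
    if I: "I \<in> S" and B: "B \<in> ?C" and r: "reach k p A (base B) y z" for I B y z
    using r
  proof induction
    case start
    then show ?case using base_in[OF B C] B Parts_sub[OF C] by auto
  next
    case (block y z b y')
    have "I y = I y'" using const_onD[of p I b y y'] I block.hyps by (auto simp: S_def)
    then show ?case using block Parts_sub[OF p] by auto
  next
    case (fwd l z)
    then show ?case using I by (auto simp: S_def ext_def pw_Suc[OF g])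
  next
    case (bwd l z)
    have "I (Inr l) = ext A g l (I (Inl l))" using I bwd by (simp add: S_def)
    then have "I (Inl l) = pw g (I (base B)) (z - of_bool (l \<in> A))"
      using bwd.IH pw1[of "I (base B)" z "I (Inl l)"] by (cases "l \<in> A") (simp_all add: ext_def)
    then show ?case using bwd by simp
  qed
  define cb where "cb y = (THE B. B \<in> ?C \<and> y \<in> B)" for y
  have cb_eq: "cb y = B" if "B \<in> ?C" "y \<in> B" for B y
    unfolding cb_def using that same_block[OF Cp] by (intro the_equality) auto
  have cb: "cb y \<in> ?C" "y \<in> cb y" if "y \<in> points k" for y
  proof -
    obtain c where "c \<in> ?C" "y \<in> c" using \<open>y \<in> points k\<close> Cp by (auto simp: partition_on_def)
    then show "cb y \<in> ?C" "y \<in> cb y" using cb_eq by auto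
  qed
  have C_cases: "cb y = cb y'" if "y \<in> points k" "y' \<in> points k" "b \<in> p" "y \<in> b" "y' \<in> b" for y y' b
  proof -
    obtain c where "c \<in> ?C" "b \<subseteq> c" using refines_cycles_of[OF p] \<open>b \<in> p\<close> unfolding refines_def by blast
    then show ?thesis using cb_eq[of c] that by blast
  qed
  have C_edge: "cb (Inl l) = cb (Inr l)" if "l < k" for l
  proof -
    have "refines (points k) (part_id k) ?C"
      unfolding cycles_of_def
      by (rule refines_part_supI(3)[OF Parts_partition[OF p] Parts_partition[OF part_id_Parts]])
    moreover have "{Inl l, Inr l} \<in> part_id k" using that by (auto simp: part_id_def)
    ultimately obtain c where "c \<in> ?C" "{Inl l, Inr l} \<subseteq> c" unfolding refines_def by blast
    then show ?thesis using cb_eq[of c] by blast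
  qed
  define \<Phi> where "\<Phi> I = restrict (\<lambda>B. I (base B)) ?C" for I :: "point \<Rightarrow> nat"
  have "bij_betw \<Phi> S (PiE ?C ?X)"
    unfolding bij_betw_def
  proof
    show "inj_on \<Phi> S"
    proof (rule inj_onI)
      fix I J assume IJ: "I \<in> S" "J \<in> S" "\<Phi> I = \<Phi> J"
      show "I = J"
      proof
        fix y show "I y = J y"
        proof (cases "y \<in> points k")
          case True
          obtain z where z: "reach k p A (base (cb y)) y z"
            using reach_cycle[OF p cb[OF True]] by blast
          have "I (base (cb y)) = J (base (cb y))"
            using fun_cong[OF IJ(3), of "cb y"] cb(1)[OF True] by (simp add: \<Phi>_def)
          then show ?thesis
            using along[OF IJ(1) cb(1)[OF True] z] along[OF IJ(2) cb(1)[OF True] z] by simp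
        next
          case False
          then show ?thesis using IJ by (auto simp: S_def indices_def PiE_def extensional_def)
        qed
      qed
    qed
    show "\<Phi> ` S = PiE ?C ?X"
    proof
      show "\<Phi> ` S \<subseteq> PiE ?C ?X"
      proof (clarsimp simp: \<Phi>_def)
        fix I B assume I: "I \<in> S" and B: "B \<in> ?C"
        have "I (base B) < N"
          using I indices_less base_in[OF B C] B Parts_sub[OF C] by (auto simp: S_def)
        moreover have "admissible k p A B (least_power g (I (base B)))"
          unfolding admissible_def pw_eq_iff[OF g, symmetric]
          using along[OF I B] by metis
        ultimately show "I (base B) < N \<and> admissible k p A B (least_power g (I (base B)))" by simp
      qed
      show "PiE ?C ?X \<subseteq> \<Phi> ` S"
      proof
        fix F assume F: "F \<in> PiE ?C ?X"
        have FX: "F B < N" "admissible k p A B (least_power g (F B))" if "B \<in> ?C" for B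
          using PiE_mem[OF F that] by auto
        define I where "I = restrict (\<lambda>y. pw g (F (cb y)) (SOME z. reach k p A (base (cb y)) y z)) (points k)"
        have val: "I y = pw g (F (cb y)) z" if y: "y \<in> points k" and z: "reach k p A (base (cb y)) y z" for y z
        proof -
          have "reach k p A (base (cb y)) y (SOME z. reach k p A (base (cb y)) y z)"
            using z by (rule someI)
          then have "int (least_power g (F (cb y))) dvd (SOME z. reach k p A (base (cb y)) y z) - z"
            using FX(2)[OF cb(1)[OF y]] z unfolding admissible_def by blast
          then have "pw g (F (cb y)) (SOME z. reach k p A (base (cb y)) y z) = pw g (F (cb y)) z"
            by (simp only: pw_eq_iff[OF g])
          then show ?thesis unfolding I_def using y by simp
        qed
        have "I \<in> indices N k"
          using pw_less[OF g FX(1)[OF cb(1)]] by (auto simp: I_def indices_def)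
        moreover have "const_on p I"
        proof (rule const_onI)
          fix b y y' assume b: "b \<in> p" "y \<in> b" "y' \<in> b"
          have y: "y \<in> points k" "y' \<in> points k" using b Parts_sub[OF p] by auto
          note cc = C_cases[OF y b]
          obtain z where z: "reach k p A (base (cb y)) y z"
            using reach_cycle[OF p cb[OF y(1)]] by blast
          have z': "reach k p A (base (cb y')) y' z" using reach.block[OF z b] cc by simp
          show "I y = I y'" using val[OF y(1) z] val[OF y(2) z'] cc by simp
        qed
        moreover have "I (Inr l) = ext A g l (I (Inl l))" if l: "l < k" for l
        proof -
          have y: "Inl l \<in> points k" "Inr l \<in> points k" using l by auto
          obtain z where z: "reach k p A (base (cb (Inl l))) (Inl l) z"
            using reach_cycle[OF p cb[OF y(1)]] by blast
          have z': "reach k p A (base (cb (Inr l))) (Inr l) (z + of_bool (l \<in> A))"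
            using reach.fwd[OF z l] C_edge[OF l] by simp
          show ?thesis
            using val[OF y(1) z] val[OF y(2) z'] C_edge[OF l] pw_Suc[OF g] by (auto simp: ext_def)
        qed
        ultimately have "I \<in> S" by (simp add: S_def)
        moreover have "\<Phi> I = F"
        proof
          fix B show "\<Phi> I B = F B"
          proof (cases "B \<in> ?C")
            case True
            have bB: "base B \<in> B" "base B \<in> points k" using base_in[OF True C] True Parts_sub[OF C] by auto
            have "cb (base B) = B" by (rule cb_eq[OF True bB(1)])
            then show ?thesis
              using val[OF bB(2), of 0] True reach.start[of k p A "base B"] by (simp add: \<Phi>_def)
          next
            case False
            then show ?thesis using PiE_arb[OF F] by (simp add: \<Phi>_def)
          qed
        qed
        ultimately show "F \<in> \<Phi> ` S" by blast
      qed
    qed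
  qed
  then have "card S = card (PiE ?C ?X)" by (rule bij_betw_same_card)
  also have "\<dots> = (\<Prod>B\<in>?C. card (?X B))" by (rule card_PiE[OF finite_Parts_elem[OF C]])
  finally have cS: "card S = (\<Prod>B\<in>?C. card (?X B))" .
  have "(\<Sum>I | I \<in> indices N k \<and> const_on p I. word_tensor k (ext A g) I) = real (card S)"
  proof -
    have "(\<Sum>I | I \<in> indices N k \<and> const_on p I. word_tensor k (ext A g) I) =
      (\<Sum>I\<in>{I \<in> indices N k. const_on p I}. if \<forall>l<k. I (Inr l) = ext A g l (I (Inl l)) then 1 else 0)"
      by (intro sum.cong refl) (simp add: word_tensor_def)
    also have "\<dots> = real (card {I \<in> {I \<in> indices N k. const_on p I}. \<forall>l<k. I (Inr l) = ext A g l (I (Inl l))})"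
      by (subst sum.inter_filter[symmetric]) simp_all
    also have "{I \<in> {I \<in> indices N k. const_on p I}. \<forall>l<k. I (Inr l) = ext A g l (I (Inl l))} = S"
      by (auto simp: S_def)
    finally show ?thesis .
  qed
  then show ?thesis by (simp add: mom_def cS prod_dividef)
qed

lemma admissible_cases:
  "(\<forall>i. admissible k p A B i) \<or> (\<exists>d. \<forall>i. admissible k p A B i \<longrightarrow> i \<le> d)"
proof (cases "\<exists>y z z'. reach k p A (base B) y z \<and> reach k p A (base B) y z' \<and> z \<noteq> z'")
  case True
  then obtain y z z' where h: "reach k p A (base B) y z" "reach k p A (base B) y z'" "z \<noteq> z'" by blast
  have "i \<le> nat \<bar>z - z'\<bar>" if "admissible k p A B i" for i
  proof -
    have "int i dvd z - z'" using that h unfolding admissible_def by blast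
    then have "\<bar>int i\<bar> \<le> \<bar>z - z'\<bar>" using h(3) by (intro dvd_imp_le_int) auto
    then show ?thesis by simp
  qed
  then show ?thesis by blast
next
  case False
  then have "admissible k p A B i" for i unfolding admissible_def by (metis cancel_comm_monoid_add_class.diff_cancel dvd_0_right)
  then show ?thesis by blast
qed

lemma admissible_1: "admissible k p A B (Suc 0)"
  by (simp add: admissible_def)

section \<open>Uniform elements of a conjugacy class\<close>

lemma period_count_conj:
  assumes \<tau>: "\<tau> \<in> perms N" and \<sigma>: "\<sigma> \<in> perms N"
  shows "period_count N (\<tau> \<circ> \<sigma> \<circ> inv_into UNIV \<tau>) i = period_count N \<sigma> i"
proof -
  let ?c = "\<tau> \<circ> \<sigma> \<circ> inv_into UNIV \<tau>"
  have pow: "(?c ^^ n) (\<tau> j) = \<tau> ((\<sigma> ^^ n) j)" for n j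
    by (induction n) (use \<tau> in \<open>auto simp: permutes_inverses\<close>)
  have inj: "inj \<tau>" using \<tau> by (auto intro: permutes_inj)
  have lp: "least_power ?c (\<tau> j) = least_power \<sigma> j" for j
    unfolding least_power_def pow using inj by (simp add: inj_eq)
  have "bij_betw \<tau> {j \<in> {..<N}. least_power \<sigma> j = i} {j \<in> {..<N}. least_power ?c j = i}"
    unfolding bij_betw_def
  proof
    show "inj_on \<tau> {j \<in> {..<N}. least_power \<sigma> j = i}" using inj by (rule inj_on_subset) simp
    show "\<tau> ` {j \<in> {..<N}. least_power \<sigma> j = i} = {j \<in> {..<N}. least_power ?c j = i}"
    proof
      show "\<tau> ` {j \<in> {..<N}. least_power \<sigma> j = i} \<subseteq> {j \<in> {..<N}. least_power ?c j = i}"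
        using perms_less[OF \<tau>] lp by auto
      show "{j \<in> {..<N}. least_power ?c j = i} \<subseteq> \<tau> ` {j \<in> {..<N}. least_power \<sigma> j = i}"
      proof
        fix j assume j: "j \<in> {j \<in> {..<N}. least_power ?c j = i}"
        have "j = \<tau> (inv_into UNIV \<tau> j)" using \<tau> by (simp add: permutes_inverses)
        moreover have "inv_into UNIV \<tau> j < N"
          using perms_less[of "inv_into UNIV \<tau>" N j] \<tau> j by (simp add: permutes_inv)
        ultimately show "j \<in> \<tau> ` {j \<in> {..<N}. least_power \<sigma> j = i}"
          using j lp[of "inv_into UNIV \<tau> j"] by (intro image_eqI[of _ _ "inv_into UNIV \<tau> j"]) auto
      qed
    qed
  qed
  then show ?thesis unfolding period_count_def by (rule bij_betw_same_card[symmetric])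
qed

lemma conjugacy_class_props:
  assumes C: "conjugacy_class N C"
  shows "C \<subseteq> perms N" "C \<noteq> {}" "finite C" "g \<in> C \<Longrightarrow> \<tau> \<in> perms N \<Longrightarrow> \<tau> \<circ> g \<circ> inv_into UNIV \<tau> \<in> C"
    and "g \<in> C \<Longrightarrow> period_count N g i = class_count N C i"
proof -
  obtain \<sigma> where \<sigma>: "\<sigma> \<in> perms N" and Ceq: "C = {\<tau> \<circ> \<sigma> \<circ> inv_into UNIV \<tau> | \<tau>. \<tau> permutes {..<N}}"
    using C by (auto simp: conjugacy_class_def)
  show sub: "C \<subseteq> perms N" using perms_conj[OF _ \<sigma>] by (auto simp: Ceq)
  then show "finite C" by (rule finite_subset) simp
  show ne: "C \<noteq> {}" unfolding Ceq using permutes_id by blast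
  have pc: "period_count N g i = period_count N \<sigma> i" if "g \<in> C" for g i
    using that period_count_conj[OF _ \<sigma>] by (auto simp: Ceq)
  show "period_count N g i = class_count N C i" if "g \<in> C"
    proof -
    have "(SOME \<sigma>. \<sigma> \<in> C) \<in> C" using ne by (simp add: some_in_eq)
    then show ?thesis unfolding class_count_def by (simp only: pc pc[OF that])
  qed
  show "\<tau> \<circ> g \<circ> inv_into UNIV \<tau> \<in> C" if g: "g \<in> C" and "\<tau> \<in> perms N"
  proof -
    obtain \<tau>' where \<tau>': "\<tau>' permutes {..<N}" "g = \<tau>' \<circ> \<sigma> \<circ> inv_into UNIV \<tau>'"
      using g unfolding Ceq by blast
    have "inv_into UNIV (\<tau> \<circ> \<tau>') = inv_into UNIV \<tau>' \<circ> inv_into UNIV \<tau>"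
      using that \<tau>' by (intro o_inv_distrib permutes_bij) auto
    then have "\<tau> \<circ> g \<circ> inv_into UNIV \<tau> = (\<tau> \<circ> \<tau>') \<circ> \<sigma> \<circ> inv_into UNIV (\<tau> \<circ> \<tau>')"
      unfolding \<tau>'(2) by (simp add: comp_assoc)
    moreover have "(\<tau> \<circ> \<tau>') permutes {..<N}" using that \<tau>' by (simp add: permutes_compose)
    ultimately show ?thesis unfolding Ceq by blast
  qed
qed

lemma least_power_1_iff: "g \<in> perms N \<Longrightarrow> least_power g x = 1 \<longleftrightarrow> g x = x"
  using least_power_of_permutation[OF perms_permutation, of g N x] least_power_gt_one[OF perms_permutation, of g N x]
    least_power_le[of 1 g x] by (cases "g x = x") auto

lemma class_count_1_less:
  assumes C: "conjugacy_class N C" "C \<noteq> {id}"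
  shows "class_count N C 1 < N"
proof (rule ccontr)
  assume a: "\<not> class_count N C 1 < N"
  have "g = id" if g: "g \<in> C" for g
  proof -
    note gp = subsetD[OF conjugacy_class_props(1)[OF C(1)] g]
    have "card {j \<in> {..<N}. least_power g j = 1} \<ge> card {..<N}"
      using a conjugacy_class_props(5)[OF C(1) g, of 1] by (simp add: period_count_def)
    then have "{j \<in> {..<N}. least_power g j = 1} = {..<N}"
      by (intro card_seteq) auto
    then have "\<forall>j<N. g j = j" using least_power_1_iff[OF gp] by auto
    then show ?thesis using gp permutes_not_in[of g "{..<N}"] by (auto simp: fun_eq_iff)
  qed
  then show False using C(2) conjugacy_class_props(2)[OF C(1)] by blast
qed

definition gen_weight :: "nat \<Rightarrow> (nat \<Rightarrow> nat) set \<Rightarrow> (nat \<Rightarrow> nat) \<Rightarrow> real" where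
  "gen_weight N C g =
    real N / real (class_support N C) * (of_bool (g \<in> C) / real (card C) - of_bool (g = id))"

lemma sum_gen_weight:
  assumes C: "conjugacy_class N C"
  shows "(\<Sum>g\<in>perms N. gen_weight N C g * f g) =
    real N / real (class_support N C) * ((\<Sum>g\<in>C. f g) / real (card C) - f id)"
proof -
  note Cp = conjugacy_class_props[OF C]
  have "(\<Sum>g\<in>perms N. gen_weight N C g * f g) = (\<Sum>g\<in>perms N. real N / real (class_support N C) *
      ((if g \<in> C then f g / real (card C) else 0) - (if g = id then f g else 0)))"
    by (intro sum.cong refl) (simp add: gen_weight_def algebra_simps)
  also have "\<dots> = real N / real (class_support N C) *
      ((\<Sum>g\<in>perms N. if g \<in> C then f g / real (card C) else 0) - (\<Sum>g\<in>perms N. if g = id then f g else 0))"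
    unfolding sum_distrib_left[symmetric] sum_subtractf ..
  also have "(\<Sum>g\<in>perms N. if g \<in> C then f g / real (card C) else 0) = (\<Sum>g\<in>C. f g / real (card C))"
    using Cp(1) by (subst sum.inter_restrict[symmetric]) (auto simp: Int_absorb1)
  also have "(\<Sum>g\<in>perms N. if g = id then f g else 0) = f id"
    by (subst sum.delta) (use id_perms[of N] in auto)
  finally show ?thesis by (simp add: sum_divide_distrib)
qed

lemma class_weight_gen:
  assumes C: "conjugacy_class N C"
  shows "class_weight N (gen_weight N C)"
  unfolding class_weight_def
proof (intro ballI)
  fix \<tau> \<sigma> assume \<tau>: "\<tau> \<in> perms N" and \<sigma>: "\<sigma> \<in> perms N"
  have "\<tau> \<circ> \<sigma> \<circ> inv_into UNIV \<tau> \<in> C \<longleftrightarrow> \<sigma> \<in> C"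
  proof
    assume "\<tau> \<circ> \<sigma> \<circ> inv_into UNIV \<tau> \<in> C"
    moreover have "inv_into UNIV \<tau> \<in> perms N" using \<tau> by (simp add: permutes_inv)
    moreover have "inv_into UNIV (inv_into UNIV \<tau>) = \<tau>" using \<tau> by (simp add: permutes_inv_inv)
    ultimately have "inv_into UNIV \<tau> \<circ> (\<tau> \<circ> \<sigma> \<circ> inv_into UNIV \<tau>) \<circ> \<tau> \<in> C"
      using conjugacy_class_props(4)[OF C] by metis
    then show "\<sigma> \<in> C" unfolding conj_inv_cancel[OF \<tau>] .
  qed (rule conjugacy_class_props(4)[OF C _ \<tau>])
  moreover have "\<tau> \<circ> \<sigma> \<circ> inv_into UNIV \<tau> = id \<longleftrightarrow> \<sigma> = id"
  proof
    assume "\<tau> \<circ> \<sigma> \<circ> inv_into UNIV \<tau> = id"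
    then have "\<sigma> = inv_into UNIV \<tau> \<circ> id \<circ> \<tau>" using conj_inv_cancel[OF \<tau>, of \<sigma>] by simp
    then show "\<sigma> = id" using \<tau> by (auto simp: fun_eq_iff permutes_inverses)
  qed (use \<tau> in \<open>auto simp: fun_eq_iff permutes_inverses\<close>)
  ultimately show "gen_weight N C (\<tau> \<circ> \<sigma> \<circ> inv_into UNIV \<tau>) = gen_weight N C \<sigma>"
    by (simp add: gen_weight_def)
qed

lemma convergent_prod_minus_1:
  fixes r :: "nat \<Rightarrow> real" and x :: "nat \<Rightarrow> 'b \<Rightarrow> real"
  assumes "finite C" "\<And>B. B \<in> C \<Longrightarrow> convergent (\<lambda>N. r N * (x N B - 1))" "\<And>B. B \<in> C \<Longrightarrow> convergent (\<lambda>N. x N B)"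
  shows "convergent (\<lambda>N. r N * ((\<Prod>B\<in>C. x N B) - 1))"
  using assms
proof (induction C)
  case (insert B C)
  have eq: "(\<Prod>B\<in>insert B C. x N B) = x N B * (\<Prod>B\<in>C. x N B)" for N using insert.hyps by simp
  have "(\<lambda>N. r N * ((\<Prod>B\<in>insert B C. x N B) - 1)) =
    (\<lambda>N. (r N * ((\<Prod>B\<in>C. x N B) - 1)) * x N B + r N * (x N B - 1))"
    unfolding eq by (auto simp: algebra_simps)
  moreover have "convergent (\<lambda>N. (r N * ((\<Prod>B\<in>C. x N B) - 1)) * x N B + r N * (x N B - 1))"
    by (intro convergent_add convergent_mult[OF insert.IH] insert.prems) auto
  ultimately show ?case by simp
qed (simp add: convergent_const)

text \<open>
  A component of the tuple graph either fits into cycles of every length or only into those up to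
  some fixed length, so its moment only involves finitely many cycle counts.
\<close>

lemma convergent_mom_gen:
  assumes L: "\<forall>N\<ge>2. conjugacy_class N (L N) \<and> L N \<noteq> {id}" and conv: "classes_converge L \<alpha>"
    and p: "p \<in> Parts k"
  shows "convergent (\<lambda>N. mom N k p (law_tensor N k A (gen_weight N (L N))))"
proof -
  obtain l :: "nat \<Rightarrow> real" where l: "\<And>i. i \<ge> 2 \<Longrightarrow> (\<lambda>N. real (class_count N (L N) i) / real (class_support N (L N))) \<longlonglongrightarrow> l i"
    using conv unfolding classes_converge_def by blast
  have c1: "(\<lambda>N. real (class_count N (L N) 1) / real N) \<longlonglongrightarrow> 1 - \<alpha>"
    using conv unfolding classes_converge_def by blast
  let ?C = "cycles_of k p"
  define r where "r N = real N / real (class_support N (L N))" for N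
  define rep where "rep N = (SOME g. g \<in> L N)" for N
  have rep: "rep N \<in> L N" if "N \<ge> 2" for N
    unfolding rep_def using conjugacy_class_props(2)[of N "L N"] L that by (simp add: some_in_eq)
  define x where "x N B = real (card {x \<in> {..<N}. admissible k p A B (least_power (rep N) x)}) / real N" for N B
  have supp: "class_count N (L N) 1 < N" "real (class_support N (L N)) = real N - real (class_count N (L N) 1)"
    "real (class_support N (L N)) > 0" if "N \<ge> 2" for N
    using class_count_1_less[of N "L N"] L that by (auto simp: class_support_def)
  have card_per: "real (card {x \<in> {..<N}. admissible k p A B (least_power g x)}) =
      (if (\<forall>i. admissible k p A B i) then real N
       else real (class_count N (L N) 1) + (\<Sum>i\<in>{i \<in> {2..SOME d. \<forall>i. admissible k p A B i \<longrightarrow> i \<le> d}. admissible k p A B i}. real (class_count N (L N) i)))"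
    if N: "N \<ge> 2" and g: "g \<in> L N" for N g B
  proof (cases "\<forall>i. admissible k p A B i")
    case False
    define d where "d = (SOME d. \<forall>i. admissible k p A B i \<longrightarrow> i \<le> d)"
    have d: "i \<le> d" if "admissible k p A B i" for i
      using someI_ex[of "\<lambda>d. \<forall>i. admissible k p A B i \<longrightarrow> i \<le> d"] admissible_cases[of k p A B] False that
      unfolding d_def by blast
    have gp: "g \<in> perms N" using conjugacy_class_props(1) L N g by blast
    let ?I = "{i \<in> {1..d}. admissible k p A B i}"
    have "{x \<in> {..<N}. admissible k p A B (least_power g x)} = (\<Union>i\<in>?I. {x \<in> {..<N}. least_power g x = i})"
      using d least_power_pos[OF gp] by (auto simp: Suc_le_eq)
    then have "card {x \<in> {..<N}. admissible k p A B (least_power g x)} = (\<Sum>i\<in>?I. period_count N g i)"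
      unfolding period_count_def by (simp only:) (rule card_UN_disjoint, auto)
    also have "\<dots> = (\<Sum>i\<in>?I. class_count N (L N) i)"
      using conjugacy_class_props(5)[OF _ g] L N by simp
    also have "?I = insert 1 {i \<in> {2..d}. admissible k p A B i}"
      using admissible_1[of k p A B] d[of "Suc 0"] by (auto simp: le_Suc_eq not_less_eq_eq)
    finally show ?thesis unfolding if_not_P[OF False] d_def by simp
  qed simp
  have "convergent (\<lambda>N. r N * ((\<Prod>B\<in>?C. x N B) - 1))"
  proof (rule convergent_prod_minus_1[OF finite_Parts_elem[OF cycles_of_Parts[OF p]]])
    fix B assume "B \<in> ?C"
    show 1: "convergent (\<lambda>N. r N * (x N B - 1))"
    proof (cases "\<forall>i. admissible k p A B i")
      case True
      have "\<forall>\<^sub>F N in sequentially. r N * (x N B - 1) = 0"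
        using eventually_ge_at_top[of 2]
        by eventually_elim (use card_per[OF _ rep] True in \<open>simp add: x_def\<close>)
      then show ?thesis by (rule convergent_eventually_eq) (rule convergent_const)
    next
      case False
      let ?I = "{i \<in> {2..SOME d. \<forall>i. admissible k p A B i \<longrightarrow> i \<le> d}. admissible k p A B i}"
      have "\<forall>\<^sub>F N in sequentially. r N * (x N B - 1) =
          (\<Sum>i\<in>?I. real (class_count N (L N) i) / real (class_support N (L N))) - 1"
        using eventually_ge_at_top[of 2]
      proof eventually_elim
        case (elim N)
        have "r N * (x N B - 1) = (real N * x N B - real N) / real (class_support N (L N))"
          by (simp add: r_def field_simps)
        also have "real N * x N B = real (class_count N (L N) 1) + (\<Sum>i\<in>?I. real (class_count N (L N) i))"
          using card_per[OF elim rep[OF elim], of B] False elim by (simp add: x_def)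
        also have "\<dots> - real N = (\<Sum>i\<in>?I. real (class_count N (L N) i)) - real (class_support N (L N))"
          using supp[OF elim] by simp
        finally show ?case using supp(3)[OF elim] by (simp add: diff_divide_distrib sum_divide_distrib)
      qed
      moreover have "convergent (\<lambda>N. (\<Sum>i\<in>?I. real (class_count N (L N) i) / real (class_support N (L N))) - 1)"
        using l by (intro convergent_diff convergent_sum convergent_const) (auto simp: convergent_def)
      ultimately show ?thesis by (rule convergent_eventually_eq)
    qed
    have "\<forall>\<^sub>F N in sequentially. x N B = 1 + (1 - real (class_count N (L N) 1) / real N) * (r N * (x N B - 1))"
      using eventually_ge_at_top[of 2]
    proof eventually_elim
      case (elim N)
      have "(1 - real (class_count N (L N) 1) / real N) * r N = 1"
      proof -
        have "1 - real (class_count N (L N) 1) / real N = real (class_support N (L N)) / real N"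
          unfolding supp(2)[OF elim] using elim by (simp add: diff_divide_distrib)
        then show ?thesis using supp(3)[OF elim] elim by (simp add: r_def)
      qed
      then show ?case by (simp add: mult.assoc[symmetric])
    qed
    moreover have "convergent (\<lambda>N. 1 + (1 - real (class_count N (L N) 1) / real N) * (r N * (x N B - 1)))"
      by (intro convergent_add convergent_mult[OF _ 1] convergent_diff convergent_const convergentI[OF c1])
    ultimately show "convergent (\<lambda>N. x N B)" by (rule convergent_eventually_eq)
  qed
  moreover have "\<forall>\<^sub>F N in sequentially. mom N k p (law_tensor N k A (gen_weight N (L N))) = r N * ((\<Prod>B\<in>?C. x N B) - 1)"
    using eventually_ge_at_top[of 2]
  proof eventually_elim
    case (elim N)
    then have C: "conjugacy_class N (L N)" using L by blast
    note Cp = conjugacy_class_props[OF C]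
    have mg: "mom N k p (word_tensor k (ext A g)) = (\<Prod>B\<in>?C. x N B)" if "g \<in> L N" for g
      unfolding mom_perm[OF p subsetD[OF Cp(1) that]] x_def card_per[OF elim that] card_per[OF elim rep[OF elim]] ..
    have "(\<Sum>g\<in>L N. mom N k p (word_tensor k (ext A g))) / real (card (L N)) = (\<Prod>B\<in>?C. x N B)"
      using mg Cp(2,3) by simp
    moreover have "mom N k p (word_tensor k (ext A id)) = 1"
      unfolding ext_id by (rule mom_word_id[OF p]) (use elim in simp)
    ultimately show ?case
      unfolding mom_law_tensor sum_gen_weight[OF C] by (simp add: r_def)
  qed
  ultimately show ?thesis by (rule convergent_eventually_eq[rotated])
qed

section \<open>Heat kernels\<close>

definition conv_op :: "nat \<Rightarrow> ((nat \<Rightarrow> nat) \<Rightarrow> real) \<Rightarrow> ((nat \<Rightarrow> nat) \<Rightarrow> real) \<Rightarrow> (nat \<Rightarrow> nat) \<Rightarrow> real" where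
  "conv_op N wt f \<sigma> = (\<Sum>g\<in>perms N. wt g * f (g \<circ> \<sigma>))"

definition heat :: "nat \<Rightarrow> ((nat \<Rightarrow> nat) \<Rightarrow> real) \<Rightarrow> real \<Rightarrow> (nat \<Rightarrow> nat) \<Rightarrow> real" where
  "heat N wt t z = semigroup_of (conv_op N wt) t (indicator {z}) id"

lemma walk_generator_conv_op:
  assumes C: "conjugacy_class N C"
  shows "walk_generator N C = conv_op N (gen_weight N C)"
proof (intro ext)
  fix f \<sigma>
  have "card C > 0" using conjugacy_class_props[OF C] by (simp add: card_gt_0_iff)
  then show "walk_generator N C f \<sigma> = conv_op N (gen_weight N C) f \<sigma>"
    unfolding conv_op_def sum_gen_weight[OF C] walk_generator_def by (simp add: sum_subtractf field_simps)
qed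

lemma conv_op_Suc:
  "(conv_op N wt ^^ Suc n) f \<sigma> = (\<Sum>g\<in>perms N. wt g * (conv_op N wt ^^ n) f (g \<circ> \<sigma>))"
  by (simp add: conv_op_def)

lemma conv_op_pow_cong:
  assumes "\<And>\<sigma>. \<sigma> \<in> perms N \<Longrightarrow> f \<sigma> = g \<sigma>" "\<sigma> \<in> perms N"
  shows "(conv_op N wt ^^ n) f \<sigma> = (conv_op N wt ^^ n) g \<sigma>"
  using assms(2)
proof (induction n arbitrary: \<sigma>)
  case (Suc n)
  show ?case unfolding conv_op_Suc
    by (rule sum.cong[OF refl], rule arg_cong2[where f = "(*)", OF refl], rule Suc.IH, rule perms_compose)
      (use Suc.prems in auto)
qed (use assms in simp)

lemma conv_op_pow_sum:
  "(conv_op N wt ^^ n) (\<lambda>\<sigma>. \<Sum>z\<in>Z. a z * f z \<sigma>) = (\<lambda>\<sigma>. \<Sum>z\<in>Z. a z * (conv_op N wt ^^ n) (f z) \<sigma>)"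
proof (induction n)
  case (Suc n)
  show ?case
    unfolding funpow.simps o_apply Suc
    unfolding conv_op_def by (rule ext) (simp add: sum_distrib_left sum.swap[of _ Z] mult.left_commute)
qed simp

lemma conv_op_pow_right: "(conv_op N wt ^^ n) (\<lambda>\<sigma>. f (\<sigma> \<circ> x)) \<sigma>0 = (conv_op N wt ^^ n) f (\<sigma>0 \<circ> x)"
  by (induction n arbitrary: \<sigma>0) (simp_all add: conv_op_def comp_assoc)

lemma conv_op_pow_conj:
  assumes wt: "class_weight N wt" and \<tau>: "\<tau> \<in> perms N"
  shows "(conv_op N wt ^^ n) (\<lambda>\<sigma>. f (\<tau> \<circ> \<sigma> \<circ> inv_into UNIV \<tau>)) \<sigma>0 =
    (conv_op N wt ^^ n) f (\<tau> \<circ> \<sigma>0 \<circ> inv_into UNIV \<tau>)"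
proof (induction n arbitrary: \<sigma>0)
  case (Suc n)
  let ?F = "(conv_op N wt ^^ n) f"
  have c: "\<tau> \<circ> (g \<circ> \<sigma>0) \<circ> inv_into UNIV \<tau> = (\<tau> \<circ> g \<circ> inv_into UNIV \<tau>) \<circ> (\<tau> \<circ> \<sigma>0 \<circ> inv_into UNIV \<tau>)" for g
    using \<tau> by (auto simp: fun_eq_iff permutes_inverses)
  have "(\<Sum>g\<in>perms N. wt g * ?F (\<tau> \<circ> (g \<circ> \<sigma>0) \<circ> inv_into UNIV \<tau>)) =
    (\<Sum>g\<in>perms N. wt (\<tau> \<circ> g \<circ> inv_into UNIV \<tau>) * ?F ((\<tau> \<circ> g \<circ> inv_into UNIV \<tau>) \<circ> (\<tau> \<circ> \<sigma>0 \<circ> inv_into UNIV \<tau>)))"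
    unfolding c using wt \<tau> by (intro sum.cong refl) (simp add: class_weight_def)
  also have "\<dots> = (\<Sum>g\<in>perms N. wt g * ?F (g \<circ> (\<tau> \<circ> \<sigma>0 \<circ> inv_into UNIV \<tau>)))"
    by (rule sum_perms_conj[OF \<tau>, of "\<lambda>g. wt g * ?F (g \<circ> (\<tau> \<circ> \<sigma>0 \<circ> inv_into UNIV \<tau>))"])
  finally show ?case unfolding conv_op_Suc Suc .
qed simp

lemma conv_op_pow_bound:
  assumes "\<And>\<sigma>. \<sigma> \<in> perms N \<Longrightarrow> \<bar>f \<sigma>\<bar> \<le> F" "\<sigma> \<in> perms N"
  shows "\<bar>(conv_op N wt ^^ n) f \<sigma>\<bar> \<le> (\<Sum>g\<in>perms N. \<bar>wt g\<bar>) ^ n * F"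
  using assms(2)
proof (induction n arbitrary: \<sigma>)
  case (Suc n)
  let ?W = "\<Sum>g\<in>perms N. \<bar>wt g\<bar>"
  have "\<bar>(conv_op N wt ^^ Suc n) f \<sigma>\<bar> \<le> (\<Sum>g\<in>perms N. \<bar>wt g * (conv_op N wt ^^ n) f (g \<circ> \<sigma>)\<bar>)"
    unfolding conv_op_Suc by (rule sum_abs)
  also have "\<dots> \<le> (\<Sum>g\<in>perms N. \<bar>wt g\<bar> * (?W ^ n * F))"
    using Suc perms_compose by (intro sum_mono) (auto simp: abs_mult intro!: mult_left_mono)
  also have "\<dots> = ?W ^ Suc n * F" by (simp add: sum_distrib_right mult.assoc)
  finally show ?case .
qed (use assms in simp)

lemma summable_conv_op:
  assumes "\<sigma> \<in> perms N"
  shows "summable (\<lambda>n. t ^ n / fact n * (conv_op N wt ^^ n) f \<sigma>)"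
proof (rule summable_comparison_test)
  let ?W = "\<Sum>g\<in>perms N. \<bar>wt g\<bar>" and ?F = "\<Sum>\<sigma>\<in>perms N. \<bar>f \<sigma>\<bar>"
  have F: "\<bar>f \<sigma>\<bar> \<le> ?F" if "\<sigma> \<in> perms N" for \<sigma>
    using member_le_sum[OF that, of "\<lambda>\<sigma>. \<bar>f \<sigma>\<bar>"] by simp
  have "norm (t ^ n / fact n * (conv_op N wt ^^ n) f \<sigma>) \<le> (\<bar>t\<bar> * ?W) ^ n /\<^sub>R fact n * ?F" for n
  proof -
    have "norm (t ^ n / fact n * (conv_op N wt ^^ n) f \<sigma>) = \<bar>t\<bar> ^ n / fact n * \<bar>(conv_op N wt ^^ n) f \<sigma>\<bar>"
      by (simp add: abs_mult power_abs)
    also have "\<dots> \<le> \<bar>t\<bar> ^ n / fact n * (?W ^ n * ?F)"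
      using conv_op_pow_bound[OF F assms] by (intro mult_left_mono) auto
    finally show ?thesis by (simp add: power_mult_distrib divide_inverse mult_ac)
  qed
  then show "\<exists>N0. \<forall>n\<ge>N0. norm (t ^ n / fact n * (conv_op N wt ^^ n) f \<sigma>) \<le> (\<bar>t\<bar> * ?W) ^ n /\<^sub>R fact n * ?F"
    by blast
  show "summable (\<lambda>n. (\<bar>t\<bar> * ?W) ^ n /\<^sub>R fact n * ?F)"
    by (intro summable_mult2 summable_exp_generic)
qed

lemma heat_translate:
  assumes x: "x \<in> perms N"
  shows "semigroup_of (conv_op N wt) t (indicator {z}) x = heat N wt t (z \<circ> inv_into UNIV x)"
proof -
  have ind: "indicator {z \<circ> inv_into UNIV x} \<sigma> = (indicator {z} (\<sigma> \<circ> x) :: real)" for \<sigma>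
    proof -
    have "\<sigma> = z \<circ> inv_into UNIV x \<longleftrightarrow> \<sigma> \<circ> x = z"
    proof
      assume a: "\<sigma> \<circ> x = z"
      show "\<sigma> = z \<circ> inv_into UNIV x" unfolding a[symmetric] using x by (auto simp: fun_eq_iff permutes_inverses)
    qed (use x in \<open>auto simp: fun_eq_iff permutes_inverses\<close>)
    then show ?thesis by (simp add: indicator_def)
  qed
  then have "(conv_op N wt ^^ n) (indicator {z \<circ> inv_into UNIV x}) id = (conv_op N wt ^^ n) (indicator {z}) x" for n
  proof -
    have "(indicator {z \<circ> inv_into UNIV x} :: _ \<Rightarrow> real) = (\<lambda>\<sigma>. indicator {z} (\<sigma> \<circ> x))"
      using ind by (rule ext)
    then show ?thesis using conv_op_pow_right[of n N wt "indicator {z}" x id] by simp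
  qed
  then show ?thesis by (simp add: heat_def semigroup_of_def)
qed

lemma class_weight_heat:
  assumes wt: "class_weight N wt"
  shows "class_weight N (heat N wt t)"
  unfolding class_weight_def
proof (intro ballI)
  fix \<tau> \<sigma> assume \<tau>: "\<tau> \<in> perms N" and \<sigma>: "\<sigma> \<in> perms N"
  let ?c = "\<lambda>\<sigma>. \<tau> \<circ> \<sigma> \<circ> inv_into UNIV \<tau>"
  have ind: "(\<lambda>\<sigma>'. indicator {?c \<sigma>} (?c \<sigma>')) = (indicator {\<sigma>} :: _ \<Rightarrow> real)"
    using conj_inv_cancel[OF \<tau>] by (auto simp: indicator_def fun_eq_iff) metis
  have cid: "?c id = id" using \<tau> by (auto simp: fun_eq_iff permutes_inverses)
  have "(conv_op N wt ^^ n) (indicator {\<sigma>}) id = (conv_op N wt ^^ n) (indicator {?c \<sigma>}) id" for n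
    using conv_op_pow_conj[OF wt \<tau>, of n "indicator {?c \<sigma>}" id] unfolding ind cid .
  then show "heat N wt t (?c \<sigma>) = heat N wt t \<sigma>" by (simp add: heat_def semigroup_of_def)
qed

lemma sum_heat:
  "(\<Sum>z\<in>perms N. heat N wt t z * f z) = (\<Sum>n. t ^ n / fact n * (conv_op N wt ^^ n) f id)"
proof -
  have eq: "(conv_op N wt ^^ n) f id = (\<Sum>z\<in>perms N. f z * (conv_op N wt ^^ n) (indicator {z}) id)" for n
  proof -
    have "f \<sigma> = (\<Sum>z\<in>perms N. f z * indicator {z} \<sigma>)" if "\<sigma> \<in> perms N" for \<sigma>
      using that by (simp add: indicator_def if_distrib[of "\<lambda>x. f _ * x"] cong: if_cong)
    then have "(conv_op N wt ^^ n) f id = (conv_op N wt ^^ n) (\<lambda>\<sigma>. \<Sum>z\<in>perms N. f z * indicator {z} \<sigma>) id"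
      by (intro conv_op_pow_cong id_perms)
    then show ?thesis unfolding conv_op_pow_sum .
  qed
  have "(\<Sum>z\<in>perms N. heat N wt t z * f z) =
    (\<Sum>z\<in>perms N. \<Sum>n. f z * (t ^ n / fact n * (conv_op N wt ^^ n) (indicator {z}) id))"
    unfolding heat_def semigroup_of_def
    by (intro sum.cong refl, subst suminf_mult[OF summable_conv_op[OF id_perms]]) (rule mult.commute)
  also have "\<dots> = (\<Sum>n. \<Sum>z\<in>perms N. f z * (t ^ n / fact n * (conv_op N wt ^^ n) (indicator {z}) id))"
    by (intro suminf_sum[symmetric] summable_mult summable_conv_op id_perms)
  also have "\<dots> = (\<Sum>n. t ^ n / fact n * (conv_op N wt ^^ n) f id)"
    unfolding eq by (simp add: sum_distrib_left mult_ac)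
  finally show ?thesis .
qed

section \<open>The evolution of the moments\<close>

fun iter :: "nat \<Rightarrow> (point set set \<Rightarrow> point set set \<Rightarrow> real) \<Rightarrow> nat \<Rightarrow> point set set \<Rightarrow> real" where
  "iter k G 0 p = 1"
| "iter k G (Suc n) p = (\<Sum>q\<in>Parts k. G p q * iter k G n (glued k p q))"

lemma ext_comp: "ext A (g \<circ> \<sigma>) = (\<lambda>l. ext A g l \<circ> ext A \<sigma> l)"
  by (auto simp: ext_def)

lemma conv_op_mom:
  assumes N: "2 * k \<le> N" "0 < N" and wt: "class_weight N wt" and p: "p \<in> Parts k" and \<sigma>: "\<sigma> \<in> perms N"
  shows "conv_op N wt (\<lambda>\<sigma>. mom N k p (word_tensor k (ext A \<sigma>))) \<sigma> =
    (\<Sum>q\<in>Parts k. (kap N k (law_tensor N k A wt) q * coef N k p q) * mom N k (glued k p q) (word_tensor k (ext A \<sigma>)))"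
proof -
  have "conv_op N wt (\<lambda>\<sigma>. mom N k p (word_tensor k (ext A \<sigma>))) \<sigma> =
    mom N k p (\<lambda>I. \<Sum>g\<in>perms N. wt g * word_tensor k (ext A (g \<circ> \<sigma>)) I)"
    unfolding conv_op_def mom_sum ..
  also have "\<dots> = mom N k p (comp_tensor N k (law_tensor N k A wt) (word_tensor k (ext A \<sigma>)))"
    unfolding ext_comp by (rule mom_cong) (rule comp_law_word[OF ext_perms[OF \<sigma>], symmetric])
  also have "\<dots> = (\<Sum>q\<in>Parts k. kap N k (law_tensor N k A wt) q * coef N k p q * mom N k (glued k p q) (word_tensor k (ext A \<sigma>)))"
    by (rule mom_comp_tensor[OF N law_tensor_invariant[OF wt] p])
  finally show ?thesis .
qed

lemma conv_op_pow_mom: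
  assumes N: "2 * k \<le> N" "0 < N" and wt: "class_weight N wt" and p: "p \<in> Parts k"
  shows "(conv_op N wt ^^ n) (\<lambda>\<sigma>. mom N k p (word_tensor k (ext A \<sigma>))) id =
    iter k (\<lambda>p q. kap N k (law_tensor N k A wt) q * coef N k p q) n p"
  using p
proof (induction n arbitrary: p)
  case 0
  then show ?case by (simp only: funpow_0 iter.simps ext_id mom_word_id[OF 0 N(2)])
next
  case (Suc n)
  have "(conv_op N wt ^^ Suc n) (\<lambda>\<sigma>. mom N k p (word_tensor k (ext A \<sigma>))) id =
    (conv_op N wt ^^ n) (\<lambda>\<sigma>. \<Sum>q\<in>Parts k. (kap N k (law_tensor N k A wt) q * coef N k p q) *
      mom N k (glued k p q) (word_tensor k (ext A \<sigma>))) id"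
    unfolding funpow_Suc_right o_apply
    by (rule conv_op_pow_cong[OF conv_op_mom[OF N wt Suc(2)] id_perms])
  also have "\<dots> = iter k (\<lambda>p q. kap N k (law_tensor N k A wt) q * coef N k p q) (Suc n) p"
    unfolding conv_op_pow_sum iter.simps
    by (intro sum.cong refl arg_cong2[where f = "(*)"] Suc.IH glued_Parts Suc.prems)
  finally show ?case .
qed

lemma mom_heat:
  assumes N: "2 * k \<le> N" "0 < N" and wt: "class_weight N wt" and p: "p \<in> Parts k"
  shows "mom N k p (law_tensor N k A (heat N wt t)) =
    (\<Sum>n. t ^ n / fact n * iter k (\<lambda>p q. kap N k (law_tensor N k A wt) q * coef N k p q) n p)"
  unfolding mom_law_tensor sum_heat conv_op_pow_mom[OF N wt p] ..

lemma iter_bound: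
  assumes "\<And>p q. p \<in> Parts k \<Longrightarrow> q \<in> Parts k \<Longrightarrow> \<bar>G p q\<bar> \<le> K" "p \<in> Parts k"
  shows "\<bar>iter k G n p\<bar> \<le> (real (card (Parts k)) * K) ^ n"
  using assms(2)
proof (induction n arbitrary: p)
  case (Suc n)
  have K: "0 \<le> K" using assms(1)[OF Suc(2) Suc(2)] by simp
  have "\<bar>iter k G (Suc n) p\<bar> \<le> (\<Sum>q\<in>Parts k. \<bar>G p q * iter k G n (glued k p q)\<bar>)" by simp
  also have "\<dots> \<le> (\<Sum>q\<in>Parts k. K * (real (card (Parts k)) * K) ^ n)"
    unfolding abs_mult using Suc glued_Parts assms(1) K by (intro sum_mono mult_mono) auto
  finally show ?case by simp
qed simp

lemma iter_tendsto:
  assumes "\<And>p q. p \<in> Parts k \<Longrightarrow> q \<in> Parts k \<Longrightarrow> (\<lambda>N. GN N p q) \<longlonglongrightarrow> G p q" "p \<in> Parts k"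
  shows "(\<lambda>N. iter k (GN N) n p) \<longlonglongrightarrow> iter k G n p"
  using assms(2)
  by (induction n arbitrary: p) (auto intro!: tendsto_sum tendsto_mult assms(1) glued_Parts)

lemma iter_series_tendsto:
  assumes G: "\<And>p q. p \<in> Parts k \<Longrightarrow> q \<in> Parts k \<Longrightarrow> (\<lambda>N. GN N p q) \<longlonglongrightarrow> G p q" and p: "p \<in> Parts k"
  shows "(\<lambda>N. \<Sum>n. t ^ n / fact n * iter k (GN N) n p) \<longlonglongrightarrow> (\<Sum>n. t ^ n / fact n * iter k G n p)"
proof -
  define K where "K = 1 + (\<Sum>p\<in>Parts k. \<Sum>q\<in>Parts k. \<bar>G p q\<bar>)"
  have GK: "\<bar>G p q\<bar> < K" if "p \<in> Parts k" "q \<in> Parts k" for p q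
  proof -
    have "\<bar>G p q\<bar> \<le> (\<Sum>q\<in>Parts k. \<bar>G p q\<bar>)" using that by (intro member_le_sum) auto
    also have "\<dots> \<le> (\<Sum>p\<in>Parts k. \<Sum>q\<in>Parts k. \<bar>G p q\<bar>)"
      using that by (intro member_le_sum[of p _ "\<lambda>p. \<Sum>q\<in>Parts k. \<bar>G p q\<bar>"]) (auto intro: sum_nonneg)
    finally show ?thesis by (simp add: K_def)
  qed
  have ev: "\<forall>\<^sub>F N in sequentially. \<forall>p\<in>Parts k. \<forall>q\<in>Parts k. \<bar>GN N p q\<bar> < K"
    using GK by (intro eventually_ball_finite finite_Parts ballI order_tendstoD(2)[OF tendsto_rabs[OF G]])
  have "\<forall>\<^sub>F (n, N) in at_top \<times>\<^sub>F sequentially. norm (t ^ n / fact n * iter k (GN N) n p) \<le>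
    (\<bar>t\<bar> * (real (card (Parts k)) * K)) ^ n /\<^sub>R fact n"
    unfolding eventually_prod_filter
  proof (intro exI conjI allI impI)
    show "\<forall>\<^sub>F n in at_top. True" by simp
    show "\<forall>\<^sub>F N in sequentially. \<forall>p\<in>Parts k. \<forall>q\<in>Parts k. \<bar>GN N p q\<bar> < K" by (rule ev)
    fix n N assume "\<forall>p\<in>Parts k. \<forall>q\<in>Parts k. \<bar>GN N p q\<bar> < K"
    then have "\<bar>iter k (GN N) n p\<bar> \<le> (real (card (Parts k)) * K) ^ n"
      by (intro iter_bound p) (simp add: less_imp_le)
    then have "\<bar>t\<bar> ^ n / fact n * \<bar>iter k (GN N) n p\<bar> \<le> \<bar>t\<bar> ^ n / fact n * (real (card (Parts k)) * K) ^ n"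
      by (intro mult_left_mono) auto
    then show "case (n, N) of (n, N) \<Rightarrow> norm (t ^ n / fact n * iter k (GN N) n p) \<le>
      (\<bar>t\<bar> * (real (card (Parts k)) * K)) ^ n /\<^sub>R fact n"
      by (simp add: abs_mult power_abs power_mult_distrib divide_inverse mult_ac)
  qed
  from tannerys_theorem[OF tendsto_mult[OF tendsto_const iter_tendsto[OF G p]] this
      summable_exp_generic trivial_limit_sequentially]
  show ?thesis by blast
qed

lemma iter_series_continuous:
  assumes p: "p \<in> Parts k"
  shows "((\<lambda>t. \<Sum>n. t ^ n / fact n * iter k G n p) \<longlongrightarrow> 1) (at_right (0::real))"
proof -
  define c where "c n = iter k G n p / fact n" for n
  define K where "K = (\<Sum>p\<in>Parts k. \<Sum>q\<in>Parts k. \<bar>G p q\<bar>)"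
  have GK: "\<bar>G p q\<bar> \<le> K" if "p \<in> Parts k" "q \<in> Parts k" for p q
  proof -
    have "\<bar>G p q\<bar> \<le> (\<Sum>q\<in>Parts k. \<bar>G p q\<bar>)" using that by (intro member_le_sum) auto
    also have "\<dots> \<le> K" unfolding K_def
      using that by (intro member_le_sum[of p _ "\<lambda>p. \<Sum>q\<in>Parts k. \<bar>G p q\<bar>"]) (auto intro: sum_nonneg)
    finally show ?thesis .
  qed
  have "summable (\<lambda>n. c n * 1 ^ n)"
  proof (rule summable_comparison_test)
    have "norm (c n * 1 ^ n) \<le> (real (card (Parts k)) * K) ^ n /\<^sub>R fact n" for n
    proof -
      have "\<bar>iter k G n p\<bar> \<le> (real (card (Parts k)) * K) ^ n" by (rule iter_bound[OF _ p]) (rule GK)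
      then show ?thesis by (simp add: c_def divide_inverse mult.commute abs_mult mult_right_mono)
    qed
    then show "\<exists>N. \<forall>n\<ge>N. norm (c n * 1 ^ n) \<le> (real (card (Parts k)) * K) ^ n /\<^sub>R fact n" by blast
  qed (rule summable_exp_generic)
  then have "isCont (\<lambda>t. \<Sum>n. c n * t ^ n) 0" by (rule isCont_powser) simp
  then have "((\<lambda>t. \<Sum>n. c n * t ^ n) \<longlongrightarrow> (\<Sum>n. c n * 0 ^ n)) (at_right 0)"
    unfolding isCont_def by (rule filterlim_mono) (auto simp: at_le)
  moreover have "(\<Sum>n. c n * 0 ^ n) = 1" unfolding powser_zero by (simp add: c_def)
  ultimately show ?thesis by (simp add: c_def mult_ac divide_inverse)
qed

abbreviation walk_heat :: "(nat \<Rightarrow> (nat \<Rightarrow> nat) set) \<Rightarrow> real \<Rightarrow> nat \<Rightarrow> (nat \<Rightarrow> nat) \<Rightarrow> real" where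
  "walk_heat L t N \<equiv> heat N (gen_weight N (L N)) t"

lemma heat_mom_limit:
  assumes L: "\<forall>N\<ge>2. conjugacy_class N (L N) \<and> L N \<noteq> {id}" and conv: "classes_converge L \<alpha>"
    and p: "p \<in> Parts k"
  shows "\<exists>a. (\<forall>t. (\<lambda>N. mom N k p (law_tensor N k A (walk_heat L t N))) \<longlonglongrightarrow> a t) \<and> (a \<longlongrightarrow> 1) (at_right 0)"
proof -
  let ?e = "\<lambda>N. law_tensor N k A (gen_weight N (L N))"
  define GN where "GN N p q = kap N k (?e N) q * coef N k p q" for N p q
  have inv: "\<forall>\<^sub>F N in sequentially. ker_invariant N k (?e N)"
    using eventually_ge_at_top[of 2]
    by eventually_elim (use L in \<open>auto intro!: law_tensor_invariant class_weight_gen\<close>)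
  have "convergent (\<lambda>N. GN N p q)" if "p \<in> Parts k" "q \<in> Parts k" for p q
    unfolding GN_def
    by (intro convergent_mult convergent_coef that convergent_kap[OF inv convergent_mom_gen[OF L conv]])
  then have G: "(\<lambda>N. GN N p q) \<longlonglongrightarrow> lim (\<lambda>N. GN N p q)" if "p \<in> Parts k" "q \<in> Parts k" for p q
    using that by (simp add: convergent_LIMSEQ_iff)
  define a where "a t = (\<Sum>n. t ^ n / fact n * iter k (\<lambda>p q. lim (\<lambda>N. GN N p q)) n p)" for t
  have "(\<lambda>N. mom N k p (law_tensor N k A (walk_heat L t N))) \<longlonglongrightarrow> a t" for t
  proof -
    have "\<forall>\<^sub>F N in sequentially. mom N k p (law_tensor N k A (walk_heat L t N)) = (\<Sum>n. t ^ n / fact n * iter k (GN N) n p)"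
      using eventually_ge_at_top[of 2] eventually_ge_at_top[of "2 * k"]
    proof eventually_elim
      case (elim N)
      then have "class_weight N (gen_weight N (L N))" using L by (auto intro: class_weight_gen)
      then show ?case using mom_heat[OF elim(2) _ _ p] elim(1) by (simp add: GN_def[abs_def])
    qed
    moreover have "(\<lambda>N. \<Sum>n. t ^ n / fact n * iter k (GN N) n p) \<longlonglongrightarrow> a t"
      unfolding a_def by (rule iter_series_tendsto[OF G p])
    ultimately show ?thesis by (simp add: tendsto_cong)
  qed
  moreover have "(a \<longlongrightarrow> 1) (at_right 0)" unfolding a_def[abs_def] by (rule iter_series_continuous[OF p])
  ultimately show ?thesis by blast
qed

lemma convergent_kap_heat:
  assumes L: "\<forall>N\<ge>2. conjugacy_class N (L N) \<and> L N \<noteq> {id}" and conv: "classes_converge L \<alpha>"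
    and q: "q \<in> Parts k"
  shows "convergent (\<lambda>N. kap N k (law_tensor N k A (walk_heat L t N)) q)"
proof (rule convergent_kap[OF _ _ q])
  show "\<forall>\<^sub>F N in sequentially. ker_invariant N k (law_tensor N k A (walk_heat L t N))"
    using eventually_ge_at_top[of 2]
    by eventually_elim (use L in \<open>auto intro!: law_tensor_invariant class_weight_heat class_weight_gen\<close>)
  show "convergent (\<lambda>N. mom N k p (law_tensor N k A (walk_heat L t N)))" if "p \<in> Parts k" for p
    using heat_mom_limit[OF L conv that] by (auto simp: convergent_def)
qed

section \<open>Finitely valued random variables\<close>

lemma finite_valued_integral:
  fixes F :: "'e \<Rightarrow> 'b :: {banach, second_countable_topology}"
  assumes M: "prob_space M" and X: "X \<in> measurable M (count_space E)" and E: "finite E"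
  shows "integrable M (\<lambda>\<omega>. F (X \<omega>))"
    and "integral\<^sup>L M (\<lambda>\<omega>. F (X \<omega>)) = (\<Sum>e\<in>E. measure M {\<omega> \<in> space M. X \<omega> = e} *\<^sub>R F e)"
proof -
  interpret prob_space M by fact
  have ev: "{\<omega> \<in> space M. X \<omega> = e} \<in> sets M" if "e \<in> E" for e
    using measurable_sets[OF X, of "{e}"] that by (simp add: vimage_def Int_def conj_commute)
  have "has_bochner_integral M (\<lambda>\<omega>. \<Sum>e\<in>E. indicator {\<omega> \<in> space M. X \<omega> = e} \<omega> *\<^sub>R F e)
    (\<Sum>e\<in>E. measure M {\<omega> \<in> space M. X \<omega> = e} *\<^sub>R F e)"
    by (intro has_bochner_integral_sum has_bochner_integral_indicator ev)
      (auto simp: emeasure_eq_measure)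
  moreover have "(\<Sum>e\<in>E. indicator {\<omega> \<in> space M. X \<omega> = e} \<omega> *\<^sub>R F e) = F (X \<omega>)" if \<omega>: "\<omega> \<in> space M" for \<omega>
  proof -
    have "X \<omega> \<in> E" using measurable_space[OF X \<omega>] by simp
    moreover have "(\<Sum>e\<in>E. indicator {\<omega> \<in> space M. X \<omega> = e} \<omega> *\<^sub>R F e) = (\<Sum>e\<in>E. if X \<omega> = e then F e else 0)"
      using \<omega> by (intro sum.cong refl) (simp add: indicator_def)
    ultimately show ?thesis using E by (simp add: sum.delta)
  qed
  ultimately have "has_bochner_integral M (\<lambda>\<omega>. F (X \<omega>)) (\<Sum>e\<in>E. measure M {\<omega> \<in> space M. X \<omega> = e} *\<^sub>R F e)"
    using has_bochner_integral_cong[of M M "\<lambda>\<omega>. \<Sum>e\<in>E. indicator {\<omega> \<in> space M. X \<omega> = e} \<omega> *\<^sub>R F e" "\<lambda>\<omega>. F (X \<omega>)"] by simp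
  then show "integrable M (\<lambda>\<omega>. F (X \<omega>))"
    and "integral\<^sup>L M (\<lambda>\<omega>. F (X \<omega>)) = (\<Sum>e\<in>E. measure M {\<omega> \<in> space M. X \<omega> = e} *\<^sub>R F e)"
    by (auto simp: integrable.simps dest: has_bochner_integral_integral_eq)
qed

lemma measurable_finite_binary:
  assumes "X \<in> measurable M (count_space E)" "Y \<in> measurable M (count_space E)" "finite E"
    and "\<And>x y. x \<in> E \<Longrightarrow> y \<in> E \<Longrightarrow> h x y \<in> E"
  shows "(\<lambda>\<omega>. h (X \<omega>) (Y \<omega>)) \<in> measurable M (count_space E)"
proof (rule measurable_compose_countable'[OF _ assms(2)])
  fix y assume "y \<in> E"
  then show "(\<lambda>\<omega>. h (X \<omega>) y) \<in> measurable M (count_space E)"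
    using assms(4) by (intro measurable_compose[OF assms(1)]) simp
qed (simp add: assms(3) countable_finite)

lemma measurable_finite_tuple:
  fixes m :: nat
  assumes X: "\<And>j. j < m \<Longrightarrow> X j \<in> measurable M (count_space E)" and E: "finite E"
  shows "(\<lambda>\<omega>. restrict (\<lambda>j. X j \<omega>) {..<m}) \<in> measurable M (count_space (PiE {..<m} (\<lambda>_. E)))"
proof (subst measurable_count_space_eq2, goal_cases fin pts)
  case fin
  show "finite (PiE {..<m} (\<lambda>_. E))" by (rule finite_PiE) (simp_all add: E)
next
  case pts
  show ?case
  proof (intro conjI ballI funcsetI)
    fix \<omega> assume "\<omega> \<in> space M"
    then show "restrict (\<lambda>j. X j \<omega>) {..<m} \<in> PiE {..<m} (\<lambda>_. E)"
      using measurable_space[OF X] by auto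
  next
    fix g assume g: "g \<in> PiE {..<m} (\<lambda>_. E)"
    have "(\<lambda>\<omega>. restrict (\<lambda>j. X j \<omega>) {..<m}) -` {g} \<inter> space M = {\<omega> \<in> space M. \<forall>j\<in>{..<m}. X j \<omega> = g j}"
      using g by (auto simp: fun_eq_iff PiE_def extensional_def restrict_def)
    also have "\<dots> \<in> sets M"
    proof (rule sets.sets_Collect_finite_All)
      fix j assume j: "j \<in> {..<m}"
      then have "g j \<in> E" using g by auto
      then show "{\<omega> \<in> space M. X j \<omega> = g j} \<in> sets M"
        using measurable_sets[OF X, of j "{g j}"] j by (simp add: vimage_def Int_def conj_commute)
    qed simp
    finally show "(\<lambda>\<omega>. restrict (\<lambda>j. X j \<omega>) {..<m}) -` {g} \<inter> space M \<in> sets M" .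
  qed
qed

section \<open>Finite-dimensional laws of the walks\<close>

definition grid :: "(nat \<Rightarrow> real) \<Rightarrow> bool" where
  "grid u \<longleftrightarrow> u 0 = 0 \<and> (\<forall>i. u i \<le> u (Suc i))"

lemma grid_mono: "grid u \<Longrightarrow> i \<le> j \<Longrightarrow> u i \<le> u j"
  unfolding grid_def using lift_Suc_mono_le[of u i j] by blast

lemma grid_nonneg: "grid u \<Longrightarrow> 0 \<le> u i"
  using grid_mono[of u 0 i] by (simp add: grid_def)

definition grid_incr :: "'w perm_process \<Rightarrow> nat \<Rightarrow> (nat \<Rightarrow> real) \<Rightarrow> 'w \<Rightarrow> nat \<Rightarrow> nat \<Rightarrow> nat" where
  "grid_incr S N u \<omega> j = S N (u (Suc j)) \<omega> \<circ> inv_into UNIV (S N (u j) \<omega>)"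

definition grid_weight ::
  "(nat \<Rightarrow> (nat \<Rightarrow> nat) set) \<Rightarrow> (nat \<Rightarrow> real) \<Rightarrow> nat \<Rightarrow> nat \<Rightarrow> (nat \<Rightarrow> nat \<Rightarrow> nat) \<Rightarrow> real" where
  "grid_weight L u N m g = (\<Prod>j<m. walk_heat L (u (Suc j) - u j) N (g j))"

fun partial_prod :: "(nat \<Rightarrow> nat \<Rightarrow> nat) \<Rightarrow> nat \<Rightarrow> nat \<Rightarrow> nat" where
  "partial_prod g 0 = id"
| "partial_prod g (Suc j) = g j \<circ> partial_prod g j"

locale walks =
  fixes M :: "nat \<Rightarrow> 'w measure" and L :: "nat \<Rightarrow> (nat \<Rightarrow> nat) set"
    and S :: "nat \<Rightarrow> real \<Rightarrow> 'w \<Rightarrow> nat \<Rightarrow> nat" and \<alpha> :: real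
  assumes classes: "\<forall>N\<ge>2. conjugacy_class N (L N) \<and> L N \<noteq> {id}"
    and converge: "classes_converge L \<alpha>"
    and walk: "\<forall>N\<ge>2. random_walk N (L N) (M N) (S N)"
begin

lemma class_N: "2 \<le> N \<Longrightarrow> conjugacy_class N (L N)"
  using classes by blast

lemma prob: "2 \<le> N \<Longrightarrow> prob_space (M N)"
  using walk by (auto simp: random_walk_def markov_process_def)

lemma S_measurable: "2 \<le> N \<Longrightarrow> 0 \<le> t \<Longrightarrow> S N t \<in> measurable (M N) (count_space (perms N))"
  using walk by (auto simp: random_walk_def markov_process_def)

lemma S_perms: "2 \<le> N \<Longrightarrow> 0 \<le> t \<Longrightarrow> \<omega> \<in> space (M N) \<Longrightarrow> S N t \<omega> \<in> perms N"
  using measurable_space[OF S_measurable, of N t \<omega>] by simp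

lemma S_0: "2 \<le> N \<Longrightarrow> AE \<omega> in M N. S N 0 \<omega> = id"
  using walk by (auto simp: random_walk_def)

lemma class_weight_walk: "2 \<le> N \<Longrightarrow> class_weight N (walk_heat L t N)"
  by (intro class_weight_heat class_weight_gen class_N)

lemma sum_walk_heat:
  assumes N: "2 \<le> N"
  shows "(\<Sum>z\<in>perms N. walk_heat L t N z) = 1"
proof -
  note Cp = conjugacy_class_props[OF class_N[OF N]]
  have one: "(conv_op N (gen_weight N (L N)) ^^ n) (\<lambda>_. 1) id = of_bool (n = 0)" for n
  proof (cases n)
    case (Suc n')
    have "conv_op N (gen_weight N (L N)) (\<lambda>_. 1) = (\<lambda>_. 0)"
      unfolding conv_op_def sum_gen_weight[OF class_N[OF N]] using Cp(2,3) by simp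
    moreover have "(conv_op N (gen_weight N (L N)) ^^ n') (\<lambda>_. 0) = (\<lambda>_. 0)"
      by (induction n') (simp_all add: conv_op_def)
    ultimately show ?thesis by (simp add: Suc funpow_Suc_right del: funpow.simps)
  qed simp
  have "(\<Sum>z\<in>perms N. walk_heat L t N z * 1) = (\<Sum>n. t ^ n / fact n * of_bool (n = 0))"
    unfolding sum_heat one ..
  also have "\<dots> = (\<Sum>n\<in>{0}. t ^ n / fact n * of_bool (n = 0))"
    by (rule suminf_finite) auto
  finally show ?thesis by simp
qed

lemma markov:
  assumes "2 \<le> N" "finite T" "T \<subseteq> {0..s}" "0 \<le> s" "s \<le> t" "x \<in> perms N" "z \<in> perms N"
  shows "measure (M N) {\<omega> \<in> space (M N). (\<forall>u\<in>T. S N u \<omega> = y u) \<and> S N s \<omega> = x \<and> S N t \<omega> = z} =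
    measure (M N) {\<omega> \<in> space (M N). (\<forall>u\<in>T. S N u \<omega> = y u) \<and> S N s \<omega> = x} *
      walk_heat L (t - s) N (z \<circ> inv_into UNIV x)"
proof -
  have "markov_process (M N) (perms N) (walk_generator N (L N)) (S N)"
    using walk assms(1) by (simp add: random_walk_def)
  then have "measure (M N) {\<omega> \<in> space (M N). (\<forall>u\<in>T. S N u \<omega> = y u) \<and> S N s \<omega> = x \<and> S N t \<omega> = z} =
    measure (M N) {\<omega> \<in> space (M N). (\<forall>u\<in>T. S N u \<omega> = y u) \<and> S N s \<omega> = x} *
      semigroup_of (walk_generator N (L N)) (t - s) (indicator {z}) x"
    using assms unfolding markov_process_def by blast
  then show ?thesis
    unfolding walk_generator_conv_op[OF class_N[OF assms(1)]] heat_translate[OF assms(6)] .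
qed

lemma grid_measure:
  assumes N: "2 \<le> N" and u: "grid u" and G: "G 0 = id" "\<And>j. j \<le> m \<Longrightarrow> G j \<in> perms N"
  shows "measure (M N) {\<omega> \<in> space (M N). \<forall>j\<le>m. S N (u j) \<omega> = G j} =
    (\<Prod>j<m. walk_heat L (u (Suc j) - u j) N (G (Suc j) \<circ> inv_into UNIV (G j)))"
  using G(2)
proof (induction m)
  case 0
  interpret prob_space "M N" by (rule prob[OF N])
  have "AE \<omega> in M N. \<omega> \<in> {\<omega> \<in> space (M N). \<forall>j\<le>0. S N (u j) \<omega> = G j}"
    using S_0[OF N] u G(1) by (auto simp: grid_def)
  then have "measure (M N) {\<omega> \<in> space (M N). \<forall>j\<le>0. S N (u j) \<omega> = G j} = 1"
    by (rule prob_eq_1[THEN iffD2, rotated])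
      (use measurable_sets[OF S_measurable[OF N], of 0 "{id}"] u G(1) in
        \<open>simp add: vimage_def Int_def conj_commute grid_def id_perms[simplified]\<close>)
  then show ?case by simp
next
  case (Suc m)
  let ?E = "\<lambda>m. {\<omega> \<in> space (M N). \<forall>j\<le>m. S N (u j) \<omega> = G j}"
  have IH: "measure (M N) (?E m) = (\<Prod>j<m. walk_heat L (u (Suc j) - u j) N (G (Suc j) \<circ> inv_into UNIV (G j)))"
    by (rule Suc.IH) (rule Suc.prems, simp)
  show ?case
  proof (cases "?E m = {}")
    case True
    then have E0: "?E (Suc m) = {}" by (auto simp: le_Suc_eq)
    have z: "(\<Prod>j<m. walk_heat L (u (Suc j) - u j) N (G (Suc j) \<circ> inv_into UNIV (G j))) = 0"
      using IH unfolding True by simp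
    show ?thesis unfolding E0 prod.lessThan_Suc z by simp
  next
    case False
    then obtain \<omega>0 where \<omega>0: "\<forall>j\<le>m. S N (u j) \<omega>0 = G j" by blast
    let ?T = "u ` {..<m}"
    let ?y = "\<lambda>t. S N t \<omega>0"
    have past: "((\<forall>v\<in>?T. S N v \<omega> = ?y v) \<and> S N (u m) \<omega> = G m) \<longleftrightarrow> (\<forall>j\<le>m. S N (u j) \<omega> = G j)" for \<omega>
    proof
      assume a: "(\<forall>v\<in>?T. S N v \<omega> = ?y v) \<and> S N (u m) \<omega> = G m"
      show "\<forall>j\<le>m. S N (u j) \<omega> = G j"
      proof (intro allI impI)
        fix j assume "j \<le> m"
        then show "S N (u j) \<omega> = G j"
          using a \<omega>0 by (cases "j = m") auto
      qed
    qed (use \<omega>0 in auto)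
    have "?T \<subseteq> {0..u m}" using grid_mono[OF u] grid_nonneg[OF u] by auto
    from markov[OF N finite_imageI[OF finite_lessThan] this grid_nonneg[OF u] grid_mono[OF u, of m "Suc m"]
        Suc.prems Suc.prems, of m "Suc m" ?y]
    have "measure (M N) {\<omega> \<in> space (M N). ((\<forall>v\<in>?T. S N v \<omega> = ?y v) \<and> S N (u m) \<omega> = G m) \<and> S N (u (Suc m)) \<omega> = G (Suc m)} =
      measure (M N) (?E m) * walk_heat L (u (Suc m) - u m) N (G (Suc m) \<circ> inv_into UNIV (G m))"
      unfolding conj_assoc[symmetric] past by simp
    moreover have "{\<omega> \<in> space (M N). ((\<forall>v\<in>?T. S N v \<omega> = ?y v) \<and> S N (u m) \<omega> = G m) \<and> S N (u (Suc m)) \<omega> = G (Suc m)} = ?E (Suc m)"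
      unfolding past by (auto simp: le_Suc_eq)
    ultimately show ?thesis unfolding IH prod.lessThan_Suc by (simp only:)
  qed
qed

lemma incr_measurable:
  assumes N: "2 \<le> N" and "0 \<le> s" "0 \<le> t"
  shows "(\<lambda>\<omega>. S N t \<omega> \<circ> inv_into UNIV (S N s \<omega>)) \<in> measurable (M N) (count_space (perms N))"
  by (rule measurable_finite_binary[OF S_measurable[OF N assms(3)] S_measurable[OF N assms(2)]])
    (simp, rule perms_compose, assumption, simp add: permutes_inv)

lemma grid_incr_measurable:
  assumes N: "2 \<le> N" and u: "grid u"
  shows "(\<lambda>\<omega>. restrict (grid_incr S N u \<omega>) {..<m}) \<in> measurable (M N) (count_space (PiE {..<m} (\<lambda>_. perms N)))"
  unfolding grid_incr_def
  by (intro measurable_finite_tuple incr_measurable[OF N] grid_nonneg[OF u] finite_perms)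

lemma grid_incr_law:
  assumes N: "2 \<le> N" and u: "grid u" and g: "g \<in> PiE {..<m} (\<lambda>_. perms N)"
  shows "measure (M N) {\<omega> \<in> space (M N). restrict (grid_incr S N u \<omega>) {..<m} = g} = grid_weight L u N m g"
proof -
  interpret prob_space "M N" by (rule prob[OF N])
  let ?G = "partial_prod g"
  have gp: "g j \<in> perms N" if "j < m" for j using g that by auto
  have G: "?G j \<in> perms N" if "j \<le> m" for j
    using that by (induction j) (use gp perms_compose in \<open>auto simp: permutes_id\<close>)
  let ?A = "{\<omega> \<in> space (M N). restrict (grid_incr S N u \<omega>) {..<m} = g}"
  let ?B = "{\<omega> \<in> space (M N). \<forall>j\<le>m. S N (u j) \<omega> = ?G j}"
  have A: "?A \<in> sets (M N)"
    using measurable_sets[OF grid_incr_measurable[OF N u, of m], of "{g}"] g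
    by (simp add: vimage_def Int_def conj_commute)
  have B: "?B \<in> sets (M N)"
  proof -
    have "?B = {\<omega> \<in> space (M N). \<forall>j\<in>{..m}. S N (u j) \<omega> = ?G j}" by auto
    also have "\<dots> \<in> sets (M N)"
    proof (rule sets.sets_Collect_finite_All)
      fix j assume "j \<in> {..m}"
      then show "{\<omega> \<in> space (M N). S N (u j) \<omega> = ?G j} \<in> sets (M N)"
        using measurable_sets[OF S_measurable[OF N grid_nonneg[OF u, of j]], of "{?G j}"] G[of j]
        by (simp add: vimage_def Int_def conj_commute)
    qed simp
    finally show ?thesis .
  qed
  have iff: "\<omega> \<in> ?A \<longleftrightarrow> \<omega> \<in> ?B" if \<omega>: "\<omega> \<in> space (M N)" "S N 0 \<omega> = id" for \<omega>
  proof -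
    have Sp: "S N (u j) \<omega> \<in> perms N" for j using S_perms[OF N grid_nonneg[OF u] \<omega>(1)] .
    have cancel: "a \<circ> inv_into UNIV b = c \<longleftrightarrow> a = c \<circ> b" if "b \<in> perms N" for a b c :: "nat \<Rightarrow> nat"
    proof
      assume "a \<circ> inv_into UNIV b = c"
      then have "c \<circ> b = a \<circ> inv_into UNIV b \<circ> b" by simp
      then show "a = c \<circ> b" using that by (auto simp: fun_eq_iff permutes_inverses)
    qed (use that in \<open>auto simp: fun_eq_iff permutes_inverses\<close>)
    have "restrict (grid_incr S N u \<omega>) {..<m} = g \<longleftrightarrow> (\<forall>j<m. grid_incr S N u \<omega> j = g j)"
    proof
      assume "\<forall>j<m. grid_incr S N u \<omega> j = g j"
      then show "restrict (grid_incr S N u \<omega>) {..<m} = g"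
        using PiE_arb[OF g] by (intro ext) (simp add: restrict_def)
    qed auto
    also have "\<dots> \<longleftrightarrow> (\<forall>j<m. S N (u (Suc j)) \<omega> = g j \<circ> S N (u j) \<omega>)"
      unfolding grid_incr_def cancel[OF Sp] ..
    also have "\<dots> \<longleftrightarrow> (\<forall>j\<le>m. S N (u j) \<omega> = ?G j)"
    proof
      assume a: "\<forall>j<m. S N (u (Suc j)) \<omega> = g j \<circ> S N (u j) \<omega>"
      show "\<forall>j\<le>m. S N (u j) \<omega> = ?G j"
      proof (intro allI impI)
        fix j assume "j \<le> m"
        then show "S N (u j) \<omega> = ?G j"
          by (induction j) (use a u \<omega>(2) in \<open>auto simp: grid_def\<close>)
      qed
    next
      assume a: "\<forall>j\<le>m. S N (u j) \<omega> = ?G j"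
      show "\<forall>j<m. S N (u (Suc j)) \<omega> = g j \<circ> S N (u j) \<omega>"
      proof (intro allI impI)
        fix j assume "j < m"
        then show "S N (u (Suc j)) \<omega> = g j \<circ> S N (u j) \<omega>"
          using a[rule_format, of "Suc j"] a[rule_format, of j] by simp
      qed
    qed
    finally show ?thesis using \<omega>(1) by simp
  qed
  have "AE \<omega> in M N. \<omega> \<in> ?A \<longleftrightarrow> \<omega> \<in> ?B"
    using S_0[OF N] AE_space by eventually_elim (rule iff)
  then have "measure (M N) ?A = measure (M N) ?B" using A B by (rule finite_measure_eq_AE)
  also have "\<dots> = (\<Prod>j<m. walk_heat L (u (Suc j) - u j) N (?G (Suc j) \<circ> inv_into UNIV (?G j)))"
    by (rule grid_measure[OF N u _ G]) simp
  also have "\<dots> = grid_weight L u N m g"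
    unfolding grid_weight_def
  proof (intro prod.cong refl)
    fix j assume "j \<in> {..<m}"
    then have "?G (Suc j) \<circ> inv_into UNIV (?G j) = g j"
      using G[of j] by (auto simp: fun_eq_iff permutes_inverses)
    then show "walk_heat L (u (Suc j) - u j) N (?G (Suc j) \<circ> inv_into UNIV (?G j)) = walk_heat L (u (Suc j) - u j) N (g j)"
      by simp
  qed
  finally show ?thesis .
qed

lemma grid_integral:
  fixes F :: "(nat \<Rightarrow> nat \<Rightarrow> nat) \<Rightarrow> 'b :: {banach, second_countable_topology}"
  assumes N: "2 \<le> N" and u: "grid u"
  shows "integrable (M N) (\<lambda>\<omega>. F (restrict (grid_incr S N u \<omega>) {..<m}))"
    and "integral\<^sup>L (M N) (\<lambda>\<omega>. F (restrict (grid_incr S N u \<omega>) {..<m})) =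
      (\<Sum>g\<in>PiE {..<m} (\<lambda>_. perms N). grid_weight L u N m g *\<^sub>R F g)"
  using finite_valued_integral[OF prob[OF N] grid_incr_measurable[OF N u] finite_PiE, of m F]
    grid_incr_law[OF N u] by (simp_all cong: sum.cong)

end

section \<open>Words in the increments over a grid\<close>

fun wprod :: "(nat \<Rightarrow> 'l set) \<Rightarrow> (nat \<Rightarrow> nat \<Rightarrow> nat) \<Rightarrow> nat \<Rightarrow> 'l \<Rightarrow> nat \<Rightarrow> nat" where
  "wprod A g 0 l = id"
| "wprod A g (Suc m) l = ext (A m) (g m) l \<circ> wprod A g m l"

definition grid_tensor ::
  "(nat \<Rightarrow> (nat \<Rightarrow> nat) set) \<Rightarrow> (nat \<Rightarrow> real) \<Rightarrow> nat \<Rightarrow> nat \<Rightarrow> nat \<Rightarrow>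
    ((nat \<Rightarrow> nat \<Rightarrow> nat) \<Rightarrow> nat \<Rightarrow> nat \<Rightarrow> nat) \<Rightarrow> (point \<Rightarrow> nat) \<Rightarrow> real" where
  "grid_tensor L u N m k w J =
    (\<Sum>g\<in>PiE {..<m} (\<lambda>_. perms N). grid_weight L u N m g * word_tensor k (w g) J)"

lemma wprod_cong: "(\<And>j. j < m \<Longrightarrow> g j = h j) \<Longrightarrow> wprod A g m l = wprod A h m l"
  by (induction m) simp_all

lemma wprod_index: "wprod A g m (f l) = wprod (\<lambda>i. {l. f l \<in> A i}) g m l"
  by (induction m) (simp_all add: ext_def)

lemma wprod_perms: "(\<And>j. j < m \<Longrightarrow> g j \<in> perms N) \<Longrightarrow> wprod A g m l \<in> perms N"
proof (induction m)
  case (Suc m)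
  then show ?case unfolding wprod.simps by (intro perms_compose ext_perms) auto
qed (simp only: wprod.simps id_perms)

lemma wprod_conj:
  assumes "\<tau> \<in> perms N"
  shows "wprod A (\<lambda>j. \<tau> \<circ> g j \<circ> inv_into UNIV \<tau>) m l = \<tau> \<circ> wprod A g m l \<circ> inv_into UNIV \<tau>"
proof (induction m)
  case 0
  show ?case using assms by (auto simp: fun_eq_iff permutes_inverses)
next
  case (Suc m)
  show ?case unfolding wprod.simps Suc
    using assms by (auto simp: fun_eq_iff permutes_inverses ext_def)
qed

lemma sum_PiE_Suc:
  "(\<Sum>g\<in>PiE {..<Suc m} (\<lambda>_. E). F g) = (\<Sum>g\<in>PiE {..<m} (\<lambda>_. E). \<Sum>h\<in>E. F (g(m := h)))"
proof -
  have "(\<Sum>g\<in>PiE {..<Suc m} (\<lambda>_. E). F g) = (\<Sum>(h, g)\<in>E \<times> PiE {..<m} (\<lambda>_. E). F (g(m := h)))"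
    unfolding lessThan_Suc PiE_insert_eq
    by (subst sum.reindex[OF inj_combinator]) (auto simp: case_prod_unfold intro!: sum.cong)
  also have "\<dots> = (\<Sum>h\<in>E. \<Sum>g\<in>PiE {..<m} (\<lambda>_. E). F (g(m := h)))"
    by (rule sum.cartesian_product[symmetric])
  also have "\<dots> = (\<Sum>g\<in>PiE {..<m} (\<lambda>_. E). \<Sum>h\<in>E. F (g(m := h)))" by (rule sum.swap)
  finally show ?thesis .
qed

lemma grid_tensor_Suc:
  assumes I: "I \<in> indices N k"
  shows "grid_tensor L u N (Suc m) k (\<lambda>g. wprod A g (Suc m)) I =
    comp_tensor N k (law_tensor N k (A m) (walk_heat L (u (Suc m) - u m) N))
      (grid_tensor L u N m k (\<lambda>g. wprod A g m)) I"
proof -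
  let ?H = "walk_heat L (u (Suc m) - u m) N"
  have "grid_tensor L u N (Suc m) k (\<lambda>g. wprod A g (Suc m)) I =
    (\<Sum>g\<in>PiE {..<m} (\<lambda>_. perms N). \<Sum>h\<in>perms N.
      grid_weight L u N (Suc m) (g(m := h)) * word_tensor k (wprod A (g(m := h)) (Suc m)) I)"
    unfolding grid_tensor_def by (rule sum_PiE_Suc)
  also have "\<dots> = (\<Sum>g\<in>PiE {..<m} (\<lambda>_. perms N). grid_weight L u N m g *
      (\<Sum>h\<in>perms N. ?H h * word_tensor k (\<lambda>l. ext (A m) h l \<circ> wprod A g m l) I))"
    unfolding sum_distrib_left
  proof (intro sum.cong refl)
    fix g h
    have w: "wprod A (g(m := h)) (Suc m) = (\<lambda>l. ext (A m) h l \<circ> wprod A g m l)"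
    proof
      fix l
      have "wprod A (g(m := h)) m l = wprod A g m l" by (rule wprod_cong) simp
      then show "wprod A (g(m := h)) (Suc m) l = ext (A m) h l \<circ> wprod A g m l"
        by (simp only: wprod.simps fun_upd_same)
    qed
    have "grid_weight L u N (Suc m) (g(m := h)) = grid_weight L u N m g * ?H h"
    proof -
      have "(\<Prod>j<m. walk_heat L (u (Suc j) - u j) N ((g(m := h)) j)) = (\<Prod>j<m. walk_heat L (u (Suc j) - u j) N (g j))"
        by (intro prod.cong) auto
      then show ?thesis unfolding grid_weight_def prod.lessThan_Suc by (simp only: fun_upd_same)
    qed
    then show "grid_weight L u N (Suc m) (g(m := h)) * word_tensor k (wprod A (g(m := h)) (Suc m)) I =
      grid_weight L u N m g * (?H h * word_tensor k (\<lambda>l. ext (A m) h l \<circ> wprod A g m l) I)"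
      unfolding w by (simp only: mult.assoc)
  qed
  also have "\<dots> = (\<Sum>g\<in>PiE {..<m} (\<lambda>_. perms N). grid_weight L u N m g *
      comp_tensor N k (law_tensor N k (A m) ?H) (word_tensor k (wprod A g m)) I)"
  proof (intro sum.cong refl)
    fix g assume g: "g \<in> PiE {..<m} (\<lambda>_. perms N)"
    have "wprod A g m l \<in> perms N" for l
      by (rule wprod_perms) (rule PiE_mem[OF g], simp)
    from comp_law_word[OF this I, of "A m" ?H]
    show "grid_weight L u N m g * (\<Sum>h\<in>perms N. ?H h * word_tensor k (\<lambda>l. ext (A m) h l \<circ> wprod A g m l) I) =
      grid_weight L u N m g * comp_tensor N k (law_tensor N k (A m) ?H) (word_tensor k (wprod A g m)) I"
      by (simp only:)
  qed
  also have "\<dots> = comp_tensor N k (law_tensor N k (A m) ?H) (grid_tensor L u N m k (\<lambda>g. wprod A g m)) I"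
    unfolding grid_tensor_def[abs_def] comp_tensor_sum_right ..
  finally show ?thesis .
qed

section \<open>Permutation matrices\<close>

lemma tensor_entry_perm:
  assumes J: "J \<in> indices N k"
  shows "tensor_entry (map (\<lambda>l. perm_mat N (w l)) [0..<k]) J = of_real (word_tensor k w J)"
proof -
  have "tensor_entry (map (\<lambda>l. perm_mat N (w l)) [0..<k]) J =
    (\<Prod>l<k. of_bool (J (Inr l) = w l (J (Inl l))))"
    unfolding tensor_entry_def
    by (intro prod.cong) (use indices_less[OF J] in \<open>auto simp: perm_mat_def\<close>)
  also have "\<dots> = of_bool (\<forall>l<k. J (Inr l) = w l (J (Inl l)))"
    by (induction k) (auto simp: less_Suc_eq)
  finally show ?thesis by (simp add: word_tensor_def)
qed

lemma P_moment_perm: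
  assumes p: "p \<in> Parts k"
  shows "P_moment N p (map (\<lambda>l. perm_mat N (w l)) [0..<k]) = of_real (mom N k p (word_tensor k w))"
proof -
  have "(\<Sum>I | I \<in> indices N k \<and> refines (points k) p (Ker k I). tensor_entry (map (\<lambda>l. perm_mat N (w l)) [0..<k]) I) =
    (\<Sum>I | I \<in> indices N k \<and> const_on p I. of_real (word_tensor k w I))"
    using refines_Ker_iff[OF p] by (intro sum.cong) (auto simp: tensor_entry_perm)
  then show ?thesis by (simp add: P_moment_def mom_def)
qed

lemma perm_mat_carrier: "perm_mat N \<sigma> \<in> carrier_mat N N"
  by (simp add: perm_mat_def)

lemma perm_mat_mult:
  assumes "\<tau> \<in> perms N" "\<sigma> \<in> perms N"
  shows "perm_mat N \<tau> * perm_mat N \<sigma> = perm_mat N (\<tau> \<circ> \<sigma>)"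
proof (rule eq_matI)
  fix i j assume ij: "i < dim_row (perm_mat N (\<tau> \<circ> \<sigma>))" "j < dim_col (perm_mat N (\<tau> \<circ> \<sigma>))"
  then have "i < N" "j < N" by (simp_all add: perm_mat_def)
  then have "(perm_mat N \<tau> * perm_mat N \<sigma>) $$ (i, j) =
    (\<Sum>l<N. (if i = \<tau> l then 1 else 0) * (if l = \<sigma> j then 1 else 0))"
    by (simp add: perm_mat_def scalar_prod_def lessThan_atLeast0)
  also have "\<dots> = (\<Sum>l<N. if l = \<sigma> j then (if i = \<tau> l then 1 else 0) else 0)"
    by (intro sum.cong) auto
  also have "\<dots> = (if i = \<tau> (\<sigma> j) then 1 else 0)"
    using perms_less[OF assms(2) \<open>j < N\<close>] by (simp add: sum.delta)
  finally show "(perm_mat N \<tau> * perm_mat N \<sigma>) $$ (i, j) = perm_mat N (\<tau> \<circ> \<sigma>) $$ (i, j)"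
    using \<open>i < N\<close> \<open>j < N\<close> by (simp add: perm_mat_def)
qed (simp_all add: perm_mat_def)

lemma random_matrix_perm:
  assumes "Y \<in> measurable M (count_space (perms N))"
  shows "random_matrix M N (\<lambda>\<omega>. perm_mat N (Y \<omega>))"
  unfolding random_matrix_def
proof (intro conjI allI ballI impI perm_mat_carrier)
  fix a b
  show "(\<lambda>\<omega>. perm_mat N (Y \<omega>) $$ (a, b)) \<in> borel_measurable M"
    by (rule measurable_compose[OF assms]) simp
qed

lemma rho_entry_eq:
  assumes q: "q \<in> Parts k" and J: "J \<in> indices N k"
  shows "rho_entry N k q J = of_bool (const_on q J)"
proof -
  have te: "tensor_entry (map (\<lambda>l. mat_unit N (I (Inr l)) (I (Inl l))) [0..<k]) J = of_bool (I = J)"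
    if I: "I \<in> indices N k" for I
  proof -
    have "tensor_entry (map (\<lambda>l. mat_unit N (I (Inr l)) (I (Inl l))) [0..<k]) J =
      (\<Prod>l<k. of_bool (J (Inr l) = I (Inr l) \<and> J (Inl l) = I (Inl l)))"
      unfolding tensor_entry_def
      by (intro prod.cong) (use indices_less[OF J] in \<open>auto simp: mat_unit_def\<close>)
    also have "\<dots> = of_bool (\<forall>l<k. J (Inr l) = I (Inr l) \<and> J (Inl l) = I (Inl l))"
      by (induction k) (auto simp: less_Suc_eq)
    also have "(\<forall>l<k. J (Inr l) = I (Inr l) \<and> J (Inl l) = I (Inl l)) \<longleftrightarrow> I = J"
    proof
      assume a: "\<forall>l<k. J (Inr l) = I (Inr l) \<and> J (Inl l) = I (Inl l)"
      show "I = J"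
      proof
        fix x show "I x = J x"
          using a I J by (cases "x \<in> points k") (auto simp: points_def indices_def PiE_def extensional_def)
      qed
    qed simp
    finally show ?thesis .
  qed
  have "rho_entry N k q J = (\<Sum>I | I \<in> indices N k \<and> const_on q I. of_bool (I = J))"
    unfolding rho_entry_def using refines_Ker_iff[OF q] te by (intro sum.cong) auto
  also have "\<dots> = of_bool (const_on q J)"
    using J by (simp add: of_bool_def sum.delta)
  finally show ?thesis .
qed

lemma P_cumulant_eq:
  assumes N: "2 * k \<le> N" "0 < N" and len: "length Xs = k" and p: "p \<in> Parts k" and f: "ker_invariant N k f"
    and int: "\<And>J. J \<in> indices N k \<Longrightarrow> integral\<^sup>L M (\<lambda>\<omega>. tensor_entry (map (\<lambda>X. X \<omega>) Xs) J) = of_real (f J)"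
  shows "P_cumulant M N p Xs = of_real (kap N k f p)"
proof -
  define \<kappa>0 where "\<kappa>0 = restrict (\<lambda>q. complex_of_real (kap N k f q)) (Parts k)"
  define sol where "sol \<kappa> \<longleftrightarrow> (\<forall>J\<in>indices N k.
    integral\<^sup>L M (\<lambda>\<omega>. tensor_entry (map (\<lambda>X. X \<omega>) Xs) J) =
    (\<Sum>q\<in>Parts k. 1 / of_nat N ^ (card q - card (cycles_of k q)) * \<kappa> q * rho_entry N k q J))"
    for \<kappa> :: "point set set \<Rightarrow> complex"
  have sol_iff: "sol \<kappa> \<longleftrightarrow> is_cumulant N k (\<lambda>J. complex_of_real (f J)) (\<lambda>q. \<kappa> q / of_nat N ^ defect k q)"
    for \<kappa>
    unfolding sol_def is_cumulant_def
  proof (intro ball_cong refl)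
    fix J assume J: "J \<in> indices N k"
    have "(\<Sum>q\<in>Parts k. 1 / of_nat N ^ (card q - card (cycles_of k q)) * \<kappa> q * rho_entry N k q J) =
      (\<Sum>q\<in>Parts k. if const_on q J then \<kappa> q / of_nat N ^ defect k q else 0)"
      by (intro sum.cong refl) (simp add: rho_entry_eq[OF _ J] defect_def)
    also have "\<dots> = (\<Sum>q\<in>{q \<in> Parts k. const_on q J}. \<kappa> q / of_nat N ^ defect k q)"
      by (rule sum.inter_filter[symmetric]) simp
    finally show "(integral\<^sup>L M (\<lambda>\<omega>. tensor_entry (map (\<lambda>X. X \<omega>) Xs) J) =
      (\<Sum>q\<in>Parts k. 1 / of_nat N ^ (card q - card (cycles_of k q)) * \<kappa> q * rho_entry N k q J)) =
      (complex_of_real (f J) = (\<Sum>q\<in>{q \<in> Parts k. const_on q J}. \<kappa> q / of_nat N ^ defect k q))"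
      by (simp only: int[OF J])
  qed
  have c0: "is_cumulant N k (\<lambda>J. complex_of_real (f J)) (\<lambda>q. \<kappa>0 q / of_nat N ^ defect k q)"
    unfolding is_cumulant_def
  proof
    fix J assume J: "J \<in> indices N k"
    have "f J = (\<Sum>q\<in>{q \<in> Parts k. const_on q J}. cum N k f q)"
      using cum_is_cumulant[OF N(1) f] J by (simp add: is_cumulant_def)
    then have "complex_of_real (f J) = (\<Sum>q\<in>{q \<in> Parts k. const_on q J}. of_real (cum N k f q))" by simp
    also have "\<dots> = (\<Sum>q\<in>{q \<in> Parts k. const_on q J}. \<kappa>0 q / of_nat N ^ defect k q)"
      by (intro sum.cong refl) (use N(2) in \<open>simp add: \<kappa>0_def kap_def\<close>)
    finally show "complex_of_real (f J) = (\<Sum>q\<in>{q \<in> Parts k. const_on q J}. \<kappa>0 q / of_nat N ^ defect k q)" .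
  qed
  have "(THE \<kappa>. \<kappa> \<in> extensional (Parts k) \<and> sol \<kappa>) = \<kappa>0"
  proof (rule the_equality)
    show "\<kappa>0 \<in> extensional (Parts k) \<and> sol \<kappa>0" using c0 sol_iff by (simp add: \<kappa>0_def)
    fix \<kappa> assume \<kappa>: "\<kappa> \<in> extensional (Parts k) \<and> sol \<kappa>"
    show "\<kappa> = \<kappa>0"
    proof
      fix q show "\<kappa> q = \<kappa>0 q"
      proof (cases "q \<in> Parts k")
        case True
        have "\<kappa> q / of_nat N ^ defect k q = \<kappa>0 q / of_nat N ^ defect k q"
          using cumulant_unique[OF N(1) _ c0 True] \<kappa> sol_iff by blast
        then show ?thesis using N(2) by simp
      next
        case False
        then show ?thesis using \<kappa> by (simp add: extensional_def \<kappa>0_def)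
      qed
    qed
  qed
  then show ?thesis
    unfolding P_cumulant_def Let_def len sol_def using p by (simp add: \<kappa>0_def)
qed

section \<open>Convergence in P-distribution\<close>

context walks
begin

lemma convergent_mom_grid:
  assumes "p \<in> Parts k"
  shows "convergent (\<lambda>N. mom N k p (grid_tensor L u N m k (\<lambda>g. wprod A g m)))"
  using assms
proof (induction m arbitrary: p)
  case 0
  have "\<forall>\<^sub>F N in sequentially. mom N k p (grid_tensor L u N 0 k (\<lambda>g. wprod A g 0)) = 1"
    using eventually_gt_at_top[of 0]
  proof eventually_elim
    case (elim N)
    have "grid_tensor L u N 0 k (\<lambda>g. wprod A g 0) = word_tensor k (\<lambda>l. id)"
      by (rule ext) (simp add: grid_tensor_def grid_weight_def wprod.simps(1)[abs_def] del: wprod.simps)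
    then show ?case using mom_word_id[OF 0 elim] by (simp only:)
  qed
  then show ?case by (rule convergent_eventually_eq) (rule convergent_const)
next
  case (Suc m)
  let ?e = "\<lambda>N. law_tensor N k (A m) (walk_heat L (u (Suc m) - u m) N)"
  have "\<forall>\<^sub>F N in sequentially. mom N k p (grid_tensor L u N (Suc m) k (\<lambda>g. wprod A g (Suc m))) =
    (\<Sum>q\<in>Parts k. kap N k (?e N) q * coef N k p q * mom N k (glued k p q) (grid_tensor L u N m k (\<lambda>g. wprod A g m)))"
    using eventually_ge_at_top[of 2] eventually_ge_at_top[of "2 * k"]
  proof eventually_elim
    case (elim N)
    have "mom N k p (grid_tensor L u N (Suc m) k (\<lambda>g. wprod A g (Suc m))) =
      mom N k p (comp_tensor N k (?e N) (grid_tensor L u N m k (\<lambda>g. wprod A g m)))"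
      by (rule mom_cong) (rule grid_tensor_Suc)
    also have "\<dots> = (\<Sum>q\<in>Parts k. kap N k (?e N) q * coef N k p q * mom N k (glued k p q) (grid_tensor L u N m k (\<lambda>g. wprod A g m)))"
      by (rule mom_comp_tensor) (use elim Suc.prems in \<open>auto intro: law_tensor_invariant class_weight_walk\<close>)
    finally show ?case .
  qed
  moreover have "convergent (\<lambda>N. \<Sum>q\<in>Parts k. kap N k (?e N) q * coef N k p q * mom N k (glued k p q) (grid_tensor L u N m k (\<lambda>g. wprod A g m)))"
    by (intro convergent_sum convergent_mult convergent_kap_heat[OF classes converge] convergent_coef Suc.IH glued_Parts Suc.prems)
  ultimately show ?case by (rule convergent_eventually_eq)
qed

definition represented :: "'j set \<Rightarrow> ('j \<Rightarrow> nat \<Rightarrow> 'w \<Rightarrow> nat \<Rightarrow> nat) \<Rightarrow> bool" where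
  "represented J Y \<longleftrightarrow>
    (\<forall>j\<in>J. \<forall>N\<ge>2. Y j N \<in> measurable (M N) (count_space (perms N))) \<and>
    (\<forall>J'\<subseteq>J. finite J' \<longrightarrow> (\<exists>u m A. grid u \<and>
      (\<forall>N\<ge>2. AE \<omega> in M N. \<forall>j\<in>J'. Y j N \<omega> = wprod A (restrict (grid_incr S N u \<omega>) {..<m}) m j)))"

lemma grid_weight_sum_conj:
  assumes N: "2 \<le> N" and \<tau>: "\<tau> \<in> perms N"
  shows "(\<Sum>g\<in>PiE {..<m} (\<lambda>_. perms N). grid_weight L u N m g * F (restrict (\<lambda>j. \<tau> \<circ> g j \<circ> inv_into UNIV \<tau>) {..<m})) =
    (\<Sum>g\<in>PiE {..<m} (\<lambda>_. perms N). grid_weight L u N m g * (F g :: real))"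
proof (rule sum.reindex_bij_witness[where i = "\<lambda>g. restrict (\<lambda>j. inv_into UNIV \<tau> \<circ> g j \<circ> \<tau>) {..<m}"
      and j = "\<lambda>g. restrict (\<lambda>j. \<tau> \<circ> g j \<circ> inv_into UNIV \<tau>) {..<m}"])
  fix g assume g: "g \<in> PiE {..<m} (\<lambda>_. perms N)"
  show "restrict (\<lambda>j. inv_into UNIV \<tau> \<circ> restrict (\<lambda>j. \<tau> \<circ> g j \<circ> inv_into UNIV \<tau>) {..<m} j \<circ> \<tau>) {..<m} = g"
    using PiE_arb[OF g] conj_inv_cancel[OF \<tau>] by (auto simp: fun_eq_iff restrict_def)
  show "restrict (\<lambda>j. \<tau> \<circ> restrict (\<lambda>j. inv_into UNIV \<tau> \<circ> g j \<circ> \<tau>) {..<m} j \<circ> inv_into UNIV \<tau>) {..<m} = g"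
    using PiE_arb[OF g] \<tau> by (auto simp: fun_eq_iff restrict_def permutes_inverses)
  have gp: "g j \<in> perms N" if "j < m" for j using g that by auto
  show "restrict (\<lambda>j. \<tau> \<circ> g j \<circ> inv_into UNIV \<tau>) {..<m} \<in> PiE {..<m} (\<lambda>_. perms N)"
    by (rule restrict_PiE_iff[THEN iffD2], rule ballI, rule perms_conj[OF \<tau> gp]) simp
  have "inv_into UNIV \<tau> \<in> perms N" using \<tau> by (simp add: permutes_inv)
  then show "restrict (\<lambda>j. inv_into UNIV \<tau> \<circ> g j \<circ> \<tau>) {..<m} \<in> PiE {..<m} (\<lambda>_. perms N)"
    by (intro restrict_PiE_iff[THEN iffD2] ballI perms_compose \<tau> gp) simp_all
  have "grid_weight L u N m (restrict (\<lambda>j. \<tau> \<circ> g j \<circ> inv_into UNIV \<tau>) {..<m}) = grid_weight L u N m g"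
    unfolding grid_weight_def
  proof (intro prod.cong refl)
    fix j assume j: "j \<in> {..<m}"
    then have "walk_heat L (u (Suc j) - u j) N (\<tau> \<circ> g j \<circ> inv_into UNIV \<tau>) = walk_heat L (u (Suc j) - u j) N (g j)"
      using class_weight_walk[OF N] \<tau> gp unfolding class_weight_def by blast
    then show "walk_heat L (u (Suc j) - u j) N (restrict (\<lambda>j. \<tau> \<circ> g j \<circ> inv_into UNIV \<tau>) {..<m} j) =
      walk_heat L (u (Suc j) - u j) N (g j)"
      using j by (simp only: restrict_apply' )
  qed
  then show "grid_weight L u N m (restrict (\<lambda>j. \<tau> \<circ> g j \<circ> inv_into UNIV \<tau>) {..<m}) *
    F (restrict (\<lambda>j. \<tau> \<circ> g j \<circ> inv_into UNIV \<tau>) {..<m}) =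
    grid_weight L u N m g * F (restrict (\<lambda>j. \<tau> \<circ> g j \<circ> inv_into UNIV \<tau>) {..<m})" by (simp only:)
qed

lemma grid_prob:
  assumes N: "2 \<le> N" and u: "grid u"
  shows "measure (M N) {\<omega> \<in> space (M N). R (restrict (grid_incr S N u \<omega>) {..<m})} =
    (\<Sum>g\<in>PiE {..<m} (\<lambda>_. perms N). grid_weight L u N m g * of_bool (R g))"
proof -
  interpret prob_space "M N" by (rule prob[OF N])
  have "measure (M N) {\<omega> \<in> space (M N). R (restrict (grid_incr S N u \<omega>) {..<m})} =
    integral\<^sup>L (M N) (\<lambda>\<omega>. indicator {\<omega> \<in> space (M N). R (restrict (grid_incr S N u \<omega>) {..<m})} \<omega>)"
    by (simp add: Int_def conj_commute)
  also have "\<dots> = integral\<^sup>L (M N) (\<lambda>\<omega>. of_bool (R (restrict (grid_incr S N u \<omega>) {..<m})))"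
    by (rule Bochner_Integration.integral_cong) (auto simp: indicator_def)
  also have "\<dots> = (\<Sum>g\<in>PiE {..<m} (\<lambda>_. perms N). grid_weight L u N m g *\<^sub>R of_bool (R g))"
    by (rule grid_integral(2)[OF N u])
  finally show ?thesis by simp
qed

lemma represented_event:
  fixes Y :: "'j \<Rightarrow> nat \<Rightarrow> 'w \<Rightarrow> nat \<Rightarrow> nat"
  assumes rep: "represented J Y" and N: "2 \<le> N" and \<tau>: "\<tau> \<in> perms N" and J': "J' \<subseteq> J" "finite J'"
    and Q: "\<And>y y'. (\<And>j. j \<in> J' \<Longrightarrow> y j = y' j) \<Longrightarrow> Q y \<longleftrightarrow> Q y'"
    and meas: "{\<omega> \<in> space (M N). Q (\<lambda>j. Y j N \<omega>)} \<in> sets (M N)"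
      "{\<omega> \<in> space (M N). Q (\<lambda>j. \<tau> \<circ> Y j N \<omega> \<circ> inv_into UNIV \<tau>)} \<in> sets (M N)"
  shows "measure (M N) {\<omega> \<in> space (M N). Q (\<lambda>j. \<tau> \<circ> Y j N \<omega> \<circ> inv_into UNIV \<tau>)} =
    measure (M N) {\<omega> \<in> space (M N). Q (\<lambda>j. Y j N \<omega>)}"
proof -
  interpret prob_space "M N" by (rule prob[OF N])
  obtain u m A where u: "grid u"
    and W: "AE \<omega> in M N. \<forall>j\<in>J'. Y j N \<omega> = wprod A (restrict (grid_incr S N u \<omega>) {..<m}) m j"
    using rep J' N unfolding represented_def by blast
  let ?D = "\<lambda>\<omega>. restrict (grid_incr S N u \<omega>) {..<m}"
  have meas_D: "{\<omega> \<in> space (M N). R (?D \<omega>)} \<in> sets (M N)" for R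
  proof -
    have "{\<omega> \<in> space (M N). R (?D \<omega>)} = ?D -` {g \<in> PiE {..<m} (\<lambda>_. perms N). R g} \<inter> space (M N)"
      using measurable_space[OF grid_incr_measurable[OF N u, of m]] unfolding space_count_space by blast
    also have "\<dots> \<in> sets (M N)"
      by (rule measurable_sets[OF grid_incr_measurable[OF N u]]) (auto simp: sets_count_space)
    finally show ?thesis .
  qed
  let ?c = "\<lambda>g. restrict (\<lambda>j. \<tau> \<circ> g j \<circ> inv_into UNIV \<tau>) {..<m}"
  have Wc: "wprod A (?c g) m j = \<tau> \<circ> wprod A g m j \<circ> inv_into UNIV \<tau>" for g j
  proof -
    have "wprod A (?c g) m j = wprod A (\<lambda>j. \<tau> \<circ> g j \<circ> inv_into UNIV \<tau>) m j"
      by (rule wprod_cong) (simp only: restrict_apply' lessThan_iff)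
    then show ?thesis unfolding wprod_conj[OF \<tau>] .
  qed
  have "measure (M N) {\<omega> \<in> space (M N). Q (\<lambda>j. \<tau> \<circ> Y j N \<omega> \<circ> inv_into UNIV \<tau>)} =
    measure (M N) {\<omega> \<in> space (M N). Q (wprod A (?c (?D \<omega>)) m)}"
  proof (rule finite_measure_eq_AE[OF _ meas(2) meas_D])
    show "AE \<omega> in M N. \<omega> \<in> {\<omega> \<in> space (M N). Q (\<lambda>j. \<tau> \<circ> Y j N \<omega> \<circ> inv_into UNIV \<tau>)} \<longleftrightarrow>
      \<omega> \<in> {\<omega> \<in> space (M N). Q (wprod A (?c (?D \<omega>)) m)}"
      using W
    proof eventually_elim
      case (elim \<omega>)
      have "Q (\<lambda>j. \<tau> \<circ> Y j N \<omega> \<circ> inv_into UNIV \<tau>) \<longleftrightarrow> Q (wprod A (?c (?D \<omega>)) m)"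
        by (rule Q) (simp only: Wc elim)
      then show ?case by blast
    qed
  qed
  also have "\<dots> = (\<Sum>g\<in>PiE {..<m} (\<lambda>_. perms N). grid_weight L u N m g * of_bool (Q (wprod A (?c g) m)))"
    by (rule grid_prob[OF N u])
  also have "\<dots> = (\<Sum>g\<in>PiE {..<m} (\<lambda>_. perms N). grid_weight L u N m g * of_bool (Q (wprod A g m)))"
    by (rule grid_weight_sum_conj[OF N \<tau>, of _ _ "\<lambda>g. of_bool (Q (wprod A g m))"])
  also have "\<dots> = measure (M N) {\<omega> \<in> space (M N). Q (wprod A (?D \<omega>) m)}"
    by (rule grid_prob[OF N u, symmetric])
  also have "\<dots> = measure (M N) {\<omega> \<in> space (M N). Q (\<lambda>j. Y j N \<omega>)}"
  proof (rule finite_measure_eq_AE[OF _ meas_D meas(1)])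
    show "AE \<omega> in M N. \<omega> \<in> {\<omega> \<in> space (M N). Q (wprod A (?D \<omega>) m)} \<longleftrightarrow>
      \<omega> \<in> {\<omega> \<in> space (M N). Q (\<lambda>j. Y j N \<omega>)}"
      using W
    proof eventually_elim
      case (elim \<omega>)
      have "Q (\<lambda>j. Y j N \<omega>) \<longleftrightarrow> Q (wprod A (?D \<omega>) m)"
        by (rule Q) (simp only: elim)
      then show ?case by blast
    qed
  qed
  finally show ?thesis .
qed

lemma represented_conj_invariant:
  fixes Y :: "'j \<Rightarrow> nat \<Rightarrow> 'w \<Rightarrow> nat \<Rightarrow> nat"
  assumes rep: "represented J Y" and N: "2 \<le> N"
  shows "conj_invariant (M N) N J (\<lambda>j \<omega>. perm_mat N (Y j N \<omega>))"
  unfolding conj_invariant_def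
proof (intro allI impI)
  fix \<tau> assume "\<tau> permutes {..<N}"
  then have \<tau>: "\<tau> \<in> perms N" and \<tau>': "inv_into UNIV \<tau> \<in> perms N" by (simp_all add: permutes_inv)
  interpret prob_space "M N" by (rule prob[OF N])
  have Ym: "Y j N \<in> measurable (M N) (count_space (perms N))" if "j \<in> J" for j
    using rep N that by (simp add: represented_def)
  define Z where "Z j \<omega> = \<tau> \<circ> Y j N \<omega> \<circ> inv_into UNIV \<tau>" for j \<omega>
  have Zm: "Z j \<in> measurable (M N) (count_space (perms N))" if "j \<in> J" for j
    unfolding Z_def
    by (rule measurable_compose[OF Ym[OF that], of "\<lambda>\<sigma>. \<tau> \<circ> \<sigma> \<circ> inv_into UNIV \<tau>"])
      (use perms_conj[OF \<tau>] in \<open>simp add: Pi_def\<close>)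
  let ?I = "J \<times> {..<N} \<times> {..<N}"
  let ?P = "Pi\<^sub>M ?I (\<lambda>_. borel :: complex measure)"
  define val where "val W \<omega> = (\<lambda>(j, a, b)\<in>?I. perm_mat N (W j \<omega>) $$ (a, b))" for W :: "'j \<Rightarrow> 'w \<Rightarrow> nat \<Rightarrow> nat" and \<omega>
  have val_meas: "val W \<in> measurable (M N) ?P"
    if "\<And>j. j \<in> J \<Longrightarrow> W j \<in> measurable (M N) (count_space (perms N))" for W
    unfolding val_def
  proof (rule measurable_restrict)
    fix i assume "i \<in> ?I"
    then obtain j a b where i: "i = (j, a, b)" "j \<in> J" by auto
    show "(\<lambda>\<omega>. case i of (j, a, b) \<Rightarrow> perm_mat N (W j \<omega>) $$ (a, b)) \<in> borel_measurable (M N)"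
      unfolding i by (simp, rule measurable_compose[OF that[OF i(2)]]) simp
  qed
  have "joint_law (M N) N J (\<lambda>j \<omega>. perm_mat N \<tau> * perm_mat N (Y j N \<omega>) * perm_mat N (inv_into UNIV \<tau>)) =
    distr (M N) ?P (val Z)"
    unfolding joint_law_def
  proof (rule distr_cong[OF refl refl])
    fix \<omega> assume \<omega>: "\<omega> \<in> space (M N)"
    have "perm_mat N \<tau> * perm_mat N (Y j N \<omega>) * perm_mat N (inv_into UNIV \<tau>) = perm_mat N (Z j \<omega>)" if "j \<in> J" for j
    proof -
      have "Y j N \<omega> \<in> perms N" using measurable_space[OF Ym[OF that] \<omega>] by simp
      then show ?thesis
        unfolding Z_def by (simp only: perm_mat_mult[OF \<tau>] perm_mat_mult[OF perms_compose[OF \<tau>] \<tau>'])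
    qed
    then show "(\<lambda>(j, a, b)\<in>?I. (perm_mat N \<tau> * perm_mat N (Y j N \<omega>) * perm_mat N (inv_into UNIV \<tau>)) $$ (a, b)) = val Z \<omega>"
      unfolding val_def by (intro restrict_ext) auto
  qed
  also have "\<dots> = distr (M N) ?P (val (\<lambda>j. Y j N))"
  proof (rule measure_eqI_PiM_infinite)
    show "finite_measure (distr (M N) ?P (val Z))"
      by (intro prob_space.finite_measure prob_space_distr val_meas Zm)
    fix B F assume F: "finite F" "F \<subseteq> ?I" and B: "\<And>i. i \<in> F \<Longrightarrow> B i \<in> sets (borel :: complex measure)"
    define Q where "Q y \<longleftrightarrow> (\<forall>(j, a, b)\<in>F. perm_mat N (y j) $$ (a, b) \<in> B (j, a, b))" for y :: "'j \<Rightarrow> nat \<Rightarrow> nat"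
    let ?X = "prod_emb ?I (\<lambda>_. borel) F (Pi\<^sub>E F B)"
    have X: "?X \<in> sets ?P" using F B by (intro sets_PiM_I) auto
    have pre: "val W -` ?X \<inter> space (M N) = {\<omega> \<in> space (M N). Q (\<lambda>j. W j \<omega>)}" for W
      using F(2) by (auto simp: prod_emb_def val_def Q_def space_PiM PiE_iff) (force+)
    have em: "emeasure (distr (M N) ?P (val W)) ?X = ennreal (measure (M N) {\<omega> \<in> space (M N). Q (\<lambda>j. W j \<omega>)})"
      and ms: "{\<omega> \<in> space (M N). Q (\<lambda>j. W j \<omega>)} \<in> sets (M N)"
      if "\<And>j. j \<in> J \<Longrightarrow> W j \<in> measurable (M N) (count_space (perms N))" for W
    proof -
      show "emeasure (distr (M N) ?P (val W)) ?X = ennreal (measure (M N) {\<omega> \<in> space (M N). Q (\<lambda>j. W j \<omega>)})"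
        by (subst emeasure_distr[OF val_meas[OF that] X]) (simp_all add: pre emeasure_eq_measure)
      show "{\<omega> \<in> space (M N). Q (\<lambda>j. W j \<omega>)} \<in> sets (M N)"
        unfolding pre[symmetric] by (rule measurable_sets[OF val_meas[OF that] X])
    qed
    have "measure (M N) {\<omega> \<in> space (M N). Q (\<lambda>j. Z j \<omega>)} = measure (M N) {\<omega> \<in> space (M N). Q (\<lambda>j. Y j N \<omega>)}"
      unfolding Z_def
    proof (rule represented_event[OF rep N \<tau>, of "fst ` F"])
      show "fst ` F \<subseteq> J" "finite (fst ` F)" using F by auto
      show "Q y \<longleftrightarrow> Q y'" if "\<And>j. j \<in> fst ` F \<Longrightarrow> y j = y' j" for y y'
        unfolding Q_def using that by (intro ball_cong refl) force
      show "{\<omega> \<in> space (M N). Q (\<lambda>j. Y j N \<omega>)} \<in> sets (M N)" using ms[OF Ym] .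
      show "{\<omega> \<in> space (M N). Q (\<lambda>j. \<tau> \<circ> Y j N \<omega> \<circ> inv_into UNIV \<tau>)} \<in> sets (M N)"
        using ms[OF Zm] unfolding Z_def .
    qed
    then show "emeasure (distr (M N) ?P (val Z)) ?X = emeasure (distr (M N) ?P (val (\<lambda>j. Y j N))) ?X"
      using em[of Z, OF Zm] em[of "\<lambda>j. Y j N", OF Ym] by (simp only:)
  qed simp_all
  also have "\<dots> = joint_law (M N) N J (\<lambda>j \<omega>. perm_mat N (Y j N \<omega>))"
    unfolding joint_law_def val_def ..
  finally show "joint_law (M N) N J (\<lambda>j \<omega>. perm_mat N \<tau> * perm_mat N (Y j N \<omega>) * perm_mat N (inv_into UNIV \<tau>)) =
    joint_law (M N) N J (\<lambda>j \<omega>. perm_mat N (Y j N \<omega>))" .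
qed

lemma word_integral:
  fixes F :: "(nat \<Rightarrow> nat \<Rightarrow> nat) \<Rightarrow> 'b :: {banach, second_countable_topology}" and m :: nat
  assumes N: "2 \<le> N" and Y: "\<And>l. l < k \<Longrightarrow> Y l \<in> measurable (M N) (count_space (perms N))"
    and F: "\<And>w w'. (\<And>l. l < k \<Longrightarrow> w l = w' l) \<Longrightarrow> F w = F w'"
    and u: "grid u" and W: "AE \<omega> in M N. \<forall>l<k. Y l \<omega> = W (restrict (grid_incr S N u \<omega>) {..<m}) l"
  shows "integrable (M N) (\<lambda>\<omega>. F (\<lambda>l. Y l \<omega>))"
    and "integral\<^sup>L (M N) (\<lambda>\<omega>. F (\<lambda>l. Y l \<omega>)) =
      (\<Sum>g\<in>PiE {..<m} (\<lambda>_. perms N). grid_weight L u N m g *\<^sub>R F (W g))"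
proof -
  have eq: "F (\<lambda>l. Y l \<omega>) = F (restrict (\<lambda>l. Y l \<omega>) {..<k})" for \<omega> by (rule F) simp
  show int: "integrable (M N) (\<lambda>\<omega>. F (\<lambda>l. Y l \<omega>))"
    unfolding eq
    by (rule finite_valued_integral(1)[OF prob[OF N] measurable_finite_tuple[OF Y finite_perms]])
      (auto intro: finite_PiE)
  have "integral\<^sup>L (M N) (\<lambda>\<omega>. F (\<lambda>l. Y l \<omega>)) = integral\<^sup>L (M N) (\<lambda>\<omega>. F (W (restrict (grid_incr S N u \<omega>) {..<m})))"
  proof (rule integral_cong_AE)
    show "AE \<omega> in M N. F (\<lambda>l. Y l \<omega>) = F (W (restrict (grid_incr S N u \<omega>) {..<m}))"
      using W by eventually_elim (rule F, simp)
    show "(\<lambda>\<omega>. F (\<lambda>l. Y l \<omega>)) \<in> borel_measurable (M N)" using int by simp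
    show "(\<lambda>\<omega>. F (W (restrict (grid_incr S N u \<omega>) {..<m}))) \<in> borel_measurable (M N)"
      using grid_integral(1)[OF N u, of "\<lambda>g. F (W g)" m] by simp
  qed
  then show "integral\<^sup>L (M N) (\<lambda>\<omega>. F (\<lambda>l. Y l \<omega>)) =
      (\<Sum>g\<in>PiE {..<m} (\<lambda>_. perms N). grid_weight L u N m g *\<^sub>R F (W g))"
    unfolding grid_integral(2)[OF N u, of "\<lambda>g. F (W g)" m] .
qed

lemma word_tensor_cong: "(\<And>l. l < k \<Longrightarrow> w l = w' l) \<Longrightarrow> word_tensor k w = word_tensor k w'"
  unfolding word_tensor_def by (intro ext) simp

lemma E_P_moment_word:
  assumes N: "2 \<le> N" and p: "p \<in> Parts k" and Y: "\<And>l. l < k \<Longrightarrow> Y l N \<in> measurable (M N) (count_space (perms N))"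
    and u: "grid u" and W: "AE \<omega> in M N. \<forall>l<k. Y l N \<omega> = W (restrict (grid_incr S N u \<omega>) {..<m}) l"
  shows "integrable (M N) (\<lambda>\<omega>. P_moment N p (map (\<lambda>l. perm_mat N (Y l N \<omega>)) [0..<k]))"
    and "E_P_moment M p (map (\<lambda>l N \<omega>. perm_mat N (Y l N \<omega>)) [0..<k]) N =
      of_real (mom N k p (grid_tensor L u N m k W))"
proof -
  note wi = word_integral[OF N Y _ u W, of "\<lambda>w. complex_of_real (mom N k p (word_tensor k w))"]
  have cong: "complex_of_real (mom N k p (word_tensor k w)) = of_real (mom N k p (word_tensor k w'))"
    if "\<And>l. l < k \<Longrightarrow> w l = w' l" for w w' using word_tensor_cong[OF that] by simp
  show "integrable (M N) (\<lambda>\<omega>. P_moment N p (map (\<lambda>l. perm_mat N (Y l N \<omega>)) [0..<k]))"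
    unfolding P_moment_perm[OF p] using wi(1) cong by blast
  have "E_P_moment M p (map (\<lambda>l N \<omega>. perm_mat N (Y l N \<omega>)) [0..<k]) N =
    integral\<^sup>L (M N) (\<lambda>\<omega>. complex_of_real (mom N k p (word_tensor k (\<lambda>l. Y l N \<omega>))))"
    unfolding E_P_moment_def P_moment_perm[OF p, symmetric] by (simp add: comp_def)
  also have "\<dots> = (\<Sum>g\<in>PiE {..<m} (\<lambda>_. perms N). grid_weight L u N m g *\<^sub>R of_real (mom N k p (word_tensor k (W g))))"
    using wi(2) cong by blast
  also have "\<dots> = of_real (mom N k p (grid_tensor L u N m k W))"
    unfolding grid_tensor_def[abs_def] mom_sum by (simp add: scaleR_conv_of_real)
  finally show "E_P_moment M p (map (\<lambda>l N \<omega>. perm_mat N (Y l N \<omega>)) [0..<k]) N =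
      of_real (mom N k p (grid_tensor L u N m k W))" .
qed

lemma represented_P_converges:
  fixes Y :: "'j \<Rightarrow> nat \<Rightarrow> 'w \<Rightarrow> nat \<Rightarrow> nat"
  assumes rep: "represented J Y"
  shows "P_converges M J (\<lambda>j N \<omega>. perm_mat N (Y j N \<omega>))"
  unfolding P_converges_def
proof (intro conjI allI impI)
  fix N :: nat assume N: "2 \<le> N"
  show "conj_invariant (M N) N J (\<lambda>j \<omega>. perm_mat N (Y j N \<omega>))"
    by (rule represented_conj_invariant[OF rep N])
  show "\<forall>j\<in>J. random_matrix (M N) N (\<lambda>\<omega>. perm_mat N (Y j N \<omega>))"
    using rep N by (auto simp: represented_def intro: random_matrix_perm)
next
  fix js p assume js: "set js \<subseteq> J \<and> p \<in> Parts (length js)"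
  let ?k = "length js"
  have p: "p \<in> Parts ?k" using js by simp
  have mem: "js ! l \<in> set js" if "l < ?k" for l using that by simp
  have Ym: "Y (js ! l) N \<in> measurable (M N) (count_space (perms N))" if "2 \<le> N" "l < ?k" for N l
    using rep js mem[OF that(2)] that(1) unfolding represented_def by blast
  obtain u m A where u: "grid u" and W: "\<forall>N\<ge>2. AE \<omega> in M N. \<forall>j\<in>set js.
      Y j N \<omega> = wprod A (restrict (grid_incr S N u \<omega>) {..<m}) m j"
    using rep js unfolding represented_def by blast
  define A' where "A' i = {l. js ! l \<in> A i}" for i
  have W': "AE \<omega> in M N. \<forall>l<?k. Y (js ! l) N \<omega> = wprod A' (restrict (grid_incr S N u \<omega>) {..<m}) m l" if "2 \<le> N" for N
    using W[rule_format, OF that]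
  proof eventually_elim
    case (elim \<omega>)
    then show ?case unfolding A'_def wprod_index[symmetric] by simp
  qed
  have map1: "map (\<lambda>j. perm_mat N (Y j N \<omega>)) js = map (\<lambda>l. perm_mat N (Y (js ! l) N \<omega>)) [0..<?k]" for N \<omega>
    by (rule nth_equalityI) simp_all
  have map2: "map (\<lambda>j N \<omega>. perm_mat N (Y j N \<omega>)) js = map (\<lambda>l N \<omega>. perm_mat N (Y (js ! l) N \<omega>)) [0..<?k]"
    by (rule nth_equalityI) simp_all
  show "integrable (M N) (\<lambda>\<omega>. P_moment N p (map (\<lambda>j. perm_mat N (Y j N \<omega>)) js))" if N: "2 \<le> N" for N
    unfolding map1
    by (rule E_P_moment_word(1)[where Y = "\<lambda>l. Y (js ! l)" and W = "\<lambda>g. wprod A' g m", OF N p Ym[OF N] u W'[OF N]])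
  have "\<forall>\<^sub>F N in sequentially. E_P_moment M p (map (\<lambda>j N \<omega>. perm_mat N (Y j N \<omega>)) js) N =
    of_real (mom N ?k p (grid_tensor L u N m ?k (\<lambda>g. wprod A' g m)))"
    using eventually_ge_at_top[of 2]
    unfolding map2
    by eventually_elim (rule E_P_moment_word(2)[where Y = "\<lambda>l. Y (js ! l)", OF _ p Ym u W'])
  then show "convergent (E_P_moment M p (map (\<lambda>j N \<omega>. perm_mat N (Y j N \<omega>)) js))"
    by (rule convergent_eventually_eq) (intro convergent_of_real convergent_mom_grid p)
qed

end

section \<open>Cumulants of juxtaposed partitions\<close>

definition shift :: "nat \<Rightarrow> point \<Rightarrow> point" where
  "shift k = map_sum ((+) k) ((+) k)"

definition left_part :: "nat \<Rightarrow> (point \<Rightarrow> nat) \<Rightarrow> point \<Rightarrow> nat" where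
  "left_part k J = restrict J (points k)"

definition right_part :: "nat \<Rightarrow> nat \<Rightarrow> (point \<Rightarrow> nat) \<Rightarrow> point \<Rightarrow> nat" where
  "right_part k k' J = restrict (J \<circ> shift k) (points k')"

lemma inj_shift: "inj (shift k)"
  unfolding shift_def inj_on_def by (auto simp: map_sum_def split: sum.splits)

lemma inj_image_shift: "inj ((`) (shift k))"
  by (rule injI) (simp add: inj_image_eq_iff[OF inj_shift])

lemma points_add: "points (k + k') = points k \<union> shift k ` points k'"
proof
  show "points (k + k') \<subseteq> points k \<union> shift k ` points k'"
  proof
    fix x :: point assume x: "x \<in> points (k + k')"
    show "x \<in> points k \<union> shift k ` points k'"
    proof (cases x)
      case (Inl l)
      then show ?thesis using x
        by (cases "l < k") (auto simp: shift_def intro!: image_eqI[of _ _ "Inl (l - k)"])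
    next
      case (Inr l)
      then show ?thesis using x
        by (cases "l < k") (auto simp: shift_def intro!: image_eqI[of _ _ "Inr (l - k)"])
    qed
  qed
qed (auto simp: points_def shift_def)

lemma shift_disjoint: "shift k ` A \<inter> points k = {}"
proof -
  have "shift k x \<notin> points k" for x by (cases x) (simp_all add: shift_def)
  then show ?thesis by blast
qed

lemma part_tensor_def': "part_tensor k p q = p \<union> (`) (shift k) ` q"
  unfolding part_tensor_def shift_def ..

lemma part_tensor_Parts:
  assumes p: "p \<in> Parts k" and q: "q \<in> Parts k'"
  shows "part_tensor k p q \<in> Parts (k + k')"
proof -
  note pp = Parts_partition[OF p] and qp = Parts_partition[OF q]
  have "partition_on (points (k + k')) (part_tensor k p q)"
  proof (rule partition_onI)
    show "\<Union>(part_tensor k p q) = points (k + k')"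
    proof -
      have "\<Union>p = points k" "\<Union>q = points k'" using pp qp by (auto simp: partition_on_def)
      then show ?thesis
        unfolding part_tensor_def' points_add Union_Un_distrib by (simp add: image_Union[symmetric])
    qed
    show "{} \<notin> part_tensor k p q"
      using pp qp by (auto simp: part_tensor_def' partition_on_def)
    fix b c assume bc: "b \<in> part_tensor k p q" "c \<in> part_tensor k p q" "b \<noteq> c"
    have cross: "disjnt b (shift k ` c)" if "b \<in> p" for b c
      using shift_disjoint[of k c] Parts_sub[OF p] that unfolding disjnt_def by blast
    have right: "disjnt (shift k ` b') (shift k ` c')" if "b' \<in> q" "c' \<in> q" "shift k ` b' \<noteq> shift k ` c'" for b' c'
    proof -
      have "b' \<inter> c' = {}" using same_block[OF qp that(1,2)] that(3) by blast
      then show ?thesis using image_Int[OF inj_shift, of k b' c'] by (simp add: disjnt_def)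
    qed
    have left: "disjnt b' c'" if "b' \<in> p" "c' \<in> p" "b' \<noteq> c'" for b' c'
      using same_block[OF pp that(1,2)] that(3) by (auto simp: disjnt_def)
    consider "b \<in> p" "c \<in> p" | c' where "b \<in> p" "c = shift k ` c'"
      | b' where "b = shift k ` b'" "c \<in> p"
      | b' c' where "b = shift k ` b'" "c = shift k ` c'" "b' \<in> q" "c' \<in> q"
      using bc(1,2) unfolding part_tensor_def' by blast
    then show "disjnt b c"
    proof cases
      case 1
      then show ?thesis using left bc(3) by simp
    next
      case 2
      then show ?thesis using cross by simp
    next
      case 3
      then show ?thesis using disjnt_sym[OF cross] by simp
    next
      case 4
      then show ?thesis using right bc(3) by simp
    qed
  qed
  then show ?thesis by (simp add: Parts_def)
qed

lemma part_tensor_split: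
  assumes p: "p \<in> Parts k" and q: "q \<in> Parts k'"
  shows "p = {b \<in> part_tensor k p q. b \<inter> points k \<noteq> {}}"
    and "(`) (shift k) ` q = {b \<in> part_tensor k p q. b \<inter> points k = {}}"
proof -
  have 1: "b \<inter> points k \<noteq> {}" if "b \<in> p" for b
  proof -
    have "b \<noteq> {}" "b \<subseteq> points k" using Parts_partition[OF p] that by (auto simp: partition_on_def)
    then show ?thesis by blast
  qed
  have 2: "b \<inter> points k = {}" if "b \<in> (`) (shift k) ` q" for b
    using that shift_disjoint[of k] by blast
  show "p = {b \<in> part_tensor k p q. b \<inter> points k \<noteq> {}}"
    "(`) (shift k) ` q = {b \<in> part_tensor k p q. b \<inter> points k = {}}"
    unfolding part_tensor_def' using 1 2 by blast+
qed

lemma part_tensor_inj: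
  assumes "p \<in> Parts k" "q \<in> Parts k'" "p' \<in> Parts k" "q' \<in> Parts k'"
    and eq: "part_tensor k p q = part_tensor k p' q'"
  shows "p = p'" "q = q'"
proof -
  show "p = p'"
    using part_tensor_split(1)[OF assms(1,2)] part_tensor_split(1)[OF assms(3,4)] eq by simp
  have "(`) (shift k) ` q = (`) (shift k) ` q'"
    using part_tensor_split(2)[OF assms(1,2)] part_tensor_split(2)[OF assms(3,4)] eq by simp
  then show "q = q'" by (simp add: inj_image_eq_iff[OF inj_image_shift])
qed

lemma card_part_tensor:
  assumes p: "p \<in> Parts k" and q: "q \<in> Parts k'"
  shows "card (part_tensor k p q) = card p + card q"
proof -
  have "p \<inter> (`) (shift k) ` q = {}"
    by (subst part_tensor_split(1)[OF p q], subst part_tensor_split(2)[OF p q]) blast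
  then have "card (part_tensor k p q) = card p + card ((`) (shift k) ` q)"
    unfolding part_tensor_def' by (intro card_Un_disjoint finite_imageI finite_Parts_elem[OF p] finite_Parts_elem[OF q])
  also have "card ((`) (shift k) ` q) = card q"
    by (rule card_image) (rule inj_on_subset[OF inj_image_shift subset_UNIV])
  finally show ?thesis .
qed

lemma const_on_part_tensor:
  assumes p: "p \<in> Parts k" and q: "q \<in> Parts k'"
  shows "const_on (part_tensor k p q) J \<longleftrightarrow> const_on p (left_part k J) \<and> const_on q (right_part k k' J)"
proof -
  have "const_on p J \<longleftrightarrow> const_on p (left_part k J)"
    by (rule const_on_cong[OF Parts_sub[OF p]]) (simp add: left_part_def)
  moreover have "const_on q (J \<circ> shift k) \<longleftrightarrow> const_on q (right_part k k' J)"
    by (rule const_on_cong[OF Parts_sub[OF q]]) (simp add: right_part_def)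
  ultimately show ?thesis unfolding part_tensor_def' const_on_Un const_on_image by blast
qed

lemma part_indices:
  assumes "J \<in> indices N (k + k')"
  shows "left_part k J \<in> indices N k" "right_part k k' J \<in> indices N k'"
proof -
  have "J x < N" if "x \<in> points k" for x
    using indices_less[OF assms] that unfolding points_add by blast
  then show "left_part k J \<in> indices N k" by (auto simp: left_part_def indices_def)
  have "J (shift k x) < N" if "x \<in> points k'" for x
    using indices_less[OF assms] that unfolding points_add by blast
  then show "right_part k k' J \<in> indices N k'" by (auto simp: right_part_def indices_def)
qed

lemma card_cycles_part_tensor:
  assumes p: "p \<in> Parts k" and q: "q \<in> Parts k'"
  shows "card (cycles_of (k + k') (part_tensor k p q)) = card (cycles_of k p) + card (cycles_of k' q)"
proof -
  note cp = cycles_of_Parts[OF p] and cq = cycles_of_Parts[OF q]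
  note pq = part_tensor_Parts[OF p q] and cpq = part_tensor_Parts[OF cp cq]
  have edges: "(\<forall>l<k + k'. J (Inl l) = J (Inr l)) \<longleftrightarrow>
    (\<forall>l<k. left_part k J (Inl l) = left_part k J (Inr l)) \<and>
    (\<forall>l<k'. right_part k k' J (Inl l) = right_part k k' J (Inr l))" for J
  proof -
    have "(\<forall>l<k + k'. Q l) \<longleftrightarrow> (\<forall>l<k. Q l) \<and> (\<forall>l<k'. Q (k + l))" for Q
    proof
      assume a: "(\<forall>l<k. Q l) \<and> (\<forall>l<k'. Q (k + l))"
      show "\<forall>l<k + k'. Q l"
      proof (intro allI impI)
        fix l assume "l < k + k'"
        then show "Q l" using a[THEN conjunct2, rule_format, of "l - k"] a by (cases "l < k") auto
      qed
    qed auto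
    from this[of "\<lambda>l. J (Inl l) = J (Inr l)"] show ?thesis
      by (simp add: left_part_def right_part_def shift_def)
  qed
  have "const_on (cycles_of (k + k') (part_tensor k p q)) J \<longleftrightarrow>
    const_on (part_tensor k (cycles_of k p) (cycles_of k' q)) J" for J :: "point \<Rightarrow> nat"
    unfolding const_on_cycles_of[OF pq] const_on_part_tensor[OF p q] const_on_part_tensor[OF cp cq]
      const_on_cycles_of[OF p] const_on_cycles_of[OF q] edges by blast
  then have "{J \<in> indices 2 (k + k'). const_on (cycles_of (k + k') (part_tensor k p q)) J} =
    {J \<in> indices 2 (k + k'). const_on (part_tensor k (cycles_of k p) (cycles_of k' q)) J}" by blast
  then have "(2::nat) ^ card (cycles_of (k + k') (part_tensor k p q)) =
    2 ^ card (part_tensor k (cycles_of k p) (cycles_of k' q))"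
    using card_const_on_indices[OF cycles_of_Parts[OF pq], of 2] card_const_on_indices[OF cpq, of 2] by simp
  then show ?thesis by (simp add: card_part_tensor[OF cp cq])
qed

lemma kap_part_tensor:
  assumes N: "2 * (k + k') \<le> N"
    and inv: "ker_invariant N k f1" "ker_invariant N k' f2" "ker_invariant N (k + k') f"
    and f: "\<And>J. J \<in> indices N (k + k') \<Longrightarrow> f J = f1 (left_part k J) * f2 (right_part k k' J)"
    and p: "p \<in> Parts k" and q: "q \<in> Parts k'"
  shows "kap N (k + k') f (part_tensor k p q) = kap N k f1 p * kap N k' f2 q"
proof -
  let ?c1 = "cum N k f1" and ?c2 = "cum N k' f2"
  have c1: "is_cumulant N k f1 ?c1" using cum_is_cumulant[OF _ inv(1)] N by simp
  have c2: "is_cumulant N k' f2 ?c2" using cum_is_cumulant[OF _ inv(2)] N by simp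
  define c where "c r = (\<Sum>(p, q)\<in>Parts k \<times> Parts k'. of_bool (r = part_tensor k p q) * (?c1 p * ?c2 q))" for r
  have "is_cumulant N (k + k') f c"
    unfolding is_cumulant_def
  proof
    fix J assume J: "J \<in> indices N (k + k')"
    note J12 = part_indices[OF J]
    have "(\<Sum>r\<in>{r \<in> Parts (k + k'). const_on r J}. c r) =
      (\<Sum>(p, q)\<in>Parts k \<times> Parts k'. \<Sum>r\<in>{r \<in> Parts (k + k'). const_on r J}. of_bool (r = part_tensor k p q) * (?c1 p * ?c2 q))"
      unfolding c_def case_prod_unfold by (rule sum.swap)
    also have "\<dots> = (\<Sum>(p, q)\<in>Parts k \<times> Parts k'.
      (of_bool (const_on p (left_part k J)) * ?c1 p) * (of_bool (const_on q (right_part k k' J)) * ?c2 q))"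
    proof (intro sum.cong refl, clarify)
      fix p q assume pq: "p \<in> Parts k" "q \<in> Parts k'"
      let ?R = "{r \<in> Parts (k + k'). const_on r J}"
      have "(\<Sum>r\<in>?R. of_bool (r = part_tensor k p q) * (?c1 p * ?c2 q)) =
        (\<Sum>r\<in>?R. if r = part_tensor k p q then ?c1 p * ?c2 q else 0)"
        by (intro sum.cong refl) simp
      also have "\<dots> = (if part_tensor k p q \<in> ?R then ?c1 p * ?c2 q else 0)"
        by (rule sum.delta) simp
      also have "\<dots> = (of_bool (const_on p (left_part k J)) * ?c1 p) * (of_bool (const_on q (right_part k k' J)) * ?c2 q)"
        using part_tensor_Parts[OF pq] const_on_part_tensor[OF pq, of J] by auto
      finally show "(\<Sum>r\<in>?R. of_bool (r = part_tensor k p q) * (?c1 p * ?c2 q)) =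
        (of_bool (const_on p (left_part k J)) * ?c1 p) * (of_bool (const_on q (right_part k k' J)) * ?c2 q)" .
    qed
    also have "\<dots> = (\<Sum>p\<in>Parts k. of_bool (const_on p (left_part k J)) * ?c1 p) *
      (\<Sum>q\<in>Parts k'. of_bool (const_on q (right_part k k' J)) * ?c2 q)"
      unfolding sum_product sum.cartesian_product by (simp add: case_prod_unfold)
    also have "(\<Sum>p\<in>Parts k. of_bool (const_on p (left_part k J)) * ?c1 p) = f1 (left_part k J)"
    proof -
      have "(\<Sum>p\<in>Parts k. of_bool (const_on p (left_part k J)) * ?c1 p) =
        (\<Sum>p\<in>Parts k. if const_on p (left_part k J) then ?c1 p else 0)" by (intro sum.cong refl) simp
      then show ?thesis using c1 J12(1) by (simp add: is_cumulant_def sum.inter_filter)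
    qed
    also have "(\<Sum>q\<in>Parts k'. of_bool (const_on q (right_part k k' J)) * ?c2 q) = f2 (right_part k k' J)"
    proof -
      have "(\<Sum>q\<in>Parts k'. of_bool (const_on q (right_part k k' J)) * ?c2 q) =
        (\<Sum>q\<in>Parts k'. if const_on q (right_part k k' J) then ?c2 q else 0)" by (intro sum.cong refl) simp
      then show ?thesis using c2 J12(2) by (simp add: is_cumulant_def sum.inter_filter)
    qed
    finally show "f J = (\<Sum>r\<in>{r \<in> Parts (k + k'). const_on r J}. c r)" using f[OF J] by simp
  qed
  from cumulant_unique[OF N cum_is_cumulant[OF N inv(3)] this part_tensor_Parts[OF p q]]
  have "cum N (k + k') f (part_tensor k p q) = c (part_tensor k p q)" .
  also have "\<dots> = (\<Sum>z\<in>Parts k \<times> Parts k'. if z = (p, q) then ?c1 p * ?c2 q else 0)"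
    unfolding c_def using part_tensor_inj[OF p q] by (intro sum.cong refl) auto
  also have "\<dots> = ?c1 p * ?c2 q" using p q by simp
  finally have cc: "cum N (k + k') f (part_tensor k p q) = ?c1 p * ?c2 q" .
  have "defect (k + k') (part_tensor k p q) = defect k p + defect k' q"
    unfolding defect_def card_part_tensor[OF p q] card_cycles_part_tensor[OF p q]
    using card_cycles_le[OF p] card_cycles_le[OF q] by simp
  then show ?thesis by (simp add: kap_def cc power_add)
qed

section \<open>Words in independent letters\<close>

definition letter :: "nat list \<Rightarrow> point \<Rightarrow> nat" where
  "letter xs = case_sum (nth xs) (nth xs)"

context walks
begin

definition letters_tensor :: "(nat \<Rightarrow> real) \<Rightarrow> nat \<Rightarrow> nat \<Rightarrow> nat list \<Rightarrow> (point \<Rightarrow> nat) \<Rightarrow> real" where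
  "letters_tensor u m N xs J =
    (\<Prod>i<m. letter_tensor N {l. l < length xs \<and> xs ! l = i} (walk_heat L (u (Suc i) - u i) N) J)"

lemma letter_tensor_empty: "2 \<le> N \<Longrightarrow> letter_tensor N {} (walk_heat L t N) J = 1"
  by (simp add: letter_tensor_def sum_walk_heat)

lemma letters_tensor_eq:
  assumes N: "2 \<le> N" and I: "I \<in> indices N (length xs)" and J: "J \<in> indices N (length xs)"
    and eq: "\<And>x y. x \<in> points (length xs) \<Longrightarrow> y \<in> points (length xs) \<Longrightarrow> letter xs x = letter xs y \<Longrightarrow> I x = I y \<longleftrightarrow> J x = J y"
  shows "letters_tensor u m N xs J = letters_tensor u m N xs I"
  unfolding letters_tensor_def
proof (intro prod.cong refl letter_tensor_kernel[OF class_weight_walk[OF N] _ I J])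
  fix i x y
  assume "x \<in> Inl ` {l. l < length xs \<and> xs ! l = i} \<union> Inr ` {l. l < length xs \<and> xs ! l = i}"
    "y \<in> Inl ` {l. l < length xs \<and> xs ! l = i} \<union> Inr ` {l. l < length xs \<and> xs ! l = i}"
  then show "I x = I y \<longleftrightarrow> J x = J y" by (intro eq) (auto simp: letter_def)
qed auto

lemma letters_tensor_invariant:
  assumes "2 \<le> N"
  shows "ker_invariant N (length xs) (letters_tensor u m N xs)"
  unfolding ker_invariant_def
proof (intro ballI impI)
  fix I J assume "I \<in> indices N (length xs)" "J \<in> indices N (length xs)"
    "Ker (length xs) I = Ker (length xs) J"
  then show "letters_tensor u m N xs I = letters_tensor u m N xs J"
    using letters_tensor_eq[OF assms, of J xs I u m] Ker_eq_iff[of "length xs" I J] by blast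
qed

lemma letters_tensor_append:
  assumes N: "2 \<le> N" and disj: "set xs \<inter> set ys = {}"
  shows "letters_tensor u m N (xs @ ys) J =
    letters_tensor u m N xs (left_part (length xs) J) *
    letters_tensor u m N ys (right_part (length xs) (length ys) J)"
  unfolding letters_tensor_def prod.distrib[symmetric]
proof (intro prod.cong refl)
  fix i
  let ?A = "{l. l < length (xs @ ys) \<and> (xs @ ys) ! l = i}"
  let ?B = "{l. l < length xs \<and> xs ! l = i}" and ?C = "{l. l < length ys \<and> ys ! l = i}"
  let ?h = "walk_heat L (u (Suc i) - u i) N"
  show "letter_tensor N ?A ?h J =
    letter_tensor N ?B ?h (left_part (length xs) J) * letter_tensor N ?C ?h (right_part (length xs) (length ys) J)"
  proof (cases "i \<in> set xs")
    case True
    then have "i \<notin> set ys" using disj by blast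
    then have C: "?C = {}" by (auto simp: in_set_conv_nth)
    have "?A = ?B"
    proof -
      have "l < length xs" if "l < length (xs @ ys)" "(xs @ ys) ! l = i" for l
      proof (rule ccontr)
        assume "\<not> l < length xs"
        then have "ys ! (l - length xs) = i" "l - length xs < length ys" using that by (auto simp: nth_append)
        then show False using \<open>i \<notin> set ys\<close> by (auto simp: in_set_conv_nth)
      qed
      note lt = this
      show ?thesis
      proof (intro Collect_cong iffI conjI)
        fix l assume l: "l < length (xs @ ys) \<and> (xs @ ys) ! l = i"
        then show "l < length xs" using lt by blast
        then show "xs ! l = i" using l by (simp add: nth_append)
      next
        fix l assume l: "l < length xs \<and> xs ! l = i"
        then show "l < length (xs @ ys)" "(xs @ ys) ! l = i" by (simp_all add: nth_append)
      qed
    qed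
    then have "letter_tensor N ?A ?h J = letter_tensor N ?B ?h (left_part (length xs) J)"
      unfolding letter_tensor_def by (intro sum.cong refl) (simp add: left_part_def)
    then show ?thesis unfolding C letter_tensor_empty[OF N] by simp
  next
    case False
    then have B: "?B = {}" by (auto simp: in_set_conv_nth)
    have "?A = (+) (length xs) ` ?C"
    proof -
      have "l \<in> (+) (length xs) ` ?C" if "l < length (xs @ ys)" "(xs @ ys) ! l = i" for l
      proof -
        have "\<not> l < length xs" using that False by (auto simp: nth_append in_set_conv_nth)
        then show ?thesis using that by (intro image_eqI[of _ _ "l - length xs"]) (auto simp: nth_append)
      qed
      then show ?thesis by (auto simp: nth_append)
    qed
    then have "letter_tensor N ?A ?h J = letter_tensor N ?C ?h (right_part (length xs) (length ys) J)"
      unfolding letter_tensor_def by (intro sum.cong refl) (simp add: right_part_def shift_def)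
    then show ?thesis unfolding B letter_tensor_empty[OF N] by simp
  qed
qed

lemma sum_grid_letters:
  assumes xs: "set xs \<subseteq> {..<m}"
  shows "grid_tensor L u N m (length xs) (\<lambda>g l. g (xs ! l)) J = letters_tensor u m N xs J"
proof -
  let ?A = "\<lambda>i. {l. l < length xs \<and> xs ! l = i}"
  have wt: "word_tensor (length xs) (\<lambda>l. g (xs ! l)) J =
    (\<Prod>i<m. of_bool (\<forall>l\<in>?A i. J (Inr l) = g i (J (Inl l))))" for g
  proof -
    have "(\<Prod>i<m. of_bool (Q i) :: real) = of_bool (\<forall>i<m. Q i)" for Q
      by (induction m) (auto simp: less_Suc_eq)
    moreover have "(\<forall>l<length xs. J (Inr l) = g (xs ! l) (J (Inl l))) \<longleftrightarrow>
      (\<forall>i<m. \<forall>l\<in>?A i. J (Inr l) = g i (J (Inl l)))"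
      using xs by (auto simp: subset_iff)
    ultimately show ?thesis unfolding word_tensor_def by simp
  qed
  have "grid_tensor L u N m (length xs) (\<lambda>g l. g (xs ! l)) J =
    (\<Sum>g\<in>PiE {..<m} (\<lambda>_. perms N). \<Prod>i<m. walk_heat L (u (Suc i) - u i) N (g i) * of_bool (\<forall>l\<in>?A i. J (Inr l) = g i (J (Inl l))))"
    unfolding grid_tensor_def grid_weight_def wt prod.distrib ..
  also have "\<dots> = (\<Prod>i<m. \<Sum>h\<in>perms N. walk_heat L (u (Suc i) - u i) N h * of_bool (\<forall>l\<in>?A i. J (Inr l) = h (J (Inl l))))"
    by (rule prod_sum_PiE[symmetric]) simp_all
  finally show ?thesis unfolding letters_tensor_def letter_tensor_def .
qed

lemma letters_tensor_replicate:
  assumes N: "2 \<le> N" and i: "i < m"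
  shows "letters_tensor u m N (replicate k i) = law_tensor N k {..<k} (walk_heat L (u (Suc i) - u i) N)"
proof
  fix J
  let ?F = "\<lambda>j. letter_tensor N {l. l < length (replicate k i) \<and> replicate k i ! l = j} (walk_heat L (u (Suc j) - u j) N) J"
  have "(\<Prod>j<m. ?F j) = ?F i * (\<Prod>j\<in>{..<m} - {i}. ?F j)" using i by (intro prod.remove) auto
  also have "(\<Prod>j\<in>{..<m} - {i}. ?F j) = 1"
  proof (rule prod.neutral, rule ballI)
    fix j assume "j \<in> {..<m} - {i}"
    then have "{l. l < length (replicate k i) \<and> replicate k i ! l = j} = {}" by auto
    then show "?F j = 1" by (simp only: letter_tensor_empty[OF N])
  qed
  also have "{l. l < length (replicate k i) \<and> replicate k i ! l = i} = {..<k}" by auto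
  finally show "letters_tensor u m N (replicate k i) J = law_tensor N k {..<k} (walk_heat L (u (Suc i) - u i) N) J"
    unfolding letters_tensor_def law_tensor_eq by simp
qed

text \<open>
  Separating the letters of an index tuple does not change the tensor, so its value at a kernel
  already is the sum of the cumulants of the partitions below that respect the letters.
\<close>

lemma cum_mixed:
  assumes N: "2 \<le> N" "2 * length xs \<le> N" and q: "q \<in> Parts (length xs)" "\<not> const_on q (letter xs)"
  shows "cum N (length xs) (letters_tensor u m N xs) q = 0"
  using q
proof (induction "corank (length xs) q" arbitrary: q rule: less_induct)
  case less
  let ?k = "length xs"
  let ?f = "letters_tensor u m N xs"
  let ?c = "cum N ?k ?f"
  have c: "?f J = (\<Sum>r\<in>{r \<in> Parts ?k. const_on r J}. ?c r)" if "J \<in> indices N ?k" for J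
    using cum_is_cumulant[OF N(2) letters_tensor_invariant[OF N(1)]] that by (simp add: is_cumulant_def)
  obtain J where J: "J \<in> indices N ?k" "Ker ?k J = q" using Ker_surj[OF less.prems(1) N(2)] by blast
  let ?P = "(\<lambda>x. (J x, letter xs x)) ` points ?k"
  have "card ?P \<le> card {..<N}"
    using card_image_le[OF finite_points, of "\<lambda>x. (J x, letter xs x)" ?k] N(2) by (simp add: card_points)
  then obtain e where e: "e ` ?P \<subseteq> {..<N}" "inj_on e ?P"
    using card_le_inj[of ?P "{..<N}"] by auto
  define J' where "J' = restrict (\<lambda>x. e (J x, letter xs x)) (points ?k)"
  have J': "J' \<in> indices N ?k" using e(1) by (auto simp: J'_def indices_def)
  have J'_eq: "J' x = J' y \<longleftrightarrow> J x = J y \<and> letter xs x = letter xs y"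
    if "x \<in> points ?k" "y \<in> points ?k" for x y
    using that inj_on_eq_iff[OF e(2), of "(J x, letter xs x)" "(J y, letter xs y)"] by (simp add: J'_def)
  have cJ': "const_on r J' \<longleftrightarrow> const_on r J \<and> const_on r (letter xs)" if r: "r \<in> Parts ?k" for r
    unfolding const_on_def using J'_eq Parts_sub[OF r] by (meson UnionI subsetD)
  have cq: "const_on q J" using refines_Ker_iff[OF less.prems(1), of J] J refines_refl[OF Parts_partition[OF less.prems(1)]] by simp
  have "?f J = ?f J'" by (rule letters_tensor_eq[OF N(1) J' J(1)]) (use J'_eq in blast)
  also have "\<dots> = (\<Sum>r\<in>{r \<in> Parts ?k. const_on r J \<and> const_on r (letter xs)}. ?c r)"
    unfolding c[OF J'] using cJ' by (intro sum.cong) auto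
  finally have 1: "?f J = \<dots>" .
  have "?f J = (\<Sum>r\<in>{r \<in> Parts ?k. const_on r J \<and> const_on r (letter xs)} \<union> {r \<in> Parts ?k. const_on r J \<and> \<not> const_on r (letter xs)}. ?c r)"
    unfolding c[OF J(1)] by (intro sum.cong) auto
  also have "\<dots> = (\<Sum>r\<in>{r \<in> Parts ?k. const_on r J \<and> const_on r (letter xs)}. ?c r) +
    (\<Sum>r\<in>{r \<in> Parts ?k. const_on r J \<and> \<not> const_on r (letter xs)}. ?c r)"
    by (rule sum.union_disjoint) auto
  also have "(\<Sum>r\<in>{r \<in> Parts ?k. const_on r J \<and> \<not> const_on r (letter xs)}. ?c r) = (\<Sum>r\<in>{q}. ?c r)"
  proof (rule sum.mono_neutral_right)
    show "{q} \<subseteq> {r \<in> Parts ?k. const_on r J \<and> \<not> const_on r (letter xs)}" using less.prems cq by simp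
    show "\<forall>r\<in>{r \<in> Parts ?k. const_on r J \<and> \<not> const_on r (letter xs)} - {q}. ?c r = 0"
    proof
      fix r assume r: "r \<in> {r \<in> Parts ?k. const_on r J \<and> \<not> const_on r (letter xs)} - {q}"
      then have "refines (points ?k) r q" using refines_Ker_iff[of r ?k J] J(2) by auto
      then show "?c r = 0" using r by (intro less.hyps corank_less) auto
    qed
  qed simp
  finally show ?case using 1 by simp
qed

lemma kap_concat:
  assumes N: "2 \<le> N" and len: "length kps = length ls" and P: "\<forall>(k, p)\<in>set kps. p \<in> Parts k"
    and ls: "distinct ls" "set ls \<subseteq> {..<m}"
    and big: "2 * length (concat (map2 (\<lambda>(k, p) i. replicate k i) kps ls)) \<le> N"
  shows "part_tensors kps \<in> Parts (length (concat (map2 (\<lambda>(k, p) i. replicate k i) kps ls))) \<and>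
    kap N (length (concat (map2 (\<lambda>(k, p) i. replicate k i) kps ls)))
      (letters_tensor u m N (concat (map2 (\<lambda>(k, p) i. replicate k i) kps ls))) (part_tensors kps) =
    (\<Prod>j<length ls. kap N (fst (kps ! j)) (letters_tensor u m N (replicate (fst (kps ! j)) (ls ! j))) (snd (kps ! j)))"
  using len P ls big
proof (induction kps ls rule: list_induct2)
  case Nil
  have P0: "Parts 0 = {{}}"
    unfolding Parts_def points_def by (auto simp: partition_on_def)
  have f1: "letters_tensor u m N [] J = 1" for J
    unfolding letters_tensor_def by (simp add: letter_tensor_empty[OF N])
  obtain J where J: "J \<in> indices N 0" using Ker_surj[of "{}" 0 N] P0 by auto
  have "is_cumulant N 0 (letters_tensor u m N []) (cum N 0 (letters_tensor u m N []))"
    using cum_is_cumulant[OF _ letters_tensor_invariant[OF N, of "[]"]] by simp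
  then have "letters_tensor u m N [] J = (\<Sum>q\<in>{q \<in> Parts 0. const_on q J}. cum N 0 (letters_tensor u m N []) q)"
    using J by (simp add: is_cumulant_def)
  moreover have "{q \<in> Parts 0. const_on q J} = {{}}" unfolding P0 by (auto simp: const_on_def)
  ultimately have "cum N 0 (letters_tensor u m N []) {} = 1" using f1 by simp
  then show ?case using P0 by (simp add: kap_def defect_def)
next
  case (Cons kp kps i ls)
  obtain k p where kp: "kp = (k, p)" by (cases kp)
  let ?xs = "replicate k i" and ?ys = "concat (map2 (\<lambda>(k, p) i. replicate k i) kps ls)"
  have ys: "set ?ys \<subseteq> set ls" by (auto dest: set_zip_rightD)
  have "i \<notin> set ls" using Cons.prems by simp
  then have "i \<notin> set ?ys" using ys by blast
  moreover have "set ?xs \<subseteq> {i}" by auto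
  ultimately have disj: "set ?xs \<inter> set ?ys = {}" by blast
  have p: "p \<in> Parts k" using Cons.prems kp by auto
  have IH: "part_tensors kps \<in> Parts (length ?ys)"
    "kap N (length ?ys) (letters_tensor u m N ?ys) (part_tensors kps) =
      (\<Prod>j<length ls. kap N (fst (kps ! j)) (letters_tensor u m N (replicate (fst (kps ! j)) (ls ! j))) (snd (kps ! j)))"
    using Cons.IH Cons.prems by auto
  have "kap N (k + length ?ys) (letters_tensor u m N (?xs @ ?ys)) (part_tensor k p (part_tensors kps)) =
    kap N k (letters_tensor u m N ?xs) p * kap N (length ?ys) (letters_tensor u m N ?ys) (part_tensors kps)"
  proof (rule kap_part_tensor[OF _ _ _ _ _ p IH(1)])
    show "2 * (k + length ?ys) \<le> N" using Cons.prems kp by simp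
    show "ker_invariant N k (letters_tensor u m N ?xs)" using letters_tensor_invariant[OF N, of ?xs] by simp
    show "ker_invariant N (length ?ys) (letters_tensor u m N ?ys)" by (rule letters_tensor_invariant[OF N])
    show "ker_invariant N (k + length ?ys) (letters_tensor u m N (?xs @ ?ys))"
      using letters_tensor_invariant[OF N, of "?xs @ ?ys"] by simp
    show "letters_tensor u m N (?xs @ ?ys) J =
      letters_tensor u m N ?xs (left_part k J) * letters_tensor u m N ?ys (right_part k (length ?ys) J)" for J
      using letters_tensor_append[OF N disj] by simp
  qed
  moreover have "part_tensor k p (part_tensors kps) \<in> Parts (k + length ?ys)"
    by (rule part_tensor_Parts[OF p IH(1)])
  ultimately show ?case
    unfolding kp IH(2) by (simp add: prod.lessThan_Suc_shift del: prod.lessThan_Suc)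
qed

end

section \<open>The limiting P-Levy process\<close>

lemma P_converges_cong:
  assumes conv: "P_converges M J X" and eq: "\<And>j. j \<in> J \<Longrightarrow> X j = X' j"
  shows "P_converges M J X'"
proof -
  have joint: "joint_law (M N) N J Z = joint_law (M N) N J Z'"
    if "\<And>j. j \<in> J \<Longrightarrow> Z j = Z' j" for N and Z Z' :: "_ \<Rightarrow> _ \<Rightarrow> complex mat"
  proof -
    have "(\<lambda>(j, a, b)\<in>J \<times> {..<N} \<times> {..<N}. Z j \<omega> $$ (a, b)) = (\<lambda>(j, a, b)\<in>J \<times> {..<N} \<times> {..<N}. Z' j \<omega> $$ (a, b))" for \<omega>
      using that by (intro restrict_ext) auto
    then show ?thesis unfolding joint_law_def by simp
  qed
  have inv: "conj_invariant (M N) N J (\<lambda>j. X' j N)" if "conj_invariant (M N) N J (\<lambda>j. X j N)" for N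
  proof -
    have "joint_law (M N) N J (\<lambda>j. X j N) = joint_law (M N) N J (\<lambda>j. X' j N)"
      by (rule joint) (simp add: eq)
    moreover have "joint_law (M N) N J (\<lambda>j \<omega>. perm_mat N \<tau> * X j N \<omega> * perm_mat N (inv_into UNIV \<tau>)) =
      joint_law (M N) N J (\<lambda>j \<omega>. perm_mat N \<tau> * X' j N \<omega> * perm_mat N (inv_into UNIV \<tau>))" for \<tau>
      by (rule joint) (simp add: eq)
    ultimately show ?thesis using that unfolding conj_invariant_def by simp
  qed
  show ?thesis
    unfolding P_converges_def
  proof (intro conjI allI impI)
    fix N :: nat assume N: "2 \<le> N"
    have X: "(\<forall>j\<in>J. random_matrix (M N) N (X j N)) \<and> conj_invariant (M N) N J (\<lambda>j. X j N)"
      using conv N unfolding P_converges_def by blast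
    then show "\<forall>j\<in>J. random_matrix (M N) N (X' j N)" using eq by simp
    show "conj_invariant (M N) N J (\<lambda>j. X' j N)" using X inv by blast
  next
    fix js p assume js: "set js \<subseteq> J \<and> p \<in> Parts (length js)"
    have maps: "map X' js = map X js" "map (\<lambda>j. X' j N \<omega>) js = map (\<lambda>j. X j N \<omega>) js" for N \<omega>
      using js eq by (auto simp: subset_iff)
    show "integrable (M N) (\<lambda>\<omega>. P_moment N p (map (\<lambda>j. X' j N \<omega>) js))" if "2 \<le> N" for N
      unfolding maps using conv js that unfolding P_converges_def by blast
    show "convergent (E_P_moment M p (map X' js))"
      unfolding maps using conv js unfolding P_converges_def by blast
  qed
qed

definition successive :: "nat \<Rightarrow> (nat \<Rightarrow> real) \<Rightarrow> (nat \<Rightarrow> real) \<Rightarrow> bool" where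
  "successive n s t \<longleftrightarrow> (\<forall>i<n. 0 \<le> s i \<and> s i \<le> t i) \<and> (\<forall>i. Suc i < n \<longrightarrow> t i \<le> s (Suc i))"

text \<open>The times \<open>0, s 0, t 0, s 1, t 1, \<dots>\<close>, constant after the last one.\<close>

definition seq_grid :: "nat \<Rightarrow> (nat \<Rightarrow> real) \<Rightarrow> (nat \<Rightarrow> real) \<Rightarrow> nat \<Rightarrow> real" where
  "seq_grid n s t j =
    (if j = 0 \<or> n = 0 then 0 else if 2 * n < j then t (n - 1)
     else if odd j then s ((j - 1) div 2) else t ((j - 1) div 2))"

lemma seq_grid_vals:
  assumes "i < n"
  shows "seq_grid n s t (2 * i + 1) = s i" "seq_grid n s t (Suc (2 * i + 1)) = t i"
proof -
  have "(2 * i + 1) div 2 = i" by simp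
  then show "seq_grid n s t (2 * i + 1) = s i" "seq_grid n s t (Suc (2 * i + 1)) = t i"
    using assms by (simp_all add: seq_grid_def)
qed

lemma grid_seq_grid:
  assumes "successive n s t"
  shows "grid (seq_grid n s t)"
  unfolding grid_def
proof (intro conjI allI)
  fix j
  show "seq_grid n s t j \<le> seq_grid n s t (Suc j)"
  proof (cases "n = 0 \<or> 2 * n < j")
    case True
    then show ?thesis by (auto simp: seq_grid_def)
  next
    case False
    then have n: "0 < n" "j \<le> 2 * n" by auto
    consider "j = 0" | i where "j = 2 * i + 1" | i where "j = Suc (2 * i + 1)"
    proof (cases j)
      case (Suc j')
      show ?thesis
      proof (cases "even j'")
        case True
        then obtain i where "j' = 2 * i" by (rule evenE)
        then show ?thesis using that(2)[of i] Suc by simp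
      next
        case False
        then obtain i where "j' = 2 * i + 1" by (rule oddE)
        then show ?thesis using that(3)[of i] Suc by simp
      qed
    qed (use that(1) in simp)
    then show ?thesis
    proof cases
      case 1
      have "seq_grid n s t (2 * 0 + 1) = s 0" by (rule seq_grid_vals(1)[OF n(1)])
      then show ?thesis using 1 assms n(1) by (simp add: successive_def seq_grid_def)
    next
      case (2 i)
      then have i: "i < n" using n by simp
      then show ?thesis using seq_grid_vals[OF i, of s t] 2 assms by (simp add: successive_def)
    next
      case (3 i)
      then have i: "i < n" using n by simp
      show ?thesis
      proof (cases "Suc i < n")
        case True
        have "Suc j = 2 * Suc i + 1" using 3 by simp
        then show ?thesis
          using seq_grid_vals(2)[OF i, of s t] seq_grid_vals(1)[OF True, of s t] 3 assms True
          by (simp only: successive_def)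
      next
        case False
        then have "n = Suc i" using i by simp
        then show ?thesis using seq_grid_vals(2)[OF i, of s t] 3 by (simp add: seq_grid_def)
      qed
    qed
  qed
qed (simp add: seq_grid_def)

lemma wprod_single: "wprod (\<lambda>i. {j. i = 2 * j + 1}) g m j = (if 2 * j + 1 < m then g (2 * j + 1) else id)"
  by (induction m) (auto simp: ext_def less_Suc_eq)

context walks
begin

abbreviation incr :: "(nat \<Rightarrow> real) \<Rightarrow> (nat \<Rightarrow> real) \<Rightarrow> nat \<Rightarrow> nat \<Rightarrow> 'w \<Rightarrow> nat \<Rightarrow> nat" where
  "incr s t j N \<omega> \<equiv> S N (t j) \<omega> \<circ> inv_into UNIV (S N (s j) \<omega>)"

lemma incr_grid_incr:
  assumes "j < n"
  shows "incr s t j N \<omega> = restrict (grid_incr S N (seq_grid n s t) \<omega>) {..<2 * n} (2 * j + 1)"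
proof -
  have "2 * j + 1 < 2 * n" using assms by simp
  then show ?thesis
    by (simp only: restrict_apply' lessThan_iff grid_incr_def seq_grid_vals[OF assms])
qed

lemma incr_meas:
  assumes "2 \<le> N" "successive n s t" "j < n"
  shows "incr s t j N \<in> measurable (M N) (count_space (perms N))"
proof -
  have "0 \<le> s j" "0 \<le> t j" using assms(2,3) unfolding successive_def by force+
  then show ?thesis by (rule incr_measurable[OF assms(1)])
qed

lemma represented_incr:
  assumes "successive n s t"
  shows "represented {..<n} (incr s t)"
  unfolding represented_def
proof (intro conjI allI ballI impI)
  fix J' :: "nat set" assume J': "J' \<subseteq> {..<n}"
  show "\<exists>u m A. grid u \<and> (\<forall>N\<ge>2. AE \<omega> in M N. \<forall>j\<in>J'.
      incr s t j N \<omega> = wprod A (restrict (grid_incr S N u \<omega>) {..<m}) m j)"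
  proof (intro exI conjI allI impI)
    show "grid (seq_grid n s t)" by (rule grid_seq_grid[OF assms])
    fix N :: nat
    show "AE \<omega> in M N. \<forall>j\<in>J'. incr s t j N \<omega> =
      wprod (\<lambda>i. {j. i = 2 * j + 1}) (restrict (grid_incr S N (seq_grid n s t) \<omega>) {..<2 * n}) (2 * n) j"
    proof (intro always_eventually allI ballI)
      fix \<omega> j assume "j \<in> J'"
      then have "j < n" using J' by auto
      then have "2 * j + 1 < 2 * n" by simp
      then show "incr s t j N \<omega> =
        wprod (\<lambda>i. {j. i = 2 * j + 1}) (restrict (grid_incr S N (seq_grid n s t) \<omega>) {..<2 * n}) (2 * n) j"
        unfolding wprod_single incr_grid_incr[OF \<open>j < n\<close>] by (simp only: if_True)
    qed
  qed
qed (use incr_meas[OF _ assms] in auto)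

lemma word_tensor_incr_integral:
  assumes N: "2 \<le> N" and succ: "successive n s t" and js: "set js \<subseteq> {..<n}" and J: "J \<in> indices N (length js)"
  shows "integral\<^sup>L (M N) (\<lambda>\<omega>. tensor_entry (map (\<lambda>X. X \<omega>) (map (\<lambda>j \<omega>. perm_mat N (incr s t j N \<omega>)) js)) J) =
    of_real (letters_tensor (seq_grid n s t) (2 * n) N (map (\<lambda>j. 2 * j + 1) js) J)"
proof -
  let ?k = "length js" and ?u = "seq_grid n s t" and ?xs = "map (\<lambda>j. 2 * j + 1) js"
  have lt: "js ! l < n" if "l < ?k" for l using js that by (auto simp: subset_iff)
  have xs: "set ?xs \<subseteq> {..<2 * n}"
  proof
    fix x assume "x \<in> set ?xs"
    then obtain j where "j \<in> set js" "x = 2 * j + 1" by auto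
    then show "x \<in> {..<2 * n}" using js by auto
  qed
  have "map (\<lambda>X. X \<omega>) (map (\<lambda>j \<omega>. perm_mat N (incr s t j N \<omega>)) js) =
    map (\<lambda>l. perm_mat N (incr s t (js ! l) N \<omega>)) [0..<?k]" for \<omega>
    by (rule nth_equalityI) simp_all
  then have te: "tensor_entry (map (\<lambda>X. X \<omega>) (map (\<lambda>j \<omega>. perm_mat N (incr s t j N \<omega>)) js)) J =
    of_real (word_tensor ?k (\<lambda>l. incr s t (js ! l) N \<omega>) J)" for \<omega>
    using tensor_entry_perm[OF J] by (simp only:)
  have "integral\<^sup>L (M N) (\<lambda>\<omega>. complex_of_real (word_tensor ?k (\<lambda>l. incr s t (js ! l) N \<omega>) J)) =
    (\<Sum>g\<in>PiE {..<2 * n} (\<lambda>_. perms N). grid_weight L ?u N (2 * n) g *\<^sub>R of_real (word_tensor ?k (\<lambda>l. g (?xs ! l)) J))"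
  proof (rule word_integral(2)[OF N, where Y = "\<lambda>l. incr s t (js ! l) N" and F = "\<lambda>w. complex_of_real (word_tensor ?k w J)" and W = "\<lambda>g l. g (?xs ! l)"])
    show "incr s t (js ! l) N \<in> measurable (M N) (count_space (perms N))" if "l < ?k" for l
      by (rule incr_meas[OF N succ lt[OF that]])
    show "complex_of_real (word_tensor ?k w J) = complex_of_real (word_tensor ?k w' J)"
      if "\<And>l. l < ?k \<Longrightarrow> w l = w' l" for w w'
      using word_tensor_cong[OF that] by simp
    show "grid ?u" by (rule grid_seq_grid[OF succ])
    show "AE \<omega> in M N. \<forall>l<?k. incr s t (js ! l) N \<omega> = restrict (grid_incr S N ?u \<omega>) {..<2 * n} (?xs ! l)"
    proof (intro always_eventually allI impI)
      fix \<omega> l assume l: "l < ?k"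
      show "incr s t (js ! l) N \<omega> = restrict (grid_incr S N ?u \<omega>) {..<2 * n} (?xs ! l)"
        unfolding nth_map[OF l] by (rule incr_grid_incr[OF lt[OF l]])
    qed
  qed
  also have "\<dots> = of_real (grid_tensor L ?u N (2 * n) (length ?xs) (\<lambda>g l. g (?xs ! l)) J)"
    unfolding grid_tensor_def by (simp add: scaleR_conv_of_real)
  also have "\<dots> = of_real (letters_tensor ?u (2 * n) N ?xs J)"
    unfolding sum_grid_letters[OF xs] ..
  finally show ?thesis unfolding te .
qed

lemma P_cumulant_word:
  assumes N: "2 \<le> N" "2 * length js \<le> N" and succ: "successive n s t" and js: "set js \<subseteq> {..<n}"
    and p: "p \<in> Parts (length js)"
  shows "P_cumulant (M N) N p (map (\<lambda>j \<omega>. perm_mat N (incr s t j N \<omega>)) js) =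
    of_real (kap N (length js) (letters_tensor (seq_grid n s t) (2 * n) N (map (\<lambda>j. 2 * j + 1) js)) p)"
proof (rule P_cumulant_eq[OF N(2) _ _ p])
  show "ker_invariant N (length js) (letters_tensor (seq_grid n s t) (2 * n) N (map (\<lambda>j. 2 * j + 1) js))"
    using letters_tensor_invariant[OF N(1), of "map (\<lambda>j. 2 * j + 1) js"] by simp
  show "integral\<^sup>L (M N) (\<lambda>\<omega>. tensor_entry (map (\<lambda>X. X \<omega>) (map (\<lambda>j \<omega>. perm_mat N (incr s t j N \<omega>)) js)) J) =
    of_real (letters_tensor (seq_grid n s t) (2 * n) N (map (\<lambda>j. 2 * j + 1) js) J)"
    if "J \<in> indices N (length js)" for J
    by (rule word_tensor_incr_integral[OF N(1) succ js that])
qed (use N in auto)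

lemma increment_eq: "increment S (s j) (t j) = (\<lambda>N \<omega>. perm_mat N (incr s t j N \<omega>))"
  by (intro ext) (simp only: increment_def)

lemma P_free_increments:
  assumes succ: "successive n s t"
  shows "P_free M (increments S n s t)"
proof -
  let ?As = "increments S n s t" and ?u = "seq_grid n s t"
  let ?f = "\<lambda>N xs. letters_tensor ?u (2 * n) N (map (\<lambda>j. 2 * j + 1) xs)"
  have len: "length ?As = n" by (simp add: increments_def)
  have nth: "?As ! j = (\<lambda>N \<omega>. perm_mat N (incr s t j N \<omega>))" if "j < n" for j
    using that by (simp add: increments_def increment_eq)
  have lim_word: "lim_P_cumulant M p (map (\<lambda>j. ?As ! j) js) = lim (\<lambda>N. complex_of_real (kap N (length js) (?f N js) p))"
    if js: "set js \<subseteq> {..<n}" and p: "p \<in> Parts (length js)" for js p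
  proof -
    have m: "map (\<lambda>X. X N) (map (\<lambda>j. ?As ! j) js) = map (\<lambda>j \<omega>. perm_mat N (incr s t j N \<omega>)) js" for N
      using js nth by (auto simp: subset_iff)
    have ev: "\<forall>\<^sub>F N in sequentially. P_cumulant (M N) N p (map (\<lambda>X. X N) (map (\<lambda>j. ?As ! j) js)) =
      complex_of_real (kap N (length js) (?f N js) p)"
      using eventually_ge_at_top[of 2] eventually_ge_at_top[of "2 * length js"]
      unfolding m by eventually_elim (rule P_cumulant_word[OF _ _ succ js p])
    show "lim_P_cumulant M p (map (\<lambda>j. ?As ! j) js) = lim (\<lambda>N. complex_of_real (kap N (length js) (?f N js) p))"
      unfolding lim_P_cumulant_def lim_def tendsto_cong[OF ev] ..
  qed
  show ?thesis
    unfolding P_free_def len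
  proof (intro conjI allI impI)
    show "P_converges M {..<n} ((!) ?As)"
      by (rule P_converges_cong[OF represented_P_converges[OF represented_incr[OF succ]]]) (simp only: nth lessThan_iff)
  next
    fix js p
    assume h: "set js \<subseteq> {..<n} \<and> p \<in> Parts (length js) \<and> (\<exists>a<length js. \<exists>b<length js. js ! a \<noteq> js ! b \<and>
        (\<exists>c\<in>cycles_of (length js) p. Inl a \<in> c \<and> Inl b \<in> c))"
    then obtain a b c where ab: "a < length js" "b < length js" "js ! a \<noteq> js ! b"
      and c: "c \<in> cycles_of (length js) p" "Inl a \<in> c" "Inl b \<in> c" by blast
    have js: "set js \<subseteq> {..<n}" and p: "p \<in> Parts (length js)" using h by auto
    let ?xs = "map (\<lambda>j. 2 * j + 1) js"
    have "\<not> const_on p (letter ?xs)"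
    proof
      assume "const_on p (letter ?xs)"
      then have "const_on (cycles_of (length js) p) (letter ?xs)"
        unfolding const_on_cycles_of[OF p] by (simp add: letter_def)
      from const_onD[OF this c] show False using ab by (simp add: letter_def)
    qed
    note mixed = this
    have "\<forall>\<^sub>F N in sequentially. complex_of_real (kap N (length js) (?f N js) p) = 0"
      using eventually_ge_at_top[of 2] eventually_ge_at_top[of "2 * length js"]
    proof eventually_elim
      case (elim N)
      have "cum N (length ?xs) (letters_tensor ?u (2 * n) N ?xs) p = 0"
        by (rule cum_mixed) (use elim p mixed in simp_all)
      then show ?case by (simp add: kap_def)
    qed
    then have "(\<lambda>N. complex_of_real (kap N (length js) (?f N js) p)) \<longlonglongrightarrow> 0"
      by (rule tendsto_eventually)
    then show "lim_P_cumulant M p (map ((!) ?As) js) = 0"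
      unfolding lim_word[OF js p] by (rule limI)
  next
    fix kps :: "(nat \<times> point set set) list"
    assume h: "length kps = n \<and> (\<forall>(k, p)\<in>set kps. p \<in> Parts k)"
    let ?w = "concat (map2 (\<lambda>(k, p) i. replicate k i) kps [0..<n])"
    have w_set: "set ?w \<subseteq> {..<n}" by (auto dest!: set_zip_rightD)
    have w_map: "map f ?w = concat (map2 (\<lambda>(k, p) i. replicate k i) kps (map f [0..<n]))" for f :: "nat \<Rightarrow> 'x"
      by (simp add: map_concat zip_map2 comp_def case_prod_unfold)
    have As_w: "concat (map2 (\<lambda>(k, p) A. replicate k A) kps ?As) = map (\<lambda>j. ?As ! j) ?w"
    proof -
      have "map (\<lambda>j. ?As ! j) [0..<n] = ?As" using len map_nth[of ?As] by simp
      then show ?thesis unfolding w_map by simp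
    qed
    let ?ls = "map (\<lambda>j. 2 * j + 1) [0..<n] :: nat list"
    have ls: "length kps = length ?ls" "distinct ?ls" "set ?ls \<subseteq> {..<2 * n}"
      using h by (auto simp: distinct_map inj_on_def)
    have lw: "length (concat (map2 (\<lambda>(k, p) i. replicate k i) kps ?ls)) = length ?w"
      unfolding w_map[symmetric] by simp
    let ?K = "\<lambda>N j. kap N (fst (kps ! j)) (?f N (replicate (fst (kps ! j)) j)) (snd (kps ! j))"
    have key: "part_tensors kps \<in> Parts (length ?w)"
      "kap N (length ?w) (?f N ?w) (part_tensors kps) = (\<Prod>j<n. ?K N j)"
      if N: "2 \<le> N" "2 * length ?w \<le> N" for N
    proof -
      from kap_concat[OF N(1) ls(1) conjunct2[OF h] ls(2,3), of ?u] N(2)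
      have "part_tensors kps \<in> Parts (length ?w) \<and> kap N (length ?w) (?f N ?w) (part_tensors kps) =
        (\<Prod>j<length ?ls. kap N (fst (kps ! j)) (letters_tensor ?u (2 * n) N (replicate (fst (kps ! j)) (?ls ! j))) (snd (kps ! j)))"
        unfolding lw by (simp only: w_map)
      moreover have "(\<Prod>j<length ?ls. kap N (fst (kps ! j)) (letters_tensor ?u (2 * n) N (replicate (fst (kps ! j)) (?ls ! j))) (snd (kps ! j))) =
        (\<Prod>j<n. ?K N j)"
        by (intro prod.cong) (simp_all add: map_replicate_const)
      ultimately show "part_tensors kps \<in> Parts (length ?w)"
        "kap N (length ?w) (?f N ?w) (part_tensors kps) = (\<Prod>j<n. ?K N j)" by simp_all
    qed
    have P: "part_tensors kps \<in> Parts (length ?w)"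
      using key(1)[of "max 2 (2 * length ?w)"] by simp
    have pj: "snd (kps ! j) \<in> Parts (fst (kps ! j))" if "j < n" for j
      using h that nth_mem[of j kps] by (auto simp: case_prod_unfold)
    have conv: "convergent (\<lambda>N. ?K N j)" if j: "j < n" for j
    proof (rule convergent_eventually_eq)
      show "convergent (\<lambda>N. kap N (fst (kps ! j)) (law_tensor N (fst (kps ! j)) {..<fst (kps ! j)}
          (walk_heat L (?u (Suc (2 * j + 1)) - ?u (2 * j + 1)) N)) (snd (kps ! j)))"
        by (rule convergent_kap_heat[OF classes converge pj[OF j]])
      have jn: "2 * j + 1 < 2 * n" using j by simp
      show "\<forall>\<^sub>F N in sequentially. ?K N j = kap N (fst (kps ! j)) (law_tensor N (fst (kps ! j)) {..<fst (kps ! j)}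
          (walk_heat L (?u (Suc (2 * j + 1)) - ?u (2 * j + 1)) N)) (snd (kps ! j))"
        using eventually_ge_at_top[of 2]
        by eventually_elim (simp only: map_replicate letters_tensor_replicate[OF _ jn])
    qed
    have lim_j: "(\<lambda>N. complex_of_real (?K N j)) \<longlonglongrightarrow>
        lim_P_cumulant M (snd (kps ! j)) (replicate (fst (kps ! j)) (?As ! j))" if j: "j < n" for j
    proof -
      have "convergent (\<lambda>N. complex_of_real (?K N j))"
        using conv[OF j] by (rule convergent_of_real)
      moreover have "lim_P_cumulant M (snd (kps ! j)) (map (\<lambda>j. ?As ! j) (replicate (fst (kps ! j)) j)) =
        lim (\<lambda>N. complex_of_real (?K N j))"
        using lim_word[of "replicate (fst (kps ! j)) j" "snd (kps ! j)"] pj[OF j] j by (auto simp: set_replicate_conv_if)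
      ultimately show ?thesis by (simp add: convergent_LIMSEQ_iff)
    qed
    have "\<forall>\<^sub>F N in sequentially. complex_of_real (kap N (length ?w) (?f N ?w) (part_tensors kps)) = (\<Prod>j<n. complex_of_real (?K N j))"
      using eventually_ge_at_top[of 2] eventually_ge_at_top[of "2 * length ?w"]
      by eventually_elim (simp only: key(2) of_real_prod)
    moreover have "(\<lambda>N. \<Prod>j<n. complex_of_real (?K N j)) \<longlonglongrightarrow>
        (\<Prod>j<n. lim_P_cumulant M (snd (kps ! j)) (replicate (fst (kps ! j)) (?As ! j)))"
      by (intro tendsto_prod lim_j) simp
    ultimately have "(\<lambda>N. complex_of_real (kap N (length ?w) (?f N ?w) (part_tensors kps))) \<longlonglongrightarrow>
        (\<Prod>j<n. lim_P_cumulant M (snd (kps ! j)) (replicate (fst (kps ! j)) (?As ! j)))"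
      by (simp only: tendsto_cong)
    then show "lim_P_cumulant M (part_tensors kps) (concat (map2 (\<lambda>(k, p) A. replicate k A) kps ?As)) =
      (\<Prod>j<n. lim_P_cumulant M (snd (kps ! j)) (replicate (fst (kps ! j)) (?As ! j)))"
      unfolding As_w lim_word[OF w_set P] by (rule limI)
  qed
qed

lemma represented_marginal: "represented {0..} (\<lambda>t N. S N t)"
  unfolding represented_def
proof (intro conjI allI ballI impI)
  fix J' :: "real set" assume J': "J' \<subseteq> {0..}" "finite J'"
  define ts where "ts = sorted_list_of_set (insert 0 J')"
  define m where "m = length ts - 1"
  define u where "u i = ts ! min i m" for i
  define A where "A j = {t. u (Suc j) \<le> t}" for j
  have "finite (insert 0 J')" using J' by simp
  then have ts: "set ts = insert 0 J'" unfolding ts_def by (rule set_sorted_list_of_set)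
  have sorted: "sorted ts" unfolding ts_def by (rule sorted_sorted_list_of_set)
  then have len: "length ts = Suc m" unfolding m_def using ts by (cases ts) auto
  have u_mem: "u i \<in> insert 0 J'" for i unfolding u_def ts[symmetric] by (rule nth_mem) (simp add: len)
  have mono: "u i \<le> u j" if "i \<le> j" for i j
    unfolding u_def using that by (intro sorted_nth_mono[OF sorted]) (auto simp: len)
  have idx: "\<exists>i\<le>m. u i = t" if "t \<in> insert 0 J'" for t
  proof -
    obtain i where "i < length ts" "ts ! i = t" using \<open>t \<in> insert 0 J'\<close> ts by (metis in_set_conv_nth)
    then show ?thesis using len by (intro exI[of _ i]) (simp add: u_def)
  qed
  have u0: "u 0 = 0"
  proof -
    obtain i where "u i = 0" using idx[of 0] by blast
    then have "u 0 \<le> 0" using mono[of 0 i] by simp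
    moreover have "0 \<le> u 0" using u_mem[of 0] J'(1) by auto
    ultimately show ?thesis by simp
  qed
  have grid: "grid u" unfolding grid_def using u0 mono by simp
  show "\<exists>u m A. grid u \<and> (\<forall>N\<ge>2. AE \<omega> in M N. \<forall>j\<in>J'.
      S N j \<omega> = wprod A (restrict (grid_incr S N u \<omega>) {..<m}) m j)"
  proof (intro exI conjI allI impI)
    show "grid u" by (rule grid)
    fix N :: nat assume N: "2 \<le> N"
    show "AE \<omega> in M N. \<forall>j\<in>J'. S N j \<omega> = wprod A (restrict (grid_incr S N u \<omega>) {..<m}) m j"
      using S_0[OF N] AE_space
    proof eventually_elim
      case (elim \<omega>)
      show ?case
      proof
        fix t assume t: "t \<in> J'"
        obtain i where i: "i \<le> m" "u i = t" using idx t by blast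
        have Sp: "S N (u j) \<omega> \<in> perms N" for j
          using S_perms[OF N grid_nonneg[OF grid] elim(2)] .
        have "wprod A (grid_incr S N u \<omega>) n t = S N (min (u n) t) \<omega>" for n
        proof (induction n)
          case 0
          have "min (u 0) t = 0" using u0 t J'(1) by auto
          then show ?case using elim(1) by (simp only: wprod.simps)
        next
          case (Suc n)
          show ?case
          proof (cases "u (Suc n) \<le> t")
            case True
            then have "u n \<le> t" using mono[of n "Suc n"] by simp
            then have mins: "min (u n) t = u n" "min (u (Suc n)) t = u (Suc n)" using True by simp_all
            have "ext (A n) (grid_incr S N u \<omega> n) t = grid_incr S N u \<omega> n" using True by (simp add: ext_def A_def)
            then have "wprod A (grid_incr S N u \<omega>) (Suc n) t = S N (u (Suc n)) \<omega> \<circ> inv_into UNIV (S N (u n) \<omega>) \<circ> S N (u n) \<omega>"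
              unfolding wprod.simps Suc mins grid_incr_def by (simp only:)
            also have "\<dots> = S N (u (Suc n)) \<omega>" using Sp[of n] by (auto simp: fun_eq_iff permutes_inverses)
            finally show ?thesis unfolding mins .
          next
            case False
            then have "i \<le> n" using mono[of "Suc n" i] i(2) by (meson not_less_eq_eq)
            then have "t \<le> u n" using mono[of i n] i(2) by simp
            then have mins: "min (u n) t = t" "min (u (Suc n)) t = t" using False by simp_all
            have "ext (A n) (grid_incr S N u \<omega> n) t = id" using False by (simp add: ext_def A_def)
            then show ?thesis unfolding wprod.simps Suc mins by (simp only: id_comp)
          qed
        qed
        from this[of m] have "wprod A (grid_incr S N u \<omega>) m t = S N t \<omega>"
          using mono[OF i(1)] i(2) by (simp add: min_def)
        moreover have "wprod A (restrict (grid_incr S N u \<omega>) {..<m}) m t = wprod A (grid_incr S N u \<omega>) m t"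
          by (rule wprod_cong) (simp only: restrict_apply' lessThan_iff)
        ultimately show "S N t \<omega> = wprod A (restrict (grid_incr S N u \<omega>) {..<m}) m t" by (simp only:)
      qed
    qed
  qed
qed (use S_measurable in auto)

lemma marginal_P_converges: "P_converges M {0..} (marginal S)"
proof -
  have "marginal S = (\<lambda>t N \<omega>. perm_mat N (S N t \<omega>))" by (intro ext) (simp only: marginal_def)
  then show ?thesis using represented_P_converges[OF represented_marginal] by simp
qed

lemma start_at_id:
  assumes ts: "set ts \<subseteq> {0..}" and p: "p \<in> Parts (length ts)" and N: "2 \<le> N"
  shows "E_P_moment M p (map (marginal S) ts) N = E_P_moment M p (map (marginal (reset_at_0 S)) ts) N"
proof -
  let ?k = "length ts"
  define R where "R t N \<omega> = (if t = 0 then id else S N t \<omega>)" for t N \<omega>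
  have nn: "0 \<le> ts ! l" if "l < ?k" for l using ts that by (meson atLeast_iff nth_mem subsetD)
  obtain u m A where u: "grid u" and W: "\<forall>N\<ge>2. AE \<omega> in M N. \<forall>j\<in>set ts.
      S N j \<omega> = wprod A (restrict (grid_incr S N u \<omega>) {..<m}) m j"
    using represented_marginal ts unfolding represented_def by blast
  let ?W = "\<lambda>g l. wprod A g m (ts ! l)"
  have WS: "AE \<omega> in M N. \<forall>l<?k. S N (ts ! l) \<omega> = ?W (restrict (grid_incr S N u \<omega>) {..<m}) l"
    using W[rule_format, OF N] by eventually_elim simp
  have WR: "AE \<omega> in M N. \<forall>l<?k. R (ts ! l) N \<omega> = ?W (restrict (grid_incr S N u \<omega>) {..<m}) l"
    using WS S_0[OF N] by eventually_elim (auto simp: R_def)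
  have RM: "R (ts ! l) N \<in> measurable (M N) (count_space (perms N))" if "l < ?k" for l
    using S_measurable[OF N nn[OF that]] id_perms[of N] unfolding R_def[abs_def] by (cases "ts ! l = 0") auto
  have m1: "map (marginal S) ts = map (\<lambda>l N \<omega>. perm_mat N (S N (ts ! l) \<omega>)) [0..<?k]"
    by (rule nth_equalityI) (simp_all add: marginal_def[abs_def])
  have "marginal (reset_at_0 S) = (\<lambda>t N \<omega>. perm_mat N (R t N \<omega>))"
    by (intro ext) (simp only: marginal_def reset_at_0_def R_def)
  then have m2: "map (marginal (reset_at_0 S)) ts = map (\<lambda>l N \<omega>. perm_mat N (R (ts ! l) N \<omega>)) [0..<?k]"
    by (intro nth_equalityI) simp_all
  show ?thesis
    unfolding m1 m2
    using E_P_moment_word(2)[where Y = "\<lambda>l N. S N (ts ! l)" and W = ?W, OF N p S_measurable[OF N nn] u WS]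
      E_P_moment_word(2)[where Y = "\<lambda>l. R (ts ! l)" and W = ?W, OF N p RM u WR] by simp
qed

lemma E_P_moment_increment:
  assumes st: "0 \<le> s" "s \<le> t" and p: "p \<in> Parts k" and N: "2 \<le> N"
    and Y: "Y N \<in> measurable (M N) (count_space (perms N))"
    and eq: "AE \<omega> in M N. Y N \<omega> = S N t \<omega> \<circ> inv_into UNIV (S N s \<omega>)"
  shows "E_P_moment M p (replicate k (\<lambda>N \<omega>. perm_mat N (Y N \<omega>))) N =
    of_real (mom N k p (law_tensor N k {..<k} (walk_heat L (t - s) N)))"
proof -
  let ?u = "seq_grid 1 (\<lambda>_. s) (\<lambda>_. t)"
  have succ: "successive 1 (\<lambda>_. s) (\<lambda>_. t)" using st by (simp add: successive_def)
  have W: "AE \<omega> in M N. \<forall>l<k. Y N \<omega> = restrict (grid_incr S N ?u \<omega>) {..<2} (replicate k 1 ! l)"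
    using eq
  proof eventually_elim
    case (elim \<omega>)
    show ?case
    proof (intro allI impI)
      fix l assume "l < k"
      then show "Y N \<omega> = restrict (grid_incr S N ?u \<omega>) {..<2} (replicate k 1 ! l)"
        using incr_grid_incr[of 0 1 N "\<lambda>_. t" \<omega> "\<lambda>_. s"] elim by (simp only: nth_replicate) simp
    qed
  qed
  have "replicate k (\<lambda>N \<omega>. perm_mat N (Y N \<omega>)) = map (\<lambda>l N \<omega>. perm_mat N (Y N \<omega>)) [0..<k]"
    by (rule nth_equalityI) simp_all
  then have "E_P_moment M p (replicate k (\<lambda>N \<omega>. perm_mat N (Y N \<omega>))) N =
    of_real (mom N k p (grid_tensor L ?u N 2 k (\<lambda>g l. g (replicate k 1 ! l))))"
    using E_P_moment_word(2)[where Y = "\<lambda>l. Y" and W = "\<lambda>g l. g (replicate k 1 ! l)", OF N p Y grid_seq_grid[OF succ] W] by simp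
  also have "grid_tensor L ?u N 2 k (\<lambda>g l. g (replicate k 1 ! l)) = letters_tensor ?u 2 N (replicate k 1)"
    using sum_grid_letters[of "replicate k 1" 2 ?u N] by (intro ext) (simp add: set_replicate_conv_if)
  also have "\<dots> = law_tensor N k {..<k} (walk_heat L (?u (Suc 1) - ?u 1) N)"
    by (rule letters_tensor_replicate[OF N]) simp
  also have "?u (Suc 1) - ?u 1 = t - s"
    using seq_grid_vals[of 0 1 "\<lambda>_. s" "\<lambda>_. t"] by simp
  finally show ?thesis .
qed

lemma limit_identity:
  assumes p: "p \<in> Parts k"
  shows "lim (\<lambda>N. P_moment N p (replicate k (1\<^sub>m N))) = 1"
proof (rule limI, rule tendsto_eventually)
  show "\<forall>\<^sub>F N in sequentially. P_moment N p (replicate k (1\<^sub>m N)) = 1"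
    using eventually_gt_at_top[of 0]
  proof eventually_elim
    case (elim N)
    have "1\<^sub>m N = perm_mat N id" by (rule eq_matI) (simp_all add: perm_mat_def)
    then have "replicate k (1\<^sub>m N) = map (\<lambda>l. perm_mat N id) [0..<k]" by (intro nth_equalityI) simp_all
    then show ?case using P_moment_perm[OF p, of N "\<lambda>_. id"] mom_word_id[OF p elim] by (simp only: of_real_1)
  qed
qed

lemma levy: "multiplicative_P_levy M S"
  unfolding multiplicative_P_levy_def
proof (intro conjI allI impI ballI)
  fix ts :: "real list" and p assume "set ts \<subseteq> {0..} \<and> p \<in> Parts (length ts)"
  note ts = this
  have "\<forall>\<^sub>F N in sequentially. E_P_moment M p (map (marginal S) ts) N -
      E_P_moment M p (map (marginal (reset_at_0 S)) ts) N = 0"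
    using eventually_ge_at_top[of 2] by eventually_elim (use start_at_id ts in simp)
  then show "(\<lambda>N. E_P_moment M p (map (marginal S) ts) N -
      E_P_moment M p (map (marginal (reset_at_0 S)) ts) N) \<longlonglongrightarrow> 0" by (rule tendsto_eventually)
next
  fix k p assume p: "p \<in> Parts k"
  obtain a where a: "\<And>t. (\<lambda>N. mom N k p (law_tensor N k {..<k} (walk_heat L t N))) \<longlonglongrightarrow> a t" and a0: "(a \<longlongrightarrow> 1) (at_right 0)"
    using heat_mom_limit[OF classes converge p] by blast
  show "\<exists>\<mu>. \<forall>s t. 0 \<le> s \<and> s \<le> t \<longrightarrow> E_P_moment M p (replicate k (increment S s t)) \<longlonglongrightarrow> \<mu> (t - s)"
  proof (intro exI allI impI)
    fix s t :: real assume st: "0 \<le> s \<and> s \<le> t"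
    have "\<forall>\<^sub>F N in sequentially. E_P_moment M p (replicate k (increment S s t)) N =
        of_real (mom N k p (law_tensor N k {..<k} (walk_heat L (t - s) N)))"
      using eventually_ge_at_top[of 2]
    proof eventually_elim
      case (elim N)
      have i: "increment S s t = (\<lambda>N \<omega>. perm_mat N (S N t \<omega> \<circ> inv_into UNIV (S N s \<omega>)))"
        by (intro ext) (simp only: increment_def)
      show ?case unfolding i
        by (rule E_P_moment_increment[where Y = "\<lambda>N \<omega>. S N t \<omega> \<circ> inv_into UNIV (S N s \<omega>)", OF _ _ p elim])
          (use st incr_measurable[OF elim] in auto)
    qed
    then show "E_P_moment M p (replicate k (increment S s t)) \<longlonglongrightarrow> complex_of_real (a (t - s))"
      using tendsto_of_real[OF a] by (simp only: tendsto_cong)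
  qed
  have lim_a: "lim (E_P_moment M p (replicate k (marginal S t))) = complex_of_real (a t)" if t: "0 < t" for t
  proof (rule limI)
    have "\<forall>\<^sub>F N in sequentially. E_P_moment M p (replicate k (marginal S t)) N =
        of_real (mom N k p (law_tensor N k {..<k} (walk_heat L (t - 0) N)))"
      using eventually_ge_at_top[of 2]
    proof eventually_elim
      case (elim N)
      have i: "marginal S t = (\<lambda>N \<omega>. perm_mat N (S N t \<omega>))" by (intro ext) (simp only: marginal_def)
      show ?case unfolding i
      proof (rule E_P_moment_increment[where Y = "\<lambda>N. S N t", OF _ _ p elim])
        show "AE \<omega> in M N. S N t \<omega> = S N t \<omega> \<circ> inv_into UNIV (S N 0 \<omega>)"
          using S_0[OF elim] by eventually_elim (simp add: inv_id)
      qed (use t S_measurable[OF elim] in auto)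
    qed
    then show "E_P_moment M p (replicate k (marginal S t)) \<longlonglongrightarrow> complex_of_real (a t)"
      using tendsto_of_real[OF a] by (simp only: tendsto_cong diff_0_right)
  qed
  have "((\<lambda>t. complex_of_real (a t)) \<longlongrightarrow> of_real 1) (at_right 0)" by (rule tendsto_of_real[OF a0])
  moreover have "\<forall>\<^sub>F t in at_right 0. lim (E_P_moment M p (replicate k (marginal S t))) = complex_of_real (a t)"
    using lim_a by (auto simp: eventually_at_filter)
  ultimately show "((\<lambda>t. lim (E_P_moment M p (replicate k (marginal S t)))) \<longlongrightarrow>
      lim (\<lambda>N. P_moment N p (replicate k (1\<^sub>m N)))) (at_right 0)"
    unfolding limit_identity[OF p] by (simp only: tendsto_cong of_real_1)
next
  fix n s t assume "successive_intervals n s t"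
  then have "successive n s t" unfolding successive_intervals_def successive_def by (auto simp: less_imp_le)
  then show "P_free M (increments S n s t)" by (rule P_free_increments)
qed

end

section \<open>Fixed points under class functions\<close>

definition fixes_of :: "nat \<Rightarrow> (nat \<Rightarrow> nat) \<Rightarrow> real" where
  "fixes_of N \<sigma> = (\<Sum>x<N. of_bool (\<sigma> x = x))"

definition law_of :: "nat \<Rightarrow> ((nat \<Rightarrow> nat) \<Rightarrow> real) \<Rightarrow> ((nat \<Rightarrow> nat) \<Rightarrow> bool) \<Rightarrow> real" where
  "law_of N wt Q = (\<Sum>g\<in>perms N. wt g * of_bool (Q g))"

lemma two_point:
  assumes wt: "class_weight N wt" and xy: "x < N" "y < N" "x' < N" "y' < N" "x = y \<longleftrightarrow> x' = y'"
    and Q: "\<And>\<tau> g. \<tau> \<in> perms N \<Longrightarrow> g \<in> perms N \<Longrightarrow> Q (\<tau> \<circ> g \<circ> inv_into UNIV \<tau>) (\<tau> x) (\<tau> y) \<longleftrightarrow> Q g x y"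
  shows "law_of N wt (\<lambda>g. Q g x' y') = law_of N wt (\<lambda>g. Q g x y)"
proof -
  obtain \<tau> where \<tau>: "\<tau> \<in> perms N" "x' = \<tau> x" "y' = \<tau> y"
  proof -
    have "\<exists>\<tau>\<in>perms N. \<forall>b\<in>UNIV. (if b then x' else y') = \<tau> (if b then x else y)"
      using xy by (intro extend_to_perm) auto
    then obtain \<tau> where "\<tau> \<in> perms N" "\<forall>b. (if b then x' else y') = \<tau> (if b then x else y)" by auto
    from this(2)[rule_format, of True] this(2)[rule_format, of False] this(1) show ?thesis
      by (intro that) auto
  qed
  have "law_of N wt (\<lambda>g. Q g x' y') =
    (\<Sum>g\<in>perms N. wt (\<tau> \<circ> g \<circ> inv_into UNIV \<tau>) * of_bool (Q (\<tau> \<circ> g \<circ> inv_into UNIV \<tau>) (\<tau> x) (\<tau> y)))"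
    unfolding law_of_def \<tau>(2,3)
    by (rule sum_perms_conj[OF \<tau>(1), of "\<lambda>g. wt g * of_bool (Q g (\<tau> x) (\<tau> y))", symmetric])
  also have "\<dots> = law_of N wt (\<lambda>g. Q g x y)"
    unfolding law_of_def
  proof (intro sum.cong refl arg_cong2[where f = "(*)"])
    fix g assume g: "g \<in> perms N"
    show "wt (\<tau> \<circ> g \<circ> inv_into UNIV \<tau>) = wt g" using wt \<tau>(1) g unfolding class_weight_def by blast
    show "of_bool (Q (\<tau> \<circ> g \<circ> inv_into UNIV \<tau>) (\<tau> x) (\<tau> y)) = (of_bool (Q g x y) :: real)"
      using Q[OF \<tau>(1) g] by simp
  qed
  finally show ?thesis .
qed

definition equivariant :: "nat \<Rightarrow> ((nat \<Rightarrow> nat) \<Rightarrow> nat \<Rightarrow> nat) \<Rightarrow> bool" where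
  "equivariant N F \<longleftrightarrow> (\<forall>g\<in>perms N. F g \<in> perms N) \<and>
    (\<forall>\<tau>\<in>perms N. \<forall>g\<in>perms N. F (\<tau> \<circ> g \<circ> inv_into UNIV \<tau>) = \<tau> \<circ> F g \<circ> inv_into UNIV \<tau>)"

lemma equivariant_self: "equivariant N (\<lambda>g. g)"
  by (simp add: equivariant_def)

lemma equivariant_square: "equivariant N (\<lambda>g. g \<circ> g)"
  unfolding equivariant_def
proof (intro conjI ballI)
  fix \<tau> g assume "\<tau> \<in> perms N" "g \<in> perms N"
  then show "\<tau> \<circ> g \<circ> inv_into UNIV \<tau> \<circ> (\<tau> \<circ> g \<circ> inv_into UNIV \<tau>) = \<tau> \<circ> (g \<circ> g) \<circ> inv_into UNIV \<tau>"
    by (auto simp: fun_eq_iff permutes_inverses)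
qed (rule perms_compose)

definition fix_rate :: "nat \<Rightarrow> ((nat \<Rightarrow> nat) \<Rightarrow> real) \<Rightarrow> ((nat \<Rightarrow> nat) \<Rightarrow> nat \<Rightarrow> nat) \<Rightarrow> real" where
  "fix_rate N wt F = (\<Sum>g\<in>perms N. wt g * fixes_of N (F g)) / real N"

lemma one_point_law:
  assumes wt: "class_weight N wt" and F: "equivariant N F" and N: "2 \<le> N" and xy: "x < N" "y < N"
  shows "law_of N wt (\<lambda>g. F g x = y) =
    (if x = y then fix_rate N wt F else ((\<Sum>g\<in>perms N. wt g) - fix_rate N wt F) / (real N - 1))"
proof -
  have eqv: "F (\<tau> \<circ> g \<circ> inv_into UNIV \<tau>) (\<tau> a) = \<tau> b \<longleftrightarrow> F g a = b"
    if "\<tau> \<in> perms N" "g \<in> perms N" for \<tau> g a b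
  proof -
    have "F (\<tau> \<circ> g \<circ> inv_into UNIV \<tau>) (\<tau> a) = (\<tau> \<circ> F g \<circ> inv_into UNIV \<tau>) (\<tau> a)"
      using F that unfolding equivariant_def by simp
    also have "\<dots> = \<tau> (F g a)" using that(1) by (simp add: permutes_inverses)
    finally show ?thesis using that(1) permutes_inj[of \<tau> "{..<N}"] by (simp add: inj_eq)
  qed
  have same: "law_of N wt (\<lambda>g. F g x' = y') = law_of N wt (\<lambda>g. F g x = y)"
    if "x < N" "y < N" "x' < N" "y' < N" "x = y \<longleftrightarrow> x' = y'" for x y x' y'
    using two_point[OF wt that, of "\<lambda>g a b. F g a = b"] eqv by blast
  have diag: "law_of N wt (\<lambda>g. F g x = x) = fix_rate N wt F" if x: "x < N" for x
  proof -
    have "(\<Sum>g\<in>perms N. wt g * fixes_of N (F g)) = (\<Sum>z<N. law_of N wt (\<lambda>g. F g z = z))"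
      unfolding fixes_of_def law_of_def sum_distrib_left by (rule sum.swap)
    also have "\<dots> = (\<Sum>z<N. law_of N wt (\<lambda>g. F g x = x))"
      by (intro sum.cong refl same[OF x x]) simp_all
    finally show ?thesis using N by (simp add: fix_rate_def)
  qed
  show ?thesis
  proof (cases "x = y")
    case True
    then show ?thesis using diag xy by simp
  next
    case False
    have "(\<Sum>g\<in>perms N. wt g) = (\<Sum>g\<in>perms N. \<Sum>z<N. wt g * of_bool (F g x = z))"
    proof (intro sum.cong refl)
      fix g assume "g \<in> perms N"
      then have "F g x < N" using F xy perms_less unfolding equivariant_def by blast
      then have "(\<Sum>z<N. of_bool (F g x = z)) = (1::real)" by (simp add: of_bool_def sum.delta)
      then show "wt g = (\<Sum>z<N. wt g * of_bool (F g x = z))" by (simp only: sum_distrib_left[symmetric] mult_1_right)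
    qed
    also have "\<dots> = (\<Sum>z<N. law_of N wt (\<lambda>g. F g x = z))"
      unfolding law_of_def by (rule sum.swap)
    also have "\<dots> = law_of N wt (\<lambda>g. F g x = x) + (\<Sum>z\<in>{..<N} - {x}. law_of N wt (\<lambda>g. F g x = z))"
      using xy by (intro sum.remove) auto
    also have "(\<Sum>z\<in>{..<N} - {x}. law_of N wt (\<lambda>g. F g x = z)) = (\<Sum>z\<in>{..<N} - {x}. law_of N wt (\<lambda>g. F g x = y))"
      by (intro sum.cong refl same[OF xy]) (use False xy in auto)
    also have "\<dots> = (real N - 1) * law_of N wt (\<lambda>g. F g x = y)"
      using xy N by (simp add: of_nat_diff)
    finally have "(\<Sum>g\<in>perms N. wt g) - fix_rate N wt F = (real N - 1) * law_of N wt (\<lambda>g. F g x = y)"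
      using diag xy by simp
    then show ?thesis using False N by simp
  qed
qed

lemma fixes_of_bounds: "0 \<le> fixes_of N \<sigma>" "fixes_of N \<sigma> \<le> real N"
proof -
  show "0 \<le> fixes_of N \<sigma>" unfolding fixes_of_def by (rule sum_nonneg) simp
  have "fixes_of N \<sigma> \<le> (\<Sum>x<N. 1)" unfolding fixes_of_def by (rule sum_mono) simp
  then show "fixes_of N \<sigma> \<le> real N" by simp
qed

lemma fixes_of_card: "fixes_of N \<sigma> = real (card {x \<in> {..<N}. \<sigma> x = x})"
proof -
  have "fixes_of N \<sigma> = (\<Sum>x<N. if \<sigma> x = x then 1 else 0)" unfolding fixes_of_def by (intro sum.cong) auto
  then show ?thesis by (simp add: sum.inter_filter[symmetric])
qed

locale class_law =
  fixes N :: nat and p :: "(nat \<Rightarrow> nat) \<Rightarrow> real"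
  assumes N: "2 \<le> N" and p: "class_weight N p" and p_nonneg: "\<And>g. g \<in> perms N \<Longrightarrow> 0 \<le> p g"
    and p_sum: "(\<Sum>g\<in>perms N. p g) = 1"
begin

abbreviation "fix1 \<equiv> fix_rate N p (\<lambda>g. g)"
abbreviation "fix2 \<equiv> fix_rate N p (\<lambda>g. g \<circ> g)"

lemma fix_rate_bounds: "0 \<le> fix_rate N p F" "fix_rate N p F \<le> 1"
proof -
  show "0 \<le> fix_rate N p F"
    unfolding fix_rate_def using p_nonneg fixes_of_bounds(1) by (intro divide_nonneg_nonneg sum_nonneg) auto
  have "(\<Sum>g\<in>perms N. p g * fixes_of N (F g)) \<le> (\<Sum>g\<in>perms N. p g * real N)"
    using p_nonneg fixes_of_bounds(2) by (intro sum_mono mult_left_mono) auto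
  also have "\<dots> = real N" by (simp add: sum_distrib_right[symmetric] p_sum)
  finally show "fix_rate N p F \<le> 1" unfolding fix_rate_def using N by simp
qed

definition swap_law :: "nat \<Rightarrow> nat \<Rightarrow> real" where
  "swap_law x y = law_of N p (\<lambda>g. g x = y \<and> g y = x)"

definition pair_fix :: real where
  "pair_fix = law_of N p (\<lambda>g. g 0 = 0 \<and> g 1 = 1)"

lemma conj_apply: "\<tau> \<in> perms N \<Longrightarrow> (\<tau> \<circ> g \<circ> inv_into UNIV \<tau>) (\<tau> a) = \<tau> b \<longleftrightarrow> g a = b"
  using permutes_inj[of \<tau> "{..<N}"] by (simp add: permutes_inverses inj_eq)

lemma pair_fix_law:
  assumes "x < N" "y < N" "x \<noteq> y"
  shows "law_of N p (\<lambda>g. g x = x \<and> g y = y) = pair_fix"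
  unfolding pair_fix_def
  using assms N two_point[OF p, of 0 1 x y "\<lambda>g a b. g a = a \<and> g b = b"] conj_apply by simp

lemma sum_off_diag:
  "(\<Sum>x<N. \<Sum>y\<in>{..<N} - {x}. law_of N p (Q x y)) = (\<Sum>g\<in>perms N. p g * (\<Sum>x<N. \<Sum>y\<in>{..<N} - {x}. of_bool (Q x y g)))"
proof -
  have "(\<Sum>x<N. \<Sum>y\<in>{..<N} - {x}. law_of N p (Q x y)) = (\<Sum>x<N. \<Sum>g\<in>perms N. \<Sum>y\<in>{..<N} - {x}. p g * of_bool (Q x y g))"
    unfolding law_of_def by (intro sum.cong refl sum.swap)
  also have "\<dots> = (\<Sum>g\<in>perms N. \<Sum>x<N. \<Sum>y\<in>{..<N} - {x}. p g * of_bool (Q x y g))" by (rule sum.swap)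
  finally show ?thesis unfolding sum_distrib_left .
qed

lemma sum_swap_law: "(\<Sum>x<N. \<Sum>y\<in>{..<N} - {x}. swap_law x y) = real N * (fix2 - fix1)"
proof -
  have "(\<Sum>x<N. \<Sum>y\<in>{..<N} - {x}. of_bool (g x = y \<and> g y = x)) = fixes_of N (g \<circ> g) - fixes_of N g"
    if g: "g \<in> perms N" for g
  proof -
    have "(\<Sum>y\<in>{..<N} - {x}. of_bool (g x = y \<and> g y = x)) = of_bool ((g \<circ> g) x = x) - (of_bool (g x = x) :: real)"
      if x: "x < N" for x
    proof -
      have "(\<Sum>y\<in>{..<N} - {x}. of_bool (g x = y \<and> g y = x)) =
        (\<Sum>y\<in>{..<N} - {x}. if y = g x then of_bool (g (g x) = x) else (0::real))"
        by (intro sum.cong refl) auto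
      also have "\<dots> = (if g x \<in> {..<N} - {x} then of_bool (g (g x) = x) else 0)"
        by (rule sum.delta) simp
      finally show ?thesis using perms_less[OF g x] by auto
    qed
    then show ?thesis unfolding fixes_of_def by (simp add: sum_subtractf)
  qed
  then have "(\<Sum>x<N. \<Sum>y\<in>{..<N} - {x}. swap_law x y) = (\<Sum>g\<in>perms N. p g * (fixes_of N (g \<circ> g) - fixes_of N g))"
    unfolding swap_law_def sum_off_diag by (intro sum.cong refl) simp
  then show ?thesis using N unfolding fix_rate_def by (simp add: right_diff_distrib sum_subtractf)
qed

lemma fix1_le_fix2: "fix1 \<le> fix2"
proof -
  have "fixes_of N g \<le> fixes_of N (g \<circ> g)" for g
    unfolding fixes_of_def by (intro sum_mono) auto
  then show ?thesis unfolding fix_rate_def using p_nonneg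
    by (intro divide_right_mono sum_mono mult_left_mono) auto
qed

text \<open>The Cauchy-Schwarz inequality for the number of fixed points.\<close>

lemma pair_fix_ge: "(real N * fix1\<^sup>2 - fix1) / (real N - 1) \<le> pair_fix"
proof -
  have pw: "(\<Sum>x<N. \<Sum>y\<in>{..<N} - {x}. of_bool (g x = x \<and> g y = y)) = (fixes_of N g)\<^sup>2 - fixes_of N g" for g
  proof -
    have "(fixes_of N g)\<^sup>2 = (\<Sum>x<N. \<Sum>y<N. of_bool (g x = x \<and> g y = y))"
      unfolding fixes_of_def power2_eq_square sum_product by (simp add: of_bool_conj)
    also have "\<dots> = (\<Sum>x<N. of_bool (g x = x) + (\<Sum>y\<in>{..<N} - {x}. of_bool (g x = x \<and> g y = y)))"
      by (intro sum.cong refl, subst sum.remove) auto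
    finally show ?thesis unfolding fixes_of_def by (simp add: sum.distrib)
  qed
  have "(\<Sum>x<N. \<Sum>y\<in>{..<N} - {x}. law_of N p (\<lambda>g. g x = x \<and> g y = y)) = (\<Sum>x<N. \<Sum>y\<in>{..<N} - {x}. pair_fix)"
    by (intro sum.cong refl pair_fix_law) auto
  also have "\<dots> = real N * (real N - 1) * pair_fix" using N by (simp add: of_nat_diff)
  finally have eq: "real N * (real N - 1) * pair_fix = (\<Sum>g\<in>perms N. p g * ((fixes_of N g)\<^sup>2 - fixes_of N g))"
    unfolding sum_off_diag pw by simp
  define m where "m = real N * fix1"
  have m: "(\<Sum>g\<in>perms N. p g * fixes_of N g) = m" using N by (simp add: fix_rate_def m_def)
  have "0 \<le> (\<Sum>g\<in>perms N. p g * (fixes_of N g - m)\<^sup>2)"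
    using p_nonneg by (intro sum_nonneg) auto
  also have "\<dots> = (\<Sum>g\<in>perms N. p g * (fixes_of N g)\<^sup>2) - 2 * m * (\<Sum>g\<in>perms N. p g * fixes_of N g) + m\<^sup>2 * (\<Sum>g\<in>perms N. p g)"
  proof -
    have "p g * (fixes_of N g - m)\<^sup>2 = p g * (fixes_of N g)\<^sup>2 - 2 * m * (p g * fixes_of N g) + m\<^sup>2 * p g" for g
      by (simp add: power2_eq_square algebra_simps)
    then show ?thesis by (simp only: sum.distrib sum_subtractf sum_distrib_left[symmetric])
  qed
  also have "\<dots> = (\<Sum>g\<in>perms N. p g * (fixes_of N g)\<^sup>2) - m\<^sup>2"
    unfolding m p_sum by (simp add: power2_eq_square)
  finally have "m\<^sup>2 - m \<le> real N * (real N - 1) * pair_fix"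
  proof -
    have "real N * (real N - 1) * pair_fix = (\<Sum>g\<in>perms N. p g * (fixes_of N g)\<^sup>2) - m"
      unfolding eq by (simp only: right_diff_distrib sum_subtractf m)
    then show "0 \<le> (\<Sum>g\<in>perms N. p g * (fixes_of N g)\<^sup>2) - m\<^sup>2 \<Longrightarrow> m\<^sup>2 - m \<le> real N * (real N - 1) * pair_fix"
      by simp
  qed
  then have "real N * (real N * fix1\<^sup>2 - fix1) \<le> real N * ((real N - 1) * pair_fix)"
    by (simp add: power2_eq_square algebra_simps m_def)
  then show ?thesis using N by (simp add: divide_le_eq mult.commute)
qed

end

locale two_laws = A: class_law N p + B: class_law N q for N p q
begin

definition expect :: "((nat \<Rightarrow> nat) \<Rightarrow> (nat \<Rightarrow> nat) \<Rightarrow> real) \<Rightarrow> real" where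
  "expect F = (\<Sum>g\<in>perms N. \<Sum>h\<in>perms N. p g * q h * F g h)"

lemma expect_sum: "expect (\<lambda>g h. \<Sum>x\<in>X. F x g h) = (\<Sum>x\<in>X. expect (F x))"
proof -
  have "expect (\<lambda>g h. \<Sum>x\<in>X. F x g h) = (\<Sum>g\<in>perms N. \<Sum>x\<in>X. \<Sum>h\<in>perms N. p g * q h * F x g h)"
    unfolding expect_def sum_distrib_left by (intro sum.cong refl sum.swap)
  then show ?thesis unfolding expect_def by (simp only: sum.swap[of _ X])
qed

lemma expect_prod: "expect (\<lambda>g h. F g * G h) = (\<Sum>g\<in>perms N. p g * F g) * (\<Sum>h\<in>perms N. q h * G h)"
  unfolding expect_def sum_product by (simp add: mult_ac)

lemma expect_left: "expect (\<lambda>g h. F g) = (\<Sum>g\<in>perms N. p g * F g)"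
  using expect_prod[of F "\<lambda>_. 1"] by (simp add: B.p_sum)

lemma expect_right: "expect (\<lambda>g h. F h) = (\<Sum>h\<in>perms N. q h * F h)"
  using expect_prod[of "\<lambda>_. 1" F] by (simp add: A.p_sum)

lemma expect_mono: "(\<And>g h. g \<in> perms N \<Longrightarrow> h \<in> perms N \<Longrightarrow> F g h \<le> G g h) \<Longrightarrow> expect F \<le> expect G"
  unfolding expect_def using A.p_nonneg B.p_nonneg by (intro sum_mono mult_left_mono) auto

lemma expect_cong: "(\<And>g h. g \<in> perms N \<Longrightarrow> h \<in> perms N \<Longrightarrow> F g h = G g h) \<Longrightarrow> expect F = expect G"
  unfolding expect_def by (intro sum.cong refl) auto

lemma expect_fixes_comp:
  assumes F: "equivariant N F" and G: "equivariant N G"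
  shows "expect (\<lambda>g h. fixes_of N (F g \<circ> G h)) / real N =
    fix_rate N p F * fix_rate N q G + (1 - fix_rate N p F) * (1 - fix_rate N q G) / (real N - 1)"
proof -
  let ?a = "fix_rate N p F" and ?b = "fix_rate N q G"
  have pw: "fixes_of N (F g \<circ> G h) = (\<Sum>x<N. \<Sum>y<N. of_bool (F g y = x) * of_bool (G h x = y))"
    if h: "h \<in> perms N" for g h
  proof -
    have "(\<Sum>y<N. of_bool (F g y = x) * of_bool (G h x = y)) = (of_bool ((F g \<circ> G h) x = x) :: real)" if x: "x < N" for x
    proof -
      have "G h x < N" using G h x perms_less unfolding equivariant_def by blast
      moreover have "(\<Sum>y<N. of_bool (F g y = x) * of_bool (G h x = y)) =
        (\<Sum>y<N. if y = G h x then of_bool (F g (G h x) = x) else (0::real))"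
        by (intro sum.cong refl) auto
      ultimately show ?thesis by (simp add: sum.delta)
    qed
    then show ?thesis unfolding fixes_of_def by (intro sum.cong refl) simp
  qed
  have "expect (\<lambda>g h. fixes_of N (F g \<circ> G h)) =
    expect (\<lambda>g h. \<Sum>x<N. \<Sum>y<N. of_bool (F g y = x) * of_bool (G h x = y))"
    by (rule expect_cong) (rule pw)
  also have "\<dots> = (\<Sum>x<N. \<Sum>y<N. law_of N p (\<lambda>g. F g y = x) * law_of N q (\<lambda>h. G h x = y))"
    unfolding expect_sum expect_prod law_of_def ..
  also have "\<dots> = (\<Sum>x<N. \<Sum>y<N. if y = x then ?a * ?b else (1 - ?a) * (1 - ?b) / (real N - 1)\<^sup>2)"
    by (intro sum.cong refl)
      (auto simp: one_point_law[OF A.p F A.N] one_point_law[OF B.p G A.N] A.p_sum B.p_sum power2_eq_square)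
  also have "\<dots> = (\<Sum>x<N. ?a * ?b + (\<Sum>y\<in>{..<N} - {x}. (1 - ?a) * (1 - ?b) / (real N - 1)\<^sup>2))"
    by (intro sum.cong refl, subst sum.remove) auto
  also have "\<dots> = real N * (?a * ?b + (real N - 1) * ((1 - ?a) * (1 - ?b) / (real N - 1)\<^sup>2))"
    using A.N by (simp add: of_nat_diff)
  also have "(real N - 1) * ((1 - ?a) * (1 - ?b) / (real N - 1)\<^sup>2) = (1 - ?a) * (1 - ?b) / (real N - 1)"
    using A.N by (simp add: power2_eq_square)
  finally have eq: "expect (\<lambda>g h. fixes_of N (F g \<circ> G h)) = real N * (?a * ?b + (1 - ?a) * (1 - ?b) / (real N - 1))" .
  show ?thesis unfolding eq using A.N by simp
qed

text \<open>
  A point is fixed by \<open>g h g h\<close> if both fix it, or if one of them swaps it with some other point and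
  the other one fixes the two points.
\<close>

lemma expect_fixes_ghgh:
  "A.fix1 * B.fix1 + (B.fix2 - B.fix1) * A.pair_fix + (A.fix2 - A.fix1) * B.pair_fix \<le>
    expect (\<lambda>g h. fixes_of N (g \<circ> h \<circ> g \<circ> h)) / real N"
proof -
  let ?F1 = "\<lambda>x (g :: nat \<Rightarrow> nat) (h :: nat \<Rightarrow> nat). of_bool (g x = x) * of_bool (h x = x) :: real"
  let ?F2 = "\<lambda>x y (g :: nat \<Rightarrow> nat) (h :: nat \<Rightarrow> nat). of_bool (g x = x \<and> g y = y) * of_bool (h x = y \<and> h y = x) :: real"
  let ?F3 = "\<lambda>x y (g :: nat \<Rightarrow> nat) (h :: nat \<Rightarrow> nat). of_bool (g x = y \<and> g y = x) * of_bool (h x = x \<and> h y = y) :: real"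
  have pw: "(\<Sum>x<N. ?F1 x g h + (\<Sum>y\<in>{..<N} - {x}. ?F2 x y g h) + (\<Sum>y\<in>{..<N} - {x}. ?F3 x y g h)) \<le> fixes_of N (g \<circ> h \<circ> g \<circ> h)"
    if g: "g \<in> perms N" and h: "h \<in> perms N" for g h
    unfolding fixes_of_def
  proof (rule sum_mono)
    fix x assume "x \<in> {..<N}"
    have "(\<Sum>y\<in>{..<N} - {x}. ?F2 x y g h) =
      (\<Sum>y\<in>{..<N} - {x}. if y = h x then of_bool (g x = x \<and> g (h x) = h x \<and> h (h x) = x) else 0)"
      by (intro sum.cong refl) auto
    also have "\<dots> = (if h x \<in> {..<N} - {x} then of_bool (g x = x \<and> g (h x) = h x \<and> h (h x) = x) else 0)"
      by (rule sum.delta) simp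
    finally have 2: "(\<Sum>y\<in>{..<N} - {x}. ?F2 x y g h) \<le> of_bool (h x \<noteq> x \<and> g (h (g (h x))) = x)" by auto
    have "(\<Sum>y\<in>{..<N} - {x}. ?F3 x y g h) =
      (\<Sum>y\<in>{..<N} - {x}. if y = g x then of_bool (h x = x \<and> h (g x) = g x \<and> g (g x) = x) else 0)"
      by (intro sum.cong refl) auto
    also have "\<dots> = (if g x \<in> {..<N} - {x} then of_bool (h x = x \<and> h (g x) = g x \<and> g (g x) = x) else 0)"
      by (rule sum.delta) simp
    finally have 3: "(\<Sum>y\<in>{..<N} - {x}. ?F3 x y g h) \<le> of_bool (h x = x \<and> g x \<noteq> x \<and> g (h (g (h x))) = x)" by auto
    have "?F1 x g h + of_bool (h x \<noteq> x \<and> g (h (g (h x))) = x) + of_bool (h x = x \<and> g x \<noteq> x \<and> g (h (g (h x))) = x) \<le>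
      of_bool ((g \<circ> h \<circ> g \<circ> h) x = x)" by auto
    then show "?F1 x g h + (\<Sum>y\<in>{..<N} - {x}. ?F2 x y g h) + (\<Sum>y\<in>{..<N} - {x}. ?F3 x y g h) \<le> of_bool ((g \<circ> h \<circ> g \<circ> h) x = x)"
      using 2 3 by linarith
  qed
  have add: "expect (\<lambda>g h. F g h + G g h) = expect F + expect G" for F G
    unfolding expect_def by (simp add: algebra_simps sum.distrib)
  have "expect (\<lambda>g h. \<Sum>x<N. ?F1 x g h + (\<Sum>y\<in>{..<N} - {x}. ?F2 x y g h) + (\<Sum>y\<in>{..<N} - {x}. ?F3 x y g h)) =
    (\<Sum>x<N. law_of N p (\<lambda>g. g x = x) * law_of N q (\<lambda>h. h x = x)
      + (\<Sum>y\<in>{..<N} - {x}. law_of N p (\<lambda>g. g x = x \<and> g y = y) * B.swap_law x y)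
      + (\<Sum>y\<in>{..<N} - {x}. A.swap_law x y * law_of N q (\<lambda>h. h x = x \<and> h y = y)))"
    unfolding expect_sum add expect_prod law_of_def A.swap_law_def B.swap_law_def ..
  also have "\<dots> = (\<Sum>x<N. A.fix1 * B.fix1 + A.pair_fix * (\<Sum>y\<in>{..<N} - {x}. B.swap_law x y)
      + B.pair_fix * (\<Sum>y\<in>{..<N} - {x}. A.swap_law x y))"
  proof (intro sum.cong refl)
    fix x assume x: "x \<in> {..<N}"
    have 1: "law_of N p (\<lambda>g. g x = x) = A.fix1" "law_of N q (\<lambda>h. h x = x) = B.fix1"
      using one_point_law[OF A.p equivariant_self A.N, of x x] one_point_law[OF B.p equivariant_self A.N, of x x] x by simp_all
    have 2: "(\<Sum>y\<in>{..<N} - {x}. law_of N p (\<lambda>g. g x = x \<and> g y = y) * B.swap_law x y) = A.pair_fix * (\<Sum>y\<in>{..<N} - {x}. B.swap_law x y)"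
      unfolding sum_distrib_left using x A.pair_fix_law by (intro sum.cong refl) auto
    have 3: "(\<Sum>y\<in>{..<N} - {x}. A.swap_law x y * law_of N q (\<lambda>h. h x = x \<and> h y = y)) = B.pair_fix * (\<Sum>y\<in>{..<N} - {x}. A.swap_law x y)"
      unfolding sum_distrib_left using x B.pair_fix_law by (intro sum.cong refl) auto
    show "law_of N p (\<lambda>g. g x = x) * law_of N q (\<lambda>h. h x = x)
      + (\<Sum>y\<in>{..<N} - {x}. law_of N p (\<lambda>g. g x = x \<and> g y = y) * B.swap_law x y)
      + (\<Sum>y\<in>{..<N} - {x}. A.swap_law x y * law_of N q (\<lambda>h. h x = x \<and> h y = y)) =
      A.fix1 * B.fix1 + A.pair_fix * (\<Sum>y\<in>{..<N} - {x}. B.swap_law x y) + B.pair_fix * (\<Sum>y\<in>{..<N} - {x}. A.swap_law x y)"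
      unfolding 1 2 3 ..
  qed
  also have "\<dots> = real N * (A.fix1 * B.fix1) + A.pair_fix * (real N * (B.fix2 - B.fix1)) + B.pair_fix * (real N * (A.fix2 - A.fix1))"
    unfolding sum.distrib sum_distrib_left[symmetric] A.sum_swap_law B.sum_swap_law by simp
  finally have eq: "expect (\<lambda>g h. \<Sum>x<N. ?F1 x g h + (\<Sum>y\<in>{..<N} - {x}. ?F2 x y g h) + (\<Sum>y\<in>{..<N} - {x}. ?F3 x y g h)) =
    real N * (A.fix1 * B.fix1 + (B.fix2 - B.fix1) * A.pair_fix + (A.fix2 - A.fix1) * B.pair_fix)"
    by (simp add: algebra_simps)
  have "real N * (A.fix1 * B.fix1 + (B.fix2 - B.fix1) * A.pair_fix + (A.fix2 - A.fix1) * B.pair_fix) \<le>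
    expect (\<lambda>g h. fixes_of N (g \<circ> h \<circ> g \<circ> h))"
    unfolding eq[symmetric] by (rule expect_mono) (rule pw)
  then show ?thesis using A.N by (simp add: le_divide_eq mult.commute)
qed

end

section \<open>Linear combinations of permutation matrices\<close>

definition lc_entry :: "(real \<times> (nat \<Rightarrow> nat)) list \<Rightarrow> nat \<Rightarrow> nat \<Rightarrow> real" where
  "lc_entry us i j = (\<Sum>(x, w)\<leftarrow>us. x * of_bool (i = w j))"

definition lc_mat :: "nat \<Rightarrow> (real \<times> (nat \<Rightarrow> nat)) list \<Rightarrow> complex mat" where
  "lc_mat N us = mat N N (\<lambda>(i, j). of_real (lc_entry us i j))"

definition lc_mult :: "(real \<times> (nat \<Rightarrow> nat)) list \<Rightarrow> (real \<times> (nat \<Rightarrow> nat)) list \<Rightarrow> (real \<times> (nat \<Rightarrow> nat)) list" where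
  "lc_mult us vs = concat (map (\<lambda>(x, w). map (\<lambda>(y, v). (x * y, w \<circ> v)) vs) us)"

lemma lc_entry_mult:
  assumes vs: "\<forall>(y, v)\<in>set vs. v \<in> perms N" and j: "j < N"
  shows "(\<Sum>l<N. lc_entry us i l * lc_entry vs l j) = lc_entry (lc_mult us vs) i j"
proof (induction us)
  case Nil
  show ?case by (simp add: lc_entry_def lc_mult_def)
next
  case (Cons xw us)
  obtain x w where xw: "xw = (x, w)" by (cases xw)
  have one: "(\<Sum>l<N. x * of_bool (i = w l) * lc_entry vs l j) = lc_entry (map (\<lambda>(y, v). (x * y, w \<circ> v)) vs) i j"
    using vs
  proof (induction vs)
    case (Cons yv vs)
    obtain y v where yv: "yv = (y, v)" by (cases yv)
    have "v j < N" using Cons.prems yv j perms_less by simp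
    have "(\<Sum>l<N. x * of_bool (i = w l) * (y * of_bool (l = v j))) = (\<Sum>l<N. if l = v j then x * y * of_bool (i = w (v j)) else 0)"
      by (intro sum.cong refl) auto
    also have "\<dots> = x * y * of_bool (i = w (v j))" using \<open>v j < N\<close> by (simp add: sum.delta)
    finally show ?case using Cons by (simp add: yv lc_entry_def distrib_left sum.distrib)
  qed (simp add: lc_entry_def)
  have "(\<Sum>l<N. lc_entry (xw # us) i l * lc_entry vs l j) =
    (\<Sum>l<N. x * of_bool (i = w l) * lc_entry vs l j) + (\<Sum>l<N. lc_entry us i l * lc_entry vs l j)"
    by (simp add: xw lc_entry_def[of "_ # _"] lc_entry_def[of us] distrib_right sum.distrib)
  also have "\<dots> = lc_entry (lc_mult (xw # us) vs) i j"
    unfolding one Cons by (simp add: xw lc_entry_def lc_mult_def)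
  finally show ?case .
qed

lemma lc_mat_mult:
  assumes "\<forall>(y, v)\<in>set vs. v \<in> perms N"
  shows "lc_mat N us * lc_mat N vs = lc_mat N (lc_mult us vs)"
proof (rule eq_matI)
  fix i j assume "i < dim_row (lc_mat N (lc_mult us vs))" "j < dim_col (lc_mat N (lc_mult us vs))"
  then have ij: "i < N" "j < N" by (simp_all add: lc_mat_def)
  then have "(lc_mat N us * lc_mat N vs) $$ (i, j) = (\<Sum>l<N. of_real (lc_entry us i l) * of_real (lc_entry vs l j))"
    by (simp add: lc_mat_def scalar_prod_def lessThan_atLeast0)
  also have "\<dots> = of_real (lc_entry (lc_mult us vs) i j)"
    unfolding lc_entry_mult[OF assms ij(2), symmetric] by simp
  finally show "(lc_mat N us * lc_mat N vs) $$ (i, j) = lc_mat N (lc_mult us vs) $$ (i, j)"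
    using ij by (simp add: lc_mat_def)
qed (simp_all add: lc_mat_def)

lemma lc_mat_carrier: "lc_mat N us \<in> carrier_mat N N"
  by (simp add: lc_mat_def)

lemma ntr_lc_mat: "ntr N (lc_mat N us) = of_real ((\<Sum>(x, w)\<leftarrow>us. x * fixes_of N w) / real N)"
proof -
  have "(\<Sum>i<N. lc_entry us i i) = (\<Sum>(x, w)\<leftarrow>us. x * fixes_of N w)"
  proof (induction us)
    case (Cons xw us)
    obtain x w where xw: "xw = (x, w)" by (cases xw)
    have "(\<Sum>i<N. lc_entry (xw # us) i i) = (\<Sum>i<N. x * of_bool (w i = i)) + (\<Sum>i<N. lc_entry us i i)"
      by (simp add: xw lc_entry_def sum.distrib eq_commute)
    then show ?case unfolding Cons by (simp add: xw fixes_of_def sum_distrib_left)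
  qed (simp add: lc_entry_def)
  moreover have "ntr N (lc_mat N us) = of_real ((\<Sum>i<N. lc_entry us i i) / real N)"
    by (simp add: ntr_def lc_mat_def)
  ultimately show ?thesis by simp
qed

lemma perm_mat_lc: "perm_mat N \<sigma> = lc_mat N [(1, \<sigma>)]"
  by (rule eq_matI) (simp_all add: perm_mat_def lc_mat_def lc_entry_def)

lemma mat_poly_lc: "mat_poly N [:- of_real a, 1:] (perm_mat N \<sigma>) = lc_mat N [(1, \<sigma>), (- a, id)]"
proof (rule eq_matI)
  fix i j assume "i < dim_row (lc_mat N [(1, \<sigma>), (- a, id)])" "j < dim_col (lc_mat N [(1, \<sigma>), (- a, id)])"
  then have ij: "i < N" "j < N" by (simp_all add: lc_mat_def)
  have pow: "perm_mat N \<sigma> ^\<^sub>m 0 = 1\<^sub>m N" "perm_mat N \<sigma> ^\<^sub>m 1 = perm_mat N \<sigma>"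
    using perm_mat_carrier[of N \<sigma>] by simp_all
  have "mat_poly N [:- of_real a, 1:] (perm_mat N \<sigma>) $$ (i, j) =
    (\<Sum>n\<le>1. coeff [:- of_real a, 1:] n * (perm_mat N \<sigma> ^\<^sub>m n) $$ (i, j))"
    using ij by (simp add: mat_poly_def)
  also have "\<dots> = - of_real a * (1\<^sub>m N) $$ (i, j) + perm_mat N \<sigma> $$ (i, j)"
    using pow by (simp add: atMost_Suc numeral_eq_Suc)
  finally show "mat_poly N [:- of_real a, 1:] (perm_mat N \<sigma>) $$ (i, j) = lc_mat N [(1, \<sigma>), (- a, id)] $$ (i, j)"
    using ij by (simp add: perm_mat_def lc_mat_def lc_entry_def)
qed (simp_all add: mat_poly_def lc_mat_def)

lemma fixes_of_commute:
  assumes \<sigma>: "\<sigma> \<in> perms N" and \<tau>: "\<tau> \<in> perms N"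
  shows "fixes_of N (\<sigma> \<circ> \<tau>) = fixes_of N (\<tau> \<circ> \<sigma>)"
  unfolding fixes_of_def
proof (rule sum.reindex_bij_witness[where i = "inv_into UNIV \<tau>" and j = \<tau>])
  fix x assume x: "x \<in> {..<N}"
  show "inv_into UNIV \<tau> (\<tau> x) = x" "\<tau> (inv_into UNIV \<tau> x) = x" using \<tau> by (simp_all add: permutes_inverses)
  show "\<tau> x \<in> {..<N}" using perms_less[OF \<tau>] x by simp
  show "inv_into UNIV \<tau> x \<in> {..<N}" using perms_less[of "inv_into UNIV \<tau>" N x] \<tau> x by (simp add: permutes_inv)
  show "of_bool ((\<tau> \<circ> \<sigma>) (\<tau> x) = \<tau> x) = (of_bool ((\<sigma> \<circ> \<tau>) x = x) :: real)"
    using permutes_inj[of \<tau> "{..<N}"] \<tau> by (simp add: inj_eq)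
qed

lemma fixes_of_id: "fixes_of N id = real N"
  by (simp add: fixes_of_def)

lemma (in two_laws) expect_centred:
  fixes a b :: real
  defines "r F G \<equiv> (1 - fix_rate N p F) * (1 - fix_rate N q G) / (real N - 1)"
  shows "expect (\<lambda>g h. (\<Sum>(x, w)\<leftarrow>lc_mult (lc_mult [(1, g), (- a, id)] [(1, h), (- b, id)])
      (lc_mult [(1, g), (- a, id)] [(1, h), (- b, id)]). x * fixes_of N w)) / real N =
    expect (\<lambda>g h. fixes_of N (g \<circ> h \<circ> g \<circ> h)) / real N
    - 2 * b * (A.fix2 * B.fix1 + r (\<lambda>g. g \<circ> g) (\<lambda>h. h))
    - 2 * a * (A.fix1 * B.fix2 + r (\<lambda>g. g) (\<lambda>h. h \<circ> h))
    + b\<^sup>2 * A.fix2 + a\<^sup>2 * B.fix2 + 4 * a * b * (A.fix1 * B.fix1 + r (\<lambda>g. g) (\<lambda>h. h))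
    - 2 * a * b\<^sup>2 * A.fix1 - 2 * a\<^sup>2 * b * B.fix1 + a\<^sup>2 * b\<^sup>2"
proof -
  have pw: "(\<Sum>(x, w)\<leftarrow>lc_mult (lc_mult [(1, g), (- a, id)] [(1, h), (- b, id)])
      (lc_mult [(1, g), (- a, id)] [(1, h), (- b, id)]). x * fixes_of N w) =
    fixes_of N (g \<circ> h \<circ> g \<circ> h) - 2 * b * fixes_of N ((g \<circ> g) \<circ> h) - 2 * a * fixes_of N (g \<circ> (h \<circ> h))
    + b\<^sup>2 * fixes_of N (g \<circ> g) + a\<^sup>2 * fixes_of N (h \<circ> h) + 4 * a * b * fixes_of N (g \<circ> h)
    - 2 * a * b\<^sup>2 * fixes_of N g - 2 * a\<^sup>2 * b * fixes_of N h + a\<^sup>2 * b\<^sup>2 * real N"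
    if g: "g \<in> perms N" and h: "h \<in> perms N" for g h
  proof -
    have c: "fixes_of N (g \<circ> h \<circ> g) = fixes_of N ((g \<circ> g) \<circ> h)" "fixes_of N (g \<circ> (g \<circ> h)) = fixes_of N ((g \<circ> g) \<circ> h)"
      "fixes_of N (h \<circ> (g \<circ> h)) = fixes_of N (g \<circ> (h \<circ> h))" "fixes_of N (g \<circ> h \<circ> h) = fixes_of N (g \<circ> (h \<circ> h))"
      "fixes_of N (h \<circ> g) = fixes_of N (g \<circ> h)" "fixes_of N (g \<circ> h \<circ> (g \<circ> h)) = fixes_of N (g \<circ> h \<circ> g \<circ> h)"
      using fixes_of_commute[OF perms_compose[OF g h] g] fixes_of_commute[OF h perms_compose[OF g h]]
        fixes_of_commute[OF h g] by (simp_all only: comp_assoc)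
    show ?thesis
      unfolding lc_mult_def
      by (simp only: list.map concat.simps append.simps prod.case sum_list.Cons sum_list.Nil map_append
          comp_id id_comp c fixes_of_id) (simp add: algebra_simps power2_eq_square)
  qed
  have lin: "expect (\<lambda>g h. F1 g h - 2 * b * F2 g h - 2 * a * F3 g h + b\<^sup>2 * F4 g h + a\<^sup>2 * F5 g h + 4 * a * b * F6 g h
      - 2 * a * b\<^sup>2 * F7 g h - 2 * a\<^sup>2 * b * F8 g h + a\<^sup>2 * b\<^sup>2 * real N) =
    expect F1 - 2 * b * expect F2 - 2 * a * expect F3 + b\<^sup>2 * expect F4 + a\<^sup>2 * expect F5 + 4 * a * b * expect F6
      - 2 * a * b\<^sup>2 * expect F7 - 2 * a\<^sup>2 * b * expect F8 + a\<^sup>2 * b\<^sup>2 * real N" for F1 F2 F3 F4 F5 F6 F7 F8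
  proof -
    have add: "expect (\<lambda>g h. F g h + G g h) = expect F + expect G" for F G
      unfolding expect_def by (simp add: algebra_simps sum.distrib)
    have sub: "expect (\<lambda>g h. F g h - G g h) = expect F - expect G" for F G
      unfolding expect_def by (simp add: algebra_simps sum_subtractf)
    have mul: "expect (\<lambda>g h. c * F g h) = c * expect F" for c F
      unfolding expect_def by (simp add: sum_distrib_left mult_ac)
    have "expect (\<lambda>g h. a\<^sup>2 * b\<^sup>2 * real N) = a\<^sup>2 * b\<^sup>2 * real N"
      using expect_left[of "\<lambda>_. a\<^sup>2 * b\<^sup>2 * real N"] by (simp add: sum_distrib_right[symmetric] A.p_sum)
    then show ?thesis by (simp only: add sub mul)
  qed
  have div: "(F1 - 2 * b * F2 - 2 * a * F3 + b\<^sup>2 * F4 + a\<^sup>2 * F5 + 4 * a * b * F6 - 2 * a * b\<^sup>2 * F7 - 2 * a\<^sup>2 * b * F8 + a\<^sup>2 * b\<^sup>2 * real N) / real N =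
    F1 / real N - 2 * b * (F2 / real N) - 2 * a * (F3 / real N) + b\<^sup>2 * (F4 / real N) + a\<^sup>2 * (F5 / real N)
     + 4 * a * b * (F6 / real N) - 2 * a * b\<^sup>2 * (F7 / real N) - 2 * a\<^sup>2 * b * (F8 / real N) + a\<^sup>2 * b\<^sup>2" for F1 F2 F3 F4 F5 F6 F7 F8
    using A.N by (simp add: add_divide_distrib diff_divide_distrib)
  have rates: "expect (\<lambda>g h. fixes_of N g) / real N = A.fix1" "expect (\<lambda>g h. fixes_of N (g \<circ> g)) / real N = A.fix2"
    "expect (\<lambda>g h. fixes_of N h) / real N = B.fix1" "expect (\<lambda>g h. fixes_of N (h \<circ> h)) / real N = B.fix2"
    by (simp_all only: expect_left expect_right fix_rate_def)
  have "expect (\<lambda>g h. (\<Sum>(x, w)\<leftarrow>lc_mult (lc_mult [(1, g), (- a, id)] [(1, h), (- b, id)])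
      (lc_mult [(1, g), (- a, id)] [(1, h), (- b, id)]). x * fixes_of N w)) =
    expect (\<lambda>g h. fixes_of N (g \<circ> h \<circ> g \<circ> h) - 2 * b * fixes_of N ((g \<circ> g) \<circ> h) - 2 * a * fixes_of N (g \<circ> (h \<circ> h))
    + b\<^sup>2 * fixes_of N (g \<circ> g) + a\<^sup>2 * fixes_of N (h \<circ> h) + 4 * a * b * fixes_of N (g \<circ> h)
    - 2 * a * b\<^sup>2 * fixes_of N g - 2 * a\<^sup>2 * b * fixes_of N h + a\<^sup>2 * b\<^sup>2 * real N)"
    by (rule expect_cong) (rule pw)
  then show ?thesis
    unfolding r_def
    by (simp only: lin div rates expect_fixes_comp[OF equivariant_square equivariant_self]
        expect_fixes_comp[OF equivariant_self equivariant_square] expect_fixes_comp[OF equivariant_self equivariant_self])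
qed

section \<open>Failure of asymptotic freeness\<close>

lemma fixes_of_walk_eigen:
  assumes C: "conjugacy_class N C" "C \<noteq> {id}" and N: "2 \<le> N" and \<sigma>: "\<sigma> \<in> perms N"
  shows "conv_op N (gen_weight N C) (\<lambda>\<sigma>. fixes_of N \<sigma> - 1) \<sigma> = - (real N / (real N - 1)) * (fixes_of N \<sigma> - 1)"
proof -
  let ?w = "gen_weight N C"
  note Cp = conjugacy_class_props[OF C(1)]
  have w: "class_weight N ?w" by (rule class_weight_gen[OF C(1)])
  have sum0: "(\<Sum>g\<in>perms N. ?w g) = 0"
    using sum_gen_weight[OF C(1), of "\<lambda>_. 1"] Cp(2,3) by simp
  have fix_C: "fixes_of N g = real (class_count N C 1)" if "g \<in> C" for g
  proof -
    have g: "g \<in> perms N" using Cp(1) that by blast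
    have "{x \<in> {..<N}. g x = x} = {x \<in> {..<N}. least_power g x = 1}" using least_power_1_iff[OF g] by auto
    then show ?thesis using Cp(5)[OF that, of 1] by (simp only: fixes_of_card period_count_def)
  qed
  have lt: "class_count N C 1 < N" by (rule class_count_1_less[OF C])
  have avg: "(\<Sum>g\<in>C. fixes_of N g) / real (card C) = real (class_count N C 1)"
    using fix_C Cp(2,3) by simp
  have "(\<Sum>g\<in>perms N. ?w g * fixes_of N g) = - real N"
    unfolding sum_gen_weight[OF C(1)] avg fixes_of_id using lt by (simp add: class_support_def field_simps of_nat_diff)
  then have rate: "fix_rate N ?w (\<lambda>g. g) = - 1" using N by (simp add: fix_rate_def)
  have law: "law_of N ?w (\<lambda>g. g x = y) = (if x = y then - 1 else 1 / (real N - 1))" if "x < N" "y < N" for x y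
    using one_point_law[OF w equivariant_self N that] rate sum0 by simp
  have "conv_op N ?w (\<lambda>\<sigma>. fixes_of N \<sigma> - 1) \<sigma> = (\<Sum>g\<in>perms N. ?w g * fixes_of N (g \<circ> \<sigma>)) - (\<Sum>g\<in>perms N. ?w g)"
    unfolding conv_op_def by (simp add: right_diff_distrib sum_subtractf)
  also have "(\<Sum>g\<in>perms N. ?w g * fixes_of N (g \<circ> \<sigma>)) = (\<Sum>x<N. law_of N ?w (\<lambda>g. g (\<sigma> x) = x))"
    unfolding fixes_of_def law_of_def sum_distrib_left by (subst sum.swap) simp
  also have "\<dots> = (\<Sum>x<N. 1 / (real N - 1) - of_bool (\<sigma> x = x) * (1 + 1 / (real N - 1)))"
    using law perms_less[OF \<sigma>] by (intro sum.cong refl) auto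
  also have "\<dots> = real N / (real N - 1) - fixes_of N \<sigma> * (1 + 1 / (real N - 1))"
    unfolding fixes_of_def sum_subtractf sum_distrib_right[symmetric] by simp
  also have "1 + 1 / (real N - 1) = real N / (real N - 1)" using N by (simp add: field_simps)
  finally have eq: "conv_op N ?w (\<lambda>\<sigma>. fixes_of N \<sigma> - 1) \<sigma> =
    real N / (real N - 1) - fixes_of N \<sigma> * (real N / (real N - 1)) - (\<Sum>g\<in>perms N. ?w g)" .
  define r where "r = real N / (real N - 1)"
  show ?thesis using eq unfolding sum0 r_def[symmetric] by (simp add: algebra_simps)
qed

lemma fixes_of_walk_heat:
  assumes C: "conjugacy_class N C" "C \<noteq> {id}" and N: "2 \<le> N"
  shows "(\<Sum>z\<in>perms N. heat N (gen_weight N C) t z * (fixes_of N z - 1)) = (real N - 1) * exp (- (real N / (real N - 1)) * t)"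
proof -
  let ?w = "gen_weight N C" and ?r = "- (real N / (real N - 1))"
  have pow: "(conv_op N ?w ^^ n) (\<lambda>\<sigma>. fixes_of N \<sigma> - 1) \<sigma> = ?r ^ n * (fixes_of N \<sigma> - 1)" if "\<sigma> \<in> perms N" for n \<sigma>
    using that
  proof (induction n arbitrary: \<sigma>)
    case (Suc n)
    have "(conv_op N ?w ^^ Suc n) (\<lambda>\<sigma>. fixes_of N \<sigma> - 1) \<sigma> = (\<Sum>g\<in>perms N. ?w g * (?r ^ n * (fixes_of N (g \<circ> \<sigma>) - 1)))"
      unfolding conv_op_Suc
      by (rule sum.cong[OF refl], rule arg_cong2[where f = "(*)", OF refl], rule Suc.IH, rule perms_compose)
        (use Suc.prems in auto)
    also have "\<dots> = ?r ^ n * conv_op N ?w (\<lambda>\<sigma>. fixes_of N \<sigma> - 1) \<sigma>"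
      unfolding conv_op_def sum_distrib_left by (simp only: mult.left_commute)
    also have "\<dots> = ?r ^ Suc n * (fixes_of N \<sigma> - 1)"
      unfolding fixes_of_walk_eigen[OF C N Suc.prems] by simp
    finally show ?case .
  qed simp
  have "(\<Sum>z\<in>perms N. heat N ?w t z * (fixes_of N z - 1)) = (\<Sum>n. t ^ n / fact n * (?r ^ n * (real N - 1)))"
    unfolding sum_heat pow[OF id_perms] fixes_of_id ..
  also have "\<dots> = (\<Sum>n. (?r * t) ^ n /\<^sub>R fact n * (real N - 1))"
    by (intro suminf_cong) (simp only: power_mult_distrib divide_inverse real_scaleR_def mult_ac)
  also have "\<dots> = (\<Sum>n. (?r * t) ^ n /\<^sub>R fact n) * (real N - 1)"
    by (rule suminf_mult2[OF summable_exp_generic, symmetric])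
  finally show ?thesis by (simp add: exp_def mult.commute)
qed

context walks
begin

lemma walk_heat_nonneg:
  assumes N: "2 \<le> N" and t: "0 \<le> t" and z: "z \<in> perms N"
  shows "0 \<le> walk_heat L t N z"
proof -
  define u where "u j = (if j = 0 then 0 else t)" for j :: nat
  have u: "grid u" using t by (simp add: grid_def u_def)
  define g where "g = restrict (\<lambda>_. z) {..<1 :: nat}"
  have "g \<in> PiE {..<1} (\<lambda>_. perms N)" using z by (simp add: g_def)
  from grid_incr_law[OF N u this] have "grid_weight L u N 1 g \<ge> 0" by (metis measure_nonneg)
  then show ?thesis by (simp add: grid_weight_def g_def u_def)
qed

lemma class_law_walk: "2 \<le> N \<Longrightarrow> 0 \<le> t \<Longrightarrow> class_law N (walk_heat L t N)"
  by unfold_locales (auto intro: class_weight_walk walk_heat_nonneg simp: sum_walk_heat)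

lemma fix_rate_walk:
  assumes N: "2 \<le> N"
  shows "fix_rate N (walk_heat L t N) (\<lambda>g. g) = (1 + (real N - 1) * exp (- (real N / (real N - 1)) * t)) / real N"
proof -
  have "(\<Sum>z\<in>perms N. walk_heat L t N z * fixes_of N z) - 1 = (\<Sum>z\<in>perms N. walk_heat L t N z * (fixes_of N z - 1))"
    by (simp add: right_diff_distrib sum_subtractf sum_walk_heat[OF N])
  also have "\<dots> = (real N - 1) * exp (- (real N / (real N - 1)) * t)"
    using fixes_of_walk_heat[of N "L N"] classes N by blast
  finally show ?thesis unfolding fix_rate_def by simp
qed

lemma fix_rate_walk_limit: "(\<lambda>N. fix_rate N (walk_heat L t N) (\<lambda>g. g)) \<longlonglongrightarrow> exp (- t)"
proof -
  have "(\<lambda>N. (1 + (real N - 1) * exp (- (real N / (real N - 1)) * t)) / real N) \<longlonglongrightarrow> exp (- t)"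
  proof -
    have 1: "(\<lambda>N. real N / (real N - 1)) \<longlonglongrightarrow> 1" by real_asymp
    have 2: "(\<lambda>N. (real N - 1) / real N) \<longlonglongrightarrow> 1" "(\<lambda>N. 1 / real N) \<longlonglongrightarrow> 0" by real_asymp+
    have "(\<lambda>N. 1 / real N + (real N - 1) / real N * exp (- (real N / (real N - 1)) * t)) \<longlonglongrightarrow> 0 + 1 * exp (- 1 * t)"
      by (intro tendsto_intros 1 2)
    then show ?thesis by (simp add: add_divide_distrib)
  qed
  moreover have "\<forall>\<^sub>F N in sequentially. fix_rate N (walk_heat L t N) (\<lambda>g. g) =
      (1 + (real N - 1) * exp (- (real N / (real N - 1)) * t)) / real N"
    using eventually_ge_at_top[of 2] by eventually_elim (rule fix_rate_walk)
  ultimately show ?thesis by (simp only: tendsto_cong)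
qed

lemma grid_sum_Suc:
  "(\<Sum>g\<in>PiE {..<Suc m} (\<lambda>_. perms N). grid_weight L u N (Suc m) g * (F g :: real)) =
    (\<Sum>g\<in>PiE {..<m} (\<lambda>_. perms N). grid_weight L u N m g *
      (\<Sum>h\<in>perms N. walk_heat L (u (Suc m) - u m) N h * F (g(m := h))))"
  unfolding sum_PiE_Suc sum_distrib_left
proof (intro sum.cong refl)
  fix g h
  have "(\<Prod>j<m. walk_heat L (u (Suc j) - u j) N ((g(m := h)) j)) = (\<Prod>j<m. walk_heat L (u (Suc j) - u j) N (g j))"
    by (intro prod.cong) auto
  then show "grid_weight L u N (Suc m) (g(m := h)) * F (g(m := h)) =
    grid_weight L u N m g * (walk_heat L (u (Suc m) - u m) N h * F (g(m := h)))"
    unfolding grid_weight_def prod.lessThan_Suc by (simp only: fun_upd_same mult.assoc)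
qed

lemma pair_integral:
  assumes N: "2 \<le> N" and succ: "successive 2 s t"
  shows "integral\<^sup>L (M N) (\<lambda>\<omega>. complex_of_real (F (incr s t 0 N \<omega>) (incr s t 1 N \<omega>))) =
    of_real (\<Sum>g\<in>perms N. \<Sum>h\<in>perms N. walk_heat L (t 0 - s 0) N g * walk_heat L (t 1 - s 1) N h * F g h)"
proof -
  let ?u = "seq_grid 2 s t"
  have "integral\<^sup>L (M N) (\<lambda>\<omega>. complex_of_real (F (incr s t 0 N \<omega>) (incr s t 1 N \<omega>))) =
    (\<Sum>g\<in>PiE {..<2 * 2} (\<lambda>_. perms N). grid_weight L ?u N (2 * 2) g *\<^sub>R complex_of_real (F (g (2 * 0 + 1)) (g (2 * 1 + 1))))"
  proof (rule word_integral(2)[where Y = "\<lambda>l. incr s t l N" and k = 2 and W = "\<lambda>g l. g (2 * l + 1)"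
        and F = "\<lambda>w. complex_of_real (F (w 0) (w 1))", OF N])
    show "incr s t l N \<in> measurable (M N) (count_space (perms N))" if "l < 2" for l
      by (rule incr_meas[OF N succ that])
    show "complex_of_real (F (w 0) (w 1)) = complex_of_real (F (w' 0) (w' 1))"
      if "\<And>l. l < 2 \<Longrightarrow> w l = w' l" for w w' :: "nat \<Rightarrow> nat \<Rightarrow> nat"
      using that[of 0] that[of 1] by simp
    show "grid ?u" by (rule grid_seq_grid[OF succ])
    show "AE \<omega> in M N. \<forall>l<2. incr s t l N \<omega> = restrict (grid_incr S N ?u \<omega>) {..<2 * 2} (2 * l + 1)"
      by (intro always_eventually allI impI incr_grid_incr)
  qed
  also have "\<dots> = of_real (\<Sum>g\<in>PiE {..<2 * 2} (\<lambda>_. perms N). grid_weight L ?u N (2 * 2) g * F (g 1) (g 3))"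
    by (simp add: scaleR_conv_of_real)
  also have "(\<Sum>g\<in>PiE {..<2 * 2} (\<lambda>_. perms N). grid_weight L ?u N (2 * 2) g * F (g 1) (g 3)) =
    (\<Sum>g\<in>PiE {..<Suc (Suc (Suc (Suc 0)))} (\<lambda>_. perms N). grid_weight L ?u N (Suc (Suc (Suc (Suc 0)))) g * F (g (Suc 0)) (g (Suc (Suc (Suc 0)))))"
    by (simp add: numeral_eq_Suc)
  also have "\<dots> = (\<Sum>a\<in>perms N. walk_heat L (?u (Suc 0) - ?u 0) N a * (\<Sum>g\<in>perms N. walk_heat L (?u (Suc (Suc 0)) - ?u (Suc 0)) N g *
      (\<Sum>c\<in>perms N. walk_heat L (?u (Suc (Suc (Suc 0))) - ?u (Suc (Suc 0))) N c *
        (\<Sum>h\<in>perms N. walk_heat L (?u (Suc (Suc (Suc (Suc 0)))) - ?u (Suc (Suc (Suc 0)))) N h * F g h))))"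
    unfolding grid_sum_Suc by (simp add: grid_weight_def)
  also have "\<dots> = (\<Sum>g\<in>perms N. walk_heat L (?u (Suc (Suc 0)) - ?u (Suc 0)) N g *
      (\<Sum>h\<in>perms N. walk_heat L (?u (Suc (Suc (Suc (Suc 0)))) - ?u (Suc (Suc (Suc 0)))) N h * F g h))"
    unfolding sum_distrib_right[symmetric] sum_walk_heat[OF N] by simp
  also have "?u (Suc (Suc 0)) - ?u (Suc 0) = t 0 - s 0"
    using seq_grid_vals[of 0 2 s t] by simp
  also have "?u (Suc (Suc (Suc (Suc 0)))) - ?u (Suc (Suc (Suc 0))) = t 1 - s 1"
    using seq_grid_vals[of 1 2 s t] by (simp add: numeral_eq_Suc)
  finally show ?thesis unfolding sum_distrib_left mult.assoc .
qed

lemma not_asymptotically_free: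
  assumes st: "0 \<le> s1" "s1 < t1" "t1 \<le> s2" "s2 < t2"
  shows "\<not> asymptotically_free M [increment S s1 t1, increment S s2 t2]"
proof
  let ?As = "[increment S s1 t1, increment S s2 t2]"
  assume free: "asymptotically_free M ?As"
  define s where "s i = (if i = 0 then s1 else s2)" for i :: nat
  define t where "t i = (if i = 0 then t1 else t2)" for i :: nat
  have succ: "successive 2 s t" using st by (auto simp: successive_def s_def t_def less_2_cases_iff)
  define p where "p = walk_heat L (t1 - s1)"
  define q where "q = walk_heat L (t2 - s2)"
  have laws: "two_laws N (p N) (q N)" if "2 \<le> N" for N
    unfolding two_laws_def p_def q_def using class_law_walk[OF that] st by simp
  have A0: "?As ! 0 = (\<lambda>N \<omega>. perm_mat N (incr s t 0 N \<omega>))" and A1: "?As ! 1 = (\<lambda>N \<omega>. perm_mat N (incr s t 1 N \<omega>))"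
    by (simp_all add: increment_def[abs_def] s_def t_def)
  have int: "integral\<^sup>L (M N) (\<lambda>\<omega>. complex_of_real (F (incr s t 0 N \<omega>) (incr s t 1 N \<omega>))) =
      of_real (two_laws.expect N (p N) (q N) F)" if N: "2 \<le> N" for N F
  proof -
    have "t 0 - s 0 = t1 - s1" "t 1 - s 1 = t2 - s2" by (simp_all add: s_def t_def)
    then show ?thesis
      using pair_integral[OF N succ, of F] unfolding two_laws.expect_def[OF laws[OF N]]
      unfolding p_def q_def by (simp only:)
  qed
  define a where "a = exp (- (t1 - s1))"
  define b where "b = exp (- (t2 - s2))"
  have ab: "0 < a" "a < 1" "0 < b" "b < 1" using st by (simp_all add: a_def b_def)
  define a1 where "a1 N = fix_rate N (p N) (\<lambda>g. g)" for N
  define a2 where "a2 N = fix_rate N (p N) (\<lambda>g. g \<circ> g)" for N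
  define b1 where "b1 N = fix_rate N (q N) (\<lambda>g. g)" for N
  define b2 where "b2 N = fix_rate N (q N) (\<lambda>g. g \<circ> g)" for N
  have a1: "a1 \<longlonglongrightarrow> a" and b1: "b1 \<longlonglongrightarrow> b"
    unfolding a1_def[abs_def] b1_def[abs_def] a_def b_def p_def q_def by (rule fix_rate_walk_limit)+
  have bounds: "0 \<le> a1 N" "a1 N \<le> 1" "0 \<le> a2 N" "a2 N \<le> 1" "0 \<le> b1 N" "b1 N \<le> 1" "0 \<le> b2 N" "b2 N \<le> 1"
    "a1 N \<le> a2 N" "b1 N \<le> b2 N" if N: "2 \<le> N" for N
  proof -
    interpret two_laws N "p N" "q N" by (rule laws[OF N])
    show "0 \<le> a1 N" "a1 N \<le> 1" "0 \<le> a2 N" "a2 N \<le> 1" "0 \<le> b1 N" "b1 N \<le> 1" "0 \<le> b2 N" "b2 N \<le> 1"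
      "a1 N \<le> a2 N" "b1 N \<le> b2 N"
      unfolding a1_def a2_def b1_def b2_def
      using A.fix_rate_bounds B.fix_rate_bounds A.fix1_le_fix2 B.fix1_le_fix2 by simp_all
  qed
  have prod1: "mat_prod N [X] = X" if "X \<in> carrier_mat N N" for N X
    using that by (simp add: mat_prod_def)
  have prod2: "mat_prod N [X, Y] = X * Y" if "X \<in> carrier_mat N N" "Y \<in> carrier_mat N N" for N X Y
    using that by (simp add: mat_prod_def)
  have prod4: "mat_prod N [X, Y, X, Y] = (X * Y) * (X * Y)" if X: "X \<in> carrier_mat N N" and Y: "Y \<in> carrier_mat N N" for N X Y
  proof -
    have "mat_prod N [X, Y, X, Y] = X * (Y * (X * Y))" using Y by (simp add: mat_prod_def)
    then show ?thesis using assoc_mult_mat[OF X Y mult_carrier_mat[OF X Y]] by simp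
  qed
  have square: "ntr N (mat_prod N [perm_mat N \<sigma>, perm_mat N \<sigma>]) = of_real (fixes_of N (\<sigma> \<circ> \<sigma>) / real N)"
    if "\<sigma> \<in> perms N" for N \<sigma>
    unfolding prod2[OF perm_mat_carrier perm_mat_carrier] perm_mat_mult[OF that that]
    unfolding perm_mat_lc ntr_lc_mat by simp
  have inc_perms: "incr s t j N \<omega> \<in> perms N" if "2 \<le> N" "j < 2" "\<omega> \<in> space (M N)" for j N \<omega>
    using measurable_space[OF incr_meas[OF that(1) succ that(2)] that(3)] by simp
  have conv2: "convergent a2" "convergent b2"
  proof -
    have conv: "convergent (E_tr_word M (map (\<lambda>j. ?As ! j) js))" if "set js \<subseteq> {..<2}" for js
      using conjunct1[OF free[unfolded asymptotically_free_def], rule_format, of js] that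
      by (simp add: numeral_2_eq_2)
    have ea: "E_tr_word M (map (\<lambda>j. ?As ! j) [0, 0]) N = of_real (a2 N)" if N: "2 \<le> N" for N
    proof -
      interpret two_laws N "p N" "q N" by (rule laws[OF N])
      have "E_tr_word M (map (\<lambda>j. ?As ! j) [0, 0]) N =
        integral\<^sup>L (M N) (\<lambda>\<omega>. complex_of_real (fixes_of N (incr s t 0 N \<omega> \<circ> incr s t 0 N \<omega>) / real N))"
        unfolding E_tr_word_def
        by (rule Bochner_Integration.integral_cong[OF refl], simp only: list.map A0, rule square, rule inc_perms[OF N]) auto
      also have "\<dots> = of_real (expect (\<lambda>g h. fixes_of N (g \<circ> g) / real N))" by (rule int[OF N])
      also have "expect (\<lambda>g h. fixes_of N (g \<circ> g) / real N) = a2 N"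
        unfolding expect_left a2_def fix_rate_def by (simp add: sum_divide_distrib)
      finally show ?thesis .
    qed
    have eb: "E_tr_word M (map (\<lambda>j. ?As ! j) [1, 1]) N = of_real (b2 N)" if N: "2 \<le> N" for N
    proof -
      interpret two_laws N "p N" "q N" by (rule laws[OF N])
      have "E_tr_word M (map (\<lambda>j. ?As ! j) [1, 1]) N =
        integral\<^sup>L (M N) (\<lambda>\<omega>. complex_of_real (fixes_of N (incr s t 1 N \<omega> \<circ> incr s t 1 N \<omega>) / real N))"
        unfolding E_tr_word_def
        by (rule Bochner_Integration.integral_cong[OF refl], simp only: list.map A1, rule square, rule inc_perms[OF N]) auto
      also have "\<dots> = of_real (expect (\<lambda>g h. fixes_of N (h \<circ> h) / real N))" by (rule int[OF N])
      also have "expect (\<lambda>g h. fixes_of N (h \<circ> h) / real N) = b2 N"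
        unfolding expect_right b2_def fix_rate_def by (simp add: sum_divide_distrib)
      finally show ?thesis .
    qed
    have real: "convergent x" if X: "convergent X" and ev: "\<forall>\<^sub>F N in sequentially. X N = complex_of_real (x N)" for X and x :: "nat \<Rightarrow> real"
    proof -
      obtain c where "X \<longlonglongrightarrow> c" using X by (auto simp: convergent_def)
      then have "(\<lambda>N. complex_of_real (x N)) \<longlonglongrightarrow> c" using ev by (simp add: tendsto_cong)
      then have "(\<lambda>N. Re (complex_of_real (x N))) \<longlonglongrightarrow> Re c" by (rule tendsto_Re)
      then show ?thesis by (auto simp: convergent_def)
    qed
    show "convergent a2"
      by (rule real[OF conv[of "[0, 0]"]], simp, use eventually_ge_at_top[of 2] in eventually_elim, rule ea)
    show "convergent b2"
      by (rule real[OF conv[of "[1, 1]"]], simp, use eventually_ge_at_top[of 2] in eventually_elim, rule eb)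
  qed
  then obtain A2 B2 where A2: "a2 \<longlonglongrightarrow> A2" and B2: "b2 \<longlonglongrightarrow> B2" by (auto simp: convergent_def)
  let ?P = "[:- complex_of_real a, 1:]" and ?Q = "[:- complex_of_real b, 1:]"
  have cent_a: "E_tr_word M [\<lambda>N \<omega>. mat_poly N ?P ((?As ! 0) N \<omega>)] \<longlonglongrightarrow> 0"
  proof -
    have eq: "E_tr_word M [\<lambda>N \<omega>. mat_poly N ?P ((?As ! 0) N \<omega>)] N = of_real (a1 N - a)" if N: "2 \<le> N" for N
    proof -
      interpret two_laws N "p N" "q N" by (rule laws[OF N])
      have "E_tr_word M [\<lambda>N \<omega>. mat_poly N ?P ((?As ! 0) N \<omega>)] N =
        integral\<^sup>L (M N) (\<lambda>\<omega>. complex_of_real (fixes_of N (incr s t 0 N \<omega>) / real N - a))"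
        unfolding E_tr_word_def A0
        by (rule Bochner_Integration.integral_cong[OF refl])
          (use N in \<open>simp add: mat_poly_lc prod1[OF lc_mat_carrier] ntr_lc_mat fixes_of_id diff_divide_distrib del: of_real_diff\<close>)
      also have "\<dots> = of_real (expect (\<lambda>g h. fixes_of N g / real N - a))" by (rule int[OF N])
      also have "expect (\<lambda>g h. fixes_of N g / real N - a) = a1 N - a"
        unfolding expect_left a1_def fix_rate_def
        by (simp add: sum_divide_distrib right_diff_distrib sum_subtractf sum_distrib_right[symmetric] A.p_sum)
      finally show ?thesis .
    qed
    have "\<forall>\<^sub>F N in sequentially. E_tr_word M [\<lambda>N \<omega>. mat_poly N ?P ((?As ! 0) N \<omega>)] N = of_real (a1 N - a)"
      using eventually_ge_at_top[of 2] by eventually_elim (rule eq)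
    moreover have "(\<lambda>N. complex_of_real (a1 N - a)) \<longlonglongrightarrow> of_real (a - a)"
      by (intro tendsto_of_real tendsto_diff a1 tendsto_const)
    ultimately show ?thesis by (simp only: tendsto_cong diff_self of_real_0)
  qed
  have cent_b: "E_tr_word M [\<lambda>N \<omega>. mat_poly N ?Q ((?As ! 1) N \<omega>)] \<longlonglongrightarrow> 0"
  proof -
    have eq: "E_tr_word M [\<lambda>N \<omega>. mat_poly N ?Q ((?As ! 1) N \<omega>)] N = of_real (b1 N - b)" if N: "2 \<le> N" for N
    proof -
      interpret two_laws N "p N" "q N" by (rule laws[OF N])
      have "E_tr_word M [\<lambda>N \<omega>. mat_poly N ?Q ((?As ! 1) N \<omega>)] N =
        integral\<^sup>L (M N) (\<lambda>\<omega>. complex_of_real (fixes_of N (incr s t 1 N \<omega>) / real N - b))"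
        unfolding E_tr_word_def A1
        by (rule Bochner_Integration.integral_cong[OF refl])
          (use N in \<open>simp add: mat_poly_lc prod1[OF lc_mat_carrier] ntr_lc_mat fixes_of_id diff_divide_distrib del: of_real_diff\<close>)
      also have "\<dots> = of_real (expect (\<lambda>g h. fixes_of N h / real N - b))" by (rule int[OF N])
      also have "expect (\<lambda>g h. fixes_of N h / real N - b) = b1 N - b"
        unfolding expect_right b1_def fix_rate_def
        by (simp add: sum_divide_distrib right_diff_distrib sum_subtractf sum_distrib_right[symmetric] B.p_sum)
      finally show ?thesis .
    qed
    have "\<forall>\<^sub>F N in sequentially. E_tr_word M [\<lambda>N \<omega>. mat_poly N ?Q ((?As ! 1) N \<omega>)] N = of_real (b1 N - b)"
      using eventually_ge_at_top[of 2] by eventually_elim (rule eq)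
    moreover have "(\<lambda>N. complex_of_real (b1 N - b)) \<longlonglongrightarrow> of_real (b - b)"
      by (intro tendsto_of_real tendsto_diff b1 tendsto_const)
    ultimately show ?thesis by (simp only: tendsto_cong diff_self of_real_0)
  qed
  let ?w = "[(0, ?P), (1, ?Q), (0, ?P), (1, ?Q)] :: (nat \<times> complex poly) list"
  let ?X = "E_tr_word M (map (\<lambda>(i, P) N \<omega>. mat_poly N P ((?As ! i) N \<omega>)) ?w)"
  have X0: "?X \<longlonglongrightarrow> 0"
  proof -
    have "?w \<noteq> [] \<and> distinct_adj (map fst ?w) \<and>
        (\<forall>(i, P)\<in>set ?w. i < length ?As \<and> E_tr_word M [\<lambda>N \<omega>. mat_poly N P ((?As ! i) N \<omega>)] \<longlonglongrightarrow> 0)"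
      using cent_a cent_b by simp
    then show ?thesis using free unfolding asymptotically_free_def by blast
  qed
  define x where "x N = two_laws.expect N (p N) (q N) (\<lambda>g h. (\<Sum>(x, w)\<leftarrow>lc_mult (lc_mult [(1, g), (- a, id)] [(1, h), (- b, id)])
      (lc_mult [(1, g), (- a, id)] [(1, h), (- b, id)]). x * fixes_of N w)) / real N" for N
  have X_eq: "?X N = of_real (x N)" if N: "2 \<le> N" for N
  proof -
    interpret two_laws N "p N" "q N" by (rule laws[OF N])
    let ?F = "\<lambda>g h. (\<Sum>(x, w)\<leftarrow>lc_mult (lc_mult [(1, g), (- a, id)] [(1, h), (- b, id)])
      (lc_mult [(1, g), (- a, id)] [(1, h), (- b, id)]). x * fixes_of N w) / real N"
    have tr: "ntr N (mat_prod N [mat_poly N ?P (perm_mat N g), mat_poly N ?Q (perm_mat N h), mat_poly N ?P (perm_mat N g), mat_poly N ?Q (perm_mat N h)]) =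
      complex_of_real (?F g h)" if g: "g \<in> perms N" and h: "h \<in> perms N" for g h
    proof -
      have 1: "lc_mat N [(1, g), (- a, id)] * lc_mat N [(1, h), (- b, id)] = lc_mat N (lc_mult [(1, g), (- a, id)] [(1, h), (- b, id)])"
        by (rule lc_mat_mult) (use h id_perms in simp)
      have 2: "\<forall>(y, v)\<in>set (lc_mult [(1, g), (- a, id)] [(1, h), (- b, id)]). v \<in> perms N"
        using g h perms_compose[OF g h] by (auto simp: lc_mult_def permutes_id permutes_compose)
      show ?thesis
        unfolding mat_poly_lc prod4[OF lc_mat_carrier lc_mat_carrier] 1 lc_mat_mult[OF 2] ntr_lc_mat ..
    qed
    have "?X N = integral\<^sup>L (M N) (\<lambda>\<omega>. complex_of_real (?F (incr s t 0 N \<omega>) (incr s t 1 N \<omega>)))"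
      unfolding E_tr_word_def
    proof (rule Bochner_Integration.integral_cong[OF refl])
      fix \<omega> assume \<omega>: "\<omega> \<in> space (M N)"
      show "ntr N (mat_prod N (map (\<lambda>X. X N \<omega>) (map (\<lambda>(i, P) N \<omega>. mat_poly N P ((?As ! i) N \<omega>)) ?w))) =
        complex_of_real (?F (incr s t 0 N \<omega>) (incr s t 1 N \<omega>))"
        unfolding list.map prod.case A0 A1
        by (rule tr) (rule inc_perms[OF N _ \<omega>], simp)+
    qed
    also have "\<dots> = of_real (expect ?F)" by (rule int[OF N])
    also have "expect ?F = x N"
      unfolding x_def expect_def by (simp only: sum_divide_distrib times_divide_eq_right)
    finally show ?thesis .
  qed
  have x0: "x \<longlonglongrightarrow> 0"
  proof -
    have "\<forall>\<^sub>F N in sequentially. ?X N = of_real (x N)"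
      using eventually_ge_at_top[of 2] by eventually_elim (rule X_eq)
    then have "(\<lambda>N. complex_of_real (x N)) \<longlonglongrightarrow> of_real 0" using X0 by (simp only: tendsto_cong of_real_0)
    then show ?thesis unfolding tendsto_of_real_iff .
  qed
  define low where "low N = a1 N * b1 N + (b2 N - b1 N) * ((real N * (a1 N)\<^sup>2 - a1 N) / (real N - 1))
      + (a2 N - a1 N) * ((real N * (b1 N)\<^sup>2 - b1 N) / (real N - 1))
      - 2 * b * (a2 N * b1 N + (1 - a2 N) * (1 - b1 N) / (real N - 1))
      - 2 * a * (a1 N * b2 N + (1 - a1 N) * (1 - b2 N) / (real N - 1))
      + b\<^sup>2 * a2 N + a\<^sup>2 * b2 N + 4 * a * b * (a1 N * b1 N + (1 - a1 N) * (1 - b1 N) / (real N - 1))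
      - 2 * a * b\<^sup>2 * a1 N - 2 * a\<^sup>2 * b * b1 N + a\<^sup>2 * b\<^sup>2" for N
  have low_le: "low N \<le> x N" if N: "2 \<le> N" for N
  proof -
    interpret two_laws N "p N" "q N" by (rule laws[OF N])
    have "(b2 N - b1 N) * ((real N * (a1 N)\<^sup>2 - a1 N) / (real N - 1)) \<le> (b2 N - b1 N) * A.pair_fix"
      using A.pair_fix_ge bounds[OF N] unfolding a1_def by (intro mult_left_mono) simp_all
    moreover have "(a2 N - a1 N) * ((real N * (b1 N)\<^sup>2 - b1 N) / (real N - 1)) \<le> (a2 N - a1 N) * B.pair_fix"
      using B.pair_fix_ge bounds[OF N] unfolding b1_def by (intro mult_left_mono) simp_all
    ultimately show ?thesis
      using expect_fixes_ghgh
      unfolding low_def x_def expect_centred a1_def[symmetric] a2_def[symmetric] b1_def[symmetric] b2_def[symmetric]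
      by linarith
  qed
  have lim: "low \<longlonglongrightarrow> a * b + (B2 - b) * (1 * a\<^sup>2 - a * 0) + (A2 - a) * (1 * b\<^sup>2 - b * 0)
      - 2 * b * (A2 * b + (1 - A2) * (1 - b) * 0)
      - 2 * a * (a * B2 + (1 - a) * (1 - B2) * 0)
      + b\<^sup>2 * A2 + a\<^sup>2 * B2 + 4 * a * b * (a * b + (1 - a) * (1 - b) * 0)
      - 2 * a * b\<^sup>2 * a - 2 * a\<^sup>2 * b * b + a\<^sup>2 * b\<^sup>2"
  proof -
    have r: "(\<lambda>N. real N / (real N - 1)) \<longlonglongrightarrow> 1" "(\<lambda>N. 1 / (real N - 1)) \<longlonglongrightarrow> 0" by real_asymp+
    have "low = (\<lambda>N. a1 N * b1 N + (b2 N - b1 N) * (real N / (real N - 1) * (a1 N)\<^sup>2 - a1 N * (1 / (real N - 1)))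
      + (a2 N - a1 N) * (real N / (real N - 1) * (b1 N)\<^sup>2 - b1 N * (1 / (real N - 1)))
      - 2 * b * (a2 N * b1 N + (1 - a2 N) * (1 - b1 N) * (1 / (real N - 1)))
      - 2 * a * (a1 N * b2 N + (1 - a1 N) * (1 - b2 N) * (1 / (real N - 1)))
      + b\<^sup>2 * a2 N + a\<^sup>2 * b2 N + 4 * a * b * (a1 N * b1 N + (1 - a1 N) * (1 - b1 N) * (1 / (real N - 1)))
      - 2 * a * b\<^sup>2 * a1 N - 2 * a\<^sup>2 * b * b1 N + a\<^sup>2 * b\<^sup>2)"
      unfolding low_def[abs_def] by (simp add: diff_divide_distrib)
    then show ?thesis
      by (simp only:) (intro tendsto_intros a1 b1 A2 B2 r)
  qed
  have "low \<longlonglongrightarrow> a * b * (1 - a) * (1 - b)"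
    using lim by (rule back_subst) (simp add: power2_eq_square algebra_simps)
  then have "a * b * (1 - a) * (1 - b) \<le> 0"
    by (rule LIMSEQ_le[OF _ x0]) (use low_le in blast)
  moreover have "0 < a * b * (1 - a) * (1 - b)" using ab by simp
  ultimately show False by simp
qed

lemma not_free_levy: "\<not> multiplicative_free_levy M S"
proof
  assume "multiplicative_free_levy M S"
  moreover have "successive_intervals 2 (\<lambda>i. real i) (\<lambda>i. real i + 1)"
    by (simp add: successive_intervals_def)
  ultimately have "asymptotically_free M (increments S 2 (\<lambda>i. real i) (\<lambda>i. real i + 1))"
    unfolding multiplicative_free_levy_def by blast
  moreover have "increments S 2 (\<lambda>i. real i) (\<lambda>i. real i + 1) = [increment S 0 1, increment S 1 2]"
    by (simp add: increments_def upt_rec)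
  ultimately show False using not_asymptotically_free[of 0 1 1 2] by simp
qed

end

theorem theorem2p8:
  fixes M :: "nat \<Rightarrow> 'w measure"
    and L :: "nat \<Rightarrow> (nat \<Rightarrow> nat) set"
    and S :: "nat \<Rightarrow> real \<Rightarrow> 'w \<Rightarrow> nat \<Rightarrow> nat"
    and \<alpha> :: real
  assumes "\<forall>N\<ge>2. conjugacy_class N (L N) \<and> L N \<noteq> {id}"
    and "classes_converge L \<alpha>"
    and "\<forall>N\<ge>2. random_walk N (L N) (M N) (S N)"
  shows "P_converges M {0..} (marginal S) \<and>
         multiplicative_P_levy M S \<and>
         (\<alpha> = 0 \<longrightarrow>
            \<not> multiplicative_free_levy M S \<and>
            (\<forall>s\<^sub>1 t\<^sub>1 s\<^sub>2 t\<^sub>2. 0 \<le> s\<^sub>1 \<and> s\<^sub>1 < t\<^sub>1 \<and> t\<^sub>1 \<le> s\<^sub>2 \<and> s\<^sub>2 < t\<^sub>2 \<longrightarrow>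
               \<not> asymptotically_free M [increment S s\<^sub>1 t\<^sub>1, increment S s\<^sub>2 t\<^sub>2]))"
proof -
  interpret walks M L S \<alpha> by (rule walks.intro[OF assms])
  show ?thesis
    using marginal_P_converges levy not_free_levy not_asymptotically_free by blast
qed

end
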